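(* Let $c_0=1/(102400\,\pi)\approx3.1\times10^{-6}$. Let $\varphi\in(-1,1)$ and suppose $\Sigma=Q^{-1}\in\mathbb R^{N\times N}$ is the first-order autoregressive covariance matrix with $(i,k)$ entry $\varphi^{|i-k|}$. Suppose $N_1=\dots=N_d=s$ so that $N=sd$, and take $h_j=\frac1{\sqrt{10s}}\,\frac{1-|\varphi|}{1+|\varphi|}$ for every $j\in[d]$. Let $D=\operatorname{diag}(Q_{1,1}^{-1},\dots,Q_{d,d}^{-1})$ (block diagonal). Then the largest eigenvalue of $I_N-DQ$ satisfies $$\psi_{\max}(I_N-DQ)\le\frac{|\varphi|+|\varphi|^{s}}{1+|\varphi|^{s+1}}.$$ It follows that the deterministic-scan component-wise MALA chain satisfies $$\|P_{\mathrm{DCW}}-\Pi\|\le1-\frac{c_0^{3}}{2^9\,N\sqrt s\,(d+1)}\cdot\frac{(1-|\varphi|)^7\bigl(1-|\varphi|^s\bigr)}{(1+|\varphi|)^6\bigl(1+|\varphi|^{s+1}\bigr)}.$$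
   Context: Let $\Pi=\mathcal N(\mu,Q^{-1})$ on $\mathbb R^N$ with density $\pi$, where $Q$ is a symmetric positive definite precision matrix. Coordinates are split into $d$ consecutive blocks of sizes $N_1,\dots,N_d$ with $\sum_jN_j=N$; write $x=(x_1,\dots,x_d)$, $x_j\in\mathbb R^{N_j}$, $x_{-j}=(x_k)_{k\ne j}$, and $Q=(Q_{j,k})_{j,k\in[d]}$ with $Q_{j,k}\in\mathbb R^{N_j\times N_k}$, where $[d]=\{1,\dots,d\}$. The matrix $I_N-DQ$ has real eigenvalues. Block MALA update $K_j$ with step size $h_j>0$: from $x$, propose $y=(y_j,x_{-j})$ with $y_j\mid x\sim\mathcal N(x_j+h_j\nabla_j\log\pi(x),\,2h_jI_{N_j})$, where $\nabla_j$ is the gradient in $x_j$; accept $y$ with probability $\min\{1,\pi(y)r_j(y,x)/(\pi(x)r_j(x,y))\}$, where $r_j(x,y)$ is the proposal density of $y_j$ given $x$; otherwise stay at $x$. $K_j$ is the resulting Markov kernel on $\mathbb R^N$, acting on $L^2(\Pi)$ by $(K_jf)(x)=\int f(y)K_j(x,\mathrm dy)$. The deterministic-scan component-wise MALA kernel is $P_{\mathrm{DCW}}=K_d\cdots K_1$. $\Pi$ also denotes the operator on $L^2(\Pi)$ sending $f$ to the constant $\int f\,\mathrm d\Pi$, and $\|\cdot\|$ is the operator norm on $L^2(\Pi)$. *)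

theory Defs
  imports "HOL-Probability.Probability" "Jordan_Normal_Form.Gauss_Jordan_Elimination"
    "Jordan_Normal_Form.Spectral_Radius"
begin

text \<open>
  Points of \<open>\<real>\<^sup>N\<close> are the elements of the product space \<open>\<Pi>\<^sub>M i\<in>{..<N}. borel\<close>, that is, functions
  \<open>nat \<Rightarrow> real\<close> that are \<open>undefined\<close> outside \<open>{..<N}\<close>. Coordinates and blocks are numbered from 0.
  \<open>Ns j\<close> is the size of block \<open>j\<close>.
\<close>

definition block_start :: "(nat \<Rightarrow> nat) \<Rightarrow> nat \<Rightarrow> nat" where
  "block_start Ns j = (\<Sum>k<j. Ns k)"

definition block :: "(nat \<Rightarrow> nat) \<Rightarrow> nat \<Rightarrow> nat set" where
  "block Ns j = {block_start Ns j ..< block_start Ns j + Ns j}"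

definition sub_block :: "(nat \<Rightarrow> nat) \<Rightarrow> real mat \<Rightarrow> nat \<Rightarrow> nat \<Rightarrow> real mat" where
  "sub_block Ns Q j k =
     Matrix.mat (Ns j) (Ns k) (\<lambda>(a, b). Q $$ (block_start Ns j + a, block_start Ns k + b))"

definition block_diag_inv :: "(nat \<Rightarrow> nat) \<Rightarrow> nat \<Rightarrow> real mat \<Rightarrow> real mat" where
  "block_diag_inv Ns d Q = diag_block_mat (map (\<lambda>j. the (mat_inverse (sub_block Ns Q j j))) [0..<d])"

definition sym_pos_def :: "nat \<Rightarrow> real mat \<Rightarrow> bool" where
  "sym_pos_def N Q \<longleftrightarrow> Q \<in> carrier_mat N N \<and> transpose_mat Q = Q \<and>
     (\<forall>v\<in>carrier_vec N. v \<noteq> 0\<^sub>v N \<longrightarrow> scalar_prod v (Q *\<^sub>v v) > 0)"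

definition ar1_cov :: "nat \<Rightarrow> real \<Rightarrow> real mat" where
  "ar1_cov N \<phi> = Matrix.mat N N (\<lambda>(i, k). \<phi> ^ nat \<bar>int i - int k\<bar>)"

text \<open>Only used for matrices all of whose complex eigenvalues are real.\<close>

definition psi_max :: "real mat \<Rightarrow> real" where
  "psi_max A = Max (spectrum A)"

definition gauss_density :: "real Matrix.vec \<Rightarrow> real mat \<Rightarrow> (nat \<Rightarrow> real) \<Rightarrow> real" where
  "gauss_density \<mu> Q x =
     (let N = dim_vec \<mu>; v = Matrix.vec N x - \<mu>
      in sqrt (Determinant.det Q / (2 * pi) ^ N) * exp (- scalar_prod v (Q *\<^sub>v v) / 2))"

definition gauss_measure :: "real Matrix.vec \<Rightarrow> real mat \<Rightarrow> (nat \<Rightarrow> real) measure" where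
  "gauss_measure \<mu> Q =
     density (\<Pi>\<^sub>M i\<in>{..<dim_vec \<mu>}. lborel) (\<lambda>x. ennreal (gauss_density \<mu> Q x))"

text \<open>
  The MALA update with step size \<open>h\<close> of the coordinates in \<open>B\<close>, for a target with density \<open>p\<close>.
  The second point in \<open>prop_density\<close> is only evaluated on \<open>B\<close>.
\<close>

definition prop_mean :: "((nat \<Rightarrow> real) \<Rightarrow> real) \<Rightarrow> real \<Rightarrow> (nat \<Rightarrow> real) \<Rightarrow> nat \<Rightarrow> real" where
  "prop_mean p h x i = x i + h * deriv (\<lambda>t. ln (p (x(i := t)))) (x i)"

definition prop_density ::
  "((nat \<Rightarrow> real) \<Rightarrow> real) \<Rightarrow> nat set \<Rightarrow> real \<Rightarrow> (nat \<Rightarrow> real) \<Rightarrow> (nat \<Rightarrow> real) \<Rightarrow> real" where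
  "prop_density p B h x y = (\<Prod>i\<in>B. normal_density (prop_mean p h x i) (sqrt (2 * h)) (y i))"

definition proposal ::
  "((nat \<Rightarrow> real) \<Rightarrow> real) \<Rightarrow> nat set \<Rightarrow> real \<Rightarrow> (nat \<Rightarrow> real) \<Rightarrow> (nat \<Rightarrow> real) measure" where
  "proposal p B h x = density (\<Pi>\<^sub>M i\<in>B. lborel) (\<lambda>z. ennreal (prop_density p B h x z))"

definition accept_prob ::
  "((nat \<Rightarrow> real) \<Rightarrow> real) \<Rightarrow> nat set \<Rightarrow> real \<Rightarrow> (nat \<Rightarrow> real) \<Rightarrow> (nat \<Rightarrow> real) \<Rightarrow> real" where
  "accept_prob p B h x y =
     min 1 (p y * prop_density p B h y x / (p x * prop_density p B h x y))"

definition mala_kernel ::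
  "nat \<Rightarrow> ((nat \<Rightarrow> real) \<Rightarrow> real) \<Rightarrow> nat set \<Rightarrow> real \<Rightarrow> (nat \<Rightarrow> real) \<Rightarrow> (nat \<Rightarrow> real) measure" where
  "mala_kernel N p B h x =
     Giry_Monad.bind (proposal p B h x) (\<lambda>z.
       let y = override_on x z B in
       Giry_Monad.bind (measure_pmf (bernoulli_pmf (accept_prob p B h x y))) (\<lambda>accepted.
         return (\<Pi>\<^sub>M i\<in>{..<N}. borel) (if accepted then y else x)))"

definition block_mala ::
  "(nat \<Rightarrow> nat) \<Rightarrow> (nat \<Rightarrow> real) \<Rightarrow> real Matrix.vec \<Rightarrow> real mat \<Rightarrow> nat \<Rightarrow> (nat \<Rightarrow> real) \<Rightarrow> (nat \<Rightarrow> real) measure"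
  where
  "block_mala Ns h \<mu> Q j = mala_kernel (dim_vec \<mu>) (gauss_density \<mu> Q) (block Ns j) (h j)"

text \<open>
  A product \<open>K L\<close> of kernels is the operator product, \<open>(K L)(x, A) = \<integral> L(y, A) K(x, dy)\<close>; hence
  \<open>dcw_mala \<dots> d\<close> is \<open>K\<^sub>d \<cdots> K\<^sub>1\<close>, in which the leftmost factor moves first.
\<close>

primrec dcw_mala ::
  "(nat \<Rightarrow> nat) \<Rightarrow> (nat \<Rightarrow> real) \<Rightarrow> real Matrix.vec \<Rightarrow> real mat \<Rightarrow> nat \<Rightarrow> (nat \<Rightarrow> real) \<Rightarrow> (nat \<Rightarrow> real) measure"
  where
  "dcw_mala Ns h \<mu> Q 0 = return (\<Pi>\<^sub>M i\<in>{..<dim_vec \<mu>}. borel)"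
| "dcw_mala Ns h \<mu> Q (Suc j) =
     (\<lambda>x. Giry_Monad.bind (block_mala Ns h \<mu> Q j x) (dcw_mala Ns h \<mu> Q j))"

definition kernel_op :: "('a \<Rightarrow> 'a measure) \<Rightarrow> ('a \<Rightarrow> real) \<Rightarrow> 'a \<Rightarrow> real" where
  "kernel_op K f x = (\<integral>y. f y \<partial>K x)"

definition mean_op :: "'a measure \<Rightarrow> ('a \<Rightarrow> real) \<Rightarrow> 'a \<Rightarrow> real" where
  "mean_op M f x = (\<integral>y. f y \<partial>M)"

definition L2 :: "'a measure \<Rightarrow> ('a \<Rightarrow> real) set" where
  "L2 M = {f \<in> borel_measurable M. integrable M (\<lambda>x. (f x)\<^sup>2)}"

definition L2_norm :: "'a measure \<Rightarrow> ('a \<Rightarrow> real) \<Rightarrow> real" where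
  "L2_norm M f = sqrt (\<integral>x. (f x)\<^sup>2 \<partial>M)"

text \<open>The infimum is \<open>\<infinity>\<close> if \<open>T\<close> does not map \<open>L2 M\<close> boundedly to itself.\<close>

definition L2_opnorm :: "'a measure \<Rightarrow> (('a \<Rightarrow> real) \<Rightarrow> 'a \<Rightarrow> real) \<Rightarrow> ereal" where
  "L2_opnorm M T =
     Inf {ereal C |C. C \<ge> 0 \<and> (\<forall>f\<in>L2 M. T f \<in> L2 M \<and> L2_norm M (T f) \<le> C * L2_norm M f)}"

definition c0 :: real where
  "c0 = 1 / (102400 * pi)"

end

theory Submission
 imports Defs
begin

text \<open>
 A scan of positive reversible kernels has a spectral gap of order \<open>1 / d\<^sup>2\<close> as soon as the sum of the
 Dirichlet forms of the kernels controls the variance: each update changes the function by at most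
 the \<open>L\<^sup>2\<close> norm that it loses, and the losses telescope along the scan.

 Block MALA is positive because the accepted part of its kernel is a mixture of products
 \<open>g(x) g(y)\<close>: the Gaussian factor has the exponent \<open>y (I / h - Q) x / 2\<close> with \<open>I / h - Q\<close> positive semidefinite, and the
 acceptance turns the remaining factor into \<open>min (a x) (a y)\<close>.

 The variance is controlled in two steps. A recursion along the autoregressive chain bounds it by the sum
 of the one-site conditional variances. A one-site conditional variance is bounded by the squared
 increments of the function over distances \<open>\<surd>h / 4\<close>; two points at such a distance propose with
 overlapping laws, so these increments are bounded by the Dirichlet form of the update.

 The eigenvalue bound is the Rayleigh quotient of \<open>Q\<close> against its block diagonal: the only coupling between
 blocks is between neighbouring end sites, and the energy of a block bounds its end values.
\<close>

section \<open>Reversible kernels and deterministic scans\<close>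

text \<open>Positivity of each kernel is what turns a Dirichlet form into a loss of norm: a
  reversible kernel with spectrum near -1 loses almost none. The step size is tied to
  \<open>bound\<close>, that is (1 + |phi|) / (1 - |phi|), which dominates the spectrum of
  \<open>Q\<close>: \<open>h * bound = 1 / sqrt (10 * s)\<close>. Hence
  \<open>h * bound <= 1\<close>, which makes I/h - Q positive semidefinite and the drift
  nonexpansive, and \<open>10 * s * (h * bound)^2 <= 1\<close>, which keeps the mean acceptance
  above 19/40 from every starting point. For a Gaussian target the acceptance ratio depends only on
  the block gradient norms at the two points; positivity, acceptance and overlap all rest on this.
  The constant 8912896 is 17 * 64 * 64 * 8 * 2 * 8: 17 for increments of a standard normal over
  distance 2, 64 for the dyadic descent to shorter distances, 64 * 8 for the distance sqrt h / 4 and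
  the overlap of proposals, 2 because \<open>energy\<close> is twice the Dirichlet form, 8 from the
  recursion along the chain. The stated rate leaves ample room for it.\<close>

type_synonym point = "nat => real"

abbreviation bmeas :: "'a measure => ('a => 'b::topological_space) set" where
 "bmeas M \<equiv> borel_measurable M"

text \<open>Fubini for a mixture of kernels with unbounded signed \<open>f\<close>. Positive and
  negative parts are handled by \<open>nn_integral_bind\<close>; finiteness of the double integral
  of the absolute value makes both inner integrals finite almost everywhere, so that their
  difference is meaningful.\<close>

lemma integral_bind_of_integrable:
 fixes f :: "'b => real"
 assumes N[measurable]: "N \<in> M \<rightarrow>\<^sub>M subprob_algebra S"
  and f[measurable]: "f \<in> bmeas S"
  and fin: "(\<integral>\<^sup>+x. \<integral>\<^sup>+y. ennreal \<bar>f y\<bar> \<partial>N x \<partial>M) < \<infinity>"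
  and ne: "space M \<noteq> {}"
 shows "integrable (M \<bind> N) f" "AE x in M. integrable (N x) f"
  "integrable M (\<lambda>x. \<integral>y. f y \<partial>N x)"
  "(\<integral>y. f y \<partial>(M \<bind> N)) = (\<integral>x. \<integral>y. f y \<partial>N x \<partial>M)"
proof -
 have sN: "sets (N x) = sets S" if "x \<in> space M" for x
  using sets_kernel[OF N that] .
 have fN: "f \<in> bmeas (N x)" if "x \<in> space M" for x
  using f measurable_cong_sets[OF sN[OF that] refl] by blast
 have mnn: "(\<lambda>x. \<integral>\<^sup>+y. g y \<partial>N x) \<in> bmeas M" if "g \<in> bmeas S" for g
  using nn_integral_measurable_subprob_algebra2[of "\<lambda>x y. g y" M S N] that N by simp
 define A where "A x = (\<integral>\<^sup>+y. ennreal \<bar>f y\<bar> \<partial>N x)" for x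
 define P where "P x = (\<integral>\<^sup>+y. ennreal (f y) \<partial>N x)" for x
 define Q where "Q x = (\<integral>\<^sup>+y. ennreal (- f y) \<partial>N x)" for x
 have [measurable]: "A \<in> bmeas M" "P \<in> bmeas M" "Q \<in> bmeas M"
  unfolding A_def P_def Q_def by (intro mnn; measurable)+
 have PA: "P x <= A x" and QA: "Q x <= A x" for x
  unfolding P_def Q_def A_def by (intro nn_integral_mono ennreal_leI; simp)+
 have Afin: "AE x in M. A x \<noteq> \<infinity>"
  using nn_integral_PInf_AE[of A M] fin unfolding A_def by auto
 have sb: "sets (M \<bind> N) = sets S" using sets_bind[OF sN ne] .
 have fb[measurable]: "f \<in> bmeas (M \<bind> N)"
  using f measurable_cong_sets[OF sb refl] by blast
 have nb: "(\<integral>\<^sup>+y. g y \<partial>(M \<bind> N)) = (\<integral>\<^sup>+x. \<integral>\<^sup>+y. g y \<partial>N x \<partial>M)" if "g \<in> bmeas S" for g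
  by (rule nn_integral_bind[OF that N])
 show ib: "integrable (M \<bind> N) f"
  unfolding integrable_iff_bounded using fin nb[of "\<lambda>y. ennreal \<bar>f y\<bar>"] by simp
 show iN: "AE x in M. integrable (N x) f"
  using Afin AE_space by eventually_elim (auto simp: integrable_iff_bounded fN A_def less_top)
 have PQ: "AE x in M. (\<integral>y. f y \<partial>N x) = enn2real (P x) - enn2real (Q x)"
  using iN by eventually_elim (simp add: real_lebesgue_integral_def P_def Q_def)
 have intA: "(\<integral>\<^sup>+x. A x \<partial>M) < \<infinity>" using fin by (simp add: A_def)
 \<comment> \<open>\<open>enn2real\<close> sends infinity to 0, but the infinite values of
   \<open>R\<close> lie in a null set.\<close>
 have e: "(\<integral>\<^sup>+x. ennreal (enn2real (R x)) \<partial>M) = (\<integral>\<^sup>+x. R x \<partial>M)" if "\<And>x. R x <= A x" for R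
 proof (rule nn_integral_cong_AE)
  show "AE x in M. ennreal (enn2real (R x)) = R x"
   using Afin
  proof eventually_elim
   case (elim x)
   then have "R x < \<infinity>" using that[of x] using elim by (auto simp: less_top order.strict_trans1)
   then show ?case by simp
  qed
 qed
 have finR: "(\<integral>\<^sup>+x. R x \<partial>M) < \<infinity>" if "\<And>x. R x <= A x" for R
  using nn_integral_mono[of M R A] that intA by (auto intro: order.strict_trans1)
 have iR: "integrable M (\<lambda>x. enn2real (R x))" if [measurable]: "R \<in> bmeas M" and "\<And>x. R x <= A x" for R
  using e[of R] finR[of R] that(2) by (intro integrableI_nonneg) auto
 note iP = iR[of P, OF _ PA] and iQ = iR[of Q, OF _ QA]
 have m: "(\<lambda>x. \<integral>y. f y \<partial>N x) \<in> bmeas M"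
  using measurable_compose[OF N integral_measurable_subprob_algebra[OF f]] .
 show "integrable M (\<lambda>x. \<integral>y. f y \<partial>N x)"
  by (subst integrable_cong_AE[OF m _ PQ]) (use iP iQ in auto)
 have "(\<integral>x. \<integral>y. f y \<partial>N x \<partial>M) = (\<integral>x. enn2real (P x) - enn2real (Q x) \<partial>M)"
  by (rule integral_cong_AE[OF m _ PQ]) simp
 also have "... = (\<integral>x. enn2real (P x) \<partial>M) - (\<integral>x. enn2real (Q x) \<partial>M)"
  using iP iQ by simp
 also have "... = enn2real (\<integral>\<^sup>+x. P x \<partial>M) - enn2real (\<integral>\<^sup>+x. Q x \<partial>M)"
  by (subst (1 2) integral_eq_nn_integral) (auto simp: e[of P, OF PA] e[of Q, OF QA])
 also have "... = (\<integral>y. f y \<partial>(M \<bind> N))"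
  unfolding real_lebesgue_integral_def[OF ib] P_def Q_def by (simp add: nb)
 finally show "(\<integral>y. f y \<partial>(M \<bind> N)) = (\<integral>x. \<integral>y. f y \<partial>N x \<partial>M)" ..
qed

lemma integrable_dominated:
 fixes f b :: "'a => real"
 assumes "integrable M b" "f \<in> bmeas M" "AE x in M. \<bar>f x\<bar> <= b x"
 shows "integrable M f"
 by (rule Bochner_Integration.integrable_bound[OF assms(1,2)]) (use assms(3) in \<open>eventually_elim, simp\<close>)

lemma L2_diff:
 assumes "f \<in> L2 M" "g \<in> L2 M"
 shows "(\<lambda>x. f x - g x) \<in> L2 M"
proof -
 have [measurable]: "f \<in> bmeas M" "g \<in> bmeas M"
  and i: "integrable M (\<lambda>x. (f x)^2)" "integrable M (\<lambda>x. (g x)^2)"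
  using assms by (auto simp: L2_def)
 have le: "\<bar>(f x - g x)^2\<bar> <= 2 * (f x)^2 + 2 * (g x)^2" for x
  unfolding abs_power2 using zero_le_power2[of "f x + g x"] by (simp add: power2_eq_square algebra_simps)
 have "integrable M (\<lambda>x. 2 * (f x)^2 + 2 * (g x)^2)" using i by simp
 then have "integrable M (\<lambda>x. (f x - g x)^2)"
  by (rule integrable_dominated[OF _ _ AE_I2[OF le]]) measurable
 then show ?thesis by (auto simp: L2_def)
qed

lemma L2_mult_integrable:
 assumes "f \<in> L2 M" "g \<in> L2 M"
 shows "integrable M (\<lambda>x. f x * g x)"
proof -
 have [measurable]: "f \<in> bmeas M" "g \<in> bmeas M"
  and i: "integrable M (\<lambda>x. (f x)^2)" "integrable M (\<lambda>x. (g x)^2)"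
  using assms by (auto simp: L2_def)
 have le: "\<bar>f x * g x\<bar> <= (f x)^2 + (g x)^2" for x
 proof -
  have "2 * (\<bar>f x\<bar> * \<bar>g x\<bar>) <= (f x)^2 + (g x)^2" "0 <= \<bar>f x\<bar> * \<bar>g x\<bar>"
   using sum_squares_bound[of "\<bar>f x\<bar>" "\<bar>g x\<bar>"] by (auto simp: mult.assoc)
  then show ?thesis unfolding abs_mult by linarith
 qed
 have "integrable M (\<lambda>x. (f x)^2 + (g x)^2)" using i by simp
 then show ?thesis
  by (rule integrable_dominated[OF _ _ AE_I2[OF le]]) measurable
qed

lemma (in prob_space) integral_square_le:
 assumes [measurable]: "f \<in> bmeas M" and i: "integrable M (\<lambda>x. (f x)^2 :: real)"
 shows "(\<integral>x. f x \<partial>M)^2 <= (\<integral>x. (f x)^2 \<partial>M)"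
proof -
 have f: "integrable M f" by (rule square_integrable_imp_integrable[OF _ i]) simp
 have "0 <= variance f" by (rule variance_positive)
 also have "... = (\<integral>x. (f x)^2 \<partial>M) - (\<integral>x. f x \<partial>M)^2" using variance_eq[OF f i] by simp
 finally show ?thesis by simp
qed

text \<open>Twice the Dirichlet form. With values in \<open>ennreal\<close> it makes sense without
  integrability and is monotone in the squared increments.\<close>

definition energy :: "'a measure => ('a => 'a measure) => ('a => real) => ennreal" where
 "energy M K f = (\<integral>\<^sup>+x. \<integral>\<^sup>+y. ennreal ((f x - f y)^2) \<partial>K x \<partial>M)"

text \<open>\<open>psd_nn\<close> is positivity of the operator tested on \<open>u - v\<close> with
  nonnegative \<open>u\<close> and \<open>v\<close>: the quadratic form is expanded and the cross
  terms are moved to the other side, so that no integrability is required. Reversibility is stated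
  for nonnegative \<open>F\<close> for the same reason.\<close>

locale psd_kernel = prob_space M for M :: "'a measure" +
 fixes K :: "'a => 'a measure"
 assumes kernel[measurable]: "K \<in> M \<rightarrow>\<^sub>M subprob_algebra M"
  and prob_kernel: "\<And>x. x \<in> space M ==> prob_space (K x)"
  and reversible: "\<And>F. F \<in> bmeas (M \<Otimes>\<^sub>M M) ==>
   (\<integral>\<^sup>+x. \<integral>\<^sup>+y. F (x, y) \<partial>K x \<partial>M) = (\<integral>\<^sup>+x. \<integral>\<^sup>+y. F (y, x) \<partial>K x \<partial>M)"
  and psd_nn: "\<And>u v :: 'a => ennreal. u \<in> bmeas M ==> v \<in> bmeas M ==>
   (\<integral>\<^sup>+x. \<integral>\<^sup>+y. u x * v y \<partial>K x \<partial>M) + (\<integral>\<^sup>+x. \<integral>\<^sup>+y. v x * u y \<partial>K x \<partial>M)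
   <= (\<integral>\<^sup>+x. \<integral>\<^sup>+y. u x * u y \<partial>K x \<partial>M) + (\<integral>\<^sup>+x. \<integral>\<^sup>+y. v x * v y \<partial>K x \<partial>M)"
begin

text \<open>The law of two consecutive states at stationarity. Reversibility becomes its invariance
  under exchanging the coordinates, and inner products with the operator become integrals against
  one measure.\<close>

definition joint :: "('a \<times> 'a) measure" where
 "joint = M \<bind> (\<lambda>x. distr (K x) (M \<Otimes>\<^sub>M M) (Pair x))"

lemma joint_kernel[measurable]: "(\<lambda>x. distr (K x) (M \<Otimes>\<^sub>M M) (Pair x)) \<in> M \<rightarrow>\<^sub>M subprob_algebra (M \<Otimes>\<^sub>M M)"
 by (rule measurable_distr2[OF _ kernel]) simp

lemma sets_joint[measurable_cong]: "sets joint = sets (M \<Otimes>\<^sub>M M)"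
 unfolding joint_def by (rule sets_bind) (simp_all add: not_empty)

lemma sets_K: "x \<in> space M ==> sets (K x) = sets M"
 using sets_kernel[OF kernel] .

lemma Pair_measurable_K: "x \<in> space M ==> Pair x \<in> K x \<rightarrow>\<^sub>M M \<Otimes>\<^sub>M M"
 by (subst measurable_cong_sets[OF sets_K refl]) auto

lemma nn_integral_joint:
 assumes F[measurable]: "F \<in> bmeas (M \<Otimes>\<^sub>M M)"
 shows "(\<integral>\<^sup>+z. F z \<partial>joint) = (\<integral>\<^sup>+x. \<integral>\<^sup>+y. F (x, y) \<partial>K x \<partial>M)"
 unfolding joint_def nn_integral_bind[OF F joint_kernel]
 by (intro nn_integral_cong) (simp add: nn_integral_distr Pair_measurable_K)

lemma nn_integral_joint_swap:
 assumes F[measurable]: "F \<in> bmeas (M \<Otimes>\<^sub>M M)"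
 shows "(\<integral>\<^sup>+z. F z \<partial>joint) = (\<integral>\<^sup>+z. F (snd z, fst z) \<partial>joint)"
 by (subst (1 2) nn_integral_joint) (use reversible[OF F] in simp_all)

lemma distr_joint_swap: "distr joint (M \<Otimes>\<^sub>M M) (\<lambda>z. (snd z, fst z)) = joint"
proof (rule measure_eqI)
 fix A assume "A \<in> sets (distr joint (M \<Otimes>\<^sub>M M) (\<lambda>z. (snd z, fst z)))"
 then have A[measurable]: "A \<in> sets (M \<Otimes>\<^sub>M M)" by simp
 have "emeasure (distr joint (M \<Otimes>\<^sub>M M) (\<lambda>z. (snd z, fst z))) A = (\<integral>\<^sup>+z. indicator A z \<partial>distr joint (M \<Otimes>\<^sub>M M) (\<lambda>z. (snd z, fst z)))"
  by simp
 also have "... = (\<integral>\<^sup>+z. indicator A (snd z, fst z) \<partial>joint)"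
  by (rule nn_integral_distr) auto
 also have "... = (\<integral>\<^sup>+z. indicator A z \<partial>joint)"
  using nn_integral_joint_swap[of "indicator A"] by simp
 also have "... = emeasure joint A" by (simp add: sets_joint)
 finally show "emeasure (distr joint (M \<Otimes>\<^sub>M M) (\<lambda>z. (snd z, fst z))) A = emeasure joint A" .
qed (simp add: sets_joint)

lemma integral_joint_swap:
 fixes F :: "'a \<times> 'a => real"
 assumes [measurable]: "F \<in> bmeas (M \<Otimes>\<^sub>M M)"
 shows "(\<integral>z. F z \<partial>joint) = (\<integral>z. F (snd z, fst z) \<partial>joint)"
 by (subst distr_joint_swap[symmetric]) (rule integral_distr; measurable)

lemma integrable_joint_swap:
 fixes F :: "'a \<times> 'a => real"
 assumes [measurable]: "F \<in> bmeas (M \<Otimes>\<^sub>M M)" and "integrable joint F"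
 shows "integrable joint (\<lambda>z. F (snd z, fst z))"
 using assms(2) by (subst (asm) distr_joint_swap[symmetric]) (subst (asm) integrable_distr_eq; measurable)

lemma nn_integral_joint_fst:
 assumes [measurable]: "f \<in> bmeas M"
 shows "(\<integral>\<^sup>+z. f (fst z) \<partial>joint) = (\<integral>\<^sup>+x. f x \<partial>M)"
 by (subst nn_integral_joint) (auto intro!: nn_integral_cong simp: prob_space.emeasure_space_1[OF prob_kernel])

lemma distr_joint_fst: "distr joint M fst = M"
proof (rule measure_eqI)
 fix A assume "A \<in> sets (distr joint M fst)"
 then have A[measurable]: "A \<in> sets M" by simp
 have "emeasure (distr joint M fst) A = (\<integral>\<^sup>+z. indicator A z \<partial>distr joint M fst)" by simp
 also have "... = (\<integral>\<^sup>+z. indicator A (fst z) \<partial>joint)"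
  by (rule nn_integral_distr) auto
 also have "... = (\<integral>\<^sup>+z. indicator A z \<partial>M)" by (rule nn_integral_joint_fst) simp
 finally show "emeasure (distr joint M fst) A = emeasure M A" by simp
qed simp

lemma integral_joint_fst:
 fixes f :: "'a => real"
 assumes [measurable]: "f \<in> bmeas M"
 shows "(\<integral>z. f (fst z) \<partial>joint) = (\<integral>x. f x \<partial>M)"
 by (subst (2) distr_joint_fst[symmetric]) (rule integral_distr[symmetric]; measurable)

lemma integrable_joint_fst:
 fixes f :: "'a => real"
 assumes [measurable]: "f \<in> bmeas M" and "integrable M f"
 shows "integrable joint (\<lambda>z. f (fst z))"
 using assms(2) by (subst (asm) distr_joint_fst[symmetric]) (subst (asm) integrable_distr_eq; measurable)

lemma integral_joint_snd:
 fixes f :: "'a => real"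
 assumes [measurable]: "f \<in> bmeas M"
 shows "(\<integral>z. f (snd z) \<partial>joint) = (\<integral>x. f x \<partial>M)"
 using integral_joint_swap[of "\<lambda>z. f (snd z)"] integral_joint_fst[of f] by simp

lemma integrable_joint_snd:
 fixes f :: "'a => real"
 assumes [measurable]: "f \<in> bmeas M" and "integrable M f"
 shows "integrable joint (\<lambda>z. f (snd z))"
 using integrable_joint_swap[of "\<lambda>z. f (fst z)"] integrable_joint_fst[OF assms] by simp

lemma nn_integral_invariant:
 assumes [measurable]: "f \<in> bmeas M"
 shows "(\<integral>\<^sup>+x. \<integral>\<^sup>+y. f y \<partial>K x \<partial>M) = (\<integral>\<^sup>+x. f x \<partial>M)"
proof -
 have "(\<integral>\<^sup>+x. \<integral>\<^sup>+y. f y \<partial>K x \<partial>M) = (\<integral>\<^sup>+z. f (snd z) \<partial>joint)" by (subst nn_integral_joint) auto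
 also have "... = (\<integral>\<^sup>+z. f (fst z) \<partial>joint)" using nn_integral_joint_swap[of "\<lambda>z. f (snd z)"] by simp
 finally show ?thesis by (simp add: nn_integral_joint_fst)
qed

context
 fixes f g :: "'a => real"
 assumes f: "f \<in> L2 M" and g: "g \<in> L2 M"
begin

lemma L2D: "f \<in> bmeas M" "integrable M (\<lambda>x. (f x)^2)" "g \<in> bmeas M" "integrable M (\<lambda>x. (g x)^2)"
 using f g by (auto simp: L2_def)

lemma integrable_joint_mult: "integrable joint (\<lambda>z. f (fst z) * g (snd z))"
proof -
 note L2D[measurable]
 have 1: "integrable joint (\<lambda>z. (f (fst z))^2)" using integrable_joint_fst[of "\<lambda>x. (f x)^2"] L2D by simp
 have 2: "integrable joint (\<lambda>z. (g (snd z))^2)" using integrable_joint_snd[of "\<lambda>x. (g x)^2"] L2D by simp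
 have "(\<lambda>z. f (fst z)) \<in> L2 joint" "(\<lambda>z. g (snd z)) \<in> L2 joint"
  using 1 2 by (auto simp: L2_def)
 then show ?thesis by (rule L2_mult_integrable)
qed

lemma integral_joint_mult:
 "(\<integral>z. f (fst z) * g (snd z) \<partial>joint) = (\<integral>x. f x * kernel_op K g x \<partial>M)"
 "integrable M (\<lambda>x. f x * kernel_op K g x)"
proof -
 note L2D[measurable]
 have fin: "(\<integral>\<^sup>+x. \<integral>\<^sup>+y. ennreal \<bar>f (fst y) * g (snd y)\<bar> \<partial>distr (K x) (M \<Otimes>\<^sub>M M) (Pair x) \<partial>M) < \<infinity>"
  using integrable_joint_mult unfolding integrable_iff_bounded
  by (subst nn_integral_bind[symmetric, OF _ joint_kernel]) (auto simp: joint_def)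
 have eq: "(\<integral>y. f (fst y) * g (snd y) \<partial>distr (K x) (M \<Otimes>\<^sub>M M) (Pair x)) = f x * kernel_op K g x" if "x \<in> space M" for x
  by (subst integral_distr) (simp_all add: Pair_measurable_K[OF that] kernel_op_def)
 note ib = integral_bind_of_integrable[OF joint_kernel _ fin not_empty]
 show "(\<integral>z. f (fst z) * g (snd z) \<partial>joint) = (\<integral>x. f x * kernel_op K g x \<partial>M)"
  unfolding joint_def by (subst ib(4)) (auto intro!: Bochner_Integration.integral_cong simp: eq)
 show "integrable M (\<lambda>x. f x * kernel_op K g x)"
  using ib(3) by (subst Bochner_Integration.integrable_cong[OF refl eq[symmetric]]) auto
qed

lemma kernel_op_measurable[measurable]: "kernel_op K f \<in> bmeas M"
 unfolding kernel_op_def[abs_def]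
 using measurable_compose[OF kernel integral_measurable_subprob_algebra[OF L2D(1)]] .

lemma AE_integrable_square: "AE x in M. integrable (K x) (\<lambda>y. (f y)^2)"
 and integrable_kernel_square: "integrable M (\<lambda>x. \<integral>y. (f y)^2 \<partial>K x)"
proof -
 note L2D[measurable]
 have fin: "(\<integral>\<^sup>+x. \<integral>\<^sup>+y. ennreal \<bar>(f y)^2\<bar> \<partial>K x \<partial>M) < \<infinity>"
  using L2D(2) unfolding integrable_iff_bounded by (subst nn_integral_invariant) auto
 note ib = integral_bind_of_integrable[OF kernel _ fin not_empty]
 show "AE x in M. integrable (K x) (\<lambda>y. (f y)^2)" "integrable M (\<lambda>x. \<integral>y. (f y)^2 \<partial>K x)"
  using ib(2,3) by auto
qed

text \<open>Jensen's inequality for each probability measure \<open>K x\<close>, then stationarity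
  of \<open>M\<close>.\<close>

lemma kernel_op_L2: "kernel_op K f \<in> L2 M"
proof -
 have "AE x in M. (kernel_op K f x)^2 <= (\<integral>y. (f y)^2 \<partial>K x)"
  using AE_integrable_square AE_space
 proof eventually_elim
  case (elim x)
  interpret Kx: prob_space "K x" by (rule prob_kernel[OF elim(2)])
  have "f \<in> bmeas (K x)" using L2D(1) measurable_cong_sets[OF sets_K[OF elim(2)] refl] by blast
  then show ?case unfolding kernel_op_def by (rule Kx.integral_square_le[OF _ elim(1)])
 qed
 then have "integrable M (\<lambda>x. (kernel_op K f x)^2)"
  by (intro integrable_dominated[OF integrable_kernel_square]) auto
 then show ?thesis by (simp add: L2_def)
qed

lemma kernel_op_symmetric: "(\<integral>x. f x * kernel_op K g x \<partial>M) = (\<integral>z. g (fst z) * f (snd z) \<partial>joint)"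
 unfolding integral_joint_mult(1)[symmetric]
 by (subst integral_joint_swap) (use L2D in \<open>auto simp: mult.commute\<close>)

end

text \<open>\<open>psd_nn\<close> is applied to the positive and the negative part of
  \<open>f\<close>; for square integrable parts all four integrals are finite, so the cross terms
  can be moved back.\<close>

lemma psd:
 assumes f: "f \<in> L2 M"
 shows "0 <= (\<integral>x. f x * kernel_op K f x \<partial>M)"
proof -
 define a where "a x = max 0 (f x)" for x
 define b where "b x = max 0 (- f x)" for x
 have fm[measurable]: "f \<in> bmeas M" and fi: "integrable M (\<lambda>x. (f x)^2)" using f by (auto simp: L2_def)
 have a: "a \<in> L2 M" and b: "b \<in> L2 M"
  unfolding L2_def a_def[abs_def] b_def[abs_def]
  by (auto intro!: Bochner_Integration.integrable_bound[OF fi] simp: max_def)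
 have ab0: "0 <= a x" "0 <= b x" for x by (auto simp: a_def b_def)
 define I where "I g k = (\<integral>z. g (fst z) * k (snd z) \<partial>joint)" for g k :: "'a => real"
 have nn: "(\<integral>\<^sup>+x. \<integral>\<^sup>+y. ennreal (g x) * ennreal (k y) \<partial>K x \<partial>M) = ennreal (I g k)"
  if g: "g \<in> L2 M" "\<And>x. 0 <= g x" and k: "k \<in> L2 M" "\<And>x. 0 <= k x" for g k
 proof -
  have [measurable]: "g \<in> bmeas M" "k \<in> bmeas M" using g k by (auto simp: L2_def)
  have "(\<integral>\<^sup>+x. \<integral>\<^sup>+y. ennreal (g x) * ennreal (k y) \<partial>K x \<partial>M) = (\<integral>\<^sup>+z. ennreal (g (fst z) * k (snd z)) \<partial>joint)"
   by (subst nn_integral_joint) (simp_all add: ennreal_mult g k)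
  also have "... = ennreal (I g k)"
   unfolding I_def using g k by (intro nn_integral_eq_integral integrable_joint_mult) auto
  finally show ?thesis .
 qed
 have I0: "0 <= I g k" if "\<And>x. 0 <= g x" "\<And>x. 0 <= k x" for g k
  unfolding I_def using that by (intro Bochner_Integration.integral_nonneg) simp
 have "ennreal (I a b) + ennreal (I b a) <= ennreal (I a a) + ennreal (I b b)"
 proof -
  have "(\<lambda>x. ennreal (a x)) \<in> bmeas M" "(\<lambda>x. ennreal (b x)) \<in> bmeas M"
   using a b by (auto simp: L2_def)
  from psd_nn[OF this] show ?thesis using a b ab0 by (simp add: nn)
 qed
 then have "ennreal (I a b + I b a) <= ennreal (I a a + I b b)" using I0 ab0 by (simp add: ennreal_plus)
 then have le: "I a b + I b a <= I a a + I b b" using I0 ab0 by (subst (asm) ennreal_le_iff) auto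
 have "(\<integral>x. f x * kernel_op K f x \<partial>M) = (\<integral>z. f (fst z) * f (snd z) \<partial>joint)"
  using integral_joint_mult(1)[OF f f] by simp
 also have "... = (\<integral>z. a (fst z) * a (snd z) - a (fst z) * b (snd z) - b (fst z) * a (snd z) + b (fst z) * b (snd z) \<partial>joint)"
  by (rule arg_cong[where f = "integral\<^sup>L joint"]) (auto simp: a_def b_def max_def fun_eq_iff)
 also have "... = I a a - I a b - I b a + I b b"
  unfolding I_def using integrable_joint_mult[OF a a] integrable_joint_mult[OF a b] integrable_joint_mult[OF b a] integrable_joint_mult[OF b b]
  by simp
 finally show ?thesis using le by simp
qed

text \<open>The Dirichlet form, i.e. the quadratic form of I - K; being a difference of real
  integrals it is meant for arguments in \<open>L2 M\<close>.\<close>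

definition gap_form :: "('a => real) => real" where
 "gap_form f = (\<integral>x. (f x)^2 \<partial>M) - (\<integral>x. f x * kernel_op K f x \<partial>M)"

lemma energy_eq:
 assumes f: "f \<in> L2 M"
 shows "energy M K f = ennreal (2 * gap_form f)" "0 <= gap_form f"
proof -
 note L2D(1,2)[OF f f, measurable]
 have i1: "integrable joint (\<lambda>z. (f (fst z))^2)" using integrable_joint_fst[of "\<lambda>x. (f x)^2"] L2D(2)[OF f f] by simp
 have i2: "integrable joint (\<lambda>z. (f (snd z))^2)" using integrable_joint_snd[of "\<lambda>x. (f x)^2"] L2D(2)[OF f f] by simp
 have i3: "integrable joint (\<lambda>z. f (fst z) * f (snd z))" using integrable_joint_mult[OF f f] .
 have e: "(f (fst z) - f (snd z))^2 = (f (fst z))^2 + (f (snd z))^2 - 2 * (f (fst z) * f (snd z))" for z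
  by (simp add: power2_eq_square algebra_simps)
 have I: "integrable joint (\<lambda>z. (f (fst z) - f (snd z))^2)" unfolding e using i1 i2 i3 by simp
 have "energy M K f = (\<integral>\<^sup>+z. ennreal ((f (fst z) - f (snd z))^2) \<partial>joint)"
  unfolding energy_def by (subst nn_integral_joint) auto
 also have "... = ennreal (\<integral>z. (f (fst z) - f (snd z))^2 \<partial>joint)"
  by (rule nn_integral_eq_integral[OF I]) simp
 also have eq: "(\<integral>z. (f (fst z) - f (snd z))^2 \<partial>joint) = 2 * gap_form f"
  unfolding e using i1 i2 i3 integral_joint_fst[of "\<lambda>x. (f x)^2"] integral_joint_snd[of "\<lambda>x. (f x)^2"] integral_joint_mult[OF f f]
  by (simp add: gap_form_def)
 finally show "energy M K f = ennreal (2 * gap_form f)" .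
 have "0 <= (\<integral>z. (f (fst z) - f (snd z))^2 \<partial>joint)" by (intro Bochner_Integration.integral_nonneg) simp
 then show "0 <= gap_form f" unfolding eq by simp
qed

lemma gap_form_le: "f \<in> L2 M ==> gap_form f <= (\<integral>x. (f x)^2 \<partial>M)"
 using psd[of f] by (simp add: gap_form_def)

text \<open>For self-adjoint K with 0 \<le> K \<le> I one has K^2 \<le> K, so |Kf|^2 is at most the
  inner product of f and Kf, and both claims follow by expanding squares. Instead of spectral
  calculus, positivity is tested on \<open>f - g\<close> with \<open>g = K f\<close>: the form
  equals (f, g) - 2 (g, g) + (g, Kg), and (g, Kg) \<le> (g, g).\<close>

lemma
 assumes f: "f \<in> L2 M"
 shows kernel_op_decrease: "(\<integral>x. (kernel_op K f x)^2 \<partial>M) <= (\<integral>x. (f x)^2 \<partial>M) - gap_form f"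
  and kernel_op_increment: "(\<integral>x. (f x - kernel_op K f x)^2 \<partial>M) <= gap_form f"
proof -
 define g where "g = kernel_op K f"
 have g: "g \<in> L2 M" unfolding g_def by (rule kernel_op_L2[OF f f])
 have fg: "(\<lambda>x. f x - g x) \<in> L2 M" by (rule L2_diff[OF f g])
 have gf: "(\<integral>z. g (fst z) * f (snd z) \<partial>joint) = (\<integral>x. (g x)^2 \<partial>M)"
  using integral_joint_mult(1)[OF g f] by (simp add: g_def[symmetric] power2_eq_square)
 have fg2: "(\<integral>z. f (fst z) * g (snd z) \<partial>joint) = (\<integral>x. (g x)^2 \<partial>M)"
  using integral_joint_mult(1)[OF f g] kernel_op_symmetric[OF f g] gf by simp
 have "0 <= (\<integral>z. (f (fst z) - g (fst z)) * (f (snd z) - g (snd z)) \<partial>joint)"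
  using psd[OF fg] integral_joint_mult(1)[OF fg fg] by simp
 also have "... = (\<integral>z. f (fst z) * f (snd z) - f (fst z) * g (snd z) - g (fst z) * f (snd z) + g (fst z) * g (snd z) \<partial>joint)"
  by (simp add: algebra_simps)
 also have "... = (\<integral>x. f x * g x \<partial>M) - 2 * (\<integral>x. (g x)^2 \<partial>M) + (\<integral>x. g x * kernel_op K g x \<partial>M)"
  using integrable_joint_mult[OF f f] integrable_joint_mult[OF f g] integrable_joint_mult[OF g f] integrable_joint_mult[OF g g]
   integral_joint_mult(1)[OF f f] integral_joint_mult(1)[OF g g] gf fg2
  by (simp add: g_def[symmetric])
 also have "... <= (\<integral>x. f x * g x \<partial>M) - (\<integral>x. (g x)^2 \<partial>M)"
  using energy_eq(2)[OF g] by (simp add: gap_form_def)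
 finally have le: "(\<integral>x. (g x)^2 \<partial>M) <= (\<integral>x. f x * g x \<partial>M)" by simp
 then show "(\<integral>x. (kernel_op K f x)^2 \<partial>M) <= (\<integral>x. (f x)^2 \<partial>M) - gap_form f"
  by (simp add: gap_form_def g_def)
 have "(\<integral>x. (f x - g x)^2 \<partial>M) = (\<integral>x. (f x)^2 + (g x)^2 - 2 * (f x * g x) \<partial>M)"
  by (intro Bochner_Integration.integral_cong) (auto simp: power2_eq_square algebra_simps)
 also have "... = (\<integral>x. (f x)^2 \<partial>M) + (\<integral>x. (g x)^2 \<partial>M) - 2 * (\<integral>x. f x * g x \<partial>M)"
  using L2D[OF f g] L2_mult_integrable[OF f g] by simp
 finally show "(\<integral>x. (f x - kernel_op K f x)^2 \<partial>M) <= gap_form f"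
  using le by (simp add: g_def gap_form_def)
qed


lemma energy_joint:
 assumes [measurable]: "f \<in> bmeas M"
 shows "energy M K f = (\<integral>\<^sup>+z. ennreal ((f (fst z) - f (snd z))^2) \<partial>joint)"
 unfolding energy_def by (subst nn_integral_joint) auto

text \<open>Squared triangle inequality for the Dirichlet seminorm: an increment of \<open>f\<close>
  is a sum of \<open>n\<close> increments, and Cauchy-Schwarz against the constant 1 gives the
  factor \<open>n\<close>.\<close>

lemma gap_form_sum_le:
 fixes u :: "nat => 'a => real"
 assumes u: "\<And>i. i < n ==> u i \<in> L2 M" and f: "f \<in> L2 M" and eq: "\<And>x. f x = (\<Sum>i<n. u i x)"
 shows "gap_form f <= real n * (\<Sum>i<n. gap_form (u i))"
proof -
 have fm[measurable]: "f \<in> bmeas M" using f by (auto simp: L2_def)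
 have um[measurable]: "u i \<in> bmeas M" if "i < n" for i using u[OF that] by (auto simp: L2_def)
 have p: "(f x - f y)^2 <= real n * (\<Sum>i<n. (u i x - u i y)^2)" for x y
  using Cauchy_Schwarz_ineq_sum[of "\<lambda>_. 1" "\<lambda>i. u i x - u i y" "{..<n}"]
  by (simp add: eq sum_subtractf)
 have s: "ennreal (real n * (\<Sum>i<n. (u i x - u i y)^2)) = ennreal (real n) * (\<Sum>i<n. ennreal ((u i x - u i y)^2))" for x y
  by (simp add: ennreal_mult sum_nonneg)
 have um2: "(\<lambda>z. ennreal ((u i (fst z) - u i (snd z))^2)) \<in> bmeas joint" if "i < n" for i
 proof -
  note um[OF that, measurable]
  show ?thesis by measurable
 qed
 have "energy M K f <= (\<integral>\<^sup>+z. ennreal (real n) * (\<Sum>i<n. ennreal ((u i (fst z) - u i (snd z))^2)) \<partial>joint)"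
  unfolding energy_joint[OF fm] s[symmetric] by (intro nn_integral_mono ennreal_leI p)
 also have "... = ennreal (real n) * (\<Sum>i<n. \<integral>\<^sup>+z. ennreal ((u i (fst z) - u i (snd z))^2) \<partial>joint)"
 proof -
  have "(\<integral>\<^sup>+z. (\<Sum>i<n. ennreal ((u i (fst z) - u i (snd z))^2)) \<partial>joint) = (\<Sum>i<n. \<integral>\<^sup>+z. ennreal ((u i (fst z) - u i (snd z))^2) \<partial>joint)"
   by (rule nn_integral_sum) (simp add: um2)
  moreover have "(\<lambda>z. \<Sum>i<n. ennreal ((u i (fst z) - u i (snd z))^2)) \<in> bmeas joint"
   by (intro borel_measurable_sum um2) simp
  ultimately show ?thesis by (simp add: nn_integral_cmult del: sum_ennreal)
 qed
 also have "... = ennreal (real n) * (\<Sum>i<n. ennreal (2 * gap_form (u i)))"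
  using energy_joint[OF um] energy_eq(1)[OF u] by simp
 also have "... = ennreal (real n * (\<Sum>i<n. 2 * gap_form (u i)))"
 proof -
  have "(\<Sum>i<n. ennreal (2 * gap_form (u i))) = ennreal (\<Sum>i<n. 2 * gap_form (u i))"
   using energy_eq(2)[OF u] by (intro sum_ennreal) auto
  moreover have "0 <= (\<Sum>i<n. 2 * gap_form (u i))"
   using energy_eq(2)[OF u] by (intro sum_nonneg) auto
  ultimately show ?thesis
   by (simp only: ennreal_mult[of "real n" "\<Sum>i<n. 2 * gap_form (u i)"] of_nat_0_le_iff)
 qed
 finally have "ennreal (2 * gap_form f) <= ennreal (real n * (\<Sum>i<n. 2 * gap_form (u i)))"
  using energy_eq(1)[OF f] by simp
 then have "2 * gap_form f <= real n * (\<Sum>i<n. 2 * gap_form (u i))"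
  using energy_eq(2)[OF u] by (subst (asm) ennreal_le_iff) (auto intro!: mult_nonneg_nonneg sum_nonneg)
 then show ?thesis by (simp add: sum_distrib_left[symmetric])
qed

end

text \<open>The losses of the scan are Dirichlet forms at the moving functions \<open>G j\<close>,
  while the left side wants them all at \<open>G 0\<close>. Writing \<open>G 0\<close> as
  \<open>G j\<close> plus the changes made before step \<open>j\<close> gives \<open>j + 1\<close>
  terms, each with Dirichlet form at most the loss of its own step, and these losses telescope.
  Summing the factors \<open>j + 1\<close> over \<open>j < d\<close> gives d (d + 1) / 2.\<close>

lemma scan_decrease:
 assumes K: "\<And>j. j < d ==> psd_kernel M (K j)"
  and G: "\<And>j. j <= d ==> G j \<in> L2 M"
  and step: "\<And>j. j < d ==> AE x in M. G (Suc j) x = kernel_op (K j) (G j) x"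
 shows "2 * (\<Sum>j<d. psd_kernel.gap_form M (K j) (G 0)) <=
  real d * (real d + 1) * ((\<integral>x. (G 0 x)^2 \<partial>M) - (\<integral>x. (G d x)^2 \<partial>M))"
proof -
 define e where "e j = psd_kernel.gap_form M (K j) (G j)" for j
 define n2 where "n2 j = (\<integral>x. (G j x)^2 \<partial>M)" for j
 have Gm: "G j \<in> bmeas M" if "j <= d" for j using G[OF that] by (auto simp: L2_def)
 have km: "kernel_op (K j) (G j) \<in> bmeas M" if "j < d" for j
  using psd_kernel.kernel_op_measurable[OF K[OF that]] G[of j] that by auto
 have e0: "0 <= e j" if "j < d" for j
  unfolding e_def using psd_kernel.energy_eq(2)[OF K[OF that]] G[of j] that by auto
 have e_le: "e j <= n2 j - n2 (Suc j)" if j: "j < d" for j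
 proof -
  have "n2 (Suc j) = (\<integral>x. (kernel_op (K j) (G j) x)^2 \<partial>M)"
   unfolding n2_def using step[OF j] Gm[of "Suc j"] km[OF j] j by (intro integral_cong_AE) auto
  then show ?thesis
   using psd_kernel.kernel_op_decrease[OF K[OF j], of "G j"] G[of j] j by (simp add: e_def n2_def)
 qed
 have incr: "(\<integral>x. (G j x - G (Suc j) x)^2 \<partial>M) <= e j" if j: "j < d" for j
 proof -
  have "(\<integral>x. (G j x - G (Suc j) x)^2 \<partial>M) = (\<integral>x. (G j x - kernel_op (K j) (G j) x)^2 \<partial>M)"
   using step[OF j] Gm[of "Suc j"] Gm[of j] km[OF j] j by (intro integral_cong_AE) auto
  then show ?thesis
   using psd_kernel.kernel_op_increment[OF K[OF j], of "G j"] G[of j] j by (simp add: e_def)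
 qed
 have sum_e: "(\<Sum>j<n. e j) <= n2 0 - n2 n" if "n <= d" for n
 proof -
  have "(\<Sum>j<n. e j) <= (\<Sum>j<n. n2 j - n2 (Suc j))" using that by (intro sum_mono e_le) auto
  then show ?thesis by (simp add: sum_lessThan_telescope')
 qed
 have gj: "psd_kernel.gap_form M (K j) (G 0) <= real (Suc j) * (n2 0 - n2 d)" if j: "j < d" for j
 proof -
  interpret psd_kernel M "K j" by (rule K[OF j])
  \<comment> \<open>The changes \<open>G i - G (Suc i)\<close> for \<open>i < j\<close>, followed by
    the remainder \<open>G j\<close>. By positivity a change has gap form at most its squared norm;
    the remainder has gap form exactly \<open>e j\<close>.\<close>
  define u where "u i x = (if i = j then G j x else G i x - G (Suc i) x)" for i x
  have uL: "u i \<in> L2 M" if "i < Suc j" for i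
   unfolding u_def using that j by (cases "i = j") (auto intro!: L2_diff G)
  have eq: "G 0 x = (\<Sum>i<Suc j. u i x)" for x
  proof -
   have "(\<Sum>i<j. u i x) = (\<Sum>i<j. G i x - G (Suc i) x)" by (intro sum.cong) (auto simp: u_def)
   then show ?thesis using sum_lessThan_telescope'[of "\<lambda>i. G i x" j] by (simp add: u_def)
  qed
  have "gap_form (u i) <= e i" if "i < Suc j" for i
  proof (cases "i = j")
   case True then show ?thesis by (simp add: e_def u_def[abs_def])
  next
   case False
   then have "i < j" using that by simp
   then have "(\<integral>x. (u i x)^2 \<partial>M) <= e i" using incr[of i] j by (simp add: u_def)
   then show ?thesis using gap_form_le[OF uL[OF that]] by simp
  qed
  then have "(\<Sum>i<Suc j. gap_form (u i)) <= (\<Sum>i<Suc j. e i)" by (intro sum_mono) auto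
  also have "... <= (\<Sum>i<d. e i)" using j e0 by (intro sum_mono2) auto
  also have "... <= n2 0 - n2 d" using sum_e by simp
  finally have "real (Suc j) * (\<Sum>i<Suc j. gap_form (u i)) <= real (Suc j) * (n2 0 - n2 d)"
   by (rule mult_left_mono) simp
  with gap_form_sum_le[OF uL G[of 0] eq] show ?thesis by linarith
 qed
 have "(\<Sum>j<d. psd_kernel.gap_form M (K j) (G 0)) <= (\<Sum>j<d. real (Suc j) * (n2 0 - n2 d))"
  by (intro sum_mono gj) auto
 also have "... = (\<Sum>j<d. real (Suc j)) * (n2 0 - n2 d)" by (rule sum_distrib_right[symmetric])
 also have "2 * (\<Sum>j<d. real (Suc j)) = real d * (real d + 1)" by (induct d) (auto simp: algebra_simps)
 then have "(\<Sum>j<d. real (Suc j)) = real d * (real d + 1) / 2" by simp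
 finally show ?thesis by (simp add: n2_def)
qed

text \<open>\<open>P (Suc j)\<close> moves by \<open>K j\<close> first and therefore applies
  \<open>K j\<close> last as an operator, so with \<open>G 0\<close> the centred \<open>f\<close>
  each \<open>G (Suc j)\<close> is \<open>K j\<close> applied to \<open>G j\<close>. Writing t for
  \<kappa> / (d (d + 1)), \<open>gap\<close> and \<open>scan_decrease\<close> give a factor 1 - 2t
  for the squared norm.\<close>

lemma scan_opnorm_le:
 fixes P :: "nat => 'a => 'a measure"
 assumes M: "prob_space M"
  and P0: "P 0 = return S" "sets S = sets M"
  and PSuc: "\<And>j. j < d ==> P (Suc j) = (\<lambda>x. K j x \<bind> P j)"
  and K: "\<And>j. j < d ==> psd_kernel M (K j)"
  and gap: "\<And>f. f \<in> L2 M ==> (\<integral>x. f x \<partial>M) = 0 ==>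
   \<kappa> * (\<integral>x. (f x)^2 \<partial>M) <= (\<Sum>j<d. psd_kernel.gap_form M (K j) f)"
  and d: "d \<ge> 1" and k: "0 <= \<kappa>" "\<kappa> <= real d * (real d + 1)"
 shows "L2_opnorm M (\<lambda>f x. kernel_op (P d) f x - mean_op M f x) <= ereal (1 - \<kappa> / (real d * (real d + 1)))"
proof -
 interpret prob_space M by (rule M)
 have Pk: "P j \<in> M \<rightarrow>\<^sub>M subprob_algebra M \<and> (\<forall>f\<in>bmeas M. (\<integral>\<^sup>+x. \<integral>\<^sup>+y. f y \<partial>P j x \<partial>M) = (\<integral>\<^sup>+x. f x \<partial>M))
  \<and> (\<forall>x\<in>space M. prob_space (P j x))" if "j <= d" for j
  using that
 proof (induction j)
  case 0
  have s: "return S x = return M x" for x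
   using return_cong[OF P0(2)] by simp
  have "P 0 = return M" unfolding P0 using s by auto
  then show ?case
   by (auto simp: nn_integral_return prob_space_return intro!: nn_integral_cong)
 next
  case (Suc j)
  interpret psd_kernel M "K j" using K[of j] Suc by auto
  have Pj[measurable]: "P j \<in> M \<rightarrow>\<^sub>M subprob_algebra M" using Suc by auto
  have meas: "P (Suc j) \<in> M \<rightarrow>\<^sub>M subprob_algebra M"
   using PSuc[of j] Suc.prems measurable_bind2[OF kernel Pj] by simp
  moreover have "(\<integral>\<^sup>+x. \<integral>\<^sup>+y. f y \<partial>P (Suc j) x \<partial>M) = (\<integral>\<^sup>+x. f x \<partial>M)" if f[measurable]: "f \<in> bmeas M" for f
  proof -
   have "(\<integral>\<^sup>+x. \<integral>\<^sup>+y. f y \<partial>P (Suc j) x \<partial>M) = (\<integral>\<^sup>+x. \<integral>\<^sup>+z. \<integral>\<^sup>+y. f y \<partial>P j z \<partial>K j x \<partial>M)"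
    using PSuc[of j] Suc.prems
    by (intro nn_integral_cong) (simp add: nn_integral_bind[OF f] measurable_cong_sets[OF sets_K refl])
   also have "... = (\<integral>\<^sup>+z. \<integral>\<^sup>+y. f y \<partial>P j z \<partial>M)"
    by (rule nn_integral_invariant) (rule measurable_compose[OF Pj nn_integral_measurable_subprob_algebra[OF f]])
   also have "... = (\<integral>\<^sup>+x. f x \<partial>M)" using Suc f by auto
   finally show ?thesis .
  qed
  moreover have "prob_space (P (Suc j) x)" if x: "x \<in> space M" for x
  proof -
   interpret Kx: prob_space "K j x" by (rule prob_kernel[OF x])
   have Pm: "P j \<in> K j x \<rightarrow>\<^sub>M subprob_algebra M"
    using Pj measurable_cong_sets[OF sets_K[OF x] refl] by blast
   have "AE z in K j x. prob_space (P j z)"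
    using Suc x sets_eq_imp_space_eq[OF sets_K[OF x]] by (auto intro!: AE_I2)
   then show ?thesis
    using PSuc[of j] Suc.prems Kx.prob_space_bind[OF _ Pm] by auto
  qed
  ultimately show ?case by blast
 qed
 define C where "C = 1 - \<kappa> / (real d * (real d + 1))"
 have dpos: "real d * (real d + 1) > 0" using d by simp
 have C: "0 <= C" using k dpos by (simp add: C_def)
 have "(\<lambda>x. kernel_op (P d) f x - mean_op M f x) \<in> L2 M \<and>
  L2_norm M (\<lambda>x. kernel_op (P d) f x - mean_op M f x) <= C * L2_norm M f" if f: "f \<in> L2 M" for f
 proof -
  define m where "m = (\<integral>x. f x \<partial>M)"
  have fm[measurable]: "f \<in> bmeas M" and f2: "integrable M (\<lambda>x. (f x)^2)" using f by (auto simp: L2_def)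
  have fi: "integrable M f" by (rule square_integrable_imp_integrable[OF fm f2])
  define G where "G j x = kernel_op (P j) f x - m" for j x
  have c: "(\<lambda>x. m) \<in> L2 M" by (simp add: L2_def)
  have finj: "AE x in M. (\<integral>\<^sup>+z. \<integral>\<^sup>+y. ennreal \<bar>f y\<bar> \<partial>P j z \<partial>K j x) < \<infinity>" if j: "j < d" for j
  proof -
   interpret psd_kernel M "K j" by (rule K[OF j])
   have Pj[measurable]: "P j \<in> M \<rightarrow>\<^sub>M subprob_algebra M" using Pk j by auto
   have m1[measurable]: "(\<lambda>z. \<integral>\<^sup>+y. ennreal \<bar>f y\<bar> \<partial>P j z) \<in> bmeas M"
    by (rule measurable_compose[OF Pj nn_integral_measurable_subprob_algebra]) simp
   have m2: "(\<lambda>x. \<integral>\<^sup>+z. \<integral>\<^sup>+y. ennreal \<bar>f y\<bar> \<partial>P j z \<partial>K j x) \<in> bmeas M"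
    by (rule measurable_compose[OF kernel nn_integral_measurable_subprob_algebra[OF m1]])
   have "(\<integral>\<^sup>+x. \<integral>\<^sup>+z. \<integral>\<^sup>+y. ennreal \<bar>f y\<bar> \<partial>P j z \<partial>K j x \<partial>M) = (\<integral>\<^sup>+x. ennreal \<bar>f x\<bar> \<partial>M)"
    using nn_integral_invariant[OF m1] Pk[of j] j by auto
   also have "... < \<infinity>" using fi by (simp add: integrable_iff_bounded)
   finally show ?thesis using nn_integral_PInf_AE[OF m2] by (auto simp: less_top)
  qed
  \<comment> \<open>Only almost everywhere: \<open>f\<close> need not be integrable under the kernel
    from every starting point.\<close>
  have st: "AE x in M. G (Suc j) x = kernel_op (K j) (G j) x" if j: "j < d" for j
   using finj[OF j] AE_space
  proof eventually_elim
   case (elim x)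
   interpret psd_kernel M "K j" by (rule K[OF j])
   interpret Kx: prob_space "K j x" by (rule prob_kernel[OF elim(2)])
   have Pj: "P j \<in> K j x \<rightarrow>\<^sub>M subprob_algebra M"
    using Pk[of j] j measurable_cong_sets[OF sets_K[OF elim(2)] refl] by auto
   note ib = integral_bind_of_integrable[OF Pj fm elim(1) Kx.not_empty]
   have "kernel_op (P (Suc j)) f x = (\<integral>z. kernel_op (P j) f z \<partial>K j x)"
    unfolding kernel_op_def PSuc[OF j] by (rule ib(4))
   moreover have "(\<integral>z. kernel_op (P j) f z - m \<partial>K j x) = (\<integral>z. kernel_op (P j) f z \<partial>K j x) - m"
    using ib(3) by (simp add: kernel_op_def Kx.prob_space)
   ultimately show ?case by (simp add: G_def[abs_def] kernel_op_def[of "K j"])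
  qed
  have G0: "G 0 x = f x - m" if "x \<in> space M" for x
  proof -
   have "P 0 x = return M x" unfolding P0 using return_cong[OF P0(2)] by simp
   then show ?thesis using that by (simp add: G_def kernel_op_def integral_return)
  qed
  have GL: "G j \<in> L2 M" if "j <= d" for j
   using that
  proof (induction j)
   case 0
   have "(\<lambda>x. f x - m) \<in> L2 M" by (rule L2_diff[OF f c])
   then show ?case unfolding L2_def using G0 by (simp cong: measurable_cong Bochner_Integration.integrable_cong)
  next
   case (Suc j)
   then interpret psd_kernel M "K j" using K[of j] by auto
   have Gj: "G j \<in> L2 M" using Suc by auto
   have k: "kernel_op (K j) (G j) \<in> L2 M" by (rule kernel_op_L2[OF Gj Gj])
   have [measurable]: "G (Suc j) \<in> bmeas M"
    unfolding G_def[abs_def] kernel_op_def[abs_def]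
    using measurable_compose[OF _ integral_measurable_subprob_algebra[OF fm], of "P (Suc j)"] Pk[OF Suc.prems] by auto
   have "integrable M (\<lambda>x. (G (Suc j) x)^2)"
    using k st[of j] Suc.prems
    by (subst integrable_cong_AE[of _ M "\<lambda>x. (kernel_op (K j) (G j) x)^2"]) (auto simp: L2_def)
   then show ?case by (simp add: L2_def)
  qed
  have mean0: "(\<integral>x. G 0 x \<partial>M) = 0"
  proof -
   have "(\<integral>x. G 0 x \<partial>M) = (\<integral>x. f x - m \<partial>M)" by (intro Bochner_Integration.integral_cong) (auto simp: G0)
   then show ?thesis using fi by (simp add: m_def prob_space)
  qed
  define a where "a = (\<integral>x. (G 0 x)^2 \<partial>M)"
  define b where "b = (\<integral>x. (G d x)^2 \<partial>M)"
  have "2 * (\<kappa> * a) <= real d * (real d + 1) * (a - b)"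
   using scan_decrease[of d M K G, OF K GL st] gap[OF GL[of 0] mean0] unfolding a_def b_def by simp
  then have ba: "b <= (1 - 2 * (\<kappa> / (real d * (real d + 1)))) * a"
   using dpos by (simp add: field_simps)
  have a0: "0 <= a" "0 <= b" unfolding a_def b_def by simp_all
  \<comment> \<open>1 - 2t \<le> (1 - t)^2: the rate for the norm is half the rate for its
    square.\<close>
  have "1 - 2 * (\<kappa> / (real d * (real d + 1))) <= C\<^sup>2"
   unfolding C_def by (simp add: power2_eq_square algebra_simps)
  then have bC: "b <= C\<^sup>2 * a" using ba a0 by (meson mult_right_mono order_trans)
  have af: "a <= (\<integral>x. (f x)^2 \<partial>M)"
  proof -
   have "a = variance f" unfolding a_def by (intro Bochner_Integration.integral_cong) (auto simp: G0 m_def)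
   also have "... <= (\<integral>x. (f x)^2 \<partial>M)" using variance_eq[OF fi f2] by simp
   finally show ?thesis .
  qed
  have "b <= C\<^sup>2 * (\<integral>x. (f x)^2 \<partial>M)" using bC mult_left_mono[OF af, of "C\<^sup>2"] by simp
  then have "sqrt b <= sqrt (C\<^sup>2 * (\<integral>x. (f x)^2 \<partial>M))" by simp
  also have "... = C * sqrt (\<integral>x. (f x)^2 \<partial>M)" using C by (simp add: real_sqrt_mult)
  finally show ?thesis
   using GL[of d] unfolding L2_norm_def b_def G_def[abs_def] m_def mean_op_def by simp
 qed
 then have "L2_opnorm M (\<lambda>f x. kernel_op (P d) f x - mean_op M f x) <= ereal C"
  unfolding L2_opnorm_def using C by (intro Inf_lower) auto
 then show ?thesis by (simp add: C_def)
qed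

section \<open>Conditional variances of Gaussian pairs\<close>

abbreviation std_normal :: "real measure" where
 "std_normal \<equiv> density lborel std_normal_density"

abbreviation std_expectation :: "(real => real) => real" (binder "EE " 10) where
 "std_expectation f \<equiv> integral\<^sup>L std_normal f"

abbreviation std_nn_expectation :: "(real => ennreal) => ennreal" (binder "EN " 10) where
 "std_nn_expectation f \<equiv> nn_integral std_normal f"

abbreviation nn_integral_line :: "(real => ennreal) => ennreal" (binder "NI " 10) where
 "nn_integral_line f \<equiv> nn_integral lborel f"

abbreviation sdens :: "real => real" where
 "sdens \<equiv> std_normal_density"

lemma prob_space_std_normal: "prob_space std_normal"
 by (rule prob_space_normal_density) simp

interpretation std_normal: prob_space std_normal
 by (rule prob_space_std_normal)

interpretation std_normal_pair: pair_prob_space std_normal std_normal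
 by standard

lemma nn_integral_std_normal:
 assumes [measurable]: "f \<in> bmeas borel"
 shows "(EN z. f z) = (NI z. ennreal (sdens z) * f z)"
 by (rule nn_integral_density) auto

lemma nn_integral_std_normal_affine:
 assumes [measurable]: "f \<in> bmeas borel" and sd: "0 < sd"
 shows "(EN z. f (\<mu> + sd * z)) = (NI y. ennreal (normal_density \<mu> sd y) * f y)"
proof -
 have "(NI y. ennreal (normal_density \<mu> sd y) * f y)
  = ennreal \<bar>sd\<bar> * (NI z. ennreal (normal_density \<mu> sd (\<mu> + sd * z)) * f (\<mu> + sd * z))"
  using sd by (intro nn_integral_real_affine) auto
 also have "... = (NI z. ennreal \<bar>sd\<bar> * (ennreal (normal_density \<mu> sd (\<mu> + sd * z)) * f (\<mu> + sd * z)))"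
  by (rule nn_integral_cmult[symmetric]) measurable
 also have "... = (NI z. ennreal (sdens z) * f (\<mu> + sd * z))"
 proof (rule nn_integral_cong)
  fix z
  have "sd * normal_density \<mu> sd (\<mu> + sd * z) = sdens z"
   using sd by (simp add: normal_density_def real_sqrt_mult power_mult_distrib)
  then show "ennreal \<bar>sd\<bar> * (ennreal (normal_density \<mu> sd (\<mu> + sd * z)) * f (\<mu> + sd * z)) = ennreal (sdens z) * f (\<mu> + sd * z)"
   using sd by (simp add: mult.assoc[symmetric] ennreal_mult[symmetric])
 qed
 also have "... = (EN z. f (\<mu> + sd * z))"
  by (rule nn_integral_std_normal[symmetric]) measurable
 finally show ?thesis ..
qed

lemma distr_std_normal_affine:
 assumes "0 < sd"
 shows "distr std_normal borel (\<lambda>z. \<mu> + sd * z) = density lborel (normal_density \<mu> sd)"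
proof (rule measure_eqI)
 fix A assume "A \<in> sets (distr std_normal borel (\<lambda>z. \<mu> + sd * z))"
 then have [measurable]: "A \<in> sets borel" by simp
 have "emeasure (distr std_normal borel (\<lambda>z. \<mu> + sd * z)) A = (\<integral>\<^sup>+z. indicator A z \<partial>distr std_normal borel (\<lambda>z. \<mu> + sd * z))" by simp
 also have "... = (EN z. indicator A (\<mu> + sd * z))" by (rule nn_integral_distr) auto
 also have "... = emeasure (density lborel (normal_density \<mu> sd)) A"
  by (subst nn_integral_std_normal_affine) (use assms in \<open>auto simp: emeasure_density\<close>)
 finally show "emeasure (distr std_normal borel (\<lambda>z. \<mu> + sd * z)) A = emeasure (density lborel (normal_density \<mu> sd)) A" .
qed simp

section \<open>Correlated Gaussian pairs\<close>

lemma normal_bivariate_swap: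
 assumes r: "rho\<^sup>2 + r\<^sup>2 = 1" "0 < r"
 shows "sdens x * normal_density (rho * x) r y = sdens y * normal_density (rho * y) r x"
proof -
 have e: "- x\<^sup>2 / 2 + - (y - rho * x)\<^sup>2 / (2 * r\<^sup>2) = - (x\<^sup>2 - 2 * rho * x * y + y\<^sup>2) / (2 * r\<^sup>2)" for x y
 proof -
  have x: "x\<^sup>2 * r\<^sup>2 = x\<^sup>2 - rho\<^sup>2 * x\<^sup>2" 
  proof -
   have "(rho\<^sup>2 + r\<^sup>2) * x\<^sup>2 = x\<^sup>2" using r by simp
   then show ?thesis by (simp add: algebra_simps)
  qed
  have "- x\<^sup>2 / 2 + - (y - rho * x)\<^sup>2 / (2 * r\<^sup>2) = - (x\<^sup>2 * r\<^sup>2 + (y - rho * x)^2) / (2 * r\<^sup>2)"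
   using r(2) by (simp add: field_simps)
  also have "x\<^sup>2 * r\<^sup>2 + (y - rho * x)^2 = x\<^sup>2 - 2 * rho * x * y + y\<^sup>2"
   unfolding x by (simp add: power2_eq_square algebra_simps)
  finally show ?thesis .
 qed
 have "exp (- x\<^sup>2 / 2) * exp (- (y - rho * x)\<^sup>2 / (2 * r\<^sup>2)) = exp (- y\<^sup>2 / 2) * exp (- (x - rho * y)\<^sup>2 / (2 * r\<^sup>2))"
  unfolding exp_add[symmetric] e by (simp add: algebra_simps)
 then show ?thesis by (simp add: normal_density_def)
qed

definition bivariate :: "real => (real \<times> real) measure" where
 "bivariate rho = distr (std_normal \<Otimes>\<^sub>M std_normal) (borel \<Otimes>\<^sub>M borel) (\<lambda>(x, z). (x, rho * x + sqrt (1 - rho\<^sup>2) * z))"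

lemma sets_bivariate[measurable_cong, simp]: "sets (bivariate rho) = sets (borel \<Otimes>\<^sub>M borel)"
 by (simp add: bivariate_def)

interpretation bivariate: prob_space "bivariate rho" for rho
 unfolding bivariate_def by (rule prob_space.prob_space_distr[OF std_normal_pair.prob_space_axioms]) measurable

lemma nn_integral_bivariate:
 assumes [measurable]: "F \<in> bmeas (borel \<Otimes>\<^sub>M borel)"
 shows "(\<integral>\<^sup>+p. F p \<partial>bivariate rho) = (EN x. (EN z. F (x, rho * x + sqrt (1 - rho\<^sup>2) * z)))"
 unfolding bivariate_def
 by (subst nn_integral_distr) (auto simp: split_beta' std_normal.nn_integral_fst[symmetric])

lemma integral_bivariate:
 fixes F :: "real \<times> real => real"
 assumes [measurable]: "F \<in> bmeas (borel \<Otimes>\<^sub>M borel)" and B: "\<And>p. \<bar>F p\<bar> <= B"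
 shows "(\<integral>p. F p \<partial>bivariate rho) = (EE x. (EE z. F (x, rho * x + sqrt (1 - rho\<^sup>2) * z)))"
proof -
 have i: "integrable (std_normal \<Otimes>\<^sub>M std_normal) (\<lambda>(x, z). F (x, rho * x + sqrt (1 - rho\<^sup>2) * z))"
  by (rule std_normal_pair.integrable_const_bound[where B=B]) (auto simp: B)
 show ?thesis
  unfolding bivariate_def
  by (subst integral_distr) (use std_normal_pair.integral_fst'[OF i] in \<open>auto simp: split_beta'\<close>)
qed

text \<open>The pair is exchangeable although its construction treats the coordinates differently:
  the joint density is symmetric by \<open>normal_bivariate_swap\<close>.\<close>

lemma bivariate_swap:
 assumes rho: "rho\<^sup>2 < 1"
 shows "distr (bivariate rho) (borel \<Otimes>\<^sub>M borel) (\<lambda>p. (snd p, fst p)) = bivariate rho"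
proof (rule measure_eqI)
 define r where "r = sqrt (1 - rho\<^sup>2)"
 have r: "rho\<^sup>2 + r\<^sup>2 = 1" "0 < r" using rho by (auto simp: r_def)
 fix A assume "A \<in> sets (distr (bivariate rho) (borel \<Otimes>\<^sub>M borel) (\<lambda>p. (snd p, fst p)))"
 then have A[measurable]: "A \<in> sets (borel \<Otimes>\<^sub>M borel)" by simp
 have *: "(\<integral>\<^sup>+p. F p \<partial>bivariate rho) = (NI x. (NI y. ennreal (sdens x * normal_density (rho * x) r y) * F (x, y)))"
  if [measurable]: "F \<in> bmeas (borel \<Otimes>\<^sub>M borel)" for F
 proof -
  have "(\<integral>\<^sup>+p. F p \<partial>bivariate rho) = (EN x. (NI y. ennreal (normal_density (rho * x) r y) * F (x, y)))"
   unfolding nn_integral_bivariate[OF that] r_def[symmetric]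
   by (intro nn_integral_cong nn_integral_std_normal_affine) (use r in auto)
  also have "... = (NI x. ennreal (sdens x) * (NI y. ennreal (normal_density (rho * x) r y) * F (x, y)))"
   by (rule nn_integral_std_normal) (auto simp: normal_density_def)
  also have "... = (NI x. (NI y. ennreal (sdens x * normal_density (rho * x) r y) * F (x, y)))"
   by (intro nn_integral_cong) (simp add: nn_integral_cmult[symmetric] ennreal_mult mult.assoc)
  finally show ?thesis .
 qed
 have "emeasure (distr (bivariate rho) (borel \<Otimes>\<^sub>M borel) (\<lambda>p. (snd p, fst p))) A
   = (\<integral>\<^sup>+p. indicator A p \<partial>distr (bivariate rho) (borel \<Otimes>\<^sub>M borel) (\<lambda>p. (snd p, fst p)))" by simp
 also have "... = (\<integral>\<^sup>+p. indicator A (snd p, fst p) \<partial>bivariate rho)"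
  by (rule nn_integral_distr) auto
 also have "... = (NI x. (NI y. ennreal (sdens x * normal_density (rho * x) r y) * indicator A (y, x)))"
  by (subst *) auto
 also have "... = (NI y. (NI x. ennreal (sdens x * normal_density (rho * x) r y) * indicator A (y, x)))"
  by (rule lborel_pair.Fubini') (simp add: normal_density_def)
 also have "... = (NI y. (NI x. ennreal (sdens y * normal_density (rho * y) r x) * indicator A (y, x)))"
  by (simp only: normal_bivariate_swap[OF r])
 also have "... = (\<integral>\<^sup>+p. indicator A p \<partial>bivariate rho)" by (subst *) auto
 also have "... = emeasure (bivariate rho) A" by simp
 finally show "emeasure (distr (bivariate rho) (borel \<Otimes>\<^sub>M borel) (\<lambda>p. (snd p, fst p))) A = emeasure (bivariate rho) A" .
qed simp

lemma integral_bivariate_swap: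
 fixes F :: "real \<times> real => real"
 assumes "rho\<^sup>2 < 1" and [measurable]: "F \<in> bmeas (borel \<Otimes>\<^sub>M borel)"
 shows "(\<integral>p. F p \<partial>bivariate rho) = (\<integral>p. F (snd p, fst p) \<partial>bivariate rho)"
 by (subst bivariate_swap[OF assms(1), symmetric]) (rule integral_distr; measurable)

text \<open>Needed to compose two Ornstein-Uhlenbeck steps, whose independent noises add up.\<close>

lemma distr_std_normal_sum:
 assumes "0 < \<alpha>" "0 < \<beta>"
 shows "distr (std_normal \<Otimes>\<^sub>M std_normal) borel (\<lambda>(x, z). \<alpha> * x + \<beta> * z) = distr std_normal borel (\<lambda>z. sqrt (\<alpha>\<^sup>2 + \<beta>\<^sup>2) * z)"
proof (rule measure_eqI)
 fix A assume "A \<in> sets (distr (std_normal \<Otimes>\<^sub>M std_normal) borel (\<lambda>(x, z). \<alpha> * x + \<beta> * z))"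
 then have [measurable]: "A \<in> sets borel" by simp
 have c: "0 < sqrt (\<alpha>\<^sup>2 + \<beta>\<^sup>2)" using assms by (simp add: add_pos_pos)
 have "emeasure (distr (std_normal \<Otimes>\<^sub>M std_normal) borel (\<lambda>(x, z). \<alpha> * x + \<beta> * z)) A
   = (\<integral>\<^sup>+p. indicator A p \<partial>distr (std_normal \<Otimes>\<^sub>M std_normal) borel (\<lambda>(x, z). \<alpha> * x + \<beta> * z))" by simp
 also have "... = (\<integral>\<^sup>+p. indicator A (\<alpha> * fst p + \<beta> * snd p) \<partial>(std_normal \<Otimes>\<^sub>M std_normal))"
  by (subst nn_integral_distr) (auto simp: split_beta')
 also have "... = (EN x. (EN z. indicator A (\<alpha> * x + \<beta> * z)))"
  by (subst std_normal.nn_integral_fst[symmetric]) auto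
 also have "... = (EN x. (NI y. ennreal (normal_density (0 + \<alpha> * x) \<beta> y) * indicator A y))"
  by (intro nn_integral_cong) (subst nn_integral_std_normal_affine, use assms in auto)
 also have "... = (NI x. ennreal (normal_density 0 \<alpha> x) * (NI y. ennreal (normal_density x \<beta> y) * indicator A y))"
  by (subst nn_integral_std_normal_affine[where f="\<lambda>x. (NI y. ennreal (normal_density x \<beta> y) * indicator A y)"])
   (use assms in \<open>auto simp: normal_density_def\<close>)
 also have "... = (NI x. (NI y. ennreal (normal_density 0 \<beta> (y - x) * normal_density 0 \<alpha> x) * indicator A y))"
 proof -
  have "normal_density x \<beta> y = normal_density 0 \<beta> (y - x)" for x y by (simp add: normal_density_def)
  then have e: "ennreal (normal_density 0 \<alpha> x) * (ennreal (normal_density x \<beta> y) * indicator A y)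
    = ennreal (normal_density 0 \<beta> (y - x) * normal_density 0 \<alpha> x) * indicator A y" for x y
   by (simp only: ennreal_mult[OF normal_density_nonneg normal_density_nonneg] mult.assoc mult.left_commute)
  show ?thesis
   unfolding e[symmetric] by (intro nn_integral_cong nn_integral_cmult[symmetric]) simp
 qed
 also have "... = (NI y. (NI x. ennreal (normal_density 0 \<beta> (y - x) * normal_density 0 \<alpha> x) * indicator A y))"
  by (rule lborel_pair.Fubini') (simp add: normal_density_def)
 also have "... = (NI y. (NI x. ennreal (normal_density 0 \<beta> (y - x) * normal_density 0 \<alpha> x)) * indicator A y)"
  by (intro nn_integral_cong nn_integral_multc) (simp add: normal_density_def)
 also have "... = (NI y. ennreal (normal_density 0 (sqrt (\<alpha>\<^sup>2 + \<beta>\<^sup>2)) y) * indicator A y)"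
  using fun_cong[OF conv_normal_density_zero_mean[OF assms(2,1)]] by (simp add: add.commute)
 also have "... = (EN z. indicator A (0 + sqrt (\<alpha>\<^sup>2 + \<beta>\<^sup>2) * z))"
  using c by (subst nn_integral_std_normal_affine) auto
 also have "... = emeasure (distr std_normal borel (\<lambda>z. sqrt (\<alpha>\<^sup>2 + \<beta>\<^sup>2) * z)) A"
  using nn_integral_distr[of "\<lambda>z. sqrt (\<alpha>\<^sup>2 + \<beta>\<^sup>2) * z" std_normal borel "indicator A"] by simp
 finally show "emeasure (distr (std_normal \<Otimes>\<^sub>M std_normal) borel (\<lambda>(x, z). \<alpha> * x + \<beta> * z)) A
  = emeasure (distr std_normal borel (\<lambda>z. sqrt (\<alpha>\<^sup>2 + \<beta>\<^sup>2) * z)) A" .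
qed simp

lemma (in prob_space) abs_expectation_le:
 fixes f :: "'a => real"
 assumes [measurable]: "f \<in> bmeas M" and B: "\<And>x. x \<in> space M ==> \<bar>f x\<bar> <= B"
 shows "integrable M f" "\<bar>\<integral>x. f x \<partial>M\<bar> <= B"
proof -
 show i: "integrable M f" by (rule integrable_const_bound[where B=B]) (use B in \<open>auto intro!: AE_I2\<close>)
 have "\<bar>\<integral>x. f x \<partial>M\<bar> <= (\<integral>x. \<bar>f x\<bar> \<partial>M)" using integral_norm_bound[of M f] by simp
 also have "... <= (\<integral>x. B \<partial>M)" using B i by (intro integral_mono) auto
 finally show "\<bar>\<integral>x. f x \<partial>M\<bar> <= B" by (simp add: prob_space)
qed

lemma integral_cauchy_schwarz:
 fixes f g :: "'a => real"
 assumes [measurable]: "f \<in> bmeas M" "g \<in> bmeas M"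
  and f2: "integrable M (\<lambda>x. (f x)^2)" and g2: "integrable M (\<lambda>x. (g x)^2)"
 shows "(\<integral>x. f x * g x \<partial>M)^2 <= (\<integral>x. (f x)^2 \<partial>M) * (\<integral>x. (g x)^2 \<partial>M)"
proof -
 have "ennreal \<bar>\<integral>x. f x * g x \<partial>M\<bar> <= (\<integral>\<^sup>+x. ennreal \<bar>f x\<bar> * ennreal \<bar>g x\<bar> \<partial>M)"
 proof (cases "integrable M (\<lambda>x. f x * g x)")
  case True
  then show ?thesis
   using integral_norm_bound_ennreal[OF True] by (simp add: abs_mult ennreal_mult)
 qed (simp add: not_integrable_integral_eq)
 then have "(ennreal \<bar>\<integral>x. f x * g x \<partial>M\<bar>)^2 <= (\<integral>\<^sup>+x. ennreal \<bar>f x\<bar> * ennreal \<bar>g x\<bar> \<partial>M)^2"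
  by (rule power_mono) simp
 also have "... <= (\<integral>\<^sup>+x. (ennreal \<bar>f x\<bar>)^2 \<partial>M) * (\<integral>\<^sup>+x. (ennreal \<bar>g x\<bar>)^2 \<partial>M)"
  by (rule Cauchy_Schwarz_nn_integral) auto
 finally have "ennreal ((\<integral>x. f x * g x \<partial>M)^2) <= ennreal ((\<integral>x. (f x)^2 \<partial>M) * (\<integral>x. (g x)^2 \<partial>M))"
  using f2 g2 by (simp add: ennreal_power nn_integral_eq_integral ennreal_mult)
 then show ?thesis by (subst (asm) ennreal_le_iff) auto
qed

section \<open>The Ornstein-Uhlenbeck (Mehler) operator and its contraction of centred
  functions\<close>

definition ou :: "real => (real => real) => real => real" where
 "ou rho k x = (EE z. k (rho * x + sqrt (1 - rho\<^sup>2) * z))"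

lemma std_normal_UNIV[simp]: "measure std_normal UNIV = 1" "emeasure std_normal UNIV = 1"
 using std_normal.prob_space std_normal.emeasure_space_1 by simp_all

lemma ou_measurable[measurable]:
 assumes [measurable]: "k \<in> bmeas borel"
 shows "ou rho k \<in> bmeas borel"
 unfolding ou_def[abs_def] by measurable

lemma abs_ou_le: "k \<in> bmeas borel ==> (\<And>x. \<bar>k x\<bar> <= B) ==> \<bar>ou rho k x\<bar> <= B"
 unfolding ou_def by (rule std_normal.abs_expectation_le(2)) auto

lemma integrable_std_normal_bounded:
 "k \<in> bmeas borel ==> (\<And>x. \<bar>k x :: real\<bar> <= B) ==> integrable std_normal k"
 by (rule std_normal.abs_expectation_le(1)) auto

lemma abs_mult_le: "\<bar>a :: real\<bar> <= A ==> \<bar>b\<bar> <= B ==> \<bar>a * b\<bar> <= A * B"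
 unfolding abs_mult by (intro mult_mono) auto

lemma abs_square_le: "\<bar>a :: real\<bar> <= A ==> \<bar>a\<^sup>2\<bar> <= A * A"
 unfolding power2_eq_square by (rule abs_mult_le)

lemma integrable_std_normal_square:
 assumes [measurable]: "k \<in> bmeas borel" and B: "\<And>x. \<bar>k x :: real\<bar> <= B"
 shows "integrable std_normal (\<lambda>x. (k x)^2)"
 by (rule integrable_std_normal_bounded[OF _ abs_square_le[OF B]]) measurable

context
 fixes k l :: "real => real" and A B rho :: real
 assumes k[measurable]: "k \<in> bmeas borel" and kB: "\<And>x. \<bar>k x\<bar> <= A"
  and l[measurable]: "l \<in> bmeas borel" and lB: "\<And>x. \<bar>l x\<bar> <= B"
  and rho: "rho\<^sup>2 < 1"
begin

lemma integral_ou_mult: "(EE x. l x * ou rho k x) = (\<integral>p. l (fst p) * k (snd p) \<partial>bivariate rho)"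
 by (subst integral_bivariate[where B="B * A"]) (auto intro!: abs_mult_le kB lB simp: ou_def)

text \<open>Exchangeability of the Gaussian pair, since \<open>ou rho k\<close> is the conditional
  expectation of \<open>k\<close> of one coordinate given the other.\<close>

lemma ou_selfadjoint: "(EE x. l x * ou rho k x) = (EE x. ou rho l x * k x)"
proof -
 have "(\<integral>p. l (fst p) * k (snd p) \<partial>bivariate rho) = (\<integral>p. k (fst p) * l (snd p) \<partial>bivariate rho)"
  by (subst integral_bivariate_swap[OF rho]) (auto simp: mult.commute)
 also have "... = (EE x. k x * ou rho l x)"
  by (subst integral_bivariate[where B="A * B"]) (auto intro!: abs_mult_le kB lB simp: ou_def)
 finally show ?thesis unfolding integral_ou_mult by (simp add: mult.commute)
qed

end

lemma integral_ou:
 assumes "k \<in> bmeas borel" "\<And>x. \<bar>k x\<bar> <= A" "rho\<^sup>2 < 1"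
 shows "(EE x. ou rho k x) = (EE x. k x)"
proof -
 have "ou rho (\<lambda>_. 1) x = 1" for x by (simp add: ou_def)
 then show ?thesis
  using ou_selfadjoint[of k A "\<lambda>_. 1" 1 rho] assms by simp
qed

text \<open>Semigroup property: with r^2 = 1 - rho^2 the two noises have total variance (rho r)^2 +
  r^2 = 1 - rho^4, as correlation rho^2 demands.\<close>

lemma ou_ou:
 assumes k[measurable]: "k \<in> bmeas borel" and kB: "\<And>x. \<bar>k x\<bar> <= A" and rho: "0 < rho" "rho < 1"
 shows "ou rho (ou rho k) x = ou (rho\<^sup>2) k x"
proof -
 define r where "r = sqrt (1 - rho\<^sup>2)"
 have rho2: "rho\<^sup>2 < 1" using rho by (simp add: abs_square_less_1)
 have r: "0 < r" "r\<^sup>2 = 1 - rho\<^sup>2" using rho2 by (auto simp: r_def)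
 have c: "sqrt ((rho * r)^2 + r\<^sup>2) = sqrt (1 - (rho\<^sup>2)^2)"
  by (simp add: power_mult_distrib r(2)) (simp add: power2_eq_square power4_eq_xxxx algebra_simps)
 have i: "integrable (std_normal \<Otimes>\<^sub>M std_normal) (\<lambda>(z, z'). k (rho\<^sup>2 * x + (rho * r * z + r * z')))"
  by (rule std_normal_pair.integrable_const_bound[where B=A]) (auto simp: kB)
 have "ou rho (ou rho k) x = (EE z. (EE z'. k (rho\<^sup>2 * x + (rho * r * z + r * z'))))"
  unfolding ou_def r_def[symmetric]
  by (intro Bochner_Integration.integral_cong refl arg_cong[of _ _ k]) (simp add: power2_eq_square algebra_simps)
 also have "... = (\<integral>p. k (rho\<^sup>2 * x + (rho * r * fst p + r * snd p)) \<partial>(std_normal \<Otimes>\<^sub>M std_normal))"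
  using std_normal_pair.integral_fst'[OF i] by (simp add: split_beta')
 also have "... = (\<integral>y. k (rho\<^sup>2 * x + y) \<partial>distr (std_normal \<Otimes>\<^sub>M std_normal) borel (\<lambda>(z, z'). rho * r * z + r * z'))"
  by (subst integral_distr) (auto simp: split_beta')
 also have "... = (\<integral>y. k (rho\<^sup>2 * x + y) \<partial>distr std_normal borel (\<lambda>z. sqrt (1 - (rho\<^sup>2)^2) * z))"
  unfolding distr_std_normal_sum[OF mult_pos_pos[OF rho(1) r(1)] r(1)] c ..
 also have "... = ou (rho\<^sup>2) k x"
  unfolding ou_def by (subst integral_distr) auto
 finally show ?thesis .
qed

text \<open>The ratio of the conditional to the marginal density is the Mehler kernel. Completing
  the square shows that its square, weighted by both marginals, is 1 / (1 - rho^2) times a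
  probability density, so that its second moment can be read off.\<close>

lemma mehler_square:
 assumes rho: "rho\<^sup>2 < 1"
 shows "sdens x * (sdens y * (normal_density (rho * x) (sqrt (1 - rho\<^sup>2)) y / sdens y)^2)
  = 1 / (1 - rho\<^sup>2) * (normal_density 0 (sqrt ((1 + rho\<^sup>2) / (1 - rho\<^sup>2))) x *
    normal_density (2 * rho * x / (1 + rho\<^sup>2)) (sqrt ((1 - rho\<^sup>2) / (1 + rho\<^sup>2))) y)"
proof -
 define u v where "u = 1 - rho\<^sup>2" and "v = 1 + rho\<^sup>2"
 have u: "0 < u" and v: "0 < v" using rho by (auto simp: u_def v_def add_pos_nonneg)
 have uv: "v\<^sup>2 = u\<^sup>2 + 4 * rho\<^sup>2" "u + 2 * rho\<^sup>2 = v" "v - u = 2 * rho\<^sup>2" "u + v = 2"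
  by (auto simp: u_def v_def power2_eq_square algebra_simps)
 have e: "- x\<^sup>2 / 2 + y\<^sup>2 / 2 + 2 * (- (y - rho * x)\<^sup>2 / (2 * u)) = - x\<^sup>2 / (2 * (v / u)) + - (y - 2 * rho * x / v)\<^sup>2 / (2 * (u / v))"
 proof -
  have "- x\<^sup>2 / 2 + y\<^sup>2 / 2 + 2 * (- (y - rho * x)\<^sup>2 / (2 * u)) = - (x\<^sup>2 * (u + 2 * rho\<^sup>2) - 4 * rho * x * y + y\<^sup>2 * (2 - u)) / (2 * u)"
   using u by (simp add: field_simps power2_eq_square)
  also have "... = - (x\<^sup>2 * v - 4 * rho * x * y + y\<^sup>2 * v) / (2 * u)" 
  proof -
   have "2 - u = v" using uv(4) by simp
   then show ?thesis by (simp only: uv(2) mult.commute[of v])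
  qed
  also have "... = - (x\<^sup>2 * v\<^sup>2 - 4 * rho * x * y * v + y\<^sup>2 * v\<^sup>2) / (2 * u * v)"
   using u v by (simp add: field_simps power2_eq_square)
  also have "... = - (x\<^sup>2 * u\<^sup>2 + (y * v - 2 * rho * x)^2) / (2 * u * v)"
  proof -
   have "x\<^sup>2 * v\<^sup>2 = x\<^sup>2 * u\<^sup>2 + 4 * rho\<^sup>2 * x\<^sup>2" unfolding uv(1) by (simp add: algebra_simps)
   then have "x\<^sup>2 * v\<^sup>2 - 4 * rho * x * y * v + y\<^sup>2 * v\<^sup>2 = x\<^sup>2 * u\<^sup>2 + (y * v - 2 * rho * x)^2"
    by (simp add: power2_diff power_mult_distrib)
   then show ?thesis by simp
  qed
  also have "... = - x\<^sup>2 / (2 * (v / u)) + - (y - 2 * rho * x / v)\<^sup>2 / (2 * (u / v))"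
   using u v by (simp add: field_simps power2_eq_square)
  finally show ?thesis .
 qed
 have s: "sqrt (2 * pi * (sqrt (v / u))^2) * sqrt (2 * pi * (sqrt (u / v))^2) = 2 * pi"
 proof -
  have "sqrt (2 * pi * (sqrt (v / u))^2) * sqrt (2 * pi * (sqrt (u / v))^2) = sqrt ((2 * pi * (v / u)) * (2 * pi * (u / v)))"
   using u v by (simp only: real_sqrt_mult[symmetric]) simp
  also have "(2 * pi * (v / u)) * (2 * pi * (u / v)) = (2 * pi)^2"
   using u v by (simp add: power2_eq_square field_simps)
  finally show ?thesis by (simp only: real_sqrt_abs) simp
 qed
 have "sdens x * (sdens y * (normal_density (rho * x) (sqrt u) y / sdens y)^2)
   = (1 / (2 * pi * u)) * (exp (- x\<^sup>2 / 2) * exp (y\<^sup>2 / 2) * exp (2 * (- (y - rho * x)\<^sup>2 / (2 * u))))"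
 proof -
  have 1: "sdens x * (sdens y * (n / sdens y)^2) = exp (- x\<^sup>2 / 2) * exp (y\<^sup>2 / 2) * n\<^sup>2" for n
   by (simp add: std_normal_density_def power2_eq_square field_simps exp_minus)
  have 2: "(normal_density (rho * x) (sqrt u) y)^2 = (1 / (2 * pi * u)) * exp (2 * (- (y - rho * x)\<^sup>2 / (2 * u)))"
  proof -
   have "(normal_density (rho * x) (sqrt u) y)^2 = (1 / sqrt (2 * pi * u))^2 * (exp (- (y - rho * x)\<^sup>2 / (2 * u)))^2"
    using u by (simp only: normal_density_def power_mult_distrib real_sqrt_pow2 less_imp_le)
   also have "(1 / sqrt (2 * pi * u))^2 = 1 / (2 * pi * u)" using u by (simp add: power_divide)
   finally show ?thesis by (simp only: exp_double[symmetric])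
  qed
  show ?thesis unfolding 1 2 by simp
 qed
 also have "... = (1 / (2 * pi * u)) * (exp (- x\<^sup>2 / (2 * (v / u))) * exp (- (y - 2 * rho * x / v)\<^sup>2 / (2 * (u / v))))"
  unfolding exp_add[symmetric] e ..
 also have "... = 1 / u * (normal_density 0 (sqrt (v / u)) x * normal_density (2 * rho * x / v) (sqrt (u / v)) y)"
 proof -
  have 3: "normal_density 0 (sqrt (v / u)) x * normal_density (2 * rho * x / v) (sqrt (u / v)) y
   = 1 / (sqrt (2 * pi * (sqrt (v / u))^2) * sqrt (2 * pi * (sqrt (u / v))^2)) *
    (exp (- x\<^sup>2 / (2 * (v / u))) * exp (- (y - 2 * rho * x / v)\<^sup>2 / (2 * (u / v))))"
   unfolding normal_density_def using u v by simp
  show ?thesis unfolding 3 s by simp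
 qed
 finally show ?thesis unfolding u_def v_def .
qed

text \<open>The squared Hilbert-Schmidt norm of the Ornstein-Uhlenbeck operator after removal of the
  constants.\<close>

lemma nn_integral_mehler:
 assumes rho: "rho\<^sup>2 < 1"
 shows "(EN x. (EN y. ennreal ((normal_density (rho * x) (sqrt (1 - rho\<^sup>2)) y / sdens y - 1)^2)))
  = ennreal (rho\<^sup>2 / (1 - rho\<^sup>2))"
proof -
 define M where "M x y = normal_density (rho * x) (sqrt (1 - rho\<^sup>2)) y / sdens y" for x y
 have [measurable]: "(\<lambda>(x, y). M x y) \<in> bmeas (borel \<Otimes>\<^sub>M borel)"
  unfolding M_def normal_density_def by measurable
 have M0: "0 <= M x y" for x y by (simp add: M_def)
 define s1 s2 where "s1 = sqrt ((1 + rho\<^sup>2) / (1 - rho\<^sup>2))" and "s2 = sqrt ((1 - rho\<^sup>2) / (1 + rho\<^sup>2))"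
 have s: "0 < s1" "0 < s2" using rho by (auto simp: s1_def s2_def add_pos_nonneg)
 have nd: "(NI y. ennreal (normal_density \<mu> sd y)) = 1" if "0 < sd" for \<mu> sd
  using that by (subst nn_integral_eq_integral) auto
 have conv: "(EN x. (EN y. ennreal (f x y)))
   = (NI x. (NI y. ennreal (sdens x * (sdens y * f x y))))"
  if [measurable]: "(\<lambda>(x, y). f x y) \<in> bmeas (borel \<Otimes>\<^sub>M borel)" and f0: "\<And>x y. 0 <= f x y" for f
 proof -
  have "(EN x. (EN y. ennreal (f x y)))
   = (NI x. ennreal (sdens x) * (NI y. ennreal (sdens y) * ennreal (f x y)))"
   by (subst nn_integral_std_normal) (auto simp: nn_integral_std_normal)
  also have "... = (NI x. (NI y. ennreal (sdens x * (sdens y * f x y))))"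
   by (intro nn_integral_cong, subst nn_integral_cmult[symmetric]) (auto simp: ennreal_mult f0)
  finally show ?thesis .
 qed
 have I1: "(EN x. (EN y. ennreal (M x y))) = 1"
 proof -
  have "(EN y. ennreal (M x y)) = 1" for x
  proof -
   have "(EN y. ennreal (M x y)) = (NI y. ennreal (normal_density (rho * x) (sqrt (1 - rho\<^sup>2)) y))"
   proof (subst nn_integral_std_normal)
    have "sdens y * M x y = normal_density (rho * x) (sqrt (1 - rho\<^sup>2)) y" for y
     using normal_density_pos[of 1 0 y] by (simp add: M_def)
    then show "(\<integral>\<^sup>+ z. ennreal (sdens z) * ennreal (M x z) \<partial>lborel) = (NI y. ennreal (normal_density (rho * x) (sqrt (1 - rho\<^sup>2)) y))"
     by (simp add: ennreal_mult[symmetric] M0)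
   qed measurable
   then show ?thesis using nd[of "sqrt (1 - rho\<^sup>2)"] rho by simp
  qed
  then show ?thesis by simp
 qed
 have I2: "(EN x. (EN y. ennreal ((M x y)^2))) = ennreal (1 / (1 - rho\<^sup>2))"
 proof -
  have "(EN x. (EN y. ennreal ((M x y)^2)))
   = (NI x. (NI y. ennreal (1 / (1 - rho\<^sup>2) * (normal_density 0 s1 x * normal_density (2 * rho * x / (1 + rho\<^sup>2)) s2 y))))"
   unfolding M_def s1_def s2_def mehler_square[OF rho, symmetric]
   by (rule conv) (auto simp: normal_density_def)
  also have "... = (NI x. ennreal (1 / (1 - rho\<^sup>2) * normal_density 0 s1 x) * (NI y. ennreal (normal_density (2 * rho * x / (1 + rho\<^sup>2)) s2 y)))"
   using rho by (intro nn_integral_cong, subst nn_integral_cmult[symmetric]) (auto simp: ennreal_mult[symmetric] mult.assoc)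
  also have "... = (NI x. ennreal (1 / (1 - rho\<^sup>2)) * ennreal (normal_density 0 s1 x))"
   unfolding nd[OF s(2)] using rho by (intro nn_integral_cong) (simp add: ennreal_mult[symmetric])
  also have "... = ennreal (1 / (1 - rho\<^sup>2))"
   by (subst nn_integral_cmult) (simp_all add: nd[OF s(1)])
  finally show ?thesis .
 qed
 define X where "X = (EN x. (EN y. ennreal ((M x y - 1)^2)))"
 \<comment> \<open>(M - 1)^2 + 2 M = M^2 + 1 keeps all terms nonnegative, so that no subtraction
   takes place in \<open>ennreal\<close>.\<close>
 have "X + 2 * (EN x. (EN y. ennreal (M x y)))
  = (EN x. (EN y. ennreal ((M x y - 1)^2) + 2 * ennreal (M x y)))"
  unfolding X_def by (simp add: nn_integral_add nn_integral_cmult)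
 also have "... = (EN x. (EN y. ennreal ((M x y)^2) + 1))"
 proof (intro nn_integral_cong)
  fix x y
  have "ennreal ((M x y - 1)^2) + 2 * ennreal (M x y) = ennreal ((M x y - 1)^2 + 2 * M x y)"
   using M0[of x y] by (simp add: ennreal_mult[symmetric] flip: ennreal_plus ennreal_numeral)
  also have "(M x y - 1)^2 + 2 * M x y = (M x y)^2 + 1" by (simp add: power2_eq_square algebra_simps)
  finally show "ennreal ((M x y - 1)^2) + 2 * ennreal (M x y) = ennreal ((M x y)^2) + 1" by simp
 qed
 also have "... = ennreal (1 / (1 - rho\<^sup>2)) + 1"
  by (simp add: nn_integral_add I2)
 finally have X2: "X + 2 = ennreal (1 / (1 - rho\<^sup>2) + 1)" using rho unfolding I1 by simp
 then have "X < \<infinity>" by (metis ennreal_add_eq_top ennreal_less_top infinity_ennreal_def less_top)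
 then obtain x where x: "X = ennreal x" "0 <= x" by (cases X) auto
 have "ennreal (x + 2) = ennreal (1 / (1 - rho\<^sup>2) + 1)" using X2 x by simp
 then have "x + 2 = 1 / (1 - rho\<^sup>2) + 1" using x rho by (subst (asm) ennreal_inj) auto
 then have "x = rho\<^sup>2 / (1 - rho\<^sup>2)" using rho by (simp add: field_simps)
 then show ?thesis using x by (simp add: X_def M_def)
qed


text \<open>Since \<open>k\<close> is centred, the constant 1 may be removed from the Mehler kernel;
  Cauchy-Schwarz then gives the Hilbert-Schmidt norm. The constant exceeds rho^2, but it is of the
  right order for small \<open>rho\<close>, which is what \<open>ou_contraction_pos\<close> exploits
  at high powers of \<open>rho\<close>.\<close>

lemma ou_hilbert_schmidt:
 assumes k[measurable]: "k \<in> bmeas borel" and kB: "\<And>x. \<bar>k x\<bar> <= A" and rho: "rho\<^sup>2 < 1"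
  and mean: "(EE x. k x) = 0"
 shows "(EE x. (ou rho k x)^2) <= rho\<^sup>2 / (1 - rho\<^sup>2) * (EE x. (k x)^2)"
proof -
 define r where "r = sqrt (1 - rho\<^sup>2)"
 have r: "0 < r" using rho by (simp add: r_def)
 define D where "D x y = normal_density (rho * x) r y / sdens y - 1" for x y
 have [measurable]: "(\<lambda>(x, y). D x y) \<in> bmeas (borel \<Otimes>\<^sub>M borel)"
  unfolding D_def normal_density_def by measurable
 have ik: "integrable std_normal k" by (rule integrable_std_normal_bounded[OF k kB])
 have k2: "integrable std_normal (\<lambda>x. (k x)^2)"
  by (rule integrable_std_normal_square[OF k kB])
 have eq: "ou rho k x = (EE y. k y * D x y)" for x
 proof -
  have "ou rho k x = (\<integral>y. k y \<partial>distr std_normal borel (\<lambda>z. rho * x + r * z))"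
   unfolding ou_def r_def by (subst integral_distr) auto
  also have "... = (\<integral>y. normal_density (rho * x) r y * k y \<partial>lborel)"
   unfolding distr_std_normal_affine[OF r] by (subst integral_density) auto
  also have "... = (\<integral>y. sdens y * (k y * D x y + k y) \<partial>lborel)"
   using normal_density_pos[of 1 0] by (intro Bochner_Integration.integral_cong) (auto simp: D_def field_simps order_less_imp_not_eq2)
  also have "... = (EE y. k y * D x y + k y)"
   by (subst integral_density) auto
  also have "... = (EE y. k y * D x y)"
  proof -
   have i: "integrable lborel (\<lambda>y. normal_density (rho * x) r y * k y)"
   proof -
    have "integrable (distr std_normal borel (\<lambda>z. rho * x + r * z)) k"
     by (subst integrable_distr_eq) (auto intro!: integrable_std_normal_bounded kB)
    then show ?thesis
     unfolding distr_std_normal_affine[OF r] by (subst (asm) integrable_density) auto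
   qed
   have "integrable std_normal (\<lambda>y. k y * D x y + k y)"
    by (subst integrable_density, simp, simp, simp, subst Bochner_Integration.integrable_cong[OF refl, of _ _ "\<lambda>y. normal_density (rho * x) r y * k y"])
     (use normal_density_pos[of 1 0] i in \<open>auto simp: D_def field_simps order_less_imp_not_eq2\<close>)
   from Bochner_Integration.integrable_diff[OF this ik] have "integrable std_normal (\<lambda>y. k y * D x y)" by simp
   then show ?thesis using ik mean by simp
  qed
  finally show ?thesis .
 qed
 have nnk: "(EN x. ennreal ((k x)^2)) = ennreal (EE x. (k x)^2)"
  by (rule nn_integral_eq_integral[OF k2]) simp
 have pt: "ennreal ((ou rho k x)^2) <= ennreal (EE x. (k x)^2) * (EN y. ennreal ((D x y)^2))" for x
 proof -
  have [measurable]: "D x \<in> bmeas borel" unfolding D_def normal_density_def by measurable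
  have "ennreal \<bar>ou rho k x\<bar> <= (EN y. ennreal \<bar>k y * D x y\<bar>)"
   unfolding eq
   by (cases "integrable std_normal (\<lambda>y. k y * D x y)")
    (use integral_norm_bound_ennreal[of std_normal "\<lambda>y. k y * D x y"] in \<open>auto simp: not_integrable_integral_eq\<close>)
  also have "... = (EN y. ennreal \<bar>k y\<bar> * ennreal \<bar>D x y\<bar>)"
   by (simp add: abs_mult ennreal_mult)
  finally have "(ennreal \<bar>ou rho k x\<bar>)^2 <= (EN y. ennreal \<bar>k y\<bar> * ennreal \<bar>D x y\<bar>)^2"
   by (rule power_mono) simp
  also have "... <= (EN y. (ennreal \<bar>k y\<bar>)^2) * (EN y. (ennreal \<bar>D x y\<bar>)^2)"
   by (rule Cauchy_Schwarz_nn_integral) auto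
  finally show ?thesis by (simp add: ennreal_power nnk)
 qed
 have [measurable]: "(\<lambda>x. (EN y. ennreal ((D x y)^2))) \<in> bmeas borel" by measurable
 have "(EN x. ennreal ((ou rho k x)^2)) <= (EN x. ennreal (EE x. (k x)^2) * (EN y. ennreal ((D x y)^2)))"
  by (intro nn_integral_mono pt)
 also have "... = ennreal (EE x. (k x)^2) * (EN x. (EN y. ennreal ((D x y)^2)))"
  by (rule nn_integral_cmult) simp
 also have "... = ennreal (EE x. (k x)^2) * ennreal (rho\<^sup>2 / (1 - rho\<^sup>2))"
  unfolding D_def r_def nn_integral_mehler[OF rho] ..
 also have "... = ennreal (rho\<^sup>2 / (1 - rho\<^sup>2) * (EE x. (k x)^2))"
  unfolding mult.commute[of "ennreal (EE x. (k x)^2)"] by (rule ennreal_mult''[symmetric]) simp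
 finally have le: "(EN x. ennreal ((ou rho k x)^2)) <= ennreal (rho\<^sup>2 / (1 - rho\<^sup>2) * (EE x. (k x)^2))" .
 have ou2: "integrable std_normal (\<lambda>x. (ou rho k x)^2)"
  by (rule integrable_std_normal_square[OF ou_measurable[OF k] abs_ou_le[OF k kB]])
 show ?thesis
  using le rho unfolding nn_integral_eq_integral[OF ou2 AE_I2[OF zero_le_power2]]
  by (subst (asm) ennreal_le_iff) (auto intro!: mult_nonneg_nonneg divide_nonneg_nonneg)
qed

text \<open>The sharp constant is obtained by a power trick in place of a Hermite expansion. With T
  = \<open>ou rho\<close>, \<open>u j\<close> is the squared norm of T^(2^j) k, and self-adjointness
  with the semigroup property gives (u j)^2 \<le> u (j + 1) n. Iterating and inserting the
  Hilbert-Schmidt bound, the number (u 0 / (rho^2 n))^(2^j) stays below 1 / (1 - rho^2) for all j,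
  which forces its base to be at most 1.\<close>

lemma ou_contraction_pos:
 assumes k[measurable]: "k \<in> bmeas borel" and kB: "\<And>x. \<bar>k x\<bar> <= A" and rho: "0 <= rho" "rho < 1"
  and mean: "(EE x. k x) = 0"
 shows "(EE x. (ou rho k x)^2) <= rho\<^sup>2 * (EE x. (k x)^2)"
proof (cases "rho = 0")
 case True
 then show ?thesis using ou_hilbert_schmidt[OF k kB _ mean, of 0] by simp
next
 case False
 then have rho0: "0 < rho" using rho by simp
 have rho2: "rho\<^sup>2 < 1" using rho by (simp add: abs_square_less_1)
 have pw: "0 < rho ^ j" "j > 0 ==> rho ^ j < 1" "j > 0 ==> (rho ^ j)^2 < 1" for j
  using rho0 rho by (auto simp: power_less_one_iff abs_square_less_1)
 define n where "n = (EE x. (k x)^2)"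
 define u where "u j = (EE x. (ou (rho ^ (2 ^ j)) k x)^2)" for j
 note sq_int = integrable_std_normal_square[of _ A]
 have n0: "0 <= n" by (simp add: n_def)
 have u0: "0 <= u j" for j by (simp add: u_def)
 have step: "(u j)^2 <= u (Suc j) * n" for j
 proof -
  define q where "q = rho ^ (2 ^ j)"
  have q: "0 < q" "q < 1" "q\<^sup>2 < 1" using pw[of "2 ^ j"] by (auto simp: q_def)
  have qq: "q\<^sup>2 = rho ^ (2 ^ Suc j)" by (simp add: q_def power_mult[symmetric] mult.commute)
  have "u j = (EE x. ou q k x * ou q k x)" by (simp add: u_def q_def power2_eq_square)
  also have "... = (EE x. k x * ou q (ou q k) x)"
   using ou_selfadjoint[of "ou q k" A k A q] abs_ou_le[OF k kB] kB q(3) by simp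
  also have "... = (EE x. k x * ou (q\<^sup>2) k x)"
   using ou_ou[OF k kB q(1,2)] by simp
  finally have uj: "u j = (EE x. k x * ou (q\<^sup>2) k x)" .
  have "(EE x. k x * ou (q\<^sup>2) k x)^2 <= (EE x. (k x)^2) * (EE x. (ou (q\<^sup>2) k x)^2)"
   by (rule integral_cauchy_schwarz) (auto intro!: sq_int kB abs_ou_le)
  then show ?thesis unfolding uj[symmetric] by (simp add: u_def n_def qq mult.commute)
 qed
 have HS: "u j <= (rho\<^sup>2) ^ (2 ^ j) / (1 - rho\<^sup>2) * n" for j
 proof -
  define q where "q = rho ^ (2 ^ j)"
  have q: "0 < q" "q < 1" "q\<^sup>2 < 1" using pw[of "2 ^ j"] by (auto simp: q_def)
  have qq: "q\<^sup>2 = (rho\<^sup>2) ^ (2 ^ j)" by (simp add: q_def power_mult[symmetric] mult.commute)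
  have ql: "q\<^sup>2 <= rho\<^sup>2" unfolding qq using power_decreasing[of 1 "2 ^ j" "rho\<^sup>2"] rho2 by simp
  have "u j <= q\<^sup>2 / (1 - q\<^sup>2) * n"
   using ou_hilbert_schmidt[OF k kB q(3) mean] by (simp add: u_def q_def n_def)
  also have "... <= q\<^sup>2 / (1 - rho\<^sup>2) * n"
   using ql rho2 n0 by (intro mult_right_mono divide_left_mono) auto
  finally show ?thesis by (simp add: qq)
 qed
 have iter: "u 0 ^ (2 ^ j) <= u j * n ^ (2 ^ j - 1)" for j
 proof (induction j)
  case (Suc j)
  have "u 0 ^ (2 ^ Suc j) = (u 0 ^ (2 ^ j))^2" by (simp add: power_mult[symmetric] mult.commute)
  also have "... <= (u j * n ^ (2 ^ j - 1))^2" by (rule power_mono[OF Suc]) (simp add: u0)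
  also have "... = (u j)^2 * n ^ (2 * (2 ^ j - 1))" by (simp add: power_mult_distrib power_mult[symmetric] mult.commute)
  also have "... <= (u (Suc j) * n) * n ^ (2 * (2 ^ j - 1))"
   by (rule mult_right_mono[OF step]) (simp add: n0)
  also have "... = u (Suc j) * n ^ (Suc (2 * (2 ^ j - 1)))" by simp
  also have "Suc (2 * (2 ^ j - 1)) = 2 ^ Suc j - (1::nat)"
  proof -
   obtain i where "2 ^ j = Suc i" using not0_implies_Suc[of "2 ^ j"] by auto
   then show ?thesis by simp
  qed
  finally show ?case .
 qed simp
 show ?thesis
 proof (cases "n = 0")
  case True
  then show ?thesis using HS[of 0] by (simp add: u_def n_def[symmetric])
 next
  case False
  then have np: "0 < n" using n0 by simp
  define t where "t = u 0 / (rho\<^sup>2 * n)"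
  have bound: "t ^ (2 ^ j) <= 1 / (1 - rho\<^sup>2)" for j
  proof -
   have "u 0 ^ (2 ^ j) <= (rho\<^sup>2) ^ (2 ^ j) / (1 - rho\<^sup>2) * n * n ^ (2 ^ j - 1)"
    using iter[of j] mult_right_mono[OF HS[of j], of "n ^ (2 ^ j - 1)"] n0 by simp
   also have "... = (rho\<^sup>2 * n) ^ (2 ^ j) / (1 - rho\<^sup>2)"
   proof -
    have "n * n ^ (2 ^ j - 1) = n ^ (2 ^ j)" using power_minus_mult[of "2 ^ j" n] by (simp add: mult.commute)
    then show ?thesis by (simp add: power_mult_distrib mult.assoc)
   qed
   finally show ?thesis
    using np rho0 rho2 by (simp add: t_def power_divide field_simps)
  qed
  have "t <= 1"
  proof (rule ccontr)
   assume "\<not> t <= 1"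
   then have t: "1 < t" by simp
   obtain m where m: "1 / (1 - rho\<^sup>2) < t ^ m" using real_arch_pow[OF t] by blast
   have "t ^ m <= t ^ (2 ^ m)" using t by (intro power_increasing) (auto intro: less_imp_le)
   then show False using m bound[of m] by simp
  qed
  then have "u 0 <= rho\<^sup>2 * n" using np rho0 by (simp add: t_def divide_le_eq)
  then show ?thesis by (simp add: u_def n_def)
 qed
qed

text \<open>Negative \<open>rho\<close> is reduced to \<open>- rho\<close> by reflecting the
  argument, which preserves the standard normal law.\<close>

lemma ou_contraction:
 assumes k[measurable]: "k \<in> bmeas borel" and kB: "\<And>x. \<bar>k x\<bar> <= A" and rho: "rho\<^sup>2 < 1"
  and mean: "(EE x. k x) = 0"
 shows "(EE x. (ou rho k x)^2) <= rho\<^sup>2 * (EE x. (k x)^2)"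
proof (cases "0 <= rho")
 case True
 then show ?thesis using ou_contraction_pos[OF k kB True _ mean] rho by (simp add: abs_square_less_1)
next
 case False
 have n: "distr std_normal borel uminus = std_normal"
 proof (rule measure_eqI)
  fix A assume "A \<in> sets (distr std_normal borel uminus)"
  then have [measurable]: "A \<in> sets borel" by simp
  have "emeasure (distr std_normal borel uminus) A = (EN z. indicator A (- z))"
   using nn_integral_distr[of uminus std_normal borel "indicator A"] by simp
  also have "... = (NI z. ennreal (sdens z) * indicator A (- z))"
   by (rule nn_integral_std_normal) measurable
  also have "... = (NI z. ennreal (sdens z) * indicator A z)"
   by (subst nn_integral_real_affine[where c="-1" and t=0]) (auto simp: normal_density_def)
  also have "... = emeasure std_normal A" by (simp add: emeasure_density)
  finally show "emeasure (distr std_normal borel uminus) A = emeasure std_normal A" .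
 qed simp
 have "ou rho k x = ou (- rho) k (- x)" for x by (simp add: ou_def)
 then have "(EE x. (ou rho k x)^2) = (EE x. (ou (- rho) k (- x))^2)" by simp
 also have "... = (\<integral>x. (ou (- rho) k x)^2 \<partial>distr std_normal borel uminus)"
  by (subst integral_distr) auto
 also have "... = (EE x. (ou (- rho) k x)^2)" by (simp add: n)
 also have "... <= (- rho)^2 * (EE x. (k x)^2)"
  using False rho by (intro ou_contraction_pos[OF k kB _ _ mean]) (auto simp: abs_square_less_1)
 finally show ?thesis by simp
qed

lemma square_le_mult: "\<bar>a :: real\<bar> <= A ==> a\<^sup>2 <= A * A"
 using abs_square_le[of a A] by simp

text \<open>This is where the maximal correlation of a Gaussian pair enters.\<close>

lemma bivariate_conditional_variance:
 fixes g :: "real => real => real"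
 assumes g[measurable]: "(\<lambda>(x, y). g x y) \<in> bmeas (borel \<Otimes>\<^sub>M borel)" and B: "\<And>x y. \<bar>g x y\<bar> <= B"
  and rho: "rho\<^sup>2 < 1" and lam: "0 < \<theta>" "\<theta> < 1"
 defines "r \<equiv> sqrt (1 - rho\<^sup>2)"
 defines "R \<equiv> \<lambda>x. (EE z. g x (rho * x + r * z))"
 defines "C \<equiv> \<lambda>y. (EE z. g (rho * y + r * z) y)"
 defines "E2 \<equiv> (EE x. (EE z. (g x (rho * x + r * z))^2))"
 defines "m \<equiv> (EE x. R x)"
 defines "C2 \<equiv> \<lambda>y. (EE z. (g (rho * y + r * z) y)^2)"
 defines "V \<equiv> (EE x. (EE z. C2 (rho * x + r * z) - (C (rho * x + r * z))^2))"
 shows "(EE x. (R x)^2) - m\<^sup>2 <= rho\<^sup>2 / \<theta> * (E2 - m\<^sup>2) + V / (1 - \<theta>)"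
proof -
 have [measurable]: "(\<lambda>p. g (fst p) (snd p)) \<in> bmeas (borel \<Otimes>\<^sub>M borel)"
  using g by (simp add: split_beta')
 have gm1[measurable]: "(\<lambda>z. g x (a + b * z)) \<in> bmeas borel" for x a b
  using measurable_compose[OF _ g, of "\<lambda>z. (x, a + b * z)" borel] by simp
 have gm2[measurable]: "(\<lambda>z. g (a + b * z) y) \<in> bmeas borel" for y a b
  using measurable_compose[OF _ g, of "\<lambda>z. (a + b * z, y)" borel] by simp
 have gm3[measurable]: "(\<lambda>p. g (fst p) (rho * fst p + r * snd p)) \<in> bmeas (borel \<Otimes>\<^sub>M borel)"
  using measurable_compose[OF _ g, of "\<lambda>p. (fst p, rho * fst p + r * snd p)" "borel \<Otimes>\<^sub>M borel"] by simp
 have gm4[measurable]: "(\<lambda>p. g (rho * fst p + r * snd p) (fst p)) \<in> bmeas (borel \<Otimes>\<^sub>M borel)"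
  using measurable_compose[OF _ g, of "\<lambda>p. (rho * fst p + r * snd p, fst p)" "borel \<Otimes>\<^sub>M borel"] by simp
 have [measurable]: "R \<in> bmeas borel" "C \<in> bmeas borel"
  unfolding R_def C_def by measurable
 have CB: "\<bar>C y\<bar> <= B" for y unfolding C_def by (rule std_normal.abs_expectation_le(2)) (auto simp: B)
 have RB: "\<bar>R y\<bar> <= B" for y unfolding R_def by (rule std_normal.abs_expectation_le(2)) (auto simp: B)
 have ib: "integrable (bivariate rho) F" if "F \<in> bmeas (borel \<Otimes>\<^sub>M borel)" "\<And>p. \<bar>F p\<bar> <= b" for F :: "real \<times> real => real" and b
  by (rule bivariate.abs_expectation_le(1)[of F]) (use that in \<open>auto simp: measurable_cong_sets[OF sets_bivariate refl]\<close>)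
 note bi = integral_bivariate[where rho=rho, folded r_def]
 have mC: "m = (EE y. C y)" and gC: "(\<integral>p. g (fst p) (snd p) * C (snd p) \<partial>bivariate rho) = (EE y. (C y)^2)"
 proof -
  have "m = (\<integral>p. g (fst p) (snd p) \<partial>bivariate rho)"
   unfolding m_def R_def by (subst bi[where B=B]) (auto simp: B)
  also have "... = (\<integral>p. g (snd p) (fst p) \<partial>bivariate rho)"
   by (subst integral_bivariate_swap[OF rho]) (auto intro: measurable_compose[OF _ g, of "\<lambda>p. (snd p, fst p)" "borel \<Otimes>\<^sub>M borel", simplified])
  also have "... = (EE y. C y)"
   unfolding C_def by (subst bi[where B=B]) (auto simp: B intro: measurable_compose[OF _ g, of "\<lambda>p. (snd p, fst p)" "borel \<Otimes>\<^sub>M borel", simplified])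
  finally show "m = (EE y. C y)" .
  have "(\<integral>p. g (fst p) (snd p) * C (snd p) \<partial>bivariate rho) = (\<integral>p. g (snd p) (fst p) * C (fst p) \<partial>bivariate rho)"
   by (subst integral_bivariate_swap[OF rho]) auto
  also have "... = (EE y. (EE z. g (rho * y + r * z) y * C y))"
   by (subst bi[where B="B * B"]) (auto intro!: abs_mult_le B CB borel_measurable_times measurable_compose[OF _ g, of "\<lambda>p. (snd p, fst p)" "borel \<Otimes>\<^sub>M borel", simplified])
  also have "... = (EE y. (C y)^2)"
   by (simp add: power2_eq_square C_def)
  finally show "(\<integral>p. g (fst p) (snd p) * C (snd p) \<partial>bivariate rho) = (EE y. (C y)^2)" .
 qed
 have C2: "(\<integral>p. (C (snd p))^2 \<partial>bivariate rho) = (EE y. (C y)^2)"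
 proof -
  have "(\<integral>p. (C (snd p))^2 \<partial>bivariate rho) = (\<integral>p. (C (fst p))^2 \<partial>bivariate rho)"
   by (subst integral_bivariate_swap[OF rho]) auto
  also have "... = (EE y. (C y)^2)"
   by (subst bi[where B="B * B"]) (auto intro!: abs_square_le square_le_mult CB )
  finally show ?thesis .
 qed
 have E2b: "E2 = (\<integral>p. (g (fst p) (snd p))^2 \<partial>bivariate rho)"
  unfolding E2_def by (subst bi[where B="B * B"]) (auto intro!: abs_square_le square_le_mult B )
 have dB: "\<bar>g x y - C y'\<bar> <= 2 * B" for x y y' using B[of x y] CB[of y'] by linarith
 define V' where "V' = (EE x. (EE z. (g x (rho * x + r * z) - C (rho * x + r * z))^2))"
 have "V' = (\<integral>p. (g (fst p) (snd p) - C (snd p))^2 \<partial>bivariate rho)"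
  unfolding V'_def by (subst bi[where B="2 * B * (2 * B)"]) (use square_le_mult[OF dB] in auto)
 also have "... = (\<integral>p. (g (fst p) (snd p))^2 - 2 * (g (fst p) (snd p) * C (snd p)) + (C (snd p))^2 \<partial>bivariate rho)"
  by (intro Bochner_Integration.integral_cong) (auto simp: power2_eq_square algebra_simps)
 also have "... = E2 - 2 * (EE y. (C y)^2) + (EE y. (C y)^2)"
 proof -
  have 1: "integrable (bivariate rho) (\<lambda>p. (g (fst p) (snd p))^2)"
   by (rule ib[where b="B * B"]) (auto intro!: abs_square_le square_le_mult B)
  have 2: "integrable (bivariate rho) (\<lambda>p. g (fst p) (snd p) * C (snd p))"
   by (rule ib[where b="B * B"]) (auto intro!: abs_mult_le B CB)
  have 3: "integrable (bivariate rho) (\<lambda>p. (C (snd p))^2)"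
   by (rule ib[where b="B * B"]) (auto intro!: abs_square_le square_le_mult CB)
  show ?thesis using 1 2 3 by (simp add: E2b gC C2)
 qed
 finally have VE': "V' = E2 - (EE y. (C y)^2)" by simp
 have C2m[measurable]: "C2 \<in> bmeas borel" unfolding C2_def by measurable
 have C2B: "\<bar>C2 y\<bar> <= B * B" for y
  unfolding C2_def by (rule std_normal.abs_expectation_le(2)) (auto intro!: abs_square_le square_le_mult B)
 have "E2 = (\<integral>p. (g (snd p) (fst p))^2 \<partial>bivariate rho)"
  unfolding E2b by (subst integral_bivariate_swap[OF rho]) (auto intro!: borel_measurable_power measurable_compose[OF _ g, of "\<lambda>p. (snd p, fst p)" "borel \<Otimes>\<^sub>M borel", simplified])
 also have "... = (EE y. C2 y)"
  unfolding C2_def by (subst bi[where B="B * B"]) (auto intro!: abs_square_le square_le_mult B borel_measurable_power measurable_compose[OF _ g, of "\<lambda>p. (snd p, fst p)" "borel \<Otimes>\<^sub>M borel", simplified])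
 finally have E2C: "E2 = (EE y. C2 y)" .
 have "V = (EE x. ou rho (\<lambda>y. C2 y - (C y)^2) x)"
  unfolding V_def ou_def r_def ..
 also have "... = (EE y. C2 y - (C y)^2)"
 proof (rule integral_ou[OF _ _ rho, where A="2 * (B * B)"])
  fix y show "\<bar>C2 y - (C y)^2\<bar> <= 2 * (B * B)"
   using C2B[of y] square_le_mult[OF CB[of y]] zero_le_power2[of "C y"] unfolding abs_le_iff by linarith
 qed measurable
 also have "... = E2 - (EE y. (C y)^2)"
  using integrable_std_normal_bounded[OF C2m C2B] integrable_std_normal_square[OF _ CB] E2C by simp
 finally have VE: "V = E2 - (EE y. (C y)^2)" .
 have VV: "V = V'" unfolding VE VE' ..
 have V0: "0 <= V" unfolding VV V'_def by (intro Bochner_Integration.integral_nonneg) simp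
 define k where "k y = C y - m" for y
 have [measurable]: "k \<in> bmeas borel" unfolding k_def by measurable
 have mB: "\<bar>m\<bar> <= B" unfolding m_def by (rule std_normal.abs_expectation_le(2)) (auto simp: RB)
 have kB: "\<bar>k y\<bar> <= 2 * B" for y using CB[of y] mB unfolding k_def by linarith
 have iC: "integrable std_normal C" by (rule integrable_std_normal_bounded[OF _ CB]) measurable
 have iR: "integrable std_normal R" by (rule integrable_std_normal_bounded[OF _ RB]) measurable
 have iC2: "integrable std_normal (\<lambda>y. (C y)^2)" by (rule integrable_std_normal_square[OF _ CB]) measurable
 have iR2: "integrable std_normal (\<lambda>y. (R y)^2)" by (rule integrable_std_normal_square[OF _ RB]) measurable
 have k0: "(EE y. k y) = 0" unfolding k_def using iC by (simp add: mC)
 have k2: "(EE y. (k y)^2) = (EE y. (C y)^2) - m\<^sup>2"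
  using std_normal.variance_eq[OF iC iC2] by (simp add: k_def mC)
 define P where "P = ou rho k"
 define W where "W x = (EE z. g x (rho * x + r * z) - C (rho * x + r * z))" for x
 have [measurable]: "P \<in> bmeas borel" "W \<in> bmeas borel"
  unfolding P_def W_def by measurable
 have PB: "\<bar>P x\<bar> <= 2 * B" for x unfolding P_def by (rule abs_ou_le[OF _ kB]) measurable
 have WB: "\<bar>W x\<bar> <= 2 * B" for x unfolding W_def by (rule std_normal.abs_expectation_le(2)) (auto simp: dB)
 \<comment> \<open>\<open>P\<close> carries the column means, whose centred variance contracts by
   rho^2; \<open>W\<close> averages the deviations from the column means and is bounded by
   \<open>V\<close> through Jensen.\<close>
 have split: "R x - m = P x + W x" for x
 proof -
  have 1: "integrable std_normal (\<lambda>z. g x (rho * x + r * z))" by (rule integrable_std_normal_bounded[OF gm1 B])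
  have 2: "integrable std_normal (\<lambda>z. C (rho * x + r * z))" by (rule integrable_std_normal_bounded[OF _ CB]) measurable
  show ?thesis using 1 2 by (simp add: R_def P_def W_def ou_def k_def r_def)
 qed
 have iP2: "integrable std_normal (\<lambda>y. (P y)^2)" by (rule integrable_std_normal_square[OF _ PB]) measurable
 have iW2: "integrable std_normal (\<lambda>y. (W y)^2)" by (rule integrable_std_normal_square[OF _ WB]) measurable
 \<comment> \<open>Weighted Young inequality; the weight \<open>\<theta>\<close> stays free until
   the recursion along the chain is solved.\<close>
 have young: "(a + b)^2 <= a\<^sup>2 / \<theta> + b\<^sup>2 / (1 - \<theta>)" for a b :: real
 proof -
  have "a\<^sup>2 / \<theta> + b\<^sup>2 / (1 - \<theta>) - (a + b)^2 = ((1 - \<theta>) * a - \<theta> * b)^2 / (\<theta> * (1 - \<theta>))"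
   using lam by (simp add: field_simps power2_eq_square)
  also have "... \<ge> 0" using lam by simp
  finally show ?thesis by simp
 qed
 have "(EE x. (R x)^2) - m\<^sup>2 = (EE x. (R x - m)^2)"
  using std_normal.variance_eq[OF iR iR2] by (simp add: m_def)
 also have "... <= (EE x. (P x)^2 / \<theta> + (W x)^2 / (1 - \<theta>))"
  unfolding split using iP2 iW2
  by (intro integral_mono young integrable_std_normal_square[where B="4 * B"] Bochner_Integration.integrable_add)
   (use PB WB in \<open>auto intro!: order_trans[OF abs_triangle_ineq] add_mono[of _ "2 * B" _ "2 * B", simplified]\<close>)
 also have "... = (EE x. (P x)^2) / \<theta> + (EE x. (W x)^2) / (1 - \<theta>)"
  using iP2 iW2 by simp
 also have "(EE x. (P x)^2) <= rho\<^sup>2 * (E2 - m\<^sup>2)"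
 proof -
  have "(EE x. (P x)^2) <= rho\<^sup>2 * (EE y. (k y)^2)"
   unfolding P_def by (rule ou_contraction[OF _ kB rho k0]) measurable
  also have "... <= rho\<^sup>2 * (E2 - m\<^sup>2)" unfolding k2 using V0 VE by (intro mult_left_mono) auto
  finally show ?thesis .
 qed
 also have "(EE x. (W x)^2) <= V"
  unfolding VV V'_def W_def
 proof (intro integral_mono)
  show "integrable std_normal (\<lambda>x. (EE z. g x (rho * x + r * z) - C (rho * x + r * z))^2)" using iW2 by (simp add: W_def)
  show "integrable std_normal (\<lambda>x. (EE z. (g x (rho * x + r * z) - C (rho * x + r * z))^2))"
   by (rule integrable_std_normal_bounded, measurable, rule std_normal.abs_expectation_le(2)[where B="2 * B * (2 * B)"])
    (use square_le_mult[OF dB] in auto)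
  show "(EE z. g x (rho * x + r * z) - C (rho * x + r * z))^2 <= (EE z. (g x (rho * x + r * z) - C (rho * x + r * z))^2)" for x
   by (rule prob_space.integral_square_le[OF prob_space_std_normal], simp, rule integrable_std_normal_square[OF _ dB]) simp
 qed
 finally show ?thesis using lam by (simp add: divide_right_mono add_mono)
qed

section \<open>Local energies of normal densities\<close>

text \<open>The minimum of the two weights is symmetric and lies below each of them, so that such a
  form can be bounded by the energy of a kernel whose transition densities from nearby points
  overlap.\<close>

definition local_energy :: "(real => real) => (real => real) => real => ennreal" where
 "local_energy w f r = (NI x. (NI y. ennreal (if \<bar>x - y\<bar> <= r then (f x - f y)^2 * min (w x) (w y) else 0)))"

lemma square_diff_le: "(a - b)^2 <= 2 * (a - c)^2 + 2 * (c - b)^2" for a b c :: real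
proof -
 have "2 * (a - c)^2 + 2 * (c - b)^2 - (a - b)^2 = (a + b - 2 * c)^2"
  by (simp add: power2_eq_square algebra_simps)
 then show ?thesis using zero_le_power2[of "a + b - 2 * c"] by linarith
qed

lemma ennreal_two_add: "0 <= a ==> 0 <= b ==> ennreal (2 * a + 2 * b) = 2 * ennreal a + 2 * ennreal b"
 using ennreal_mult'[of 2 a] ennreal_mult'[of 2 b] by (simp add: ennreal_plus)

lemma ennreal_le_sum3: "a = b \<or> a = c \<or> a = d ==> a <= b + (c + d)" for a b c d :: ennreal
 by (metis add.commute add.left_commute le_iff_add)

lemma local_energy_mono: "r <= s ==> (\<And>x. 0 <= w x) ==> local_energy w f r <= local_energy w f s"
 unfolding local_energy_def by (intro nn_integral_mono ennreal_leI) auto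

text \<open>Pass through the midpoint: the squared increment splits with a factor 2 into two halves,
  each substitution to the midpoint has Jacobian 2, and 2 * 2 + 2 * 2 = 8. The hypothesis
  \<open>mid\<close>, a form of quasi-concavity, keeps the weight at the midpoint large
  enough.\<close>

lemma local_energy_double:
 assumes [measurable]: "f \<in> bmeas borel" "w \<in> bmeas borel"
  and w0: "\<And>x. 0 <= w x" and mid: "\<And>x y. min (w x) (w y) <= w ((x + y) / 2)"
 shows "local_energy w f (2 * r) <= 8 * local_energy w f r"
proof -
 define I where "I s x y = ennreal (if \<bar>x - y\<bar> <= s then (f x - f y)^2 * min (w x) (w y) else 0)" for s x y
 have [measurable]: "(\<lambda>p. I s (fst p) (snd p)) \<in> bmeas (borel \<Otimes>\<^sub>M borel)" for s
  unfolding I_def by measurable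
 have [measurable]: "I s x \<in> bmeas borel" "(\<lambda>x. I s x y) \<in> bmeas borel" for s x y
  unfolding I_def by measurable
 have [measurable]: "(\<lambda>p. I s (fst p) ((fst p + snd p) / 2)) \<in> bmeas (borel \<Otimes>\<^sub>M borel)"
  "(\<lambda>p. I s ((fst p + snd p) / 2) (snd p)) \<in> bmeas (borel \<Otimes>\<^sub>M borel)"
  "(\<lambda>p. I s ((snd p + fst p) / 2) (fst p)) \<in> bmeas (borel \<Otimes>\<^sub>M borel)"
  "(\<lambda>p. I s (snd p) (fst p)) \<in> bmeas (borel \<Otimes>\<^sub>M borel)" for s
  unfolding I_def by measurable
 have pt: "I (2 * r) x y <= 2 * I r x ((x + y) / 2) + 2 * I r ((x + y) / 2) y" for x y
 proof (cases "\<bar>x - y\<bar> <= 2 * r")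
  case True
  define z where "z = (x + y) / 2"
  have a: "\<bar>x - z\<bar> <= r" "\<bar>z - y\<bar> <= r" using True by (auto simp: z_def abs_le_iff field_simps)
  have mm: "min (w x) (w y) <= min (w x) (w z)" "min (w x) (w y) <= min (w z) (w y)"
   using mid[of x y] by (auto simp: z_def)
  have "(f x - f y)^2 * min (w x) (w y) <= (2 * (f x - f z)^2 + 2 * (f z - f y)^2) * min (w x) (w y)"
   using w0 by (intro mult_right_mono square_diff_le) auto
  also have "... <= 2 * ((f x - f z)^2 * min (w x) (w z)) + 2 * ((f z - f y)^2 * min (w z) (w y))"
   using mult_left_mono[OF mm(1), of "2 * (f x - f z)^2"] mult_left_mono[OF mm(2), of "2 * (f z - f y)^2"]
   by (simp add: distrib_right mult.assoc)
  finally have "I (2 * r) x y <= ennreal (2 * ((f x - f z)^2 * min (w x) (w z)) + 2 * ((f z - f y)^2 * min (w z) (w y)))"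
   using True by (auto simp: I_def intro!: ennreal_leI)
  also have "... = 2 * I r x z + 2 * I r z y"
   using a w0 ennreal_two_add[of "(f x - f z)^2 * min (w x) (w z)" "(f z - f y)^2 * min (w z) (w y)"]
   by (simp add: I_def)
  finally show ?thesis by (simp add: z_def)
 qed (simp add: I_def)
 have half: "(NI y. g ((x + y) / 2)) = 2 * (NI y. g y)" if [measurable]: "g \<in> bmeas borel" for g :: "real => ennreal" and x :: real
 proof -
  have "(NI y. g y) = ennreal (1/2) * (NI y. g (x / 2 + (1/2) * y))"
   using nn_integral_real_affine[of g "1/2" "x/2"] by simp
  then have "2 * (NI y. g y) = (2 * ennreal (1/2)) * (NI y. g (x / 2 + (1/2) * y))" by (simp add: mult.assoc)
  also have "2 * ennreal (1/2) = 1" using ennreal_mult'[of 2 "1/2"] by simp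
  finally show ?thesis by (simp add: add_divide_distrib)
 qed
 have E: "local_energy w f s = (NI x. (NI y. I s x y))" for s by (simp add: local_energy_def I_def)
 have 1: "(NI x. (NI y. I r x ((x + y) / 2))) = 2 * local_energy w f r"
  unfolding E by (simp add: half nn_integral_cmult)
 have "(NI x. (NI y. I r ((x + y) / 2) y)) = (NI y. (NI x. I r ((x + y) / 2) y))"
  by (rule lborel_pair.Fubini') (simp add: split_beta')
 also have "... = (NI y. 2 * (NI x. I r x y))"
  using half[of "\<lambda>x. I r x y" y for y] by (simp add: add.commute)
 also have "... = 2 * (NI y. (NI x. I r x y))" by (rule nn_integral_cmult) measurable
 also have "(NI y. (NI x. I r x y)) = local_energy w f r"
  unfolding E by (rule lborel_pair.Fubini') (simp add: split_beta')
 finally have 2: "(NI x. (NI y. I r ((x + y) / 2) y)) = 2 * local_energy w f r" .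
 have "local_energy w f (2 * r) <= (NI x. (NI y. 2 * I r x ((x + y) / 2) + 2 * I r ((x + y) / 2) y))"
  unfolding E by (intro nn_integral_mono pt)
 also have "... = 2 * (NI x. (NI y. I r x ((x + y) / 2))) + 2 * (NI x. (NI y. I r ((x + y) / 2) y))"
 proof -
  have [measurable]: "(\<lambda>y. I r x ((x + y) / 2)) \<in> bmeas borel" "(\<lambda>y. I r ((x + y) / 2) y) \<in> bmeas borel" for x
   unfolding I_def by measurable
  have [measurable]: "(\<lambda>x. (NI y. I r x ((x + y) / 2))) \<in> bmeas borel"
   "(\<lambda>x. (NI y. I r ((x + y) / 2) y)) \<in> bmeas borel"
   unfolding I_def by measurable
  show ?thesis by (simp add: nn_integral_add nn_integral_cmult)
 qed
 also have "... = 8 * local_energy w f r"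
  unfolding 1 2 by (simp add: mult.assoc[symmetric] distrib_right[symmetric])
 finally show ?thesis .
qed

lemma local_energy_double_power:
 assumes "f \<in> bmeas borel" "w \<in> bmeas borel"
  and "\<And>x. 0 <= w x" and "\<And>x y. min (w x) (w y) <= w ((x + y) / 2)"
 shows "local_energy w f (2 ^ k * r) <= 8 ^ k * local_energy w f r"
proof (induction k)
 case (Suc k)
 have "local_energy w f (2 ^ Suc k * r) = local_energy w f (2 * (2 ^ k * r))" by (simp add: mult.assoc)
 also have "... <= 8 * local_energy w f (2 ^ k * r)" by (rule local_energy_double[OF assms])
 also have "... <= 8 * (8 ^ k * local_energy w f r)" by (rule mult_left_mono[OF Suc]) simp
 finally show ?case by (simp add: mult.assoc)
qed simp

lemma std_normal_density_le: "\<bar>x\<bar> <= \<bar>y\<bar> ==> sdens y <= sdens x"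
 by (simp add: std_normal_density_def abs_le_square_iff divide_right_mono)

lemma exp_minus_three_halves: "exp (- (3 / 2)) <= (1 / 4 :: real)"
proof -
 have "(4 :: real) <= exp (3 / 2)"
 proof -
  have "(1 + (1 / 2) + (1 / 2)^2 / 2 :: real) <= exp (1 / 2)" by (rule exp_lower_Taylor_quadratic) simp
  then have "(13 / 8 :: real) <= exp (1 / 2)" by (simp add: power2_eq_square)
  then have "(13 / 8 :: real) ^ 3 <= exp (1 / 2) ^ 3" by (intro power_mono) auto
  also have "exp (1 / 2 :: real) ^ 3 = exp (3 / 2)" by (simp add: exp_of_nat_mult[symmetric])
  finally show ?thesis by (simp add: power3_eq_cube)
 qed
 then show ?thesis by (simp add: exp_minus field_simps)
qed

lemma ennreal_le_half_cancel:
 fixes a b :: ennreal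
 assumes "a <= a / 2 + b" "a < \<infinity>"
 shows "a <= 2 * b"
proof (cases b)
 case (real y)
 obtain x where x: "a = ennreal x" "0 <= x" using assms(2) by (cases a) auto
 have "a / 2 = ennreal (x / 2)" using x by (simp add: divide_ennreal[symmetric] flip: ennreal_numeral)
 then have "ennreal x <= ennreal (x / 2 + y)" using assms(1) x real by simp
 then have "x <= 2 * y" using x real by (subst (asm) ennreal_le_iff) auto
 then have "ennreal x <= ennreal (2 * y)" by (rule ennreal_leI)
 then show ?thesis using x real by (simp add: ennreal_mult')
qed (simp add: ennreal_mult_top)

text \<open>Shift the tail T by some \<open>\<delta>\<close> in [1, 2] towards the centre. What
  stays beyond 1 has lost a factor 4 of density, so the shifted tail is at most T / 4 plus the core,
  and T can be absorbed into the left side. Boundedness of \<open>f\<close> makes T finite, which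
  the absorption needs.\<close>

lemma tail_le_local_energy:
 fixes f :: "real => real"
 assumes f[measurable]: "f \<in> bmeas borel" and fB: "\<And>x. \<bar>f x\<bar> <= B"
 shows "(NI x. ennreal (if 1 <= x then (f x - c)^2 * sdens x else 0))
  <= 4 * (NI x. ennreal (if \<bar>x\<bar> <= 1 then (f x - c)^2 * sdens x else 0))
   + 4 * local_energy sdens f 2"
proof -
 define T where "T = (NI x. ennreal (if 1 <= x then (f x - c)^2 * sdens x else 0))"
 define core where "core = (NI x. ennreal (if \<bar>x\<bar> <= 1 then (f x - c)^2 * sdens x else 0))"
 define A where "A \<delta> = (NI x. ennreal (if 1 <= x then (f x - f (x - \<delta>))^2 * sdens x else 0))" for \<delta>
 have nd[simp]: "0 <= sdens x" for x by simp
 have Tfin: "T < \<infinity>"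
 proof -
  have "\<bar>f x - c\<bar> <= B + \<bar>c\<bar>" for x using fB[of x] by linarith
  from abs_square_le[OF this] have b: "(f x - c)^2 <= (B + \<bar>c\<bar>) * (B + \<bar>c\<bar>)" for x by simp
  have "T <= (NI x. ennreal ((B + \<bar>c\<bar>) * (B + \<bar>c\<bar>)) * ennreal (sdens x))"
   unfolding T_def using b by (intro nn_integral_mono) (auto simp: ennreal_mult'[symmetric] intro!: ennreal_leI mult_right_mono)
  also have "... = ennreal ((B + \<bar>c\<bar>) * (B + \<bar>c\<bar>)) * (NI x. ennreal (sdens x))"
   by (rule nn_integral_cmult) measurable
  also have "(NI x. ennreal (sdens x)) = 1"
   by (subst nn_integral_eq_integral) auto
  finally show ?thesis by (rule order.strict_trans1) simp
 qed
 have main: "T <= 4 * core + 4 * A \<delta>" if \<delta>: "1 <= \<delta>" "\<delta> <= 2" for \<delta>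
 proof -
  define Bd where "Bd = (NI x. ennreal (if 1 <= x then (f (x - \<delta>) - c)^2 * sdens x else 0))"
  have "T <= (NI x. 2 * ennreal (if 1 <= x then (f (x - \<delta>) - c)^2 * sdens x else 0)
    + 2 * ennreal (if 1 <= x then (f x - f (x - \<delta>))^2 * sdens x else 0))"
   unfolding T_def
  proof (intro nn_integral_mono)
   fix x
   have "(f x - c)^2 * sdens x <= (2 * (f x - f (x - \<delta>))^2 + 2 * (f (x - \<delta>) - c)^2) * sdens x"
    by (intro mult_right_mono square_diff_le) simp
   then have "ennreal ((f x - c)^2 * sdens x) <= ennreal (2 * ((f (x - \<delta>) - c)^2 * sdens x) + 2 * ((f x - f (x - \<delta>))^2 * sdens x))"
    by (intro ennreal_leI) (simp add: algebra_simps)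
   also have "... = 2 * ennreal ((f (x - \<delta>) - c)^2 * sdens x) + 2 * ennreal ((f x - f (x - \<delta>))^2 * sdens x)"
    by (rule ennreal_two_add) simp_all
   finally show "ennreal (if 1 <= x then (f x - c)^2 * sdens x else 0)
    <= 2 * ennreal (if 1 <= x then (f (x - \<delta>) - c)^2 * sdens x else 0)
    + 2 * ennreal (if 1 <= x then (f x - f (x - \<delta>))^2 * sdens x else 0)"
    by simp
  qed
  also have "... = 2 * Bd + 2 * A \<delta>"
   unfolding Bd_def A_def by (simp add: nn_integral_add nn_integral_cmult)
  finally have TB: "T <= 2 * Bd + 2 * A \<delta>" .
  have "Bd = (NI y. ennreal (if 1 <= \<delta> + y then (f y - c)^2 * sdens (\<delta> + y) else 0))"
   unfolding Bd_def by (subst nn_integral_real_affine[where c=1 and t=\<delta>]) (auto intro!: nn_integral_cong)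
  also have "... <= (NI y. ennreal (1 / 4) * ennreal (if 1 <= y then (f y - c)^2 * sdens y else 0)
    + ennreal (if \<bar>y\<bar> <= 1 then (f y - c)^2 * sdens y else 0))"
  proof (intro nn_integral_mono)
   fix y
   consider "1 <= y" | "1 <= \<delta> + y" "y < 1" | "\<delta> + y < 1" using \<delta> by linarith
   then show "ennreal (if 1 <= \<delta> + y then (f y - c)^2 * sdens (\<delta> + y) else 0)
    <= ennreal (1 / 4) * ennreal (if 1 <= y then (f y - c)^2 * sdens y else 0)
     + ennreal (if \<bar>y\<bar> <= 1 then (f y - c)^2 * sdens y else 0)"
   proof cases
    \<comment> \<open>With \<open>y\<close> and \<open>\<delta>\<close> at least 1, the terms 2
      \<delta> y and \<delta>^2 add at least 3 to y^2, so the density drops by exp (-3/2) \<le>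
      1/4.\<close>
    case 1
    have "y\<^sup>2 + 3 <= (\<delta> + y)^2"
     using mult_mono[of 1 \<delta> 1 y] mult_mono[of 1 \<delta> 1 \<delta>] 1 \<delta> by (simp add: power2_eq_square algebra_simps)
    then have "exp (- (\<delta> + y)\<^sup>2 / 2) <= exp (- (3 / 2)) * exp (- y\<^sup>2 / 2)" unfolding exp_add[symmetric] by simp
    also have "... <= (1 / 4) * exp (- y\<^sup>2 / 2)" by (intro mult_right_mono exp_minus_three_halves) simp
    finally have "sdens (\<delta> + y) <= (1 / 4) * sdens y"
     unfolding std_normal_density_def by (simp add: field_simps)
    then have "(f y - c)^2 * sdens (\<delta> + y) <= (1 / 4) * ((f y - c)^2 * sdens y)"
     using mult_left_mono[of "sdens (\<delta> + y)" "(1 / 4) * sdens y" "(f y - c)^2"] by simp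
    then have "ennreal ((f y - c)^2 * sdens (\<delta> + y)) <= ennreal (1 / 4) * ennreal ((f y - c)^2 * sdens y)"
     by (subst ennreal_mult[symmetric]) (auto intro!: ennreal_leI)
    then show ?thesis using 1 \<delta> by (simp add: add_increasing2)
   next
    case 2
    have "\<bar>y\<bar> <= \<bar>\<delta> + y\<bar>" "\<bar>y\<bar> <= 1" using 2 \<delta> by auto
    then have "(f y - c)^2 * sdens (\<delta> + y) <= (f y - c)^2 * sdens y"
     by (intro mult_left_mono std_normal_density_le) auto
    then show ?thesis using 2 \<open>\<bar>y\<bar> <= 1\<close> by (auto intro!: ennreal_leI)
   qed simp
  qed
  also have "... = ennreal (1 / 4) * T + core"
   unfolding T_def core_def by (simp add: nn_integral_add nn_integral_cmult)
  finally have "2 * Bd <= 2 * (ennreal (1 / 4) * T + core)" by (rule mult_left_mono) simp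
  also have "... = T / 2 + 2 * core"
  proof -
   have "2 * (ennreal (1 / 4) * T) = T / 2"
   proof -
    obtain t where t: "T = ennreal t" "0 <= t" using Tfin by (cases T) auto
    have "T / 2 = ennreal (t / 2)" using t by (simp add: divide_ennreal[symmetric] flip: ennreal_numeral)
    moreover have "2 * (ennreal (1 / 4) * T) = ennreal (2 * (1 / 4 * t))"
     unfolding t(1) using ennreal_mult'[of "1 / 4" t] ennreal_mult'[of 2 "1 / 4 * t"] by simp
    ultimately show ?thesis by simp
   qed
   then show ?thesis by (simp add: distrib_left)
  qed
  finally have "T <= T / 2 + (2 * core + 2 * A \<delta>)"
   using TB by (metis (no_types, lifting) add.assoc add_right_mono order_trans)
  then have "T <= 2 * (2 * core + 2 * A \<delta>)" using Tfin by (rule ennreal_le_half_cancel)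
  then show ?thesis by (simp add: distrib_left mult.assoc[symmetric])
 qed
 have Am: "(\<lambda>\<delta>. A \<delta>) \<in> bmeas borel" unfolding A_def by measurable
 \<comment> \<open>Averaging over \<open>\<delta>\<close> in [1, 2] turns the shifted increments
   into a double integral over pairs at distance at most 2.\<close>
 have ind: "(\<integral>\<^sup>+\<delta>. K * indicator {1..2::real} \<delta> \<partial>lborel) = K" for K by (simp add: nn_integral_cmult_indicator)
 have "T = (\<integral>\<^sup>+\<delta>. T * indicator {1..2::real} \<delta> \<partial>lborel)" by (simp only: ind)
 also have "... <= (\<integral>\<^sup>+\<delta>. (4 * core) * indicator {1..2} \<delta> + 4 * (A \<delta> * indicator {1..2} \<delta>) \<partial>lborel)"
  using main by (intro nn_integral_mono) (auto split: split_indicator)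
 also have "... = 4 * core + 4 * (\<integral>\<^sup>+\<delta>. A \<delta> * indicator {1..2} \<delta> \<partial>lborel)"
  using Am by (subst nn_integral_add) (auto simp: ind nn_integral_cmult)
 also have "(\<integral>\<^sup>+\<delta>. A \<delta> * indicator {1..2} \<delta> \<partial>lborel)
  = (\<integral>\<^sup>+\<delta>. (NI x. ennreal (if 1 <= x \<and> 1 <= \<delta> \<and> \<delta> <= 2 then (f x - f (x - \<delta>))^2 * sdens x else 0)) \<partial>lborel)"
  unfolding A_def by (intro nn_integral_cong) (auto split: split_indicator intro!: nn_integral_cong)
 also have "... = (NI x. \<integral>\<^sup>+\<delta>. ennreal (if 1 <= x \<and> 1 <= \<delta> \<and> \<delta> <= 2 then (f x - f (x - \<delta>))^2 * sdens x else 0) \<partial>lborel)"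
  by (rule lborel_pair.Fubini') measurable
 also have "... = (NI x. (NI y. ennreal (if 1 <= x \<and> 1 <= x - y \<and> x - y <= 2 then (f x - f y)^2 * sdens x else 0)))"
 proof (rule nn_integral_cong)
  fix x :: real
  show "(\<integral>\<^sup>+\<delta>. ennreal (if 1 <= x \<and> 1 <= \<delta> \<and> \<delta> <= 2 then (f x - f (x - \<delta>))^2 * sdens x else 0) \<partial>lborel)
   = (NI y. ennreal (if 1 <= x \<and> 1 <= x - y \<and> x - y <= 2 then (f x - f y)^2 * sdens x else 0))"
  proof (subst nn_integral_real_affine[where c="-1" and t=x])
   have "x - (x + - 1 * y) = y" "x + - 1 * y = x - y" for y by simp_all
   then show "ennreal \<bar>-1\<bar> * (NI y. ennreal (if 1 <= x \<and> 1 <= x + - 1 * y \<and> x + - 1 * y <= 2 then (f x - f (x - (x + - 1 * y)))^2 * sdens x else 0))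
    = (NI y. ennreal (if 1 <= x \<and> 1 <= x - y \<and> x - y <= 2 then (f x - f y)^2 * sdens x else 0))"
    by (simp only: abs_minus_cancel abs_one ennreal_1 mult_1_left)
  qed measurable
 qed
 also have "... <= local_energy sdens f 2"
  unfolding local_energy_def
 proof (intro nn_integral_mono ennreal_leI)
  fix x y :: real
  show "(if 1 <= x \<and> 1 <= x - y \<and> x - y <= 2 then (f x - f y)^2 * sdens x else 0)
   <= (if \<bar>x - y\<bar> <= 2 then (f x - f y)^2 * min (sdens x) (sdens y) else 0)"
  proof (cases "1 <= x \<and> 1 <= x - y \<and> x - y <= 2")
   case True
   then have "sdens x <= sdens y" by (intro std_normal_density_le) auto
   then show ?thesis using True by auto
  qed auto
 qed
 finally show ?thesis by (simp add: T_def core_def mult_left_mono add_left_mono)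
qed

text \<open>For every constant c the variance is at most the mean square of f - c, which splits into
  a core on [-1, 1] and two tails, together at most 9 core + 8 E. Averaging over c = f z with z in
  [-1, 1], an interval of length 2, turns the core into at most 2 E; so twice the variance is at
  most 18 E + 16 E.\<close>

lemma std_normal_variance_le_local_energy:
 fixes f :: "real => real"
 assumes f[measurable]: "f \<in> bmeas borel" and fB: "\<And>x. \<bar>f x\<bar> <= B"
 shows "ennreal ((EE x. (f x)^2) - (EE x. f x)^2) <= 17 * local_energy sdens f 2"
proof -
 define vr where "vr = (EE x. (f x)^2) - (EE x. f x)^2"
 define core where "core c = (NI x. ennreal (if \<bar>x\<bar> <= 1 then (f x - c)^2 * sdens x else 0))" for c
 define E where "E = local_energy sdens f 2"
 have if1: "integrable std_normal f" by (rule integrable_std_normal_bounded[OF f fB])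
 have if2: "integrable std_normal (\<lambda>x. (f x)^2)" by (rule integrable_std_normal_square[OF f fB])
 have refl1: "(NI x. g (- x)) = (NI x. g x)" if "g \<in> bmeas borel" for g :: "real => ennreal"
  using nn_integral_real_affine[OF that, of "-1" 0] by simp
 have le: "ennreal vr <= 9 * core c + 8 * E" for c
 proof -
  have ic: "integrable std_normal (\<lambda>x. (f x - c)^2)"
   by (rule integrable_std_normal_square[where B="B + \<bar>c\<bar>"]) (use fB in \<open>auto intro: order_trans[OF abs_triangle_ineq4]\<close>)
  have "(EE x. (f x - c)^2) = (EE x. (f x)^2 - 2 * c * f x + c\<^sup>2)"
   by (intro Bochner_Integration.integral_cong) (auto simp: power2_eq_square algebra_simps)
  also have "... = (EE x. (f x)^2) - 2 * c * (EE x. f x) + c\<^sup>2" using if1 if2 by simp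
  also have "... = vr + ((EE x. f x) - c)^2" by (simp add: vr_def power2_eq_square algebra_simps)
  finally have "vr <= (EE x. (f x - c)^2)" by simp
  then have "ennreal vr <= ennreal (EE x. (f x - c)^2)" by (rule ennreal_leI)
  also have "... = (EN x. ennreal ((f x - c)^2))" by (rule nn_integral_eq_integral[symmetric, OF ic]) simp
  also have "... = (NI x. ennreal ((f x - c)^2 * sdens x))"
   by (subst nn_integral_std_normal) (auto simp: ennreal_mult mult.commute)
  also have "... <= (NI x. ennreal (if \<bar>x\<bar> <= 1 then (f x - c)^2 * sdens x else 0)
   + (ennreal (if 1 <= x then (f x - c)^2 * sdens x else 0)
   + ennreal (if 1 <= - x then (f (- (- x)) - c)^2 * sdens (- x) else 0)))"
  proof (intro nn_integral_mono)
   fix x :: real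
   have sym: "sdens (- x) = sdens x" by (simp add: std_normal_density_def)
   consider "\<bar>x\<bar> <= 1" | "1 <= x" | "1 <= - x" by linarith
   then show "ennreal ((f x - c)^2 * sdens x) <= ennreal (if \<bar>x\<bar> <= 1 then (f x - c)^2 * sdens x else 0)
   + (ennreal (if 1 <= x then (f x - c)^2 * sdens x else 0)
   + ennreal (if 1 <= - x then (f (- (- x)) - c)^2 * sdens (- x) else 0))"
    unfolding sym by cases (rule ennreal_le_sum3, simp)+
  qed
  also have "... = core c + ((NI x. ennreal (if 1 <= x then (f x - c)^2 * sdens x else 0))
   + (NI x. ennreal (if 1 <= x then (f (- x) - c)^2 * sdens x else 0)))"
   using refl1[of "\<lambda>x. ennreal (if 1 <= x then (f (- x) - c)^2 * sdens x else 0)"]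
   by (simp add: nn_integral_add core_def)
  also have "... <= core c + ((4 * core c + 4 * E) + (4 * core c + 4 * E))"
  proof (intro add_mono order_refl)
   show "(NI x. ennreal (if 1 <= x then (f x - c)^2 * sdens x else 0)) <= 4 * core c + 4 * E"
    unfolding core_def E_def by (rule tail_le_local_energy[OF f fB])
   have sym: "sdens (- x) = sdens x" for x by (simp add: std_normal_density_def)
   have c': "core c = (NI x. ennreal (if \<bar>x\<bar> <= 1 then (f (- x) - c)^2 * sdens x else 0))"
    using refl1[of "\<lambda>x. ennreal (if \<bar>x\<bar> <= 1 then (f x - c)^2 * sdens x else 0)"]
    unfolding sym by (simp add: core_def)
   have E': "E = local_energy sdens (\<lambda>x. f (- x)) 2"
   proof -
    have "E = (NI x. (NI y. ennreal (if \<bar>- x - y\<bar> <= 2 then (f (- x) - f y)^2 * min (sdens (- x)) (sdens y) else 0)))"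
     unfolding E_def local_energy_def by (rule refl1[symmetric]) measurable
    also have "... = (NI x. (NI y. ennreal (if \<bar>- x - - y\<bar> <= 2 then (f (- x) - f (- y))^2 * min (sdens (- x)) (sdens (- y)) else 0)))"
     by (rule nn_integral_cong, rule refl1[symmetric]) measurable
    also have "... = local_energy sdens (\<lambda>x. f (- x)) 2"
     unfolding local_energy_def sym by (intro nn_integral_cong) (auto simp: abs_minus_commute)
    finally show ?thesis .
   qed
   show "(NI x. ennreal (if 1 <= x then (f (- x) - c)^2 * sdens x else 0)) <= 4 * core c + 4 * E"
    unfolding c' E' by (rule tail_le_local_energy[of "\<lambda>x. f (- x)" B]) (use fB in auto)
  qed
  also have "... = 9 * core c + 8 * E"
  proof -
   have "core c + ((4 * core c + 4 * E) + (4 * core c + 4 * E)) = (1 + 4 + 4) * core c + (4 + 4) * E"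
    by (simp only: distrib_right mult_1_left add.assoc add.left_commute add.commute)
   then show ?thesis by simp
  qed
  finally show ?thesis .
 qed
 have ind: "(NI z. K * indicator {-1..1::real} z) = 2 * K" for K by (simp add: nn_integral_cmult_indicator mult.commute)
 have cm: "(\<lambda>z. core (f z)) \<in> bmeas borel" unfolding core_def by measurable
 have "2 * ennreal vr = (NI z. ennreal vr * indicator {-1..1::real} z)" by (simp only: ind)
 also have "... <= (NI z. 9 * (core (f z) * indicator {-1..1} z) + 8 * E * indicator {-1..1} z)"
  using le by (intro nn_integral_mono) (auto split: split_indicator)
 also have "... = 9 * (NI z. core (f z) * indicator {-1..1} z) + 2 * (8 * E)"
  using cm by (subst nn_integral_add) (auto simp: ind nn_integral_cmult)
 also have "(NI z. core (f z) * indicator {-1..1} z) <= 2 * E"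
 proof -
  have "(NI z. core (f z) * indicator {-1..1} z) <= (NI z. (NI x. 2 * ennreal (if \<bar>z - x\<bar> <= 2 then (f z - f x)^2 * min (sdens z) (sdens x) else 0)))"
  proof (rule nn_integral_mono)
   fix z :: real
   show "core (f z) * indicator {-1..1} z <= (NI x. 2 * ennreal (if \<bar>z - x\<bar> <= 2 then (f z - f x)^2 * min (sdens z) (sdens x) else 0))"
   proof (cases "\<bar>z\<bar> <= 1")
    case True
    have "core (f z) <= (NI x. 2 * ennreal (if \<bar>z - x\<bar> <= 2 then (f z - f x)^2 * min (sdens z) (sdens x) else 0))"
     unfolding core_def
    proof (rule nn_integral_mono)
     fix x :: real
     show "ennreal (if \<bar>x\<bar> <= 1 then (f x - f z)^2 * sdens x else 0)
      <= 2 * ennreal (if \<bar>z - x\<bar> <= 2 then (f z - f x)^2 * min (sdens z) (sdens x) else 0)"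
     proof (cases "\<bar>x\<bar> <= 1")
      case x: True
      \<comment> \<open>On [-1, 1] the density varies by at most the factor exp (1/2), which is
        below 2.\<close>
      have "sdens x <= 2 * sdens 1"
      proof -
       have "sdens x <= sdens 0" by (rule std_normal_density_le) simp
       also have "... <= 2 * sdens 1"
       proof -
        have "(1::real) + - (1 / 2) <= exp (- (1 / 2))" by (rule exp_ge_add_one_self)
        then show ?thesis by (simp add: std_normal_density_def field_simps)
       qed
       finally show ?thesis .
      qed
      moreover have "sdens 1 <= min (sdens z) (sdens x)"
       using True x by (auto intro!: std_normal_density_le)
      ultimately have "sdens x <= 2 * min (sdens z) (sdens x)" by linarith
      then have "(f x - f z)^2 * sdens x <= (f x - f z)^2 * (2 * min (sdens z) (sdens x))"
       by (rule mult_left_mono) simp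
      also have "... = 2 * ((f z - f x)^2 * min (sdens z) (sdens x))"
       by (simp add: power2_commute)
      finally have "ennreal ((f x - f z)^2 * sdens x) <= 2 * ennreal ((f z - f x)^2 * min (sdens z) (sdens x))"
       by (metis ennreal_leI ennreal_mult' ennreal_numeral zero_le_numeral)
      moreover have "\<bar>z - x\<bar> <= 2" using True x by linarith
      ultimately show ?thesis using x by simp
     qed simp
    qed
    moreover have "core (f z) * indicator {-1..1} z <= core (f z) * 1"
     by (rule mult_left_mono) (simp_all add: indicator_def)
    ultimately show ?thesis by simp
   next
    case False
    then have "z \<notin> {-1..1}" by auto
    then show ?thesis by simp
   qed
  qed
  also have "... = 2 * E" unfolding E_def local_energy_def by (simp add: nn_integral_cmult)
  finally show ?thesis .
 qed
 finally have "2 * ennreal vr <= 9 * (2 * E) + 2 * (8 * E)" by (simp add: mult_left_mono add_right_mono)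
 also have "... = 2 * (17 * E)"
  by (simp only: mult.assoc[symmetric] distrib_right[symmetric]) simp
 finally have "2 * ennreal vr <= 2 * (17 * E)" .
 then have le: "(1 / 2) * (2 * ennreal vr) <= (1 / 2) * (2 * (17 * E))" by (rule mult_left_mono) simp
 have half: "(1 / 2) * (2 * x) = x" for x :: ennreal
  by (simp add: mult.assoc[symmetric] ennreal_divide_times)
 show ?thesis using le unfolding half vr_def E_def .
qed

text \<open>Standardise, descend dyadically from distance 2 to distance r / sd at the price of a
  factor 8 per halving, and scale back. The constant is 17 * 64, and the surplus sd^2 is at most
  1.\<close>

lemma normal_variance_le_local_energy:
 fixes g :: "real => real"
 assumes g[measurable]: "g \<in> bmeas borel" and gB: "\<And>x. \<bar>g x\<bar> <= B"
  and sd: "0 < sd" "sd <= 1" and r: "0 < r" "r <= 2 * sd"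
 shows "ennreal ((EE z. (g (\<mu> + sd * z))^2) - (EE z. g (\<mu> + sd * z))^2)
  <= ennreal (1088 / r ^ 3) * local_energy (normal_density \<mu> sd) g r"
proof -
 define n where "n = normal_density \<mu> sd"
 define f where "f z = g (\<mu> + sd * z)" for z
 have [measurable]: "f \<in> bmeas borel" "n \<in> bmeas borel" unfolding f_def n_def by measurable
 have nf: "sdens z = sd * n (\<mu> + sd * z)" for z
  using sd by (simp add: n_def normal_density_def real_sqrt_mult power_mult_distrib)
 have n0: "0 <= n x" for x by (simp add: n_def)
 \<comment> \<open>The least number of halvings that brings the distance 2 down to r / sd.
   Minimality loses only a factor 2, so 8^k \<le> 64 (sd / r)^3.\<close>
 obtain k where k: "2 / 2 ^ k <= r / sd" "r / sd <= 4 / 2 ^ k"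
 proof -
  have ex: "\<exists>k. 2 / 2 ^ k <= r / sd"
  proof -
   obtain k where "2 * sd / r < 2 ^ k" using real_arch_pow[of 2] by auto
   then have "2 / 2 ^ k <= r / sd" using r sd by (simp add: field_simps)
   then show ?thesis ..
  qed
  define k where "k = (LEAST k. 2 / 2 ^ k <= r / sd)"
  have k1: "2 / 2 ^ k <= r / sd" unfolding k_def by (rule LeastI_ex[OF ex])
  have "r / sd <= 4 / 2 ^ k"
  proof (cases k)
   case 0
   then show ?thesis using r sd by (simp add: field_simps)
  next
   case (Suc j)
   then have "\<not> 2 / 2 ^ j <= r / sd" unfolding k_def by (intro not_less_Least) simp
   then show ?thesis using Suc by simp
  qed
  with k1 show ?thesis by (rule that)
 qed
 define q where "q = 2 / (2::real) ^ k"
 have mid: "min (sdens x) (sdens y) <= sdens ((x + y) / 2)" for x y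
 proof (cases "\<bar>x\<bar> <= \<bar>y\<bar>")
  case True
  then have "sdens y <= sdens ((x + y) / 2)" by (intro std_normal_density_le) auto
  then show ?thesis by simp
 next
  case False
  then have "sdens x <= sdens ((x + y) / 2)" by (intro std_normal_density_le) auto
  then show ?thesis by simp
 qed
 have "ennreal ((EE z. (f z)^2) - (EE z. f z)^2) <= 17 * local_energy sdens f 2"
  by (rule std_normal_variance_le_local_energy[where B=B]) (auto simp: f_def gB)
 also have "local_energy sdens f 2 = local_energy sdens f (2 ^ k * q)" by (simp add: q_def)
 also have "... <= 8 ^ k * local_energy sdens f q"
  by (rule local_energy_double_power) (auto simp: mid)
 also have "... <= 8 ^ k * local_energy sdens f (r / sd)"
  using k(1) by (intro mult_left_mono local_energy_mono) (auto simp: q_def)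
 \<comment> \<open>The substitution in both variables contributes sd^-2, the rescaled density one
   factor sd.\<close>
 also have "local_energy sdens f (r / sd) = ennreal (1 / sd) * local_energy n g r"
 proof -
  define F where "F x y = ennreal (if \<bar>x - y\<bar> <= r then (g x - g y)^2 * min (n x) (n y) else 0)" for x y
  have [measurable]: "(\<lambda>p. F (fst p) (snd p)) \<in> bmeas (borel \<Otimes>\<^sub>M borel)" unfolding F_def by measurable
  have [measurable]: "F x \<in> bmeas borel" for x unfolding F_def by measurable
  have pw: "ennreal (if \<bar>x - y\<bar> <= r / sd then (f x - f y)^2 * min (sdens x) (sdens y) else 0)
   = ennreal sd * F (\<mu> + sd * x) (\<mu> + sd * y)" for x y
  proof -
   have "\<bar>(\<mu> + sd * x) - (\<mu> + sd * y)\<bar> = sd * \<bar>x - y\<bar>" using sd by (simp add: abs_mult flip: right_diff_distrib)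
   then have a: "\<bar>(\<mu> + sd * x) - (\<mu> + sd * y)\<bar> <= r \<longleftrightarrow> \<bar>x - y\<bar> <= r / sd" using sd by (simp add: field_simps)
   have b: "min (sdens x) (sdens y) = sd * min (n (\<mu> + sd * x)) (n (\<mu> + sd * y))"
    unfolding nf using sd by (simp add: min_mult_distrib_left)
   show ?thesis unfolding F_def a b f_def using sd n0
    by (auto simp: ennreal_mult[symmetric] mult.left_commute)
  qed
  have aff: "(NI x. h x) = ennreal sd * (NI x. h (\<mu> + sd * x))" if "h \<in> bmeas borel" for h
   using nn_integral_real_affine[OF that, of sd \<mu>] sd by simp
  have "local_energy n g r = ennreal sd * (NI x. (NI y. F (\<mu> + sd * x) y))"
  proof -
   have "(\<lambda>x. (NI y. F x y)) \<in> bmeas borel" unfolding F_def by measurable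
   from aff[OF this] show ?thesis unfolding local_energy_def F_def[symmetric] .
  qed
  also have "... = ennreal sd * (NI x. (NI y. ennreal sd * F (\<mu> + sd * x) (\<mu> + sd * y)))"
  proof -
   have [measurable]: "(\<lambda>y. F x (\<mu> + sd * y)) \<in> bmeas borel" for x unfolding F_def by measurable
   have "(NI y. F x y) = (NI y. ennreal sd * F x (\<mu> + sd * y))" for x
    by (simp add: nn_integral_cmult aff[symmetric])
   then show ?thesis by simp
  qed
  also have "... = ennreal sd * local_energy sdens f (r / sd)"
   unfolding local_energy_def pw ..
  finally have "ennreal (1 / sd) * local_energy n g r = (ennreal (1 / sd) * ennreal sd) * local_energy sdens f (r / sd)"
   by (simp add: mult.assoc)
  also have "ennreal (1 / sd) * ennreal sd = 1" using sd by (simp add: ennreal_mult[symmetric])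
  finally show ?thesis by simp
 qed
 finally have "ennreal ((EE z. (f z)^2) - (EE z. f z)^2) <= 17 * (8 ^ k * (ennreal (1 / sd) * local_energy n g r))"
  by (simp add: mult_left_mono)
 also have "... = ennreal (17 * (8 ^ k * (1 / sd))) * local_energy n g r"
 proof -
  have "ennreal (17 * (8 ^ k * (1 / sd))) = 17 * ennreal (8 ^ k * (1 / sd))"
   using ennreal_mult'[of 17 "8 ^ k * (1 / sd)"] by simp
  also have "ennreal (8 ^ k * (1 / sd)) = 8 ^ k * ennreal (1 / sd)"
   using ennreal_mult'[of "8 ^ k" "1 / sd"] ennreal_power[of 8 k] by simp
  finally show ?thesis by (simp only: mult.assoc)
 qed
 also have "... <= ennreal (1088 / r ^ 3) * local_energy n g r"
 proof (intro mult_right_mono ennreal_leI)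
  have "(r / sd) ^ 3 <= (4 / 2 ^ k) ^ 3" using k(2) r sd by (intro power_mono) auto
  also have "... = 64 / 8 ^ k" by (simp add: power_divide power_mult[symmetric] power3_eq_cube power_mult_distrib[symmetric])
  finally have "8 ^ k * r ^ 3 <= 64 * sd ^ 3" using sd by (simp add: field_simps)
  then have "17 * (8 ^ k * (1 / sd)) <= 1088 * sd\<^sup>2 / r ^ 3"
   using sd r by (simp add: field_simps power2_eq_square power3_eq_cube)
  also have "... <= 1088 / r ^ 3" using sd r by (intro divide_right_mono) (auto simp: power_le_one)
  finally show "17 * (8 ^ k * (1 / sd)) <= 1088 / r ^ 3" .
 qed simp
 finally show ?thesis by (simp add: f_def n_def)
qed

section \<open>Variance of an autoregressive chain\<close>

abbreviation leb :: "nat set => point measure" where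
 "leb I \<equiv> \<Pi>\<^sub>M i\<in>I. lborel"

abbreviation lebn :: "nat => point measure" where
 "lebn n \<equiv> leb {..<n}"

interpretation lborel_product: product_sigma_finite "\<lambda>_::nat. lborel :: real measure"
 by standard

locale ar1_chain =
 fixes \<phi> :: real and \<mu> :: "nat => real"
 assumes \<phi>: "\<bar>\<phi>\<bar> < 1"
begin

text \<open>\<open>c\<close> and \<open>sd\<close> are the mean and standard deviation of coordinate
  \<open>t\<close> given its predecessor. \<open>sd 0 = 1\<close> starts the chain in stationarity,
  so that every coordinate has variance 1.\<close>

definition c :: "nat => point => real" where
 "c t x = (if t = 0 then \<mu> 0 else \<mu> t + \<phi> * (x (t - 1) - \<mu> (t - 1)))"

definition sd :: "nat => real" where
 "sd t = (if t = 0 then 1 else sqrt (1 - \<phi>\<^sup>2))"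

definition chain_density :: "nat => point => real" where
 "chain_density n x = (\<Prod>t<n. normal_density (c t x) (sd t) (x t))"

definition chain :: "nat => point measure" where
 "chain n = density (lebn n) (\<lambda>x. ennreal (chain_density n x))"

lemma phi_square_less: "\<phi>\<^sup>2 < 1"
 using \<phi> by (simp add: abs_square_less_1)

lemma sigma_pos: "0 < sd t"
 using phi_square_less by (simp add: sd_def)

lemma sets_chain[measurable_cong, simp]: "sets (chain n) = sets (lebn n)"
 by (simp add: chain_def)

lemma space_chain[simp]: "space (chain n) = space (lebn n)"
 by (simp add: chain_def)

lemma c_measurable[measurable]: "t <= n ==> c t \<in> bmeas (lebn n)"
 unfolding c_def[abs_def]
proof -
 assume "t <= n"
 then have "t \<noteq> 0 ==> t - 1 \<in> {..<n}" by auto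
 then have "t \<noteq> 0 ==> (\<lambda>x. x (t - 1)) \<in> bmeas (lebn n)"
  using measurable_component_singleton[of "t - 1" "{..<n}" "\<lambda>_. lborel :: real measure"] by simp
 then show "(\<lambda>x. if t = 0 then \<mu> 0 else \<mu> t + \<phi> * (x (t - 1) - \<mu> (t - 1))) \<in> bmeas (lebn n)"
  by (cases "t = 0") auto
qed

lemma c_self_measurable[measurable]: "c n \<in> bmeas (lebn n)"
 by (rule c_measurable) simp

lemma coordinate_measurable: "t < n ==> (\<lambda>x. x t) \<in> bmeas (lebn n)"
 using measurable_component_singleton[of t "{..<n}" "\<lambda>_. lborel :: real measure"] by simp

lemma chain_density_measurable[measurable]: "chain_density n \<in> bmeas (lebn n)"
 unfolding chain_density_def[abs_def]
proof (intro borel_measurable_prod)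
 fix t assume t: "t \<in> {..<n}"
 have [measurable]: "c t \<in> bmeas (lebn n)" using t by (intro c_measurable) auto
 have [measurable]: "(\<lambda>x. x t) \<in> bmeas (lebn n)" using t by (intro coordinate_measurable) auto
 show "(\<lambda>x. normal_density (c t x) (sd t) (x t)) \<in> bmeas (lebn n)"
  unfolding normal_density_def by measurable
qed

lemma chain_density_nonneg: "0 <= chain_density n x"
 unfolding chain_density_def by (intro prod_nonneg) auto

lemma c_upd: "t <= n ==> c t (x(n := y)) = c t x"
 by (auto simp: c_def)

lemma chain_density_Suc_upd: "chain_density (Suc n) (x(n := y)) = chain_density n x * normal_density (c n x) (sd n) y"
 unfolding chain_density_def by (auto simp: c_upd lessThan_Suc intro!: prod.cong)

lemma upd_measurable[measurable]: "(\<lambda>p. (fst p)(n := snd p)) \<in> lebn n \<Otimes>\<^sub>M borel \<rightarrow>\<^sub>M lebn (Suc n)"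
 using measurable_add_dim[of n "{..<n}" "\<lambda>_. lborel :: real measure"]
 by (simp add: split_beta' lessThan_Suc cong: measurable_cong_sets)

lemma upd_measurable_in: "t < n ==> (\<lambda>p. (fst p)(t := snd p)) \<in> lebn n \<Otimes>\<^sub>M borel \<rightarrow>\<^sub>M lebn n"
 using measurable_add_dim[of t "{..<n}" "\<lambda>_. lborel :: real measure"]
 by (simp add: split_beta' insert_absorb cong: measurable_cong_sets)

lemma upd_measurable_fun:
 assumes "t < n" "f \<in> M \<rightarrow>\<^sub>M lebn n" "g \<in> bmeas M"
 shows "(\<lambda>w. (f w)(t := g w)) \<in> M \<rightarrow>\<^sub>M lebn n"
 using measurable_compose[OF measurable_Pair[OF assms(2,3)] upd_measurable_in[OF assms(1)]] by simp

lemma upd_Suc_measurable_fun: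
 assumes "f \<in> M \<rightarrow>\<^sub>M lebn n" "g \<in> bmeas M"
 shows "(\<lambda>w. (f w)(n := g w)) \<in> M \<rightarrow>\<^sub>M lebn (Suc n)"
 using measurable_compose[OF measurable_Pair[OF assms] upd_measurable] by simp

abbreviation nxt :: "nat => point => real => nat => real" where
 "nxt n x z \<equiv> x(n := c n x + sd n * z)"

lemma nn_integral_chain_Suc:
 assumes F[measurable]: "F \<in> bmeas (lebn (Suc n))"
 shows "(\<integral>\<^sup>+x. F x \<partial>chain (Suc n)) = (\<integral>\<^sup>+x. (EN z. F (nxt n x z)) \<partial>chain n)"
proof -
 have [measurable]: "(\<lambda>y. F (x(n := y))) \<in> bmeas borel" if "x \<in> space (lebn n)" for x
  using that by (intro measurable_compose[OF upd_Suc_measurable_fun F]) auto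
 have Fp[measurable]: "(\<lambda>p. F ((fst p)(n := snd p))) \<in> bmeas (lebn n \<Otimes>\<^sub>M borel)"
  by (rule measurable_compose[OF upd_measurable F])
 have [measurable]: "c n \<in> bmeas (lebn n)" by simp
 have nm[measurable]: "(\<lambda>p. normal_density (c n (fst p)) (sd n) (snd p)) \<in> bmeas (lebn n \<Otimes>\<^sub>M borel)"
  unfolding normal_density_def by measurable
 have "(\<integral>\<^sup>+x. F x \<partial>chain (Suc n)) = (\<integral>\<^sup>+x. ennreal (chain_density (Suc n) x) * F x \<partial>lebn (Suc n))"
  unfolding chain_def by (rule nn_integral_density) auto
 also have "... = (\<integral>\<^sup>+x. (NI y. ennreal (chain_density (Suc n) (x(n := y))) * F (x(n := y))) \<partial>lebn n)"
  unfolding lessThan_Suc by (rule lborel_product.product_nn_integral_insert) (auto simp flip: lessThan_Suc)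
 also have "... = (\<integral>\<^sup>+x. ennreal (chain_density n x) * (EN z. F (nxt n x z)) \<partial>lebn n)"
 proof (rule nn_integral_cong)
  fix x assume x: "x \<in> space (lebn n)"
  have "(NI y. ennreal (chain_density (Suc n) (x(n := y))) * F (x(n := y)))
   = (NI y. ennreal (chain_density n x) * (ennreal (normal_density (c n x) (sd n) y) * F (x(n := y))))"
   by (intro nn_integral_cong) (simp add: chain_density_Suc_upd ennreal_mult chain_density_nonneg mult.assoc)
  also have "... = ennreal (chain_density n x) * (NI y. ennreal (normal_density (c n x) (sd n) y) * F (x(n := y)))"
   using x by (intro nn_integral_cmult) measurable
  also have "(NI y. ennreal (normal_density (c n x) (sd n) y) * F (x(n := y))) = (EN z. F (nxt n x z))"
   using x by (intro nn_integral_std_normal_affine[symmetric] sigma_pos) measurable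
  finally show "(NI y. ennreal (chain_density (Suc n) (x(n := y))) * F (x(n := y)))
   = ennreal (chain_density n x) * (EN z. F (nxt n x z))" .
 qed
 also have "... = (\<integral>\<^sup>+x. (EN z. F (nxt n x z)) \<partial>chain n)"
 proof -
  have "(\<lambda>p. F (nxt n (fst p) (snd p))) \<in> bmeas (lebn n \<Otimes>\<^sub>M std_normal)"
   by (intro measurable_compose[OF upd_Suc_measurable_fun F]) auto
  then have "(\<lambda>x. (EN z. F (nxt n x z))) \<in> bmeas (lebn n)"
   by (intro std_normal.borel_measurable_nn_integral) (simp add: split_beta')
  then show ?thesis unfolding chain_def by (subst nn_integral_density) auto
 qed
 finally show ?thesis .
qed

lemma prob_space_chain: "prob_space (chain n)"
proof (induction n)
 case 0
 show ?case
  by (rule prob_spaceI) (simp add: chain_def emeasure_density chain_density_def PiM_empty nn_integral_count_space_finite)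
next
 case (Suc n)
 show ?case
 proof (rule prob_spaceI)
  have "emeasure (chain (Suc n)) (space (chain (Suc n))) = (\<integral>\<^sup>+x. 1 \<partial>chain (Suc n))" by simp
  also have "... = (\<integral>\<^sup>+x. 1 \<partial>chain n)" by (subst nn_integral_chain_Suc) auto
  also have "... = 1" using prob_space.emeasure_space_1[OF Suc] by simp
  finally show "emeasure (chain (Suc n)) (space (chain (Suc n))) = 1" .
 qed
qed

sublocale chain: prob_space "chain n" for n
 by (rule prob_space_chain)

lemma step_measurable[measurable]: "(\<lambda>p. nxt n (fst p) (snd p)) \<in> lebn n \<Otimes>\<^sub>M borel \<rightarrow>\<^sub>M lebn (Suc n)"
 by (intro upd_Suc_measurable_fun) auto

lemma chain_Suc: "chain (Suc n) = distr (chain n \<Otimes>\<^sub>M std_normal) (lebn (Suc n)) (\<lambda>p. nxt n (fst p) (snd p))"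
proof (rule measure_eqI)
 fix A assume "A \<in> sets (chain (Suc n))"
 then have A[measurable]: "A \<in> sets (lebn (Suc n))" by simp
 have m: "(\<lambda>p. nxt n (fst p) (snd p)) \<in> chain n \<Otimes>\<^sub>M std_normal \<rightarrow>\<^sub>M lebn (Suc n)"
  using step_measurable[of n] by (simp cong: measurable_cong_sets)
 have "emeasure (chain (Suc n)) A = (\<integral>\<^sup>+x. indicator A x \<partial>chain (Suc n))" by simp
 also have "... = (\<integral>\<^sup>+x. (EN z. indicator A (nxt n x z)) \<partial>chain n)"
  by (rule nn_integral_chain_Suc) simp
 also have "... = (\<integral>\<^sup>+p. indicator A (nxt n (fst p) (snd p)) \<partial>(chain n \<Otimes>\<^sub>M std_normal))"
  using measurable_compose[OF m, of "indicator A :: _ => ennreal" borel]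
  by (subst std_normal.nn_integral_fst[symmetric]) auto
 also have "... = (\<integral>\<^sup>+x. indicator A x \<partial>distr (chain n \<Otimes>\<^sub>M std_normal) (lebn (Suc n)) (\<lambda>p. nxt n (fst p) (snd p)))"
  using m by (subst nn_integral_distr) auto
 finally show "emeasure (chain (Suc n)) A = emeasure (distr (chain n \<Otimes>\<^sub>M std_normal) (lebn (Suc n)) (\<lambda>p. nxt n (fst p) (snd p))) A"
  by simp
qed simp

lemma integral_chain_Suc:
 fixes F :: "point => real"
 assumes F[measurable]: "F \<in> bmeas (lebn (Suc n))" and B: "\<And>x. \<bar>F x\<bar> <= B"
 shows "(\<integral>x. F x \<partial>chain (Suc n)) = (\<integral>x. (EE z. F (nxt n x z)) \<partial>chain n)"
proof -
 interpret P: pair_prob_space "chain n" std_normal by standard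
 have m: "(\<lambda>p. nxt n (fst p) (snd p)) \<in> chain n \<Otimes>\<^sub>M std_normal \<rightarrow>\<^sub>M lebn (Suc n)"
  using step_measurable[of n] by (simp cong: measurable_cong_sets)
 have i: "integrable (chain n \<Otimes>\<^sub>M std_normal) (\<lambda>p. F (nxt n (fst p) (snd p)))"
  by (rule P.integrable_const_bound[where B=B]) (use B measurable_compose[OF m F] in auto)
 have "(\<integral>x. F x \<partial>chain (Suc n)) = (\<integral>p. F (nxt n (fst p) (snd p)) \<partial>(chain n \<Otimes>\<^sub>M std_normal))"
  unfolding chain_Suc by (rule integral_distr[OF m]) simp
 also have "... = (\<integral>x. (EE z. F (nxt n x z)) \<partial>chain n)"
  using P.integral_fst'[OF i] by simp
 finally show ?thesis .
qed

end

definition normal_var :: "real => real => (real => real) => real" where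
 "normal_var \<mu> sd h = (EE z. (h (\<mu> + sd * z))^2) - (EE z. h (\<mu> + sd * z))^2"

lemma normal_var_eq:
 assumes [measurable]: "h \<in> bmeas borel" and B: "\<And>x. \<bar>h x\<bar> <= B"
 shows "normal_var \<mu> sd h = (EE z. (h (\<mu> + sd * z) - (EE z. h (\<mu> + sd * z)))^2)"
 unfolding normal_var_def
 by (subst std_normal.variance_eq) (auto intro!: integrable_std_normal_bounded[OF _ B] integrable_std_normal_square[OF _ B])

lemma normal_var_nonneg:
 assumes "h \<in> bmeas borel" "\<And>x. \<bar>h x\<bar> <= B"
 shows "0 <= normal_var \<mu> sd h"
 unfolding normal_var_eq[OF assms] by (intro Bochner_Integration.integral_nonneg) simp

lemma abs_normal_var_le:
 assumes [measurable]: "h \<in> bmeas borel" and B: "\<And>x. \<bar>h x\<bar> <= B"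
 shows "\<bar>normal_var \<mu> sd h\<bar> <= B * B"
proof -
 have "\<bar>(EE z. (h (\<mu> + sd * z))^2)\<bar> <= B * B"
  by (rule std_normal.abs_expectation_le(2)) (use square_le_mult[OF B] in auto)
 then have "normal_var \<mu> sd h <= B * B" unfolding normal_var_def by (smt (verit) zero_le_power2)
 then show ?thesis using normal_var_nonneg[OF assms, of \<mu> sd] by simp
qed

lemma normal_var_measurable:
 assumes h: "(\<lambda>p. h (fst p) (snd p)) \<in> bmeas (M \<Otimes>\<^sub>M borel)" and [measurable]: "m \<in> bmeas M"
 shows "(\<lambda>x. normal_var (m x) sd (h x)) \<in> bmeas M"
proof -
 have [measurable]: "(\<lambda>p. h (fst p) (m (fst p) + sd * snd p)) \<in> bmeas (M \<Otimes>\<^sub>M std_normal)"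
  using measurable_compose[OF _ h, of "\<lambda>p. (fst p, m (fst p) + sd * snd p)" "M \<Otimes>\<^sub>M std_normal"] by simp
 show ?thesis unfolding normal_var_def by measurable
qed

lemma integral_std_normal_swap:
 fixes H :: "real => real => real"
 assumes [measurable]: "(\<lambda>p. H (fst p) (snd p)) \<in> bmeas (borel \<Otimes>\<^sub>M borel)" and B: "\<And>x z. \<bar>H x z\<bar> <= B"
 shows "(EE x. (EE z. H x z)) = (EE z. (EE x. H x z))"
proof -
 have "integrable (std_normal \<Otimes>\<^sub>M std_normal) (\<lambda>(x, z). H x z)"
  by (rule std_normal_pair.integrable_const_bound[where B=B]) (auto simp: B split_beta')
 from std_normal_pair.Fubini_integral[OF this] show ?thesis by simp
qed

text \<open>Convexity of the variance, by Jensen for the average over \<open>z\<close> of the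
  centred functions. It lets a one-site variance survive the integration of another
  coordinate.\<close>

lemma normal_var_integral_le:
 fixes H :: "real => real => real"
 assumes Hm[measurable]: "(\<lambda>p. H (fst p) (snd p)) \<in> bmeas (borel \<Otimes>\<^sub>M borel)" and B: "\<And>u z. \<bar>H u z\<bar> <= B"
 shows "normal_var \<mu> sd (\<lambda>u. (EE z. H u z)) <= (EE z. normal_var \<mu> sd (\<lambda>u. H u z))"
proof -
 define U where "U u z = H (\<mu> + sd * u) z" for u z
 define M where "M z = (EE u. U u z)" for z
 have [measurable]: "(\<lambda>p. U (fst p) (snd p)) \<in> bmeas (borel \<Otimes>\<^sub>M borel)"
  unfolding U_def using measurable_compose[OF _ Hm, of "\<lambda>p. (\<mu> + sd * fst p, snd p)" "borel \<Otimes>\<^sub>M borel"] by simp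
 have [measurable]: "(\<lambda>u. H u z) \<in> bmeas borel" "H u \<in> bmeas borel"
  "(\<lambda>u. U u z) \<in> bmeas borel" "U u \<in> bmeas borel" for u z
  using measurable_compose[OF _ Hm, of "\<lambda>u. (u, z)" borel] measurable_compose[OF _ Hm, of "\<lambda>z. (u, z)" borel]
   measurable_compose[OF _ Hm, of "\<lambda>u. (\<mu> + sd * u, z)" borel] measurable_compose[OF _ Hm, of "\<lambda>z. (\<mu> + sd * u, z)" borel]
  by (simp_all add: U_def[abs_def])
 have UB: "\<bar>U u z\<bar> <= B" for u z by (simp add: U_def B)
 have [measurable]: "M \<in> bmeas borel"
 proof -
  have [measurable]: "(\<lambda>p. U (snd p) (fst p)) \<in> bmeas (borel \<Otimes>\<^sub>M std_normal)"
   using measurable_compose[OF _ Hm, of "\<lambda>p. (\<mu> + sd * snd p, fst p)" "borel \<Otimes>\<^sub>M std_normal"] by (simp add: U_def)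
  show ?thesis unfolding M_def by measurable
 qed
 have MB: "\<bar>M z\<bar> <= B" for z unfolding M_def by (rule std_normal.abs_expectation_le(2)) (auto simp: UB)
 have dB: "\<bar>U u z - M z\<bar> <= 2 * B" for u z using UB[of u z] MB[of z] by linarith
 have hm[measurable]: "(\<lambda>u. (EE z. H u z)) \<in> bmeas borel"
 proof -
  have [measurable]: "(\<lambda>p. H (fst p) (snd p)) \<in> bmeas (borel \<Otimes>\<^sub>M std_normal)" using Hm by (simp cong: measurable_cong_sets)
  show ?thesis by measurable
 qed
 have hB: "\<bar>(EE z. H u z)\<bar> <= B" for u by (rule std_normal.abs_expectation_le(2)) (auto simp: B)
 have iU: "integrable std_normal (U u)" for u by (rule integrable_std_normal_bounded[OF _ UB]) measurable
 have iM: "integrable std_normal M" by (rule integrable_std_normal_bounded[OF _ MB]) measurable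
 have mean: "(EE u. (EE z. U u z)) = (EE z. M z)"
  unfolding M_def by (rule integral_std_normal_swap[OF _ UB]) measurable
 have [measurable]: "(\<lambda>p. U (fst p) (snd p) - M (snd p)) \<in> bmeas (borel \<Otimes>\<^sub>M borel)" by measurable
 have "normal_var \<mu> sd (\<lambda>u. (EE z. H u z)) = (EE u. ((EE z. U u z) - (EE z. M z))^2)"
  unfolding normal_var_eq[OF hm hB] U_def[symmetric] mean ..
 also have "... = (EE u. (EE z. U u z - M z)^2)" using iU iM by simp
 also have "... <= (EE u. (EE z. (U u z - M z)^2))"
 proof (rule integral_mono)
  have [measurable]: "(\<lambda>p. U (fst p) (snd p)) \<in> bmeas (borel \<Otimes>\<^sub>M std_normal)" by (simp cong: measurable_cong_sets)
  show "integrable std_normal (\<lambda>u. (EE z. U u z - M z)^2)"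
   by (rule integrable_std_normal_square[where B="2 * B"], measurable, rule std_normal.abs_expectation_le(2)) (auto simp: dB)
  show "integrable std_normal (\<lambda>u. (EE z. (U u z - M z)^2))"
   by (rule integrable_std_normal_bounded, measurable, rule std_normal.abs_expectation_le(2)[where B="2 * B * (2 * B)"])
    (use square_le_mult[OF dB] in auto)
  show "(EE z. U u z - M z)^2 <= (EE z. (U u z - M z)^2)" for u
   by (rule prob_space.integral_square_le[OF prob_space_std_normal], simp, rule integrable_std_normal_square[OF _ dB]) simp
 qed
 also have "... = (EE z. (EE u. (U u z - M z)^2))"
  by (rule integral_std_normal_swap[where B="2 * B * (2 * B)"], measurable) (use square_le_mult[OF dB] in auto)
 also have "... = (EE z. normal_var \<mu> sd (\<lambda>u. H u z))"
  unfolding M_def U_def by (subst normal_var_eq[OF _ B]) auto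
 finally show ?thesis .
qed

section \<open>One-site conditional variances and the recursion over the last coordinate\<close>

context ar1_chain
begin

text \<open>The law of coordinate \<open>t\<close> given all others, for a site with a right
  neighbour; by the Markov property only the neighbours enter. The last site of a chain has the law
  given by \<open>c\<close> and \<open>sd\<close> instead.\<close>

definition gibbs_mean :: "nat => point => real" where
 "gibbs_mean t x = (if t = 0 then \<mu> 0 + \<phi> * (x 1 - \<mu> 1)
  else \<mu> t + \<phi> / (1 + \<phi>\<^sup>2) * ((x (t - 1) - \<mu> (t - 1)) + (x (Suc t) - \<mu> (Suc t))))"

definition gibbs_sd :: "nat => real" where
 "gibbs_sd t = (if t = 0 then sqrt (1 - \<phi>\<^sup>2) else sqrt ((1 - \<phi>\<^sup>2) / (1 + \<phi>\<^sup>2)))"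

definition gibbs_var :: "nat => nat => (point => real) => real" where
 "gibbs_var n t f = (\<integral>x. normal_var (gibbs_mean t x) (gibbs_sd t) (\<lambda>u. f (x(t := u))) \<partial>chain n)"

definition last_var :: "nat => (point => real) => real" where
 "last_var n f = (\<integral>x. normal_var (c n x) (sd n) (\<lambda>u. f (x(n := u))) \<partial>chain n)"

definition last_mean :: "nat => (point => real) => point => real" where
 "last_mean n f x = (EE z. f (nxt n x z))"

definition chain_var :: "nat => (point => real) => real" where
 "chain_var n f = (\<integral>x. (f x)^2 \<partial>chain n) - (\<integral>x. f x \<partial>chain n)^2"

lemma gibbs_mean_measurable:
 assumes "Suc t < n" shows "gibbs_mean t \<in> bmeas (lebn n)"
proof (cases "t = 0")
 case True
 then show ?thesis unfolding gibbs_mean_def[abs_def] using coordinate_measurable[of 1 n] assms by simp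
next
 case False
 then show ?thesis
  unfolding gibbs_mean_def[abs_def] using coordinate_measurable[of "t - 1" n] coordinate_measurable[of "Suc t" n] assms by simp
qed

lemma integrable_chain:
 fixes f :: "point => real" and B :: real
 assumes [measurable]: "f \<in> bmeas (lebn n)" and "\<And>x. \<bar>f x\<bar> <= B"
 shows "integrable (chain n) f"
 by (rule chain.abs_expectation_le(1)[where B=B]) (use assms in auto)

context
 fixes f :: "point => real" and n :: nat
 assumes f[measurable]: "f \<in> bmeas (lebn (Suc n))"
begin

lemma step_compose: "(\<lambda>p. f (nxt n (fst p) (snd p))) \<in> bmeas (lebn n \<Otimes>\<^sub>M borel)"
 by (rule measurable_compose[OF step_measurable f])

lemma upd_compose: "(\<lambda>p. f ((fst p)(n := snd p))) \<in> bmeas (lebn n \<Otimes>\<^sub>M borel)"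
 by (rule measurable_compose[OF upd_measurable f])

lemma upd_section: "x \<in> space (lebn n) ==> (\<lambda>u. f (x(n := u))) \<in> bmeas borel"
 by (intro measurable_compose[OF upd_Suc_measurable_fun f]) auto

lemma upd_in_compose: "t < Suc n ==> (\<lambda>p. f ((fst p)(t := snd p))) \<in> bmeas (lebn (Suc n) \<Otimes>\<^sub>M borel)"
 by (rule measurable_compose[OF upd_measurable_in f])

lemma upd_in_section: "t < Suc n ==> x \<in> space (lebn (Suc n)) ==> (\<lambda>u. f (x(t := u))) \<in> bmeas borel"
 by (intro measurable_compose[OF upd_measurable_fun f]) auto

lemma last_mean_measurable: "last_mean n f \<in> bmeas (lebn n)"
proof -
 have [measurable]: "(\<lambda>p. f (nxt n (fst p) (snd p))) \<in> bmeas (lebn n \<Otimes>\<^sub>M std_normal)"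
  using step_compose by (simp cong: measurable_cong_sets)
 show ?thesis unfolding last_mean_def[abs_def] by measurable
qed

end

lemma abs_last_mean_le:
 assumes B: "\<And>x. \<bar>f x\<bar> <= B"
 shows "\<bar>last_mean n f x\<bar> <= B"
proof (cases "integrable std_normal (\<lambda>z. f (nxt n x z))")
 case True
 then show ?thesis
  unfolding last_mean_def by (intro std_normal.abs_expectation_le(2) B) auto
next
 case False
 \<comment> \<open>A section that is not integrable has integral 0, which obeys the bound as
   well.\<close>
 then show ?thesis using order_trans[OF abs_ge_zero B] by (simp add: last_mean_def not_integrable_integral_eq)
qed

context
 fixes f :: "point => real" and B :: real and n :: nat
 assumes f[measurable]: "f \<in> bmeas (lebn (Suc n))" and B: "\<And>x. \<bar>f x\<bar> <= B"
begin

text \<open>Law of total variance, conditioning on the first \<open>n\<close> coordinates.\<close>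

lemma chain_var_Suc: "chain_var (Suc n) f = chain_var n (last_mean n f) + last_var n f"
proof -
 note [measurable] = last_mean_measurable[OF f]
 have i1: "integrable (chain n) (\<lambda>x. (EE z. (f (nxt n x z))^2))"
 proof (rule chain.abs_expectation_le(1)[where B="B * B"])
  have [measurable]: "(\<lambda>p. f (nxt n (fst p) (snd p))) \<in> bmeas (lebn n \<Otimes>\<^sub>M std_normal)"
   using step_compose[OF f] by (simp cong: measurable_cong_sets)
  show "(\<lambda>x. (EE z. (f (nxt n x z))^2)) \<in> bmeas (chain n)" by measurable
  show "\<bar>(EE z. (f (nxt n x z))^2)\<bar> <= B * B" if "x \<in> space (chain n)" for x
   by (rule std_normal.abs_expectation_le(2))
    (use that square_le_mult[OF B] in \<open>auto intro!: borel_measurable_power measurable_compose[OF _ upd_section[OF f]]\<close>)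
 qed
 have i2: "integrable (chain n) (\<lambda>x. (last_mean n f x)^2)"
  by (rule chain.abs_expectation_le(1)[where B="B * B"]) (use square_le_mult[OF abs_last_mean_le[OF B]] in auto)
 have "last_var n f = (\<integral>x. (EE z. (f (nxt n x z))^2) \<partial>chain n) - (\<integral>x. (last_mean n f x)^2 \<partial>chain n)"
  unfolding last_var_def normal_var_def last_mean_def[symmetric] using i1 i2 by simp
 also have "(\<integral>x. (EE z. (f (nxt n x z))^2) \<partial>chain n) = (\<integral>x. (f x)^2 \<partial>chain (Suc n))"
  by (rule integral_chain_Suc[symmetric, where B="B * B"]) (use square_le_mult[OF B] in auto)
 finally show ?thesis
  unfolding chain_var_def using integral_chain_Suc[OF f B] by (simp add: last_mean_def[abs_def])
qed

end

end

context ar1_chain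
begin

lemma gibbs_var_measurable:
 assumes f: "f \<in> bmeas (lebn (Suc n))" and t: "t < n"
 shows "(\<lambda>x. normal_var (gibbs_mean t x) (gibbs_sd t) (\<lambda>u. f (x(t := u)))) \<in> bmeas (lebn (Suc n))"
 by (rule normal_var_measurable[OF upd_in_compose[OF f]]) (use t gibbs_mean_measurable in auto)

text \<open>\<open>Suc t < n\<close> keeps the right neighbour of \<open>t\<close> among the
  remaining coordinates, so the one-site law at \<open>t\<close> does not involve coordinate
  \<open>n\<close>. Averaging over that coordinate can then only lower the variance at
  \<open>t\<close>.\<close>

lemma gibbs_var_last_mean_le:
 assumes f: "f \<in> bmeas (lebn (Suc n))" and B: "\<And>x. \<bar>f x\<bar> <= B" and t: "Suc t < n"
 shows "gibbs_var n t (last_mean n f) <= gibbs_var (Suc n) t f"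
proof -
 note fm[measurable] = f
 define G where "G x = normal_var (gibbs_mean t x) (gibbs_sd t) (\<lambda>u. f (x(t := u)))" for x
 have Gm[measurable]: "G \<in> bmeas (lebn (Suc n))"
  unfolding G_def[abs_def] using t by (intro gibbs_var_measurable[OF f]) auto
 have sec: "(\<lambda>u. f (x(t := u))) \<in> bmeas borel" if "x \<in> space (lebn (Suc n))" for x
  using that t by (intro upd_in_section[OF f]) auto
 \<comment> \<open>Sections of \<open>f\<close> are measurable only at points of the space.
   Extension by zero gives the bound at every argument, as \<open>integral_chain_Suc\<close>
   demands.\<close>
 define G' where "G' x = (if x \<in> space (lebn (Suc n)) then G x else 0)" for x
 have G'm: "G' \<in> bmeas (lebn (Suc n))"
  by (subst measurable_cong[of _ _ G]) (auto simp: G'_def)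
 have G'B: "\<bar>G' x\<bar> <= B * B" for x
  unfolding G'_def G_def using abs_normal_var_le[OF sec B] order_trans[OF zero_le_power2 square_le_mult[OF B]]
  by auto
 have sp: "x(n := c n x + sd n * z) \<in> space (lebn (Suc n))" if "x \<in> space (lebn n)" for x z
  using that by (auto simp: space_PiM PiE_def extensional_def)
 have "gibbs_var (Suc n) t f = (\<integral>x. G' x \<partial>chain (Suc n))"
  unfolding gibbs_var_def G_def[symmetric] by (intro Bochner_Integration.integral_cong) (auto simp: G'_def)
 also have "... = (\<integral>x. (EE z. G' (nxt n x z)) \<partial>chain n)"
  by (rule integral_chain_Suc[OF G'm G'B])
 finally have eq: "gibbs_var (Suc n) t f = (\<integral>x. (EE z. G' (nxt n x z)) \<partial>chain n)" .
 have G'c: "(\<lambda>p. G' (nxt n (fst p) (snd p))) \<in> bmeas (lebn n \<Otimes>\<^sub>M std_normal)"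
  using step_compose[OF G'm] by (simp cong: measurable_cong_sets)
 have G's: "(\<lambda>z. G' (nxt n x z)) \<in> bmeas borel" if "x \<in> space (lebn n)" for x
  using measurable_compose[OF _ upd_section[OF G'm that], of "\<lambda>z. c n x + sd n * z" borel] by simp
 show ?thesis
  unfolding eq unfolding gibbs_var_def
 proof (rule integral_mono)
  have lm: "last_mean n f \<in> bmeas (lebn (Suc (n - 1)))"
   using last_mean_measurable[OF f] t by simp
  have lms: "(\<lambda>u. last_mean n f (x(t := u))) \<in> bmeas borel" if "x \<in> space (lebn n)" for x
   using upd_in_section[OF lm, of t x] that t by auto
  have lmB: "\<bar>last_mean n f (x(t := u))\<bar> <= B" if "x \<in> space (lebn n)" for x u
   by (rule abs_last_mean_le[OF B])
  show "integrable (chain n) (\<lambda>x. normal_var (gibbs_mean t x) (gibbs_sd t) (\<lambda>u. last_mean n f (x(t := u))))"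
  proof (rule chain.abs_expectation_le(1)[where B="B * B"])
   show "(\<lambda>x. normal_var (gibbs_mean t x) (gibbs_sd t) (\<lambda>u. last_mean n f (x(t := u)))) \<in> bmeas (chain n)"
    using gibbs_var_measurable[OF lm, of t] t by simp
   show "\<bar>normal_var (gibbs_mean t x) (gibbs_sd t) (\<lambda>u. last_mean n f (x(t := u)))\<bar> <= B * B" if "x \<in> space (chain n)" for x
    using that by (intro abs_normal_var_le lms lmB) auto
  qed
  show "integrable (chain n) (\<lambda>x. (EE z. G' (nxt n x z)))"
  proof (rule chain.abs_expectation_le(1)[where B="B * B"])
   show "(\<lambda>x. (EE z. G' (nxt n x z))) \<in> bmeas (chain n)"
    using G'c by (intro std_normal.borel_measurable_lebesgue_integral) (simp add: split_beta' cong: measurable_cong_sets)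
   show "\<bar>(EE z. G' (nxt n x z))\<bar> <= B * B" if "x \<in> space (chain n)" for x
    by (rule std_normal.abs_expectation_le(2)) (use G's that G'B in auto)
  qed
  fix x assume "x \<in> space (chain n)"
  then have x: "x \<in> space (lebn n)" by simp
  have cx: "c n (x(t := u)) = c n x" for u using t by (auto simp: c_def)
  have tw: "(x(t := u))(n := y) = (x(n := y))(t := u)" for u y using t by (auto simp: fun_upd_twist)
  have gm: "gibbs_mean t (x(n := y)) = gibbs_mean t x" for y using t by (auto simp: gibbs_mean_def)
  have Hm: "(\<lambda>p. f (x(t := fst p, n := c n x + sd n * snd p))) \<in> bmeas (borel \<Otimes>\<^sub>M borel)"
  proof (rule measurable_compose[OF upd_Suc_measurable_fun f])
   show "(\<lambda>p. x(t := fst p)) \<in> borel \<Otimes>\<^sub>M borel \<rightarrow>\<^sub>M lebn n"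
    using t x by (intro upd_measurable_fun) auto
  qed simp
  have "normal_var (gibbs_mean t x) (gibbs_sd t) (\<lambda>u. last_mean n f (x(t := u)))
   = normal_var (gibbs_mean t x) (gibbs_sd t) (\<lambda>u. (EE z. f (x(t := u, n := c n x + sd n * z))))"
   unfolding last_mean_def cx ..
  also have "... <= (EE z. normal_var (gibbs_mean t x) (gibbs_sd t) (\<lambda>u. f (x(t := u, n := c n x + sd n * z))))"
   by (rule normal_var_integral_le[OF Hm B])
  also have "... = (EE z. G' (nxt n x z))"
   unfolding G'_def G_def using sp[OF x] by (simp add: gm tw)
  finally show "normal_var (gibbs_mean t x) (gibbs_sd t) (\<lambda>u. last_mean n f (x(t := u))) <= (EE z. G' (nxt n x z))" .
 qed
qed

text \<open>The correlation of coordinates \<open>n\<close> and \<open>n + 1\<close> given the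
  earlier ones: their covariance is \<phi> (sd n)^2, and coordinate \<open>n + 1\<close> has
  variance \<phi>^2 (sd n)^2 + 1 - \<phi>^2.\<close>

definition corr :: "nat => real" where
 "corr n = \<phi> * sd n / sqrt (\<phi>\<^sup>2 * (sd n)^2 + (1 - \<phi>\<^sup>2))"

lemma sigma_square: "(sd n)^2 = (if n = 0 then 1 else 1 - \<phi>\<^sup>2)"
 using phi_square_less by (simp add: sd_def)

lemma corr_square: "(corr n)^2 = (if n = 0 then \<phi>\<^sup>2 else \<phi>\<^sup>2 / (1 + \<phi>\<^sup>2))"
proof -
 have p: "0 < 1 - \<phi>\<^sup>2" using phi_square_less by simp
 have q: "0 < 1 + \<phi>\<^sup>2" by (simp add: add_pos_nonneg)
 have s: "0 <= \<phi>\<^sup>2 * (sd n)^2 + (1 - \<phi>\<^sup>2)" using p by simp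
 have e: "(corr n)^2 = \<phi>\<^sup>2 * (sd n)^2 / (\<phi>\<^sup>2 * (sd n)^2 + (1 - \<phi>\<^sup>2))"
  unfolding corr_def power_divide power_mult_distrib real_sqrt_pow2[OF s] ..
 have f: "\<phi>\<^sup>2 * (1 - \<phi>\<^sup>2) + (1 - \<phi>\<^sup>2) = (1 - \<phi>\<^sup>2) * (1 + \<phi>\<^sup>2)" by (simp add: algebra_simps)
 show ?thesis unfolding e sigma_square using p q by (simp add: f)
qed

lemma corr_square_less: "(corr n)^2 < 1"
proof -
 have "\<phi>\<^sup>2 / (1 + \<phi>\<^sup>2) < 1" by (simp add: divide_less_eq add_pos_nonneg)
 then show ?thesis using phi_square_less by (simp add: corr_square)
qed

text \<open>Given the first \<open>n\<close> coordinates, the next two form a Gaussian pair with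
  correlation \<open>corr n\<close>. In standardised variables X and Y, \<open>W0\<close> is the
  variance of the mean over Y given X, \<open>W1\<close> the mean variance over Y given X, and
  \<open>V\<close> the mean variance when X is resampled given Y, so
  \<open>bivariate_conditional_variance\<close> applies with E2 - m^2 = W0 + W1.\<close>

lemma last_var_pointwise:
 assumes f: "f \<in> bmeas (lebn (Suc (Suc n)))" and B: "\<And>x. \<bar>f x\<bar> <= B"
  and x: "x \<in> space (lebn n)" and th: "0 < \<theta>" "\<theta> < 1"
 defines "W0 \<equiv> normal_var (c n x) (sd n) (\<lambda>u. last_mean (Suc n) f (x(n := u)))"
  and "W1 \<equiv> (EE z. normal_var (c (Suc n) (nxt n x z)) (sd (Suc n)) (\<lambda>u. f (x(n := c n x + sd n * z, Suc n := u))))"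
  and "V \<equiv> (EE z. (EE z'. normal_var
    (gibbs_mean n (x(n := c n x + sd n * z, Suc n := c (Suc n) (nxt n x z) + sd (Suc n) * z'))) (gibbs_sd n)
    (\<lambda>u. f (x(n := u, Suc n := c (Suc n) (nxt n x z) + sd (Suc n) * z')))))"
 shows "W0 <= (corr n)^2 / \<theta> * (W0 + W1) + V / (1 - \<theta>)"
proof -
 define rho where "rho = corr n"
 define s where "s = sqrt (\<phi>\<^sup>2 * (sd n)^2 + (1 - \<phi>\<^sup>2))"
 define r where "r = sqrt (1 - rho\<^sup>2)"
 define \<beta> where "\<beta> = \<mu> (Suc n) + \<phi> * (c n x - \<mu> n)"
 have p: "0 < 1 - \<phi>\<^sup>2" using phi_square_less by simp
 have s2: "s\<^sup>2 = \<phi>\<^sup>2 * (sd n)^2 + (1 - \<phi>\<^sup>2)" and s0: "0 < s"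
  using p by (auto simp: s_def add_nonneg_pos)
 have rhos: "s * rho = \<phi> * sd n" using s0 by (simp add: rho_def corr_def s_def[symmetric])
 have rs: "s * r = sd (Suc n)"
 proof -
  have "s * r = sqrt (s\<^sup>2 * (1 - rho\<^sup>2))" using s0 by (simp add: r_def real_sqrt_mult)
  also have "s\<^sup>2 * (1 - rho\<^sup>2) = s\<^sup>2 - (s * rho)^2" by (simp add: power_mult_distrib algebra_simps)
  also have "... = 1 - \<phi>\<^sup>2" unfolding rhos s2 by (simp add: power_mult_distrib)
  finally show ?thesis by (simp add: sd_def)
 qed
 define g where "g X Y = f (x(n := c n x + sd n * X, Suc n := \<beta> + s * Y))" for X Y
 have up: "(\<lambda>w. x(n := h w, Suc n := k w)) \<in> M \<rightarrow>\<^sub>M lebn (Suc (Suc n))"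
  if "h \<in> bmeas M" "k \<in> bmeas M" for h k and M :: "'b measure"
  using that x by (intro upd_Suc_measurable_fun) auto
 have gm: "(\<lambda>(X, Y). g X Y) \<in> bmeas (borel \<Otimes>\<^sub>M borel)"
  unfolding g_def split_beta' by (rule measurable_compose[OF up f]) auto
 have gB: "\<bar>g X Y\<bar> <= B" for X Y by (simp add: g_def B)
 have cS: "c (Suc n) (nxt n x z) = \<beta> + s * (rho * z)" for z
 proof -
  have "c (Suc n) (nxt n x z) = \<mu> (Suc n) + \<phi> * (c n x + sd n * z - \<mu> n)" by (simp add: c_def)
  also have "... = \<beta> + \<phi> * sd n * z" by (simp add: \<beta>_def algebra_simps)
  also have "\<phi> * sd n * z = s * (rho * z)" by (simp add: mult.assoc[symmetric] rhos)
  finally show ?thesis .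
 qed
 have b: "c (Suc n) (nxt n x z) + sd (Suc n) * z' = \<beta> + s * (rho * z + r * z')" for z z'
  unfolding cS rs[symmetric] by (simp add: algebra_simps)
 \<comment> \<open>In standardised coordinates, resampling site \<open>n\<close> given its
   neighbours is one Ornstein-Uhlenbeck step started at Y.\<close>
 have gmean: "gibbs_mean n (x(n := a, Suc n := \<beta> + s * Y)) + gibbs_sd n * w = c n x + sd n * (rho * Y + r * w)" for a Y w
 proof -
  have sd: "sd n * r = gibbs_sd n"
  proof -
   have "sd n * r = sqrt ((sd n)^2 * (1 - rho\<^sup>2))" using sigma_pos[of n] by (simp add: r_def real_sqrt_mult)
   also have "(sd n)^2 * (1 - rho\<^sup>2) = (if n = 0 then 1 - \<phi>\<^sup>2 else (1 - \<phi>\<^sup>2) / (1 + \<phi>\<^sup>2))"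
   proof -
    have "0 < 1 + \<phi>\<^sup>2" by (simp add: add_pos_nonneg)
    then show ?thesis unfolding rho_def corr_square sigma_square by (auto simp: divide_simps)
   qed
   finally show ?thesis by (simp add: gibbs_sd_def)
  qed
  have "gibbs_mean n (x(n := a, Suc n := \<beta> + s * Y)) = c n x + sd n * rho * Y"
  proof (cases "n = 0")
   case True
   have "s = 1" unfolding s_def sigma_square using True by simp
   then show ?thesis using True rhos by (simp add: gibbs_mean_def c_def \<beta>_def sd_def)
  next
   case False
   have q: "0 < 1 + \<phi>\<^sup>2" by (simp add: add_pos_nonneg)
   have s2': "s\<^sup>2 = (sd n)^2 * (1 + \<phi>\<^sup>2)" unfolding s2 sigma_square using False by (simp add: algebra_simps)
   have "sd n * rho * s = sd n * (s * rho)" by simp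
   also have "... = \<phi> * (sd n)^2" unfolding rhos by (simp add: power2_eq_square)
   finally have "sd n * rho * s * (1 + \<phi>\<^sup>2) = \<phi> * s * s" unfolding mult.assoc power2_eq_square[symmetric] s2' by simp
   then have "(sd n * rho * (1 + \<phi>\<^sup>2)) * s = (\<phi> * s) * s" by (simp add: mult.assoc mult.left_commute mult.commute)
   then have "sd n * rho * (1 + \<phi>\<^sup>2) = \<phi> * s" using s0 by (subst (asm) mult_right_cancel) auto
   then have k: "sd n * rho = \<phi> / (1 + \<phi>\<^sup>2) * s" using q by (simp add: field_simps)
   have cx: "c n x - \<mu> n = \<phi> * (x (n - 1) - \<mu> (n - 1))" using False by (simp add: c_def)
   define d where "d = x (n - 1) - \<mu> (n - 1)"
   have "gibbs_mean n (x(n := a, Suc n := \<beta> + s * Y)) = \<mu> n + \<phi> / (1 + \<phi>\<^sup>2) * (d + (\<phi> * (\<phi> * d) + s * Y))"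
   proof -
    have "n - Suc 0 \<noteq> n" "n - Suc 0 \<noteq> Suc n" using False by auto
    then show ?thesis using False by (simp add: gibbs_mean_def \<beta>_def cx d_def)
   qed
   also have "... = \<mu> n + \<phi> / (1 + \<phi>\<^sup>2) * ((1 + \<phi>\<^sup>2) * d) + \<phi> / (1 + \<phi>\<^sup>2) * s * Y"
   proof -
    have "k * (d + (\<phi> * (\<phi> * d) + s * Y)) = k * ((1 + \<phi>\<^sup>2) * d) + k * s * Y" for k
     by (simp add: algebra_simps power2_eq_square)
    then show ?thesis by (simp only: add.assoc)
   qed
   also have "\<phi> / (1 + \<phi>\<^sup>2) * ((1 + \<phi>\<^sup>2) * d) = \<phi> * d" using q by simp
   finally have e: "gibbs_mean n (x(n := a, Suc n := \<beta> + s * Y)) = \<mu> n + \<phi> * d + \<phi> / (1 + \<phi>\<^sup>2) * s * Y" .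
   have "c n x = \<mu> n + \<phi> * d" using cx by (simp add: d_def)
   then show ?thesis by (simp only: e k)
  qed
  then show ?thesis unfolding sd[symmetric] by (simp add: algebra_simps)
 qed
 define R where "R X = (EE z. g X (rho * X + r * z))" for X
 define E2 where "E2 = (EE X. (EE z. (g X (rho * X + r * z))^2))"
 define m where "m = (EE X. R X)"
 have lm: "last_mean (Suc n) f (x(n := c n x + sd n * X)) = R X" for X
  unfolding last_mean_def R_def g_def b ..
 have W0: "W0 = (EE X. (R X)^2) - m\<^sup>2"
  unfolding W0_def normal_var_def lm m_def ..
 have gm': "(\<lambda>p. g (fst p) (rho * fst p + r * snd p)) \<in> bmeas (borel \<Otimes>\<^sub>M std_normal)"
  using measurable_compose[OF _ gm, of "\<lambda>p. (fst p, rho * fst p + r * snd p)" "borel \<Otimes>\<^sub>M std_normal"] by simp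
 note [measurable] = gm'
 have gs[measurable]: "(\<lambda>z. g X (rho * X + r * z)) \<in> bmeas borel" for X
  using measurable_compose[OF _ gm, of "\<lambda>z. (X, rho * X + r * z)" borel] by simp
 have W1: "W1 = E2 - (EE X. (R X)^2)"
 proof -
  have "W1 = (EE X. (EE z. (g X (rho * X + r * z))^2) - (R X)^2)"
   unfolding W1_def normal_var_def b R_def g_def ..
  moreover have "integrable std_normal (\<lambda>X. (EE z. (g X (rho * X + r * z))^2))"
   by (rule integrable_std_normal_bounded, measurable, rule std_normal.abs_expectation_le(2)[where B="B * B"]) (use square_le_mult[OF gB] in auto)
  moreover have "integrable std_normal (\<lambda>X. (R X)^2)"
   unfolding R_def
   by (rule integrable_std_normal_square[where B=B], measurable, rule std_normal.abs_expectation_le(2)) (use gB in auto)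
  ultimately show ?thesis by (simp add: E2_def)
 qed
 have V: "V = (EE X. (EE z. (EE w. (g (rho * (rho * X + r * z) + r * w) (rho * X + r * z))^2)
   - (EE w. g (rho * (rho * X + r * z) + r * w) (rho * X + r * z))^2))"
  unfolding V_def normal_var_def b gmean g_def ..
 have "W0 <= rho\<^sup>2 / \<theta> * (E2 - m\<^sup>2) + V / (1 - \<theta>)"
  unfolding W0 V m_def R_def E2_def r_def rho_def
  by (rule bivariate_conditional_variance[OF gm gB corr_square_less th])
 moreover have "E2 - m\<^sup>2 = W0 + W1" by (simp add: W0 W1)
 ultimately show ?thesis by (simp add: rho_def)
qed

end

context ar1_chain
begin

lemma last_var_measurable:
 assumes f: "f \<in> bmeas (lebn (Suc n))"
 shows "(\<lambda>x. normal_var (c n x) (sd n) (\<lambda>u. f (x(n := u)))) \<in> bmeas (lebn n)"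
 by (rule normal_var_measurable[OF upd_compose[OF f]]) simp

lemma last_var_nonneg:
 assumes f: "f \<in> bmeas (lebn (Suc n))" and B: "\<And>x. \<bar>f x\<bar> <= B"
 shows "0 <= last_var n f"
 unfolding last_var_def by (intro integral_nonneg_AE AE_I2 normal_var_nonneg[OF upd_section[OF f] B]) simp

lemma gibbs_var_nonneg:
 assumes f: "f \<in> bmeas (lebn (Suc n))" and B: "\<And>x. \<bar>f x\<bar> <= B" and t: "t < Suc n"
 shows "0 <= gibbs_var (Suc n) t f"
 unfolding gibbs_var_def by (intro integral_nonneg_AE AE_I2 normal_var_nonneg[OF upd_in_section[OF f t] B]) simp

lemma bounded_representative:
 assumes f: "f \<in> bmeas (lebn n)" and B: "\<forall>x\<in>space (lebn n). \<bar>f x\<bar> <= B"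
  and B0: "0 <= (B::real)"
 defines "g \<equiv> \<lambda>x. if x \<in> space (lebn n) then f x else 0"
 shows "g \<in> bmeas (lebn n)" "\<And>x. \<bar>g x\<bar> <= B" "\<And>x. x \<in> space (lebn n) ==> g x = f x"
proof -
 show "g \<in> bmeas (lebn n)"
  by (subst measurable_cong[of _ _ f]) (auto simp: g_def f)
qed (use B B0 in \<open>auto simp: g_def\<close>)

lemma integral_chain_Suc':
 fixes F :: "point => real"
 assumes F: "F \<in> bmeas (lebn (Suc n))"
  and B: "\<And>x. x \<in> space (lebn (Suc n)) ==> \<bar>F x\<bar> <= B" and B0: "0 <= B"
 shows "(\<integral>x. F x \<partial>chain (Suc n)) = (\<integral>x. (EE z. F (nxt n x z)) \<partial>chain n)"
  "integrable (chain n) (\<lambda>x. (EE z. F (nxt n x z)))"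
proof -
 define g where "g x = (if x \<in> space (lebn (Suc n)) then F x else 0)" for x
 have B': "\<forall>x\<in>space (lebn (Suc n)). \<bar>F x\<bar> <= B" using B by blast
 note g = bounded_representative[OF F B' B0, folded g_def]
 have sp: "x(n := y) \<in> space (lebn (Suc n))" if "x \<in> space (lebn n)" for x y
  using that by (auto simp: space_PiM PiE_def extensional_def)
 have e1: "(\<integral>x. F x \<partial>chain (Suc n)) = (\<integral>x. g x \<partial>chain (Suc n))"
  by (intro Bochner_Integration.integral_cong) (auto simp: g(3))
 have e2: "(EE z. F (nxt n x z)) = (EE z. g (nxt n x z))"
  if "x \<in> space (chain n)" for x
  using that sp by (simp add: g(3))
 show "(\<integral>x. F x \<partial>chain (Suc n)) = (\<integral>x. (EE z. F (nxt n x z)) \<partial>chain n)"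
  unfolding e1 integral_chain_Suc[OF g(1,2)] by (rule Bochner_Integration.integral_cong) (simp_all add: e2)
 have "integrable (chain n) (last_mean n g)"
  by (rule integrable_chain[OF last_mean_measurable[OF g(1)] abs_last_mean_le[OF g(2)]])
 then show "integrable (chain n) (\<lambda>x. (EE z. F (nxt n x z)))"
  by (subst Bochner_Integration.integrable_cong[OF refl e2]) (auto simp: last_mean_def[abs_def])
qed

lemma last_var_le:
 assumes f: "f \<in> bmeas (lebn (Suc (Suc n)))" and B: "\<And>x. \<bar>f x\<bar> <= B"
  and th: "0 < \<theta>" "\<theta> < 1"
 shows "last_var n (last_mean (Suc n) f) <= (corr n)^2 / \<theta> * (last_var n (last_mean (Suc n) f) + last_var (Suc n) f)
  + gibbs_var (Suc (Suc n)) n f / (1 - \<theta>)"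
proof -
 define W0 where "W0 x = normal_var (c n x) (sd n) (\<lambda>u. last_mean (Suc n) f (x(n := u)))" for x
 define W1 where "W1 x = normal_var (c (Suc n) x) (sd (Suc n)) (\<lambda>u. f (x(Suc n := u)))" for x
 define V where "V x = normal_var (gibbs_mean n x) (gibbs_sd n) (\<lambda>u. f (x(n := u)))" for x
 define V' where "V' x = (EE z. V (x(Suc n := c (Suc n) x + sd (Suc n) * z)))" for x
 have BB: "0 <= B * B" using order_trans[OF zero_le_power2 square_le_mult[OF B]] .
 note lm = last_mean_measurable[OF f] and lB = abs_last_mean_le[OF B]
 have W1m: "W1 \<in> bmeas (lebn (Suc n))"
  unfolding W1_def[abs_def] by (rule last_var_measurable[OF f])
 have W1B: "\<bar>W1 x\<bar> <= B * B" if "x \<in> space (lebn (Suc n))" for x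
  unfolding W1_def by (rule abs_normal_var_le[OF upd_section[OF f that] B])
 have Vm: "V \<in> bmeas (lebn (Suc (Suc n)))"
  unfolding V_def[abs_def] by (rule gibbs_var_measurable[OF f]) simp
 have VB: "\<bar>V x\<bar> <= B * B" if "x \<in> space (lebn (Suc (Suc n)))" for x
  unfolding V_def by (rule abs_normal_var_le[OF upd_in_section[OF f _ that] B]) simp
 define V'' where "V'' x = (if x \<in> space (lebn (Suc (Suc n))) then V x else 0)" for x
 have VB': "\<forall>x\<in>space (lebn (Suc (Suc n))). \<bar>V x\<bar> <= B * B" using VB by blast
 note V'' = bounded_representative[OF Vm VB' BB, folded V''_def]
 have sp: "x(Suc n := y) \<in> space (lebn (Suc (Suc n)))" if "x \<in> space (lebn (Suc n))" for x y
  using that by (auto simp: space_PiM PiE_def extensional_def)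
 have V'eq: "V' x = last_mean (Suc n) V'' x" if "x \<in> space (lebn (Suc n))" for x
  unfolding V'_def last_mean_def by (simp add: V''(3)[OF sp[OF that]])
 have V'm: "V' \<in> bmeas (lebn (Suc n))"
  by (subst measurable_cong[OF V'eq]) (auto intro: last_mean_measurable[OF V''(1)])
 have V'B: "\<bar>V' x\<bar> <= B * B" if "x \<in> space (lebn (Suc n))" for x
  unfolding V'eq[OF that] by (rule abs_last_mean_le[OF V''(2)])
 have I0: "integrable (chain n) W0"
 proof (rule chain.abs_expectation_le(1)[where B="B * B"])
  show "W0 \<in> bmeas (chain n)"
   unfolding W0_def[abs_def] using last_var_measurable[OF lm] by simp
  show "\<bar>W0 x\<bar> <= B * B" if "x \<in> space (chain n)" for x
   unfolding W0_def using that by (intro abs_normal_var_le[OF upd_section[OF lm] lB]) auto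
 qed
 note I1 = integral_chain_Suc'[OF W1m W1B BB] and I2 = integral_chain_Suc'[OF V'm V'B BB]
 have e0: "last_var n (last_mean (Suc n) f) = (\<integral>x. W0 x \<partial>chain n)" by (simp add: last_var_def W0_def)
 have e1: "last_var (Suc n) f = (\<integral>x. (EE z. W1 (nxt n x z)) \<partial>chain n)"
  using I1(1) by (simp add: last_var_def W1_def)
 have e2: "gibbs_var (Suc (Suc n)) n f = (\<integral>x. (EE z. V' (nxt n x z)) \<partial>chain n)"
  using I2(1) integral_chain_Suc'(1)[OF Vm VB BB] by (simp add: gibbs_var_def V_def V'_def)
 have "(\<integral>x. W0 x \<partial>chain n) <= (\<integral>x. (corr n)^2 / \<theta> * (W0 x + (EE z. W1 (nxt n x z)))
  + (EE z. V' (nxt n x z)) / (1 - \<theta>) \<partial>chain n)"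
 proof (rule integral_mono[OF I0])
  show "integrable (chain n) (\<lambda>x. (corr n)^2 / \<theta> * (W0 x + (EE z. W1 (nxt n x z)))
  + (EE z. V' (nxt n x z)) / (1 - \<theta>))"
   using I0 I1(2) I2(2) by simp
  fix x assume "x \<in> space (chain n)"
  then have x: "x \<in> space (lebn n)" by simp
  have tw: "x(n := a, Suc n := b, n := u) = x(n := u, Suc n := b)" for a b u by (auto simp: fun_eq_iff)
  show "W0 x <= (corr n)^2 / \<theta> * (W0 x + (EE z. W1 (nxt n x z)))
  + (EE z. V' (nxt n x z)) / (1 - \<theta>)"
   using last_var_pointwise[OF f B x th] unfolding W0_def W1_def V'_def V_def tw .
 qed
 also have "... = (corr n)^2 / \<theta> * ((\<integral>x. W0 x \<partial>chain n) + (\<integral>x. (EE z. W1 (nxt n x z)) \<partial>chain n))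
  + (\<integral>x. (EE z. V' (nxt n x z)) \<partial>chain n) / (1 - \<theta>)"
  using I0 I1(2) I2(2) by simp
 finally show ?thesis unfolding e0 e1 e2 .
qed

text \<open>With a = |\<phi>|, \<open>last_var_le\<close> is solved for the earlier variance. For n
  > 0 this yields W0 \<le> a W1 up to the one-site term, and 1 / (1 - a) is the fixed point of k = a
  k + 1. For n = 0 the coefficient is only a / (1 - a), which the initial weight 1 matches.\<close>

lemma last_var_step:
 assumes f: "f \<in> bmeas (lebn (Suc (Suc n)))" and B: "\<And>x. \<bar>f x\<bar> <= B"
 shows "(if n = 0 then 1 else 1 / (1 - \<bar>\<phi>\<bar>)) * last_var n (last_mean (Suc n) f) + last_var (Suc n) f
  <= 8 / (1 - \<bar>\<phi>\<bar>)^2 * gibbs_var (Suc (Suc n)) n f + 1 / (1 - \<bar>\<phi>\<bar>) * last_var (Suc n) f"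
proof -
 define a where "a = \<bar>\<phi>\<bar>"
 have a: "0 <= a" "a < 1" using \<phi> by (auto simp: a_def)
 have a2: "\<phi>\<^sup>2 = a\<^sup>2" by (simp add: a_def)
 define W0 W1 V where "W0 = last_var n (last_mean (Suc n) f)" and "W1 = last_var (Suc n) f" and "V = gibbs_var (Suc (Suc n)) n f"
 have W0: "0 <= W0" unfolding W0_def by (rule last_var_nonneg[OF last_mean_measurable[OF f] abs_last_mean_le[OF B]])
 have W1: "0 <= W1" unfolding W1_def by (rule last_var_nonneg[OF f B])
 have V0: "0 <= V" unfolding V_def by (rule gibbs_var_nonneg[OF f B]) simp
 have main: "W0 <= (corr n)^2 / \<theta> * (W0 + W1) + V / (1 - \<theta>)" if "0 < \<theta>" "\<theta> < 1" for \<theta>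
  unfolding W0_def W1_def V_def by (rule last_var_le[OF f B that])
 show ?thesis
 proof (cases "n = 0")
  case True
  \<comment> \<open>Halfway between a, where \<open>corr^2 / \<theta>\<close> equals a, and
    1.\<close>
  define \<theta> where "\<theta> = (1 + a) / 2"
  have th: "0 < \<theta>" "\<theta> < 1" and th1: "1 - \<theta> = (1 - a) / 2" using a by (auto simp: \<theta>_def field_simps)
  have q: "(corr n)^2 / \<theta> <= a"
  proof -
   have "(corr n)^2 = a * a" by (simp only: corr_square True if_True a2) (simp add: power2_eq_square)
   moreover have "a * a <= a * \<theta>" using a by (intro mult_left_mono) (auto simp: \<theta>_def)
   ultimately show ?thesis using th by (simp add: divide_le_eq)
  qed
  have "W0 <= a * (W0 + W1) + 2 * V / (1 - a)"
  proof -
   have "V / (1 - \<theta>) = 2 * V / (1 - a)" unfolding th1 using a by (simp add: field_simps)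
   moreover have "(corr n)^2 / \<theta> * (W0 + W1) <= a * (W0 + W1)" using q W0 W1 by (intro mult_right_mono) auto
   ultimately show ?thesis using main[OF th] by linarith
  qed
  then have "(1 - a) * W0 <= a * W1 + 2 * V / (1 - a)" by (simp add: algebra_simps)
  then have "(1 - a) * W0 / (1 - a) <= (a * W1 + 2 * V / (1 - a)) / (1 - a)" using a by (intro divide_right_mono) auto
  then have "W0 <= a / (1 - a) * W1 + 2 / (1 - a)^2 * V" using a by (simp add: add_divide_distrib power2_eq_square)
  moreover have "2 / (1 - a)^2 * V <= 8 / (1 - a)^2 * V" using V0 by (intro mult_right_mono divide_right_mono) auto
  moreover have "a / (1 - a) * W1 + W1 = 1 / (1 - a) * W1" using a by (simp add: field_simps)
  ultimately show ?thesis using True by (simp add: W0_def W1_def V_def a_def)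
 next
  case False
  have p: "0 < 1 + a\<^sup>2" by (simp add: add_pos_nonneg)
  \<comment> \<open>Halfway between the value a (1 + a) / (1 + a^2), where
    \<open>corr^2 / \<theta>\<close> equals a / (1 + a), and 1. The coefficient a / (1 + a) becomes
    a once the \<open>W0\<close> on the right has been moved to the left.\<close>
  define \<theta> where "\<theta> = (1 + a + 2 * a\<^sup>2) / (2 * (1 + a\<^sup>2))"
  have th0: "0 < \<theta>" using a p by (auto simp: \<theta>_def intro!: divide_pos_pos add_pos_nonneg)
  have th1: "1 - \<theta> = (1 - a) / (2 * (1 + a\<^sup>2))" using p by (simp add: \<theta>_def field_simps)
  have th: "\<theta> < 1"
  proof -
   have "0 < 1 - \<theta>" unfolding th1 using a p by (intro divide_pos_pos) auto
   then show ?thesis by simp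
  qed
  have q: "(corr n)^2 / \<theta> <= a / (1 + a)"
  proof -
   have e: "(corr n)^2 / \<theta> = 2 * a\<^sup>2 / (1 + a + 2 * a\<^sup>2)"
   proof -
    have "x / P / (q / (2 * P)) = 2 * x / q" if "P \<noteq> 0" for x P q :: real
     using that by (cases "q = 0") (auto simp: field_simps)
    from this[of "1 + a\<^sup>2" "a\<^sup>2" "1 + a + 2 * a\<^sup>2"] show ?thesis
     using False p by (simp only: corr_square a2 \<theta>_def if_False less_imp_neq[THEN not_sym] simp_thms)
   qed
   have "2 * a\<^sup>2 * (1 + a) <= a * (1 + a + 2 * a\<^sup>2)"
   proof -
    have "a * (1 + a + 2 * a\<^sup>2) - 2 * a\<^sup>2 * (1 + a) = a * (1 - a)" by (simp add: power2_eq_square algebra_simps)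
    also have "... \<ge> 0" using a by simp
    finally show ?thesis by simp
   qed
   moreover have "0 < 1 + a + 2 * a\<^sup>2" using a by (simp add: add_pos_nonneg)
   ultimately show ?thesis unfolding e using a by (subst frac_le_eq) (auto simp: divide_le_0_iff)
  qed
  have i: "V / (1 - \<theta>) <= 4 / (1 - a) * V"
  proof -
   have "V / (1 - \<theta>) = 2 * (1 + a\<^sup>2) / (1 - a) * V" unfolding th1 by simp
   also have "... <= 4 / (1 - a) * V" using a V0 power_le_one[of a 2] by (intro mult_right_mono divide_right_mono) auto
   finally show ?thesis .
  qed
  have "W0 <= a / (1 + a) * (W0 + W1) + 4 / (1 - a) * V"
   using main[OF th0 th] mult_right_mono[OF q, of "W0 + W1"] W0 W1 i by simp
  then have "(1 + a) * W0 <= (1 + a) * (a / (1 + a) * (W0 + W1) + 4 / (1 - a) * V)" using a by (intro mult_left_mono) auto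
  also have "... = a * (W0 + W1) + (1 + a) * (4 / (1 - a) * V)" using a by (simp add: distrib_left)
  also have "(1 + a) * (4 / (1 - a) * V) <= 2 * (4 / (1 - a) * V)" using a V0 by (intro mult_right_mono) auto
  finally have "W0 <= a * W1 + 8 / (1 - a) * V" by (simp add: algebra_simps)
  then have "1 / (1 - a) * W0 <= 1 / (1 - a) * (a * W1 + 8 / (1 - a) * V)" using a by (intro mult_left_mono) auto
  also have "... = a / (1 - a) * W1 + 8 / (1 - a)^2 * V" by (simp add: distrib_left power2_eq_square)
  finally have "1 / (1 - a) * W0 <= a / (1 - a) * W1 + 8 / (1 - a)^2 * V" .
  moreover have "a / (1 - a) * W1 + W1 = 1 / (1 - a) * W1" using a by (simp add: field_simps)
  ultimately show ?thesis using False by (simp add: W0_def W1_def V_def a_def)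
 qed
qed

text \<open>Induction over the last coordinate. The total variance passes to
  \<open>last_mean\<close>, whose one-site variances are at most those of \<open>f\<close>. The
  former last site becomes an interior one, and \<open>last_var_step\<close> exchanges its forward
  variance for a one-site term while keeping the weight of the new last site at 1 / (1 -
  |\<phi>|).\<close>

lemma chain_var_le:
 assumes "f \<in> bmeas (lebn (Suc n))" and "\<And>x. \<bar>f x\<bar> <= B"
 shows "chain_var (Suc n) f <= 8 / (1 - \<bar>\<phi>\<bar>)^2 * (\<Sum>t<n. gibbs_var (Suc n) t f)
  + (if n = 0 then 1 else 1 / (1 - \<bar>\<phi>\<bar>)) * last_var n f"
 using assms
proof (induction n arbitrary: f)
 case 0
 have "chain_var 0 g = 0" for g
 proof -
  have e: "chain 0 = return (count_space {\<lambda>_. undefined}) (\<lambda>_. undefined)"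
  proof (rule measure_eqI)
   fix A assume "A \<in> sets (chain 0)"
   then have "A = {} \<or> A = {\<lambda>_. undefined}" by (auto simp: PiM_empty)
   moreover have "emeasure (chain 0) {\<lambda>_. undefined} = 1"
    using chain.emeasure_space_1[of 0] by (simp add: space_PiM)
   ultimately show "emeasure (chain 0) A = emeasure (return (count_space {\<lambda>_. undefined}) (\<lambda>_. undefined)) A" by auto
  qed (simp add: PiM_empty)
  show ?thesis unfolding chain_var_def e by (subst (1 2) integral_return) auto
 qed
 then show ?case using chain_var_Suc[OF 0] by simp
next
 case (Suc n)
 define C where "C = 8 / (1 - \<bar>\<phi>\<bar>)^2"
 have C: "0 <= C" by (simp add: C_def)
 note lm = last_mean_measurable[OF Suc.prems(1)] and lB = abs_last_mean_le[OF Suc.prems(2)]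
 have "chain_var (Suc (Suc n)) f = chain_var (Suc n) (last_mean (Suc n) f) + last_var (Suc n) f"
  by (rule chain_var_Suc[OF Suc.prems])
 also have "chain_var (Suc n) (last_mean (Suc n) f) <= C * (\<Sum>t<n. gibbs_var (Suc n) t (last_mean (Suc n) f))
  + (if n = 0 then 1 else 1 / (1 - \<bar>\<phi>\<bar>)) * last_var n (last_mean (Suc n) f)"
  unfolding C_def by (rule Suc.IH[OF lm lB])
 also have "(\<Sum>t<n. gibbs_var (Suc n) t (last_mean (Suc n) f)) <= (\<Sum>t<n. gibbs_var (Suc (Suc n)) t f)"
  by (intro sum_mono gibbs_var_last_mean_le[OF Suc.prems]) auto
 finally have "chain_var (Suc (Suc n)) f <= C * (\<Sum>t<n. gibbs_var (Suc (Suc n)) t f)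
  + ((if n = 0 then 1 else 1 / (1 - \<bar>\<phi>\<bar>)) * last_var n (last_mean (Suc n) f) + last_var (Suc n) f)"
  using C by (simp add: mult_left_mono)
 also have "... <= C * (\<Sum>t<n. gibbs_var (Suc (Suc n)) t f) + (C * gibbs_var (Suc (Suc n)) n f + 1 / (1 - \<bar>\<phi>\<bar>) * last_var (Suc n) f)"
  unfolding C_def by (intro add_left_mono last_var_step[OF Suc.prems])
 finally show ?case by (simp add: C_def distrib_left)
qed

end

section \<open>Reversibility of the MALA update\<close>

text \<open>\<open>b = a + c\<close> replaces the square of a difference, so that infinite values
  are covered.\<close>

lemma ennreal_cross_le: "a * b + b * a <= a * a + b * b" for a b :: ennreal
proof -
 have "a * b + b * a <= a * a + b * b" if "a <= b" for a b :: ennreal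
 proof -
  obtain c where c: "b = a + c" using \<open>a <= b\<close> by (auto simp: le_iff_add)
  have "a * a + b * b = (a * b + b * a) + c * c"
   unfolding c by (simp only: distrib_left distrib_right add.assoc add.commute add.left_commute)
  then show ?thesis by simp
 qed
 from this[of a b] this[of b a] show ?thesis by (cases "a <= b") (auto simp: add.commute)
qed

lemma override_on_measurable:
 assumes B: "B \<subseteq> I"
 shows "(\<lambda>p. override_on (fst p) (snd p) B) \<in> leb I \<Otimes>\<^sub>M leb B \<rightarrow>\<^sub>M leb I"
proof (rule measurable_PiM_single')
 fix i assume i: "i \<in> I"
 show "(\<lambda>p. override_on (fst p) (snd p) B i) \<in> leb I \<Otimes>\<^sub>M leb B \<rightarrow>\<^sub>M lborel"
  using i by (cases "i \<in> B") (auto intro!: measurable_compose[OF measurable_fst measurable_component_singleton] measurable_compose[OF measurable_snd measurable_component_singleton])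
qed (use B in \<open>auto simp: space_PiM space_pair_measure PiE_def extensional_def override_on_def\<close>)

text \<open>Coordinates outside the block are shared by the current point and the proposal;
  splitting them off leaves two independent Lebesgue integrals over block values.\<close>

lemma nn_integral_override_fold:
 fixes G :: "point \<times> point => ennreal"
 assumes B: "B \<subseteq> I" "finite I" and G[measurable]: "G \<in> bmeas (leb I \<Otimes>\<^sub>M leb I)"
 defines "R \<equiv> I - B"
 shows "(\<integral>\<^sup>+x. \<integral>\<^sup>+z. G (x, override_on x z B) \<partial>leb B \<partial>leb I)
  = (\<integral>\<^sup>+a. \<integral>\<^sup>+b. \<integral>\<^sup>+z. G (merge R B (a, b), merge R B (a, z)) \<partial>leb B \<partial>leb B \<partial>leb R)"
proof -
 have RB: "R \<inter> B = {}" "R \<union> B = I" "finite R" "finite B" using B by (auto simp: R_def intro: finite_subset)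
 interpret FB: finite_product_sigma_finite "\<lambda>_::nat. lborel :: real measure" B by standard (rule RB)
 note [measurable] = override_on_measurable[OF B(1)]
 have m: "(\<lambda>x. \<integral>\<^sup>+z. G (x, override_on x z B) \<partial>leb B) \<in> bmeas (leb I)"
 proof (rule FB.borel_measurable_nn_integral)
  show "(\<lambda>(x, z). G (x, override_on x z B)) \<in> bmeas (leb I \<Otimes>\<^sub>M leb B)"
   unfolding split_beta' by measurable
 qed
 have "(\<integral>\<^sup>+x. \<integral>\<^sup>+z. G (x, override_on x z B) \<partial>leb B \<partial>leb I)
  = (\<integral>\<^sup>+a. \<integral>\<^sup>+b. \<integral>\<^sup>+z. G (merge R B (a, b), override_on (merge R B (a, b)) z B) \<partial>leb B \<partial>leb B \<partial>leb R)"
  using lborel_product.product_nn_integral_fold[OF RB(1,3,4), of "\<lambda>x. \<integral>\<^sup>+z. G (x, override_on x z B) \<partial>leb B"] m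
  unfolding RB(2) by blast
 also have "... = (\<integral>\<^sup>+a. \<integral>\<^sup>+b. \<integral>\<^sup>+z. G (merge R B (a, b), merge R B (a, z)) \<partial>leb B \<partial>leb B \<partial>leb R)"
  using RB by (intro nn_integral_cong arg_cong[of _ _ G]) (auto simp: merge_def override_on_def fun_eq_iff space_PiM PiE_def extensional_def)
 finally show ?thesis .
qed

text \<open>The change of variables behind detailed balance: old and new block values trade
  places.\<close>

lemma nn_integral_override_swap:
 fixes H :: "point \<times> point => ennreal"
 assumes B: "B \<subseteq> I" "finite I" and H[measurable]: "H \<in> bmeas (leb I \<Otimes>\<^sub>M leb I)"
 shows "(\<integral>\<^sup>+x. \<integral>\<^sup>+z. H (x, override_on x z B) \<partial>leb B \<partial>leb I)
  = (\<integral>\<^sup>+x. \<integral>\<^sup>+z. H (override_on x z B, x) \<partial>leb B \<partial>leb I)"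
proof -
 define R where "R = I - B"
 have RB: "R \<inter> B = {}" "R \<union> B = I" "finite R" "finite B" using B by (auto simp: R_def intro: finite_subset)
 have "(\<integral>\<^sup>+x. \<integral>\<^sup>+z. H (x, override_on x z B) \<partial>leb B \<partial>leb I)
  = (\<integral>\<^sup>+a. \<integral>\<^sup>+b. \<integral>\<^sup>+z. H (merge R B (a, b), merge R B (a, z)) \<partial>leb B \<partial>leb B \<partial>leb R)"
  unfolding R_def by (rule nn_integral_override_fold[OF B H])
 also have "... = (\<integral>\<^sup>+a. \<integral>\<^sup>+z. \<integral>\<^sup>+b. H (merge R B (a, b), merge R B (a, z)) \<partial>leb B \<partial>leb B \<partial>leb R)"
 proof (rule nn_integral_cong)
  fix a assume a: "a \<in> space (leb R)"
  interpret PB: pair_sigma_finite "leb B" "leb B"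
   by (intro pair_sigma_finite.intro lborel_product.sigma_finite RB)
  have [measurable]: "(\<lambda>z. merge R B (a, z)) \<in> leb B \<rightarrow>\<^sub>M leb I"
   using measurable_compose[OF measurable_Pair1'[OF a] measurable_merge[of R B "\<lambda>_. lborel :: real measure"]] unfolding RB(2) .
  show "(\<integral>\<^sup>+b. \<integral>\<^sup>+z. H (merge R B (a, b), merge R B (a, z)) \<partial>leb B \<partial>leb B)
   = (\<integral>\<^sup>+z. \<integral>\<^sup>+b. H (merge R B (a, b), merge R B (a, z)) \<partial>leb B \<partial>leb B)"
   by (rule PB.Fubini') (unfold split_beta', measurable)
 qed
 also have "... = (\<integral>\<^sup>+x. \<integral>\<^sup>+z. (\<lambda>p. H (snd p, fst p)) (x, override_on x z B) \<partial>leb B \<partial>leb I)"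
  unfolding R_def by (subst nn_integral_override_fold[OF B]) auto
 finally show ?thesis by simp
qed

locale mala_target =
 fixes N :: nat and p :: "point => real" and B :: "nat set" and h :: real
 assumes p_measurable[measurable]: "p \<in> bmeas (lebn N)" and p_pos: "\<And>x. 0 < p x"
  and B: "B \<subseteq> {..<N}" and h: "0 < h"
  and mean_measurable[measurable]: "\<And>i. i \<in> B ==> (\<lambda>x. prop_mean p h x i) \<in> bmeas (lebn N)"
  and p_prob: "(\<integral>\<^sup>+x. ennreal (p x) \<partial>lebn N) = 1"
begin

abbreviation ov :: "point => point => nat => real" where
 "ov x z \<equiv> override_on x z B"

text \<open>\<open>aw\<close> and \<open>rw\<close> are the densities of an accepted and of a rejected proposal at stationarity.\<close>

abbreviation pd :: "point => point => real" where
 "pd \<equiv> prop_density p B h"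

abbreviation ap :: "point => point => real" where
 "ap \<equiv> accept_prob p B h"

abbreviation aw :: "point => point => real" where
 "aw x z \<equiv> p x * pd x z * ap x (ov x z)"

abbreviation rw :: "point => point => real" where
 "rw x z \<equiv> p x * pd x z * (1 - ap x (ov x z))"

abbreviation target :: "point measure" where
 "target \<equiv> density (lebn N) (\<lambda>x. ennreal (p x))"

abbreviation K :: "point => point measure" where
 "K \<equiv> mala_kernel N p B h"

lemma finite_B: "finite B" using B by (rule finite_subset) simp

sublocale FB: finite_product_sigma_finite "\<lambda>_::nat. lborel :: real measure" B
 by standard (rule finite_B)

sublocale FN: finite_product_sigma_finite "\<lambda>_::nat. lborel :: real measure" "{..<N}"
 by standard simp

lemma ov_measurable[measurable]: "(\<lambda>p. ov (fst p) (snd p)) \<in> lebn N \<Otimes>\<^sub>M leb B \<rightarrow>\<^sub>M lebn N"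
 by (rule override_on_measurable[OF B])

lemma ov_space: "x \<in> space (lebn N) ==> z \<in> space (leb B) ==> ov x z \<in> space (lebn N)"
 using B by (auto simp: space_PiM PiE_def extensional_def override_on_def)

lemma ov_section: "x \<in> space (lebn N) ==> ov x \<in> leb B \<rightarrow>\<^sub>M lebn N"
 using measurable_compose[OF measurable_Pair1' ov_measurable, of x] by simp

lemma prop_density_cong: "(\<And>i. i \<in> B ==> y i = y' i) ==> pd x y = pd x y'"
 by (simp add: prop_density_def)

lemma prop_density_ov: "pd x (ov x' z) = pd x z"
 by (rule prop_density_cong) (simp add: override_on_def)

lemma prop_density_pos: "0 < pd x y"
 unfolding prop_density_def using h by (intro prod_pos normal_density_pos) simp

lemma prop_density_measurable:
 assumes C: "B \<subseteq> C"
 shows "(\<lambda>w. pd (fst w) (snd w)) \<in> bmeas (lebn N \<Otimes>\<^sub>M leb C)"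
 unfolding prop_density_def
proof (intro borel_measurable_prod)
 fix i assume i: "i \<in> B"
 have [measurable]: "(\<lambda>w. prop_mean p h (fst w) i) \<in> bmeas (lebn N \<Otimes>\<^sub>M leb C)"
  by (rule measurable_compose[OF measurable_fst mean_measurable[OF i]])
 have [measurable]: "(\<lambda>w. snd w i) \<in> bmeas (lebn N \<Otimes>\<^sub>M leb C)"
  using measurable_compose[OF measurable_snd measurable_component_singleton[of i C "\<lambda>_. lborel :: real measure"]] i C by auto
 show "(\<lambda>w. normal_density (prop_mean p h (fst w) i) (sqrt (2 * h)) (snd w i)) \<in> bmeas (lebn N \<Otimes>\<^sub>M leb C)"
  unfolding normal_density_def by measurable
qed

lemma prop_density_measurable_B[measurable]: "(\<lambda>w. pd (fst w) (snd w)) \<in> bmeas (lebn N \<Otimes>\<^sub>M leb B)"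
 by (rule prop_density_measurable) simp

lemma prop_density_measurable_N[measurable]: "(\<lambda>w. pd (fst w) (snd w)) \<in> bmeas (lebn N \<Otimes>\<^sub>M lebn N)"
 by (rule prop_density_measurable) (rule B)

lemma prop_density_section: "x \<in> space (lebn N) ==> pd x \<in> bmeas (leb B)"
 using measurable_compose[OF measurable_Pair1' prop_density_measurable_B, of x] by simp

lemma nn_integral_prop_density: "(\<integral>\<^sup>+z. ennreal (pd x z) \<partial>leb B) = 1"
proof -
 have "(\<integral>\<^sup>+z. ennreal (pd x z) \<partial>leb B)
  = (\<integral>\<^sup>+z. (\<Prod>i\<in>B. ennreal (normal_density (prop_mean p h x i) (sqrt (2 * h)) (z i))) \<partial>leb B)"
  by (simp add: prop_density_def prod_ennreal)
 also have "... = (\<Prod>i\<in>B. (NI y. ennreal (normal_density (prop_mean p h x i) (sqrt (2 * h)) y)))"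
  by (rule lborel_product.product_nn_integral_prod[OF finite_B]) simp
 also have "... = 1"
  using h by (intro prod.neutral ballI) (subst nn_integral_eq_integral, auto)
 finally show ?thesis .
qed

lemma accept_prob_bounds: "0 <= ap x y" "ap x y <= 1"
 using p_pos[of x] p_pos[of y] prop_density_pos[of x y] prop_density_pos[of y x] by (auto simp: accept_prob_def)

lemma accept_prob_measurable[measurable]: "(\<lambda>w. ap (fst w) (snd w)) \<in> bmeas (lebn N \<Otimes>\<^sub>M lebn N)"
proof -
 have [measurable]: "(\<lambda>w. pd (snd w) (fst w)) \<in> bmeas (lebn N \<Otimes>\<^sub>M lebn N)"
  using measurable_compose[OF measurable_pair_swap' prop_density_measurable_N] by (simp add: split_beta')
 show ?thesis unfolding accept_prob_def by measurable
qed

lemma accept_ov_measurable[measurable]: "(\<lambda>w. ap (fst w) (ov (fst w) (snd w))) \<in> bmeas (lebn N \<Otimes>\<^sub>M leb B)"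
 using measurable_compose[OF measurable_Pair[OF measurable_fst ov_measurable] accept_prob_measurable] by simp

text \<open>The Metropolis identity. Its symmetric right side gives reversibility here and, as a
  minimum, positivity later.\<close>

lemma accept_flow: "p x * pd x y * ap x y = min (p x * pd x y) (p y * pd y x)"
proof -
 define a b where "a = p x * pd x y" and "b = p y * pd y x"
 have "0 < a" "0 < b" using p_pos prop_density_pos by (auto simp: a_def b_def)
 then have "a * min 1 (b / a) = min a b" by (auto simp: min_def divide_simps)
 then show ?thesis by (simp add: a_def b_def accept_prob_def)
qed

text \<open>\<open>mala_kernel\<close> returns measures on the power of \<open>borel\<close>,
  whereas densities refer to \<open>lebn N\<close>; the measurable sets agree.\<close>

lemma sets_borel_power: "sets (\<Pi>\<^sub>M i\<in>{..<N}. (borel :: real measure)) = sets (lebn N)"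
 by (rule sets_PiM_cong) simp_all

lemma space_borel_power: "space (\<Pi>\<^sub>M i\<in>{..<N}. (borel :: real measure)) = space (lebn N)"
 by (rule sets_eq_imp_space_eq[OF sets_borel_power])

lemma subprob_algebra_borel_power: "subprob_algebra (\<Pi>\<^sub>M i\<in>{..<N}. (borel :: real measure)) = subprob_algebra (lebn N)"
 by (rule subprob_algebra_cong[OF sets_borel_power])

definition accept_step :: "point => point => point measure" where
 "accept_step x y = measure_pmf (bernoulli_pmf (ap x y)) \<bind> (\<lambda>accepted. return (\<Pi>\<^sub>M i\<in>{..<N}. borel) (if accepted then y else x))"

lemma K_eq: "K x = proposal p B h x \<bind> (\<lambda>z. accept_step x (ov x z))"
 by (simp add: mala_kernel_def accept_step_def Let_def)

context
 fixes x y :: "nat => real"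
 assumes x: "x \<in> space (lebn N)" and y: "y \<in> space (lebn N)"
begin

lemma accept_kernel: "(\<lambda>accepted. return (\<Pi>\<^sub>M i\<in>{..<N}. (borel :: real measure)) (if accepted then y else x))
 \<in> measure_pmf (bernoulli_pmf q) \<rightarrow>\<^sub>M subprob_algebra (lebn N)"
 unfolding subprob_algebra_borel_power[symmetric]
 by (rule measurable_compose[OF _ return_measurable]) (use x y in \<open>auto simp: space_borel_power\<close>)

lemma nn_integral_accept_step:
 assumes [measurable]: "F \<in> bmeas (lebn N)"
 shows "(\<integral>\<^sup>+w. F w \<partial>accept_step x y) = ennreal (ap x y) * F y + ennreal (1 - ap x y) * F x"
proof -
 have F': "F \<in> bmeas (\<Pi>\<^sub>M i\<in>{..<N}. (borel :: real measure))"
  using assms by (simp add: measurable_cong_sets[OF sets_borel_power refl])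
 have "(\<integral>\<^sup>+w. F w \<partial>accept_step x y) = (\<integral>\<^sup>+a. F (if a then y else x) \<partial>measure_pmf (bernoulli_pmf (ap x y)))"
  unfolding accept_step_def nn_integral_bind[OF assms accept_kernel]
  by (intro nn_integral_cong nn_integral_return[OF _ F']) (use x y in \<open>auto simp: space_borel_power\<close>)
 also have "... = ennreal (ap x y) * F y + ennreal (1 - ap x y) * F x"
  using accept_prob_bounds by (simp add: mult.commute)
 finally show ?thesis .
qed

lemma sets_accept_step: "sets (accept_step x y) = sets (lebn N)"
 unfolding accept_step_def by (rule sets_bind[OF sets_kernel[OF accept_kernel]]) simp_all

end

lemma sets_proposal: "sets (proposal p B h x) = sets (leb B)"
 by (simp add: proposal_def)

context
 fixes x :: "nat => real"
 assumes x: "x \<in> space (lebn N)"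
begin

lemma accept_section[measurable]: "(\<lambda>z. ap x (ov x z)) \<in> bmeas (leb B)"
 using measurable_compose[OF measurable_Pair1'[OF x] accept_ov_measurable] by simp

lemma prob_space_proposal: "prob_space (proposal p B h x)"
proof (rule prob_spaceI)
 have [measurable]: "pd x \<in> bmeas (leb B)" by (rule prop_density_section[OF x])
 show "emeasure (proposal p B h x) (space (proposal p B h x)) = 1"
  unfolding proposal_def by (subst emeasure_density) (auto simp: nn_integral_prop_density cong: nn_integral_cong_simp)
qed

lemma accept_step_kernel: "(\<lambda>z. accept_step x (ov x z)) \<in> proposal p B h x \<rightarrow>\<^sub>M subprob_algebra (lebn N)"
proof (rule measurable_subprob_algebra)
 note ovs = ov_space[OF x]
 have sp: "space (proposal p B h x) = space (leb B)" by (rule sets_eq_imp_space_eq[OF sets_proposal])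
 fix z assume z: "z \<in> space (proposal p B h x)"
 show "sets (accept_step x (ov x z)) = sets (lebn N)"
  using z by (intro sets_accept_step x ovs) (simp add: sp)
 have "emeasure (accept_step x (ov x z)) (space (accept_step x (ov x z))) = (\<integral>\<^sup>+w. 1 \<partial>accept_step x (ov x z))" by simp
 also have "... = 1"
  using z accept_prob_bounds[of x "ov x z"] by (subst nn_integral_accept_step) (auto simp: x ovs sp ennreal_plus[symmetric] simp del: ennreal_plus)
 finally have "prob_space (accept_step x (ov x z))" by (rule prob_spaceI)
 then show "subprob_space (accept_step x (ov x z))" by (rule prob_space_imp_subprob_space)
next
 note ovs = ov_space[OF x]
 have sp: "space (proposal p B h x) = space (leb B)" by (rule sets_eq_imp_space_eq[OF sets_proposal])
 fix A assume A[measurable]: "A \<in> sets (lebn N)"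
 note [measurable] = ov_section[OF x]
 have "(\<lambda>z. emeasure (accept_step x (ov x z)) A) \<in> bmeas (leb B)"
 proof (subst measurable_cong)
  fix z assume z: "z \<in> space (leb B)"
  have "emeasure (accept_step x (ov x z)) A = (\<integral>\<^sup>+w. indicator A w \<partial>accept_step x (ov x z))"
   using sets_accept_step[OF x ovs[OF z]] by simp
  also have "... = ennreal (ap x (ov x z)) * indicator A (ov x z) + ennreal (1 - ap x (ov x z)) * indicator A x"
   by (rule nn_integral_accept_step[OF x ovs[OF z]]) simp
  finally show "emeasure (accept_step x (ov x z)) A = ennreal (ap x (ov x z)) * indicator A (ov x z) + ennreal (1 - ap x (ov x z)) * indicator A x" .
 qed measurable
 then show "(\<lambda>z. emeasure (accept_step x (ov x z)) A) \<in> bmeas (proposal p B h x)"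
  by (simp add: measurable_cong_sets[OF sets_proposal refl])
qed

lemma nn_integral_K:
 assumes F[measurable]: "F \<in> bmeas (lebn N)"
 shows "(\<integral>\<^sup>+w. F w \<partial>K x) = (\<integral>\<^sup>+z. ennreal (pd x z) * (ennreal (ap x (ov x z)) * F (ov x z)
  + ennreal (1 - ap x (ov x z)) * F x) \<partial>leb B)"
proof -
 note [measurable] = ov_section[OF x] prop_density_section[OF x]
 have sp: "space (proposal p B h x) = space (leb B)" by (rule sets_eq_imp_space_eq[OF sets_proposal])
 have "(\<integral>\<^sup>+w. F w \<partial>K x) = (\<integral>\<^sup>+z. \<integral>\<^sup>+w. F w \<partial>accept_step x (ov x z) \<partial>proposal p B h x)"
  unfolding K_eq by (rule nn_integral_bind[OF F accept_step_kernel])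
 also have "... = (\<integral>\<^sup>+z. ennreal (ap x (ov x z)) * F (ov x z)
  + ennreal (1 - ap x (ov x z)) * F x \<partial>proposal p B h x)"
  by (intro nn_integral_cong nn_integral_accept_step[OF x ov_space[OF x] F]) (simp add: sp)
 also have "... = (\<integral>\<^sup>+z. ennreal (pd x z) * (ennreal (ap x (ov x z)) * F (ov x z)
  + ennreal (1 - ap x (ov x z)) * F x) \<partial>leb B)"
  unfolding proposal_def by (rule nn_integral_density) measurable
 finally show ?thesis .
qed

lemma sets_K: "sets (K x) = sets (lebn N)"
 unfolding K_eq
 by (rule sets_bind[OF sets_kernel[OF accept_step_kernel]]) (use prob_space.not_empty[OF prob_space_proposal] in auto)

lemma prob_space_K: "prob_space (K x)"
proof (rule prob_spaceI)
 have "emeasure (K x) (space (K x)) = (\<integral>\<^sup>+w. 1 \<partial>K x)" by simp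
 also have "... = (\<integral>\<^sup>+z. ennreal (pd x z) \<partial>leb B)"
  using accept_prob_bounds by (subst nn_integral_K) (auto simp: ennreal_plus[symmetric] simp del: ennreal_plus)
 finally show "emeasure (K x) (space (K x)) = 1" by (simp add: nn_integral_prop_density)
qed

end

lemma K_measurable: "K \<in> lebn N \<rightarrow>\<^sub>M subprob_algebra (lebn N)"
proof (rule measurable_subprob_algebra)
 fix x assume x: "x \<in> space (lebn N)"
 show "subprob_space (K x)" by (rule prob_space_imp_subprob_space[OF prob_space_K[OF x]])
 show "sets (K x) = sets (lebn N)" by (rule sets_K[OF x])
next
 fix A assume A[measurable]: "A \<in> sets (lebn N)"
 show "(\<lambda>x. emeasure (K x) A) \<in> bmeas (lebn N)"
 proof (subst measurable_cong)
  fix x assume x: "x \<in> space (lebn N)"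
  show "emeasure (K x) A = (\<integral>\<^sup>+z. ennreal (pd x z) * (ennreal (ap x (ov x z)) * indicator A (ov x z)
  + ennreal (1 - ap x (ov x z)) * indicator A x) \<partial>leb B)"
   using nn_integral_K[OF x, of "indicator A"] sets_K[OF x] by simp
 qed (rule FB.borel_measurable_nn_integral, unfold split_beta', measurable)
qed

lemma prob_space_target: "prob_space target"
 by (rule prob_spaceI) (simp add: emeasure_density p_prob cong: nn_integral_cong_simp)

lemma nn_integral_target_K:
 assumes F[measurable]: "F \<in> bmeas (lebn N \<Otimes>\<^sub>M lebn N)"
 shows "(\<integral>\<^sup>+x. \<integral>\<^sup>+y. F (x, y) \<partial>K x \<partial>target)
  = (\<integral>\<^sup>+x. \<integral>\<^sup>+z. ennreal (aw x z) * F (x, ov x z) \<partial>leb B \<partial>lebn N)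
  + (\<integral>\<^sup>+x. \<integral>\<^sup>+z. ennreal (rw x z) * F (x, x) \<partial>leb B \<partial>lebn N)"
proof -
 have [measurable]: "(\<lambda>w. F (fst w, ov (fst w) (snd w))) \<in> bmeas (lebn N \<Otimes>\<^sub>M leb B)"
  using measurable_compose[OF measurable_Pair[OF measurable_fst ov_measurable] F] by simp
 have m: "(\<lambda>x. \<integral>\<^sup>+y. F (x, y) \<partial>K x) \<in> bmeas (lebn N)"
  using nn_integral_measurable_subprob_algebra2[of "\<lambda>x y. F (x, y)", OF _ K_measurable] by simp
 have "(\<integral>\<^sup>+x. \<integral>\<^sup>+y. F (x, y) \<partial>K x \<partial>target) = (\<integral>\<^sup>+x. ennreal (p x) * (\<integral>\<^sup>+y. F (x, y) \<partial>K x) \<partial>lebn N)"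
  by (rule nn_integral_density[OF _ m]) simp
 also have "... = (\<integral>\<^sup>+x. (\<integral>\<^sup>+z. ennreal (aw x z) * F (x, ov x z) \<partial>leb B)
  + (\<integral>\<^sup>+z. ennreal (rw x z) * F (x, x) \<partial>leb B) \<partial>lebn N)"
 proof (rule nn_integral_cong)
  fix x assume x: "x \<in> space (lebn N)"
  note [measurable] = ov_section[OF x] prop_density_section[OF x] accept_section[OF x]
  have [measurable]: "(\<lambda>y. F (x, y)) \<in> bmeas (lebn N)" using x by measurable
  have [measurable]: "(\<lambda>z. F (x, ov x z)) \<in> bmeas (leb B)" by measurable
  have "ennreal (p x) * (\<integral>\<^sup>+y. F (x, y) \<partial>K x)
   = (\<integral>\<^sup>+z. ennreal (p x) * (ennreal (pd x z) * (ennreal (ap x (ov x z)) * F (x, ov x z)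
    + ennreal (1 - ap x (ov x z)) * F (x, x))) \<partial>leb B)"
   by (subst nn_integral_K[OF x]) (auto intro!: nn_integral_cmult[symmetric])
  also have "... = (\<integral>\<^sup>+z. ennreal (aw x z) * F (x, ov x z)
   + ennreal (rw x z) * F (x, x) \<partial>leb B)"
   using p_pos[of x] prop_density_pos[of x] accept_prob_bounds[of x]
   by (intro nn_integral_cong) (simp add: ennreal_mult less_imp_le distrib_left mult.assoc)
  also have "... = (\<integral>\<^sup>+z. ennreal (aw x z) * F (x, ov x z) \<partial>leb B)
  + (\<integral>\<^sup>+z. ennreal (rw x z) * F (x, x) \<partial>leb B)"
   by (rule nn_integral_add) measurable
  finally show "ennreal (p x) * (\<integral>\<^sup>+y. F (x, y) \<partial>K x) = (\<integral>\<^sup>+z. ennreal (aw x z) * F (x, ov x z) \<partial>leb B)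
  + (\<integral>\<^sup>+z. ennreal (rw x z) * F (x, x) \<partial>leb B)" .
 qed
 also have "... = (\<integral>\<^sup>+x. \<integral>\<^sup>+z. ennreal (aw x z) * F (x, ov x z) \<partial>leb B \<partial>lebn N)
  + (\<integral>\<^sup>+x. \<integral>\<^sup>+z. ennreal (rw x z) * F (x, x) \<partial>leb B \<partial>lebn N)"
  by (rule nn_integral_add; rule FB.borel_measurable_nn_integral, unfold split_beta', measurable)
 finally show ?thesis .
qed

text \<open>The accepted flow is symmetric by \<open>accept_flow\<close>, and the rejected part sits
  on the diagonal.\<close>

lemma K_reversible:
 assumes F[measurable]: "F \<in> bmeas (lebn N \<Otimes>\<^sub>M lebn N)"
 shows "(\<integral>\<^sup>+x. \<integral>\<^sup>+y. F (x, y) \<partial>K x \<partial>target) = (\<integral>\<^sup>+x. \<integral>\<^sup>+y. F (y, x) \<partial>K x \<partial>target)"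
proof -
 have [measurable]: "(\<lambda>w. F (snd w, fst w)) \<in> bmeas (lebn N \<Otimes>\<^sub>M lebn N)" by measurable
 have [measurable]: "(\<lambda>w. pd (snd w) (fst w)) \<in> bmeas (lebn N \<Otimes>\<^sub>M lebn N)"
  using measurable_compose[OF measurable_pair_swap' prop_density_measurable_N] by (simp add: split_beta')
 define J where "J x y = min (p x * pd x y) (p y * pd y x)" for x y
 have flow: "aw x z = J x (ov x z)" for x z
  using accept_flow[of x "ov x z"] by (simp add: J_def prop_density_ov)
 have Jm[measurable]: "(\<lambda>w. J (fst w) (snd w)) \<in> bmeas (lebn N \<Otimes>\<^sub>M lebn N)"
  unfolding J_def by measurable
 have J: "J x y = J y x" for x y by (simp add: J_def min.commute)
 have "(\<integral>\<^sup>+x. \<integral>\<^sup>+z. ennreal (J x (ov x z)) * F (x, ov x z) \<partial>leb B \<partial>lebn N)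
  = (\<integral>\<^sup>+x. \<integral>\<^sup>+z. ennreal (J x (ov x z)) * F (ov x z, x) \<partial>leb B \<partial>lebn N)"
  using nn_integral_override_swap[OF B, of "\<lambda>w. ennreal (J (fst w) (snd w)) * F (fst w, snd w)"] by (simp add: J)
 then show ?thesis
  using nn_integral_target_K[OF F] nn_integral_target_K[of "\<lambda>w. F (snd w, fst w)"] by (simp add: flow)
qed

text \<open>A rejected move stays put, so its part of the kernel is multiplication by the
  nonnegative weight \<open>W\<close> and is always positive; only the accepted part has to be
  tested.\<close>

lemma psd_kernel_target:
 assumes pos: "\<And>u v. u \<in> bmeas (lebn N) ==> v \<in> bmeas (lebn N) ==>
   (\<integral>\<^sup>+x. \<integral>\<^sup>+z. ennreal (aw x z) * (u x * v (ov x z)) \<partial>leb B \<partial>lebn N)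
  + (\<integral>\<^sup>+x. \<integral>\<^sup>+z. ennreal (aw x z) * (v x * u (ov x z)) \<partial>leb B \<partial>lebn N)
  <= (\<integral>\<^sup>+x. \<integral>\<^sup>+z. ennreal (aw x z) * (u x * u (ov x z)) \<partial>leb B \<partial>lebn N)
  + (\<integral>\<^sup>+x. \<integral>\<^sup>+z. ennreal (aw x z) * (v x * v (ov x z)) \<partial>leb B \<partial>lebn N)"
 shows "psd_kernel target K"
proof (intro psd_kernel.intro psd_kernel_axioms.intro prob_space_target)
 have s: "sets target = sets (lebn N)" by simp
 show "K \<in> target \<rightarrow>\<^sub>M subprob_algebra target"
  using K_measurable by (simp add: measurable_cong_sets[OF s subprob_algebra_cong[OF s, THEN arg_cong[of _ _ sets]]] subprob_algebra_cong[OF s])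
 show "prob_space (K x)" if "x \<in> space target" for x using that by (intro prob_space_K) simp
 show "(\<integral>\<^sup>+x. \<integral>\<^sup>+y. F (x, y) \<partial>K x \<partial>target) = (\<integral>\<^sup>+x. \<integral>\<^sup>+y. F (y, x) \<partial>K x \<partial>target)"
  if F: "F \<in> bmeas (target \<Otimes>\<^sub>M target)" for F
 proof -
  have "F \<in> bmeas (lebn N \<Otimes>\<^sub>M lebn N)"
   using F by (simp add: measurable_cong_sets[OF sets_pair_measure_cong[OF s s] refl])
  then show ?thesis by (rule K_reversible)
 qed
 fix u v :: "point => ennreal" assume "u \<in> bmeas target" "v \<in> bmeas target"
 then have u[measurable]: "u \<in> bmeas (lebn N)" and v[measurable]: "v \<in> bmeas (lebn N)"
  by simp_all
 define J where "J f g = (\<integral>\<^sup>+x. \<integral>\<^sup>+z. ennreal (aw x z) * (f x * g (ov x z)) \<partial>leb B \<partial>lebn N)"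
  for f g :: "point => ennreal"
 define W where "W x = (\<integral>\<^sup>+z. ennreal (rw x z) \<partial>leb B)" for x
 have [measurable]: "W \<in> bmeas (lebn N)"
  unfolding W_def[abs_def] by (rule FB.borel_measurable_nn_integral, unfold split_beta', measurable)
 have X: "(\<integral>\<^sup>+x. \<integral>\<^sup>+y. f x * g y \<partial>K x \<partial>target) = J f g + (\<integral>\<^sup>+x. W x * (f x * g x) \<partial>lebn N)"
  if [measurable]: "f \<in> bmeas (lebn N)" "g \<in> bmeas (lebn N)" for f g
 proof -
  have "(\<integral>\<^sup>+x. \<integral>\<^sup>+z. ennreal (rw x z) * (f x * g x) \<partial>leb B \<partial>lebn N)
   = (\<integral>\<^sup>+x. W x * (f x * g x) \<partial>lebn N)"
  proof (rule nn_integral_cong)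
   fix x assume x: "x \<in> space (lebn N)"
   note [measurable] = prop_density_section[OF x] accept_section[OF x]
   show "(\<integral>\<^sup>+z. ennreal (rw x z) * (f x * g x) \<partial>leb B) = W x * (f x * g x)"
    unfolding W_def by (rule nn_integral_multc) measurable
  qed
  then show ?thesis using nn_integral_target_K[of "\<lambda>w. f (fst w) * g (snd w)"] by (simp add: J_def)
 qed
 have le: "(\<integral>\<^sup>+x. W x * (u x * v x) \<partial>lebn N) + (\<integral>\<^sup>+x. W x * (v x * u x) \<partial>lebn N)
  <= (\<integral>\<^sup>+x. W x * (u x * u x) \<partial>lebn N) + (\<integral>\<^sup>+x. W x * (v x * v x) \<partial>lebn N)"
  by (subst (1 2) nn_integral_add[symmetric]) (auto intro!: nn_integral_mono mult_left_mono ennreal_cross_le simp: distrib_left[symmetric])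
 have "J u v + J v u + ((\<integral>\<^sup>+x. W x * (u x * v x) \<partial>lebn N) + (\<integral>\<^sup>+x. W x * (v x * u x) \<partial>lebn N))
  <= J u u + J v v + ((\<integral>\<^sup>+x. W x * (u x * u x) \<partial>lebn N) + (\<integral>\<^sup>+x. W x * (v x * v x) \<partial>lebn N))"
  using pos[OF u v] unfolding J_def[symmetric] by (rule add_mono[OF _ le])
 then show "(\<integral>\<^sup>+x. \<integral>\<^sup>+y. u x * v y \<partial>K x \<partial>target) + (\<integral>\<^sup>+x. \<integral>\<^sup>+y. v x * u y \<partial>K x \<partial>target)
  <= (\<integral>\<^sup>+x. \<integral>\<^sup>+y. u x * u y \<partial>K x \<partial>target) + (\<integral>\<^sup>+x. \<integral>\<^sup>+y. v x * v y \<partial>K x \<partial>target)"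
  unfolding X[OF u v] X[OF v u] X[OF u u] X[OF v v] by (simp only: ac_simps)
qed

end

section \<open>Acceptance and overlap of the block proposals\<close>

lemma square_le_of_quadratic_nonneg:
 fixes a b c :: real
 assumes q: "\<And>t. 0 <= a + 2 * t * b + t\<^sup>2 * c" and c: "0 <= c"
 shows "b\<^sup>2 <= a * c"
proof (cases "c = 0")
 case True
 have "b = 0"
 proof (rule ccontr)
  assume "b \<noteq> 0"
  then show False using q[of "- (a + 1) / (2 * b)"] True by (simp add: field_simps)
 qed
 then show ?thesis using True by simp
next
 case False
 then have c: "0 < c" using c by simp
 have "0 <= c * (a + 2 * (- b / c) * b + (- b / c)^2 * c)" using q[of "- b / c"] c by simp
 also have "... = a * c - b\<^sup>2" using c by (simp add: field_simps power2_eq_square)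
 finally show ?thesis by simp
qed

text \<open>\<open>T\<close> is the precision matrix and \<open>\<Lambda>\<close> an upper bound of
  its spectrum. \<open>step_le_1\<close> makes the drift step nonexpansive on the block;
  \<open>step_le\<close> bounds the mean effect of the proposal noise on the acceptance.\<close>

locale gauss_block =
 fixes N :: nat and T :: "nat => nat => real" and \<mu> :: "nat => real" and Z \<Lambda> h :: real and B :: "nat set"
 assumes T_sym: "\<And>i k. T i k = T k i"
  and form_nonneg: "\<And>w. 0 <= (\<Sum>i<N. \<Sum>k<N. T i k * w i * w k)"
  and form_le: "\<And>w. (\<Sum>i<N. \<Sum>k<N. T i k * w i * w k) <= \<Lambda> * (\<Sum>i<N. (w i)^2)"
  and Z_pos: "0 < Z" and \<Lambda>_pos: "0 < \<Lambda>" and h_pos: "0 < h"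
  and block_subset: "B \<subseteq> {..<N}"
  and step_le: "10 * real (card B) * (h * \<Lambda>)^2 <= 1" and step_le_1: "h * \<Lambda> <= 1"
begin

definition form :: "point => point => real" where
 "form v w = (\<Sum>i<N. \<Sum>k<N. T i k * v i * w k)"

text \<open>The gradient of minus the log density, so the drift of the proposal is
  \<open>- h * grad\<close>.\<close>

definition grad :: "point => nat => real" where
 "grad x i = (\<Sum>k<N. T i k * (x k - \<mu> k))"

definition dens :: "point => real" where
 "dens x = Z * exp (- form (\<lambda>i. x i - \<mu> i) (\<lambda>i. x i - \<mu> i) / 2)"

definition apply_block :: "point => nat => real" where
 "apply_block w i = (\<Sum>k\<in>B. T i k * w k)"

definition grad_norm :: "point => real" where
 "grad_norm x = (\<Sum>i\<in>B. (grad x i)^2)"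

lemma finite_block: "finite B"
 using block_subset by (rule finite_subset) simp

lemma form_sym: "form v w = form w v"
proof -
 have "form v w = (\<Sum>k<N. \<Sum>i<N. T i k * v i * w k)" unfolding form_def by (rule sum.swap)
 also have "... = form w v" unfolding form_def by (intro sum.cong refl) (simp add: T_sym mult.commute mult.left_commute)
 finally show ?thesis .
qed

lemma form_add: "form (\<lambda>i. u i + v i) w = form u w + form v w"
 unfolding form_def sum.distrib[symmetric] by (intro sum.cong refl) (simp add: algebra_simps)

lemma form_scale: "form (\<lambda>i. a * u i) w = a * form u w"
 by (simp add: form_def sum_distrib_left mult.assoc mult.left_commute)

lemma form_add_right: "form w (\<lambda>i. u i + v i) = form w u + form w v"
 using form_add[of u v w] by (simp add: form_sym[of w])

lemma form_scale_right: "form w (\<lambda>i. a * u i) = a * form w u"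
 using form_scale[of a u w] by (simp add: form_sym[of w])

lemma form_cauchy_schwarz: "(form u w)^2 <= form u u * form w w"
proof (rule square_le_of_quadratic_nonneg)
 fix t
 have "0 <= form (\<lambda>i. u i + t * w i) (\<lambda>i. u i + t * w i)" unfolding form_def by (rule form_nonneg)
 then show "0 <= form u u + 2 * t * form u w + t\<^sup>2 * form w w"
  by (simp add: form_add form_add_right form_scale form_scale_right form_sym[of w u] power2_eq_square algebra_simps)
qed (use form_nonneg in \<open>simp add: form_def\<close>)

lemma form_grad: "form w (\<lambda>i. x i - \<mu> i) = (\<Sum>i<N. w i * grad x i)"
 by (simp add: form_def grad_def sum_distrib_left mult.assoc mult.left_commute)

lemma form_block:
 "form (\<lambda>i. if i \<in> B then u i else 0) (\<lambda>i. if i \<in> B then w i else 0) = (\<Sum>i\<in>B. u i * apply_block w i)"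
proof -
 have inner: "(\<Sum>k<N. T i k * a * (if k \<in> B then w k else 0)) = a * apply_block w i" for i a
 proof -
  have "(\<Sum>k<N. T i k * a * (if k \<in> B then w k else 0)) = (\<Sum>k<N. if k \<in> B then a * (T i k * w k) else 0)"
   by (intro sum.cong) auto
  also have "... = (\<Sum>k\<in>B. a * (T i k * w k))"
   using block_subset by (simp add: sum.inter_restrict[symmetric] Int_absorb1)
  finally show ?thesis by (simp add: apply_block_def sum_distrib_left)
 qed
 have "form (\<lambda>i. if i \<in> B then u i else 0) (\<lambda>i. if i \<in> B then w i else 0) = (\<Sum>i<N. if i \<in> B then u i * apply_block w i else 0)"
  unfolding form_def inner by (intro sum.cong) auto
 also have "... = (\<Sum>i\<in>B. u i * apply_block w i)"
  using block_subset by (simp add: sum.inter_restrict[symmetric] Int_absorb1)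
 finally show ?thesis .
qed

lemma norm_block: "(\<Sum>i<N. (if i \<in> B then u i else 0 :: real)^2) = (\<Sum>i\<in>B. (u i)^2)"
proof -
 have "(\<Sum>i<N. (if i \<in> B then u i else 0 :: real)^2) = (\<Sum>i<N. if i \<in> B then (u i)^2 else 0)"
  by (intro sum.cong) auto
 then show ?thesis using block_subset by (simp add: sum.inter_restrict[symmetric] Int_absorb1)
qed

lemma block_form_nonneg: "0 <= (\<Sum>i\<in>B. w i * apply_block w i)"
 unfolding form_block[symmetric] unfolding form_def by (rule form_nonneg)

lemma block_form_le: "(\<Sum>i\<in>B. w i * apply_block w i) <= \<Lambda> * (\<Sum>i\<in>B. (w i)^2)"
 unfolding form_block[symmetric] norm_block[symmetric] unfolding form_def by (rule form_le)

text \<open>With u = T w on the block, Cauchy-Schwarz for the semidefinite form gives |u|^4 \<le>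
  (u, T u) (w, T w) \<le> \<Lambda> |u|^2 (w, T w).\<close>

lemma apply_block_norm_le: "(\<Sum>i\<in>B. (apply_block w i)^2) <= \<Lambda> * (\<Sum>i\<in>B. w i * apply_block w i)"
proof -
 define n where "n = (\<Sum>i\<in>B. (apply_block w i)^2)"
 define e where "e = (\<Sum>i\<in>B. w i * apply_block w i)"
 have e: "0 <= e" unfolding e_def by (rule block_form_nonneg)
 have n: "0 <= n" by (simp add: n_def sum_nonneg)
 have "n\<^sup>2 <= (\<Sum>i\<in>B. apply_block w i * apply_block (apply_block w) i) * e"
  using form_cauchy_schwarz[of "\<lambda>i. if i \<in> B then apply_block w i else 0" "\<lambda>i. if i \<in> B then w i else 0"]
  unfolding form_block by (simp add: n_def e_def power2_eq_square)
 also have "... <= (\<Lambda> * n) * e" using e unfolding n_def by (intro mult_right_mono block_form_le) auto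
 finally have "n * n <= n * (\<Lambda> * e)" by (simp add: power2_eq_square mult.assoc mult.left_commute)
 then have "n <= \<Lambda> * e"
 proof (cases "n = 0")
  case True
  then show ?thesis using e \<Lambda>_pos by simp
 qed (use n in auto)
 then show ?thesis by (simp add: n_def e_def)
qed

lemma apply_block_norm_le2: "(\<Sum>i\<in>B. (apply_block w i)^2) <= \<Lambda>\<^sup>2 * (\<Sum>i\<in>B. (w i)^2)"
proof -
 have "\<Lambda> * (\<Sum>i\<in>B. w i * apply_block w i) <= \<Lambda> * (\<Lambda> * (\<Sum>i\<in>B. (w i)^2))"
  using \<Lambda>_pos by (intro mult_left_mono block_form_le) auto
 then show ?thesis using apply_block_norm_le[of w] by (simp add: power2_eq_square mult.assoc)
qed

text \<open>Since \<open>h * \<Lambda> \<le> 1\<close>, \<open>apply_block_norm_le\<close> gives h^2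
  |T w|^2 \<le> h (w, T w), which the term -2 h (w, T w) outweighs. Applied both to the block
  gradient and to the difference of two proposal means.\<close>

lemma step_contraction: "(\<Sum>i\<in>B. (w i - h * apply_block w i)^2) <= (\<Sum>i\<in>B. (w i)^2)"
proof -
 define n where "n = (\<Sum>i\<in>B. (apply_block w i)^2)"
 define e where "e = (\<Sum>i\<in>B. w i * apply_block w i)"
 have e: "0 <= e" unfolding e_def by (rule block_form_nonneg)
 have "h * n <= (h * \<Lambda>) * e" using apply_block_norm_le[of w] h_pos unfolding n_def e_def by simp
 also have "... <= 1 * e" using e step_le_1 by (rule mult_right_mono[rotated])
 finally have "h * (h * n) <= h * (2 * e)" using e h_pos by (intro mult_left_mono) auto
 moreover have "(\<Sum>i\<in>B. (w i - h * apply_block w i)^2) = (\<Sum>i\<in>B. (w i)^2) - 2 * h * e + h\<^sup>2 * n"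
  by (simp add: n_def e_def power2_diff power_mult_distrib sum.distrib sum_subtractf sum_distrib_left mult.assoc mult.left_commute)
 ultimately show ?thesis by (simp add: power2_eq_square mult.assoc)
qed

lemma form_upd:
 assumes i: "i < N"
 shows "form (\<lambda>k. (x(i := t)) k - \<mu> k) (\<lambda>k. (x(i := t)) k - \<mu> k)
  = form (\<lambda>k. x k - \<mu> k) (\<lambda>k. x k - \<mu> k) + 2 * (t - x i) * grad x i + (t - x i)^2 * T i i"
proof -
 define e where "e k = (t - x i) * (if k = i then 1 else 0 :: real)" for k
 have eq: "(\<lambda>k. (x(i := t)) k - \<mu> k) = (\<lambda>k. (x k - \<mu> k) + e k)" by (auto simp: e_def)
 have e1: "form e (\<lambda>k. x k - \<mu> k) = (t - x i) * grad x i"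
  unfolding form_grad e_def using i by (simp add: if_distrib[of "\<lambda>a. a * _"] if_distrib[of "\<lambda>a. _ * a"] cong: if_cong)
 have e2: "form e e = (t - x i)^2 * T i i"
  unfolding form_def e_def using i
  by (simp add: if_distrib[of "\<lambda>a. a * _"] if_distrib[of "\<lambda>a. _ * a"] power2_eq_square cong: if_cong)
 show ?thesis
  unfolding eq form_add form_add_right e2 form_sym[of "\<lambda>k. x k - \<mu> k" e] e1 by simp
qed

lemma dens_pos: "0 < dens x"
 by (simp add: dens_def Z_pos)

lemma prop_mean_dens:
 assumes i: "i < N"
 shows "prop_mean dens h x i = x i - h * grad x i"
proof -
 define a where "a = form (\<lambda>k. x k - \<mu> k) (\<lambda>k. x k - \<mu> k)"
 have "ln (dens (x(i := t))) = ln Z - (a + 2 * (t - x i) * grad x i + (t - x i)^2 * T i i) / 2" for t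
 proof -
  have "ln (dens y) = ln Z - form (\<lambda>k. y k - \<mu> k) (\<lambda>k. y k - \<mu> k) / 2" for y
   using Z_pos by (simp add: dens_def ln_mult)
  then show ?thesis by (simp only: form_upd[OF i] a_def)
 qed
 moreover have "((\<lambda>t. ln Z - (a + 2 * (t - x i) * grad x i + (t - x i)^2 * T i i) / 2) has_real_derivative - grad x i) (at (x i))"
  by (auto intro!: derivative_eq_intros)
 ultimately have "deriv (\<lambda>t. ln (dens (x(i := t)))) (x i) = - grad x i" by (simp add: DERIV_imp_deriv)
 then show ?thesis by (simp add: prop_mean_def)
qed

definition sym_flow :: "point => point => real" where
 "sym_flow x y = Z * (1 / sqrt (2 * pi * (2 * h))) ^ card B *
  exp (- (\<Sum>i\<in>B. (y i - x i)^2) / (4 * h) - form (\<lambda>i. y i - \<mu> i) (\<lambda>i. x i - \<mu> i) / 2)"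

lemma sym_flow_sym: "sym_flow x y = sym_flow y x"
 unfolding sym_flow_def by (simp add: form_sym[of "\<lambda>i. y i - \<mu> i"] power2_commute)

lemma sym_flow_pos: "0 < sym_flow x y"
 using Z_pos h_pos by (simp add: sym_flow_def)

text \<open>In the proposal exponent the cross term is minus half the inner product of y - x with
  the gradient at x. For a Gaussian density it merges with the log density into the bilinear form of
  y - \<mu> and x - \<mu>, which is symmetric in the two points. Only the squared gradient at x
  remains, so the acceptance ratio compares gradient norms.\<close>

lemma flow_eq:
 assumes off: "\<And>i. i < N ==> i \<notin> B ==> y i = x i"
 shows "dens x * prop_density dens B h x y = sym_flow x y * exp (- (h / 4) * grad_norm x)"
proof -
 have "prop_density dens B h x y = (\<Prod>i\<in>B. (1 / sqrt (2 * pi * (2 * h))) * exp (- (y i - x i + h * grad x i)\<^sup>2 / (4 * h)))"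
  unfolding prop_density_def using block_subset h_pos
  by (intro prod.cong refl) (auto simp: normal_density_def prop_mean_dens subset_iff algebra_simps)
 also have "... = (1 / sqrt (2 * pi * (2 * h))) ^ card B * exp (\<Sum>i\<in>B. - (y i - x i + h * grad x i)\<^sup>2 / (4 * h))"
  by (simp only: prod.distrib prod_constant exp_sum[OF finite_block])
 finally have r: "prop_density dens B h x y = (1 / sqrt (2 * pi * (2 * h))) ^ card B * exp (\<Sum>i\<in>B. - (y i - x i + h * grad x i)\<^sup>2 / (4 * h))" .
 have "(\<Sum>i\<in>B. - (y i - x i + h * grad x i)\<^sup>2 / (4 * h)) = (\<Sum>i\<in>B. - ((y i - x i)^2 / (4 * h)) - (y i - x i) * grad x i / 2 - h / 4 * (grad x i)^2)"
  using h_pos by (intro sum.cong refl) (simp add: field_simps power2_eq_square)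
 also have "... = - (\<Sum>i\<in>B. (y i - x i)^2) / (4 * h) - (\<Sum>i\<in>B. (y i - x i) * grad x i) / 2 - h / 4 * grad_norm x"
  by (simp add: sum_subtractf sum_negf sum_divide_distrib sum_distrib_left grad_norm_def)
 finally have s: "(\<Sum>i\<in>B. - (y i - x i + h * grad x i)\<^sup>2 / (4 * h)) = - (\<Sum>i\<in>B. (y i - x i)^2) / (4 * h) - (\<Sum>i\<in>B. (y i - x i) * grad x i) / 2 - h / 4 * grad_norm x" .
 have "(\<Sum>i\<in>B. (y i - x i) * grad x i) = (\<Sum>i<N. (y i - x i) * grad x i)"
  using block_subset off by (intro sum.mono_neutral_left) auto
 also have "... = form (\<lambda>i. y i - x i) (\<lambda>i. x i - \<mu> i)" by (simp add: form_grad)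
 finally have d: "(\<Sum>i\<in>B. (y i - x i) * grad x i) = form (\<lambda>i. y i - x i) (\<lambda>i. x i - \<mu> i)" .
 have "(\<lambda>i. y i - \<mu> i) = (\<lambda>i. (x i - \<mu> i) + (y i - x i))" by auto
 then have f: "form (\<lambda>i. y i - \<mu> i) (\<lambda>i. x i - \<mu> i) = form (\<lambda>i. x i - \<mu> i) (\<lambda>i. x i - \<mu> i) + form (\<lambda>i. y i - x i) (\<lambda>i. x i - \<mu> i)"
  by (simp only: form_add)
 have "dens x * prop_density dens B h x y = Z * (1 / sqrt (2 * pi * (2 * h))) ^ card B *
  (exp (- form (\<lambda>i. x i - \<mu> i) (\<lambda>i. x i - \<mu> i) / 2) * exp (- (\<Sum>i\<in>B. (y i - x i)^2) / (4 * h) - form (\<lambda>i. y i - x i) (\<lambda>i. x i - \<mu> i) / 2 - h / 4 * grad_norm x))"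
  unfolding r s d dens_def by (simp add: mult.assoc mult.left_commute)
 also have "exp (- form (\<lambda>i. x i - \<mu> i) (\<lambda>i. x i - \<mu> i) / 2) * exp (- (\<Sum>i\<in>B. (y i - x i)^2) / (4 * h) - form (\<lambda>i. y i - x i) (\<lambda>i. x i - \<mu> i) / 2 - h / 4 * grad_norm x)
  = exp (- (\<Sum>i\<in>B. (y i - x i)^2) / (4 * h) - form (\<lambda>i. y i - \<mu> i) (\<lambda>i. x i - \<mu> i) / 2) * exp (- (h / 4) * grad_norm x)"
  unfolding exp_add[symmetric] f by (simp add: add_divide_distrib)
 finally show ?thesis by (simp add: sym_flow_def mult.assoc)
qed

lemma accept_prob_eq:
 assumes off: "\<And>i. i < N ==> i \<notin> B ==> y i = x i"
 shows "accept_prob dens B h x y = min 1 (exp (h / 4 * (grad_norm x - grad_norm y)))"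
proof -
 have "dens y * prop_density dens B h y x = sym_flow x y * exp (- (h / 4) * grad_norm y)"
  using flow_eq[of x y] off by (simp add: sym_flow_sym)
 moreover have "dens x * prop_density dens B h x y = sym_flow x y * exp (- (h / 4) * grad_norm x)"
  by (rule flow_eq[OF off])
 ultimately have "accept_prob dens B h x y = min 1 (exp (- (h / 4) * grad_norm y) / exp (- (h / 4) * grad_norm x))"
  using sym_flow_pos[of x y] by (simp add: accept_prob_def)
 also have "exp (- (h / 4) * grad_norm y) / exp (- (h / 4) * grad_norm x) = exp (h / 4 * (grad_norm x - grad_norm y))"
  unfolding exp_diff[symmetric] by (simp add: algebra_simps)
 finally show ?thesis .
qed

lemma grad_measurable[measurable]: "(\<lambda>x. grad x i) \<in> bmeas (lebn N)"
proof -
 have "(\<lambda>x. x k) \<in> bmeas (lebn N)" if "k < N" for k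
  using measurable_component_singleton[of k "{..<N}" "\<lambda>_. lborel :: real measure"] that by simp
 then show ?thesis unfolding grad_def by (intro borel_measurable_sum borel_measurable_times borel_measurable_diff) auto
qed

lemma grad_norm_measurable[measurable]: "grad_norm \<in> bmeas (lebn N)"
 unfolding grad_norm_def[abs_def] by measurable

lemma dens_measurable[measurable]: "dens \<in> bmeas (lebn N)"
proof -
 have c: "(\<lambda>x. x k) \<in> bmeas (lebn N)" if "k < N" for k
  using measurable_component_singleton[of k "{..<N}" "\<lambda>_. lborel :: real measure"] that by simp
 have [measurable]: "(\<lambda>x. \<Sum>i<N. (x i - \<mu> i) * grad x i) \<in> bmeas (lebn N)"
  using c by (intro borel_measurable_sum borel_measurable_times borel_measurable_diff) auto
 show ?thesis unfolding dens_def[abs_def] form_grad by measurable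
qed

end

lemma nn_integral_power_reflect:
 fixes F :: "point => ennreal"
 assumes I: "finite I" and F[measurable]: "F \<in> bmeas (leb I)"
 shows "(\<integral>\<^sup>+z. F (\<lambda>i\<in>I. c i - z i) \<partial>leb I) = (\<integral>\<^sup>+z. F z \<partial>leb I)"
proof -
 have m[measurable]: "(\<lambda>z. \<lambda>i\<in>I. c i - z i) \<in> leb I \<rightarrow>\<^sub>M leb I"
 proof (rule measurable_restrict)
  fix i assume "i \<in> I"
  then have "(\<lambda>z. z i) \<in> bmeas (leb I)"
   using measurable_component_singleton[of i I "\<lambda>_. lborel :: real measure"] by simp
  then show "(\<lambda>z. c i - z i) \<in> leb I \<rightarrow>\<^sub>M lborel" by simp
 qed
 have "distr (leb I) (leb I) (\<lambda>z. \<lambda>i\<in>I. c i - z i) = leb I"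
 proof (rule lborel_product.PiM_eqI[OF I])
  fix A :: "nat => real set" assume A: "\<And>i. i \<in> I ==> A i \<in> sets lborel"
  have reflect: "emeasure lborel ((\<lambda>y. a - y) -` S) = emeasure lborel S" if "S \<in> sets lborel" for a and S :: "real set"
  proof -
   have "emeasure lborel S = (NI y. indicator S y)" using that by simp
   also have "... = (NI y. indicator S (a - y))"
    using nn_integral_real_affine[of "indicator S" "-1" a] that by simp
   also have "... = (NI y. indicator ((\<lambda>y. a - y) -` S) y)"
    by (intro nn_integral_cong) (auto simp: indicator_def)
   also have "... = emeasure lborel ((\<lambda>y. a - y) -` S)"
    using that measurable_sets[of "\<lambda>y. a - y" lborel borel S] by simp
   finally show ?thesis ..
  qed
  have ms: "(\<lambda>y. a - y) -` S \<in> sets lborel" if "S \<in> sets lborel" for a and S :: "real set"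
   using that measurable_sets[of "\<lambda>y. a - y" lborel borel S] by simp
  have box: "Pi\<^sub>E I A \<in> sets (leb I)" by (rule sets_PiM_I_finite[OF I]) (rule A)
  have pre: "(\<lambda>z. \<lambda>i\<in>I. c i - z i) -` Pi\<^sub>E I A \<inter> space (leb I) = Pi\<^sub>E I (\<lambda>i. (\<lambda>y. c i - y) -` A i)"
   by (auto simp: space_PiM PiE_def Pi_def extensional_def)
  have "emeasure (distr (leb I) (leb I) (\<lambda>z. \<lambda>i\<in>I. c i - z i)) (Pi\<^sub>E I A)
   = emeasure (leb I) (Pi\<^sub>E I (\<lambda>i. (\<lambda>y. c i - y) -` A i))"
   by (subst emeasure_distr[OF m box]) (simp add: pre)
  also have "... = (\<Prod>i\<in>I. emeasure lborel ((\<lambda>y. c i - y) -` A i))"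
   by (rule lborel_product.emeasure_PiM[OF I]) (rule ms[OF A])
  also have "... = (\<Prod>i\<in>I. emeasure lborel (A i))" by (intro prod.cong refl reflect A)
  finally show "emeasure (distr (leb I) (leb I) (\<lambda>z. \<lambda>i\<in>I. c i - z i)) (Pi\<^sub>E I A) = (\<Prod>i\<in>I. emeasure lborel (A i))" .
 qed simp
 then show ?thesis using nn_integral_distr[OF m, of F] by simp
qed

text \<open>The integrand of the chi-square divergence between normal laws of equal variance is a
  multiple of a normal density centred at the reflected mean, so on products it integrates to an
  exponential.\<close>

lemma normal_density_square_div:
 assumes "0 < sd"
 shows "(normal_density b sd z)^2 / normal_density a sd z = exp ((a - b)^2 / sd\<^sup>2) * normal_density (2 * b - a) sd z"
proof -
 have e: "2 * (- (z - b)\<^sup>2 / (2 * sd\<^sup>2)) - (- (z - a)\<^sup>2 / (2 * sd\<^sup>2)) = (a - b)^2 / sd\<^sup>2 + - (z - (2 * b - a))\<^sup>2 / (2 * sd\<^sup>2)"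
  using assms by (simp add: field_simps power2_eq_square)
 define C where "C = 1 / sqrt (2 * pi * sd\<^sup>2)"
 have C: "0 < C" using assms by (simp add: C_def)
 have n: "normal_density m sd z = C * exp (- (z - m)\<^sup>2 / (2 * sd\<^sup>2))" for m by (simp add: normal_density_def C_def)
 have "(normal_density b sd z)^2 / normal_density a sd z = C * ((exp (- (z - b)\<^sup>2 / (2 * sd\<^sup>2)))^2 / exp (- (z - a)\<^sup>2 / (2 * sd\<^sup>2)))"
  unfolding n using C by (simp add: power2_eq_square)
 also have "(exp (- (z - b)\<^sup>2 / (2 * sd\<^sup>2)))^2 / exp (- (z - a)\<^sup>2 / (2 * sd\<^sup>2)) = exp ((a - b)^2 / sd\<^sup>2) * exp (- (z - (2 * b - a))\<^sup>2 / (2 * sd\<^sup>2))"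
  unfolding exp_double[symmetric] exp_diff[symmetric] exp_add[symmetric] e ..
 finally show ?thesis unfolding n by (simp add: mult.left_commute)
qed

section \<open>Mean acceptance probability of a block proposal\<close>

context gauss_block
begin

sublocale FB: finite_product_sigma_finite "\<lambda>_::nat. lborel :: real measure" B
 by standard (rule finite_block)

abbreviation ov :: "point => point => nat => real" where
 "ov x z \<equiv> override_on x z B"

abbreviation pden :: "point => point => real" where
 "pden \<equiv> prop_density dens B h"

abbreviation acc :: "point => point => real" where
 "acc \<equiv> accept_prob dens B h"

definition pmean :: "point => nat => real" where
 "pmean x i = x i - h * grad x i"

lemma block_less: "i \<in> B ==> i < N"
 using block_subset by auto

lemma prop_eq: "pden x z = (\<Prod>i\<in>B. normal_density (pmean x i) (sqrt (2 * h)) (z i))"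
 unfolding prop_density_def by (intro prod.cong refl) (simp add: prop_mean_dens block_less pmean_def)

lemma prop_pos: "0 < pden x z"
 unfolding prop_eq using h_pos by (intro prod_pos normal_density_pos) simp

lemma prop_meas[measurable]: "pden x \<in> bmeas (leb B)"
 unfolding prop_eq[abs_def]
proof (intro borel_measurable_prod)
 fix i assume "i \<in> B"
 then have [measurable]: "(\<lambda>z. z i) \<in> bmeas (leb B)"
  using measurable_component_singleton[of i B "\<lambda>_. lborel :: real measure"] by simp
 show "(\<lambda>z. normal_density (pmean x i) (sqrt (2 * h)) (z i)) \<in> bmeas (leb B)" by measurable
qed

lemma nn_integral_prop: "(\<integral>\<^sup>+z. ennreal (pden x z) \<partial>leb B) = 1"
proof -
 have "(\<integral>\<^sup>+z. ennreal (pden x z) \<partial>leb B)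
  = (\<integral>\<^sup>+z. (\<Prod>i\<in>B. ennreal (normal_density (pmean x i) (sqrt (2 * h)) (z i))) \<partial>leb B)"
  by (simp add: prop_eq prod_ennreal)
 also have "... = (\<Prod>i\<in>B. (NI y. ennreal (normal_density (pmean x i) (sqrt (2 * h)) y)))"
  by (rule lborel_product.product_nn_integral_prod[OF finite_block]) simp
 also have "... = 1"
  using h_pos by (intro prod.neutral ballI) (subst nn_integral_eq_integral, auto)
 finally show ?thesis .
qed

lemma grad_diff: "(\<And>i. i < N ==> i \<notin> B ==> y i = x i) ==> grad y i = grad x i + apply_block (\<lambda>k. y k - x k) i"
proof -
 assume off: "\<And>i. i < N ==> i \<notin> B ==> y i = x i"
 have "grad y i - grad x i = (\<Sum>k<N. T i k * (y k - x k))"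
  by (simp add: grad_def sum_subtractf[symmetric] right_diff_distrib[symmetric])
 also have "... = apply_block (\<lambda>k. y k - x k) i"
  unfolding apply_block_def using block_subset off by (intro sum.mono_neutral_right) auto
 finally show ?thesis by simp
qed

lemma acc_ov: "acc x (ov x z) = min 1 (exp (h / 4 * (grad_norm x - grad_norm (ov x z))))"
 by (rule accept_prob_eq) (simp add: override_on_def)

definition noise_size :: "point => point => real" where
 "noise_size x z = (\<Sum>i\<in>B. (apply_block (\<lambda>k. z k - pmean x k) i)^2)"

text \<open>Reflecting the proposal noise changes the sign of the linear term of \<^term>\<open>grad_norm\<close>, so one of
 the two proposals is accepted with a probability that does not depend on the current point.\<close>

lemma acc_reflect: "1 - h / 4 * noise_size x z <= acc x (ov x z) + acc x (ov x (\<lambda>i\<in>B. 2 * pmean x i - z i))"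
proof -
 \<comment> \<open>\<open>a\<close> is the block gradient at the proposal mean and
   \<open>\<eta>\<close> the change caused by the noise. Reflecting \<open>z\<close> in the proposal
   mean keeps \<open>a\<close> and negates \<open>\<eta>\<close>.\<close>
 define \<eta> where "\<eta> i = apply_block (\<lambda>k. z k - pmean x k) i" for i
 define a where "a i = grad x i - h * apply_block (grad x) i" for i
 define z' where "z' = (\<lambda>i\<in>B. 2 * pmean x i - z i)"
 have ab: "apply_block (\<lambda>k. u k + v k) i = apply_block u i + apply_block v i" for u v i
  by (simp add: apply_block_def sum.distrib distrib_left)
 have abs: "apply_block (\<lambda>k. c * u k) i = c * apply_block u i" for c u i
  by (simp add: apply_block_def sum_distrib_left mult.left_commute)
 have abc: "apply_block u i = apply_block v i" if "\<And>k. k \<in> B ==> u k = v k" for u v i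
  using that by (simp add: apply_block_def)
 have g1: "grad (ov x z) i = a i + \<eta> i" for i
 proof -
  have "grad (ov x z) i = grad x i + apply_block (\<lambda>k. ov x z k - x k) i" by (rule grad_diff) (simp add: override_on_def)
  also have "apply_block (\<lambda>k. ov x z k - x k) i = apply_block (\<lambda>k. (z k - pmean x k) + (- h) * grad x k) i"
   by (rule abc) (simp add: pmean_def)
  also have "... = \<eta> i - h * apply_block (grad x) i" unfolding ab abs \<eta>_def by simp
  finally show ?thesis by (simp add: a_def)
 qed
 have g2: "grad (ov x z') i = a i - \<eta> i" for i
 proof -
  have "grad (ov x z') i = grad x i + apply_block (\<lambda>k. ov x z' k - x k) i" by (rule grad_diff) (simp add: override_on_def)
  also have "apply_block (\<lambda>k. ov x z' k - x k) i = apply_block (\<lambda>k. (-1) * (z k - pmean x k) + (- h) * grad x k) i"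
   by (rule abc) (simp add: pmean_def z'_def)
  also have "... = - \<eta> i - h * apply_block (grad x) i" unfolding ab abs \<eta>_def by simp
  finally show ?thesis by (simp add: a_def)
 qed
 define l where "l = (\<Sum>i\<in>B. a i * \<eta> i)"
 define E where "E = noise_size x z"
 have na: "(\<Sum>i\<in>B. (a i)^2) <= grad_norm x" unfolding a_def grad_norm_def by (rule step_contraction)
 have n1: "grad_norm (ov x z) = (\<Sum>i\<in>B. (a i)^2) + 2 * l + E"
  unfolding grad_norm_def g1 l_def E_def noise_size_def \<eta>_def[symmetric]
  by (simp add: power2_sum sum.distrib sum_distrib_left mult.assoc)
 have n2: "grad_norm (ov x z') = (\<Sum>i\<in>B. (a i)^2) - 2 * l + E"
  unfolding grad_norm_def g2 l_def E_def noise_size_def \<eta>_def[symmetric]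
  by (simp add: power2_diff sum.distrib sum_subtractf sum_distrib_left mult.assoc)
 have lower: "1 - h / 4 * E <= min 1 (exp (h / 4 * d))" if "- E <= d" for d
 proof -
  have E: "0 <= E" by (simp add: E_def noise_size_def sum_nonneg)
  have "1 - h / 4 * E <= exp (- (h / 4 * E))" using exp_ge_add_one_self[of "- (h / 4 * E)"] by simp
  also have "... <= exp (h / 4 * d)"
   using mult_left_mono[OF that, of "h / 4"] h_pos by simp
  finally show ?thesis using E h_pos by simp
 qed
 have nn: "0 <= min 1 (exp (h / 4 * d))" for d by simp
 show ?thesis
 \<comment> \<open>The linear term has opposite signs for the two proposals. Where it is
   nonpositive, the squared gradient norm grows by at most \<open>E\<close>, because the drift alone
   does not increase it.\<close>
 proof (cases "l <= 0")
  case True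
  then have "1 - h / 4 * E <= acc x (ov x z)" unfolding acc_ov using na by (intro lower) (simp add: n1)
  then show ?thesis using nn unfolding acc_ov E_def[symmetric] z'_def[symmetric] by (simp add: add_increasing2)
 next
  case False
  then have "1 - h / 4 * E <= acc x (ov x z')" unfolding acc_ov using na by (intro lower) (simp add: n2)
  then show ?thesis using nn unfolding acc_ov E_def[symmetric] z'_def[symmetric] by (simp add: add_increasing)
 qed
qed

lemma ov_meas: "x \<in> space (lebn N) ==> ov x \<in> leb B \<rightarrow>\<^sub>M lebn N"
proof -
 assume x: "x \<in> space (lebn N)"
 show ?thesis
 proof (rule measurable_PiM_single')
  fix i assume i: "i \<in> {..<N}"
  show "(\<lambda>z. ov x z i) \<in> leb B \<rightarrow>\<^sub>M lborel"
   using i by (cases "i \<in> B") (auto intro!: measurable_component_singleton)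
 qed (use block_subset x in \<open>auto simp: space_PiM PiE_def extensional_def override_on_def\<close>)
qed

lemma noise_size_meas[measurable]: "noise_size x \<in> bmeas (leb B)"
proof -
 have "(\<lambda>z. z i) \<in> bmeas (leb B)" if "i \<in> B" for i
  using measurable_component_singleton[of i B "\<lambda>_. lborel :: real measure"] that by simp
 then show ?thesis
  unfolding noise_size_def[abs_def] apply_block_def
  by (intro borel_measurable_sum borel_measurable_power borel_measurable_times borel_measurable_diff) auto
qed

text \<open>The noise has variance 2 h in each coordinate, so the mean is at most (h / 4)
  \<Lambda>^2 (2 h) card B, which is half of card B (h \<Lambda>)^2 and hence at most 1/20 by
  \<open>step_le\<close>.\<close>

lemma nn_integral_noise_size: "(\<integral>\<^sup>+z. ennreal (h / 4 * noise_size x z) * ennreal (pden x z) \<partial>leb B) <= ennreal (1 / 20)"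
proof -
 have cm: "(\<lambda>z. z i) \<in> bmeas (leb B)" if "i \<in> B" for i
  using measurable_component_singleton[of i B "\<lambda>_. lborel :: real measure"] that by simp
 have second: "(\<integral>\<^sup>+z. ennreal ((z k - pmean x k)^2) * ennreal (pden x z) \<partial>leb B) = ennreal (2 * h)" if k: "k \<in> B" for k
 proof -
  define F where "F i y = normal_density (pmean x i) (sqrt (2 * h)) y * (if i = k then (y - pmean x i)^2 else 1)" for i y
  have "(\<integral>\<^sup>+z. ennreal ((z k - pmean x k)^2) * ennreal (pden x z) \<partial>leb B) = (\<integral>\<^sup>+z. (\<Prod>i\<in>B. ennreal (F i (z i))) \<partial>leb B)"
  proof (rule nn_integral_cong)
   fix z
   have "(z k - pmean x k)^2 * pden x z = (\<Prod>i\<in>B. F i (z i))"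
    unfolding F_def prop_eq prod.distrib using k finite_block by (simp add: mult.commute)
   then show "ennreal ((z k - pmean x k)^2) * ennreal (pden x z) = (\<Prod>i\<in>B. ennreal (F i (z i)))"
    using prop_pos[of x z] by (subst prod_ennreal) (auto simp: F_def ennreal_mult[symmetric] less_imp_le)
  qed
  also have "... = (\<Prod>i\<in>B. (NI y. ennreal (F i y)))"
   by (rule lborel_product.product_nn_integral_prod[OF finite_block]) (simp add: F_def)
  also have "... = (\<Prod>i\<in>B. if i = k then ennreal (2 * h) else 1)"
  proof (intro prod.cong refl)
   fix i
   show "(NI y. ennreal (F i y)) = (if i = k then ennreal (2 * h) else 1)"
   proof (cases "i = k")
    case True
    have s: "0 < sqrt (2 * h)" using h_pos by simp
    have hb: "has_bochner_integral lborel (\<lambda>y. normal_density (pmean x k) (sqrt (2 * h)) y * (y - pmean x k)^2) (2 * h)"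
     using normal_moment_even[OF s, of "pmean x k" 1] h_pos by simp
    show ?thesis
     using True hb unfolding F_def by (simp add: has_bochner_integral_iff nn_integral_eq_integral)
   next
    case False
    then show ?thesis using h_pos unfolding F_def by (subst nn_integral_eq_integral) auto
   qed
  qed
  also have "... = ennreal (2 * h)" using k finite_block by simp
  finally show ?thesis .
 qed
 have "(\<integral>\<^sup>+z. ennreal (h / 4 * noise_size x z) * ennreal (pden x z) \<partial>leb B)
  <= (\<integral>\<^sup>+z. (\<Sum>k\<in>B. ennreal (h / 4 * \<Lambda>\<^sup>2) * (ennreal ((z k - pmean x k)^2) * ennreal (pden x z))) \<partial>leb B)"
 proof (rule nn_integral_mono)
  fix z
  have "h / 4 * noise_size x z <= h / 4 * (\<Lambda>\<^sup>2 * (\<Sum>k\<in>B. (z k - pmean x k)^2))"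
   unfolding noise_size_def using h_pos by (intro mult_left_mono apply_block_norm_le2) auto
  also have "... = (\<Sum>k\<in>B. h / 4 * \<Lambda>\<^sup>2 * (z k - pmean x k)^2)" by (simp add: sum_distrib_left mult.assoc)
  finally have "ennreal (h / 4 * noise_size x z) <= ennreal (\<Sum>k\<in>B. h / 4 * \<Lambda>\<^sup>2 * (z k - pmean x k)^2)" by (rule ennreal_leI)
  also have "... = (\<Sum>k\<in>B. ennreal (h / 4 * \<Lambda>\<^sup>2) * ennreal ((z k - pmean x k)^2))"
   using h_pos by (simp add: ennreal_mult[symmetric])
  finally have "ennreal (h / 4 * noise_size x z) * ennreal (pden x z) <= (\<Sum>k\<in>B. ennreal (h / 4 * \<Lambda>\<^sup>2) * ennreal ((z k - pmean x k)^2)) * ennreal (pden x z)"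
   by (rule mult_right_mono) simp
  then show "ennreal (h / 4 * noise_size x z) * ennreal (pden x z) <= (\<Sum>k\<in>B. ennreal (h / 4 * \<Lambda>\<^sup>2) * (ennreal ((z k - pmean x k)^2) * ennreal (pden x z)))"
   by (simp add: sum_distrib_right mult.assoc)
 qed
 also have "... = (\<Sum>k\<in>B. ennreal (h / 4 * \<Lambda>\<^sup>2) * ennreal (2 * h))"
 proof (subst nn_integral_sum)
  show "(\<lambda>z. ennreal (h / 4 * \<Lambda>\<^sup>2) * (ennreal ((z k - pmean x k)^2) * ennreal (pden x z))) \<in> bmeas (leb B)" if "k \<in> B" for k
   using cm[OF that] by simp
  show "(\<Sum>k\<in>B. \<integral>\<^sup>+z. ennreal (h / 4 * \<Lambda>\<^sup>2) * (ennreal ((z k - pmean x k)^2) * ennreal (pden x z)) \<partial>leb B)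
   = (\<Sum>k\<in>B. ennreal (h / 4 * \<Lambda>\<^sup>2) * ennreal (2 * h))"
   using cm second by (intro sum.cong refl) (subst nn_integral_cmult, auto)
 qed
 also have "... = ennreal (real (card B) * (h / 4 * \<Lambda>\<^sup>2 * (2 * h)))"
  using h_pos by (simp add: ennreal_mult[symmetric] ennreal_of_nat_eq_real_of_nat)
 also have "... <= ennreal (1 / 20)"
  using step_le by (intro ennreal_leI) (simp add: power_mult_distrib power2_eq_square algebra_simps)
 finally show ?thesis .
qed

lemma acc_section_meas:
 assumes x: "x \<in> space (lebn N)"
 shows "(\<lambda>z. acc x (ov x z)) \<in> bmeas (leb B)"
proof -
 have [measurable]: "(\<lambda>z. grad_norm (ov x z)) \<in> bmeas (leb B)"
  by (rule measurable_compose[OF ov_meas[OF x] grad_norm_measurable])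
 show ?thesis unfolding acc_ov by measurable
qed

lemma acc_nonneg: "0 <= acc x (ov x z)"
 unfolding acc_ov by simp

text \<open>Reflection preserves the proposal law, so integrating \<open>acc_reflect\<close> counts
  the mean acceptance X twice: 1 \<le> 2 X + 1/20.\<close>

lemma mean_acceptance:
 assumes x: "x \<in> space (lebn N)"
 shows "ennreal (19 / 40) <= (\<integral>\<^sup>+z. ennreal (acc x (ov x z)) * ennreal (pden x z) \<partial>leb B)" (is "_ <= ?X")
proof -
 note [measurable] = acc_section_meas[OF x]
 define R where "R z = (\<lambda>i\<in>B. 2 * pmean x i - z i)" for z
 have Rm[measurable]: "R \<in> leb B \<rightarrow>\<^sub>M leb B"
  unfolding R_def[abs_def]
 proof (rule measurable_restrict)
  fix i assume "i \<in> B"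
  then have "(\<lambda>z. z i) \<in> bmeas (leb B)"
   using measurable_component_singleton[of i B "\<lambda>_. lborel :: real measure"] by simp
  then show "(\<lambda>z. 2 * pmean x i - z i) \<in> leb B \<rightarrow>\<^sub>M lborel" by simp
 qed
 have pR: "pden x (R z) = pden x z" for z
  unfolding prop_eq by (intro prod.cong refl) (simp add: R_def normal_density_def power2_commute)
 have "?X = (\<integral>\<^sup>+z. ennreal (acc x (ov x (R z))) * ennreal (pden x (R z)) \<partial>leb B)"
  using nn_integral_power_reflect[OF finite_block, of "\<lambda>z. ennreal (acc x (ov x z)) * ennreal (pden x z)" "\<lambda>i. 2 * pmean x i"]
  by (simp add: R_def)
 then have XR: "?X = (\<integral>\<^sup>+z. ennreal (acc x (ov x (R z))) * ennreal (pden x z) \<partial>leb B)" by (simp add: pR)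
 have aR[measurable]: "(\<lambda>z. acc x (ov x (R z))) \<in> bmeas (leb B)"
  by (rule measurable_compose[OF Rm]) measurable
 have "1 = (\<integral>\<^sup>+z. ennreal (pden x z) \<partial>leb B)" by (rule nn_integral_prop[symmetric])
 also have "... <= (\<integral>\<^sup>+z. ennreal (acc x (ov x z)) * ennreal (pden x z) + (ennreal (acc x (ov x (R z))) * ennreal (pden x z)
  + ennreal (h / 4 * noise_size x z) * ennreal (pden x z)) \<partial>leb B)"
 proof (rule nn_integral_mono)
  fix z
  have n: "0 <= h / 4 * noise_size x z" using h_pos by (simp add: noise_size_def sum_nonneg)
  have "ennreal 1 <= ennreal (acc x (ov x z) + (acc x (ov x (R z)) + h / 4 * noise_size x z))"
   using acc_reflect[of x z] by (intro ennreal_leI) (simp add: R_def)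
  also have "... = ennreal (acc x (ov x z)) + (ennreal (acc x (ov x (R z))) + ennreal (h / 4 * noise_size x z))"
   using acc_nonneg n by simp
  finally have "1 * ennreal (pden x z) <= (ennreal (acc x (ov x z)) + (ennreal (acc x (ov x (R z))) + ennreal (h / 4 * noise_size x z))) * ennreal (pden x z)"
   by (intro mult_right_mono) auto
  then show "ennreal (pden x z) <= ennreal (acc x (ov x z)) * ennreal (pden x z) + (ennreal (acc x (ov x (R z))) * ennreal (pden x z)
  + ennreal (h / 4 * noise_size x z) * ennreal (pden x z))" by (simp add: distrib_right)
 qed
 also have "... = ?X + (?X + (\<integral>\<^sup>+z. ennreal (h / 4 * noise_size x z) * ennreal (pden x z) \<partial>leb B))"
  unfolding XR[symmetric] by (subst nn_integral_add, measurable, subst nn_integral_add, measurable, simp only: XR[symmetric])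
 also have "... <= ?X + (?X + ennreal (1 / 20))" by (intro add_left_mono nn_integral_noise_size)
 finally have le: "1 <= ?X + (?X + ennreal (1 / 20))" .
 show ?thesis
 proof (cases ?X)
  case (real q)
  have "ennreal (a + (b + c)) = ennreal a + (ennreal b + ennreal c)" if "0 <= a" "0 <= b" "0 <= c" for a b c
   using that by simp
  from this[of q q "1 / 20"] have e: "ennreal (q + (q + 1 / 20)) = ennreal q + (ennreal q + ennreal (1 / 20))"
   using real by auto
  have "ennreal 1 <= ennreal (q + (q + 1 / 20))" unfolding e using le real by simp
  then have "1 <= q + (q + 1 / 20)" using real by (subst (asm) ennreal_le_iff) auto
  then show ?thesis using real by (auto intro!: ennreal_leI)
 qed simp
qed

end

lemma exp_thirtysecond: "exp (1 / 32) <= (26 / 25 :: real)"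
proof -
 have "exp (1 / 32 :: real) <= 1 + 1 / 32 + (1 / 32)^2" by (rule exp_bound) auto
 then show ?thesis by (simp add: power2_eq_square)
qed

lemma nn_integral_coordinate_swap:
 fixes H :: "point \<times> point => ennreal"
 assumes t: "t < N" and H[measurable]: "H \<in> bmeas (lebn N \<Otimes>\<^sub>M lebn N)"
 shows "(\<integral>\<^sup>+x. (NI u. H (x, x(t := u))) \<partial>lebn N)
  = (\<integral>\<^sup>+x. (NI u. H (x(t := u), x)) \<partial>lebn N)"
proof -
 define I where "I = {..<N} - {t}"
 have I: "finite I" "t \<notin> I" "insert t I = {..<N}" using t by (auto simp: I_def)
 have up[measurable]: "(\<lambda>w. (fst w)(t := snd w)) \<in> lebn N \<Otimes>\<^sub>M borel \<rightarrow>\<^sub>M lebn N"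
  using measurable_add_dim[of t "{..<N}" "\<lambda>_. lborel :: real measure"] t
  by (simp add: split_beta' insert_absorb cong: measurable_cong_sets)
 have unf: "(\<integral>\<^sup>+x. (NI u. G (x, x(t := u))) \<partial>lebn N)
  = (\<integral>\<^sup>+a. (NI y. (NI u. G (a(t := y), a(t := u)))) \<partial>leb I)"
  if [measurable]: "G \<in> bmeas (lebn N \<Otimes>\<^sub>M lebn N)" for G :: "point \<times> point => ennreal"
 proof -
  have "(\<lambda>w. G (fst w, (fst w)(t := snd w))) \<in> bmeas (lebn N \<Otimes>\<^sub>M borel)" by measurable
  then have "(\<lambda>x. (NI u. G (x, x(t := u)))) \<in> bmeas (leb (insert t I))"
   unfolding I(3) by (intro lborel.borel_measurable_nn_integral) (simp add: split_beta' cong: measurable_cong_sets)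
  from lborel_product.product_nn_integral_insert[OF I(1,2) this] show ?thesis unfolding I(3) by simp
 qed
 have "(\<integral>\<^sup>+x. (NI u. H (x, x(t := u))) \<partial>lebn N)
  = (\<integral>\<^sup>+a. (NI y. (NI u. H (a(t := y), a(t := u)))) \<partial>leb I)"
  by (rule unf[OF H])
 also have "... = (\<integral>\<^sup>+a. (NI u. (NI y. H (a(t := y), a(t := u)))) \<partial>leb I)"
 proof (rule nn_integral_cong)
  fix a assume a: "a \<in> space (leb I)"
  have [measurable]: "(\<lambda>y. a(t := y)) \<in> borel \<rightarrow>\<^sub>M lebn N"
   using measurable_component_update[OF a I(2)] unfolding I(3) by (simp cong: measurable_cong_sets)
  show "(NI y. (NI u. H (a(t := y), a(t := u)))) = (NI u. (NI y. H (a(t := y), a(t := u))))"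
   by (rule lborel_pair.Fubini') (unfold split_beta', measurable)
 qed
 also have "... = (\<integral>\<^sup>+x. (NI u. (\<lambda>w. H (snd w, fst w)) (x, x(t := u))) \<partial>lebn N)"
  by (subst unf) auto
 finally show ?thesis by simp
qed

section \<open>Overlap of the accepted proposals from two nearby points\<close>

context gauss_block
begin

text \<open>By \<open>step_contraction\<close> the proposal means are no further apart than the
  points, so the chi-square divergence of the proposals is at most exp (1/32) - 1 \<le> 1/25, which
  bounds their L1 distance by 1/5.\<close>

lemma proposal_excess:
 assumes t: "t \<in> B" and d: "(x t - u)^2 <= h / 16"
 shows "(\<integral>\<^sup>+z. ennreal (max 0 (pden x z - pden (x(t := u)) z)) \<partial>leb B) <= ennreal (1 / 5)"
proof -
 define x' where "x' = x(t := u)"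
 define w where "w k = (if k = t then u - x t else 0)" for k :: nat
 have dm: "pmean x' i - pmean x i = w i - h * apply_block w i" for i
 proof -
  have "grad x' i = grad x i + apply_block (\<lambda>k. x' k - x k) i"
   by (rule grad_diff) (use t in \<open>auto simp: x'_def\<close>)
  also have "(\<lambda>k. x' k - x k) = w" by (auto simp: x'_def w_def)
  finally have g: "grad x' i = grad x i + apply_block w i" .
  have "x' i = x i + w i" by (auto simp: x'_def w_def)
  then show ?thesis unfolding pmean_def g by (simp add: algebra_simps)
 qed
 have "(\<Sum>i\<in>B. (pmean x i - pmean x' i)^2) = (\<Sum>i\<in>B. (w i - h * apply_block w i)^2)"
  unfolding dm[symmetric] by (intro sum.cong refl) (simp add: power2_commute)
 also have "... <= (\<Sum>i\<in>B. (w i)^2)" by (rule step_contraction)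
 also have "... = (\<Sum>i\<in>B. if i = t then (u - x t)^2 else 0)" by (intro sum.cong refl) (simp add: w_def)
 also have "... = (x t - u)^2" using t finite_block by (simp add: power2_commute)
 finally have D: "(\<Sum>i\<in>B. (pmean x i - pmean x' i)^2) <= h / 16" using d by simp
 define q where "q z = (\<Prod>i\<in>B. normal_density (2 * pmean x' i - pmean x i) (sqrt (2 * h)) (z i))" for z :: "nat => real"
 define e where "e = exp ((\<Sum>i\<in>B. (pmean x i - pmean x' i)^2) / (2 * h))"
 have chi: "(pden x' z)^2 / pden x z = e * q z" for z
 proof -
  have "(pden x' z)^2 / pden x z = (\<Prod>i\<in>B. (normal_density (pmean x' i) (sqrt (2 * h)) (z i))^2 / normal_density (pmean x i) (sqrt (2 * h)) (z i))"
   by (simp add: prop_eq prod_dividef prod_power_distrib)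
  also have "... = (\<Prod>i\<in>B. exp ((pmean x i - pmean x' i)^2 / (2 * h)) * normal_density (2 * pmean x' i - pmean x i) (sqrt (2 * h)) (z i))"
   using h_pos by (intro prod.cong refl) (simp add: normal_density_square_div)
  also have "... = e * q z"
   by (simp add: prod.distrib q_def e_def sum_divide_distrib exp_sum[OF finite_block])
  finally show ?thesis .
 qed
 have e: "e <= 26 / 25" "0 <= e"
 proof -
  have "(\<Sum>i\<in>B. (pmean x i - pmean x' i)^2) / (2 * h) <= 1 / 32" using D h_pos by (simp add: field_simps)
  then have "e <= exp (1 / 32)" by (simp add: e_def)
  then show "e <= 26 / 25" using exp_thirtysecond by simp
 qed (simp add: e_def)
 have q0: "0 <= q z" for z unfolding q_def by (intro prod_nonneg) auto
 have qm[measurable]: "q \<in> bmeas (leb B)"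
  unfolding q_def[abs_def]
 proof (intro borel_measurable_prod)
  fix i assume "i \<in> B"
  then have [measurable]: "(\<lambda>z. z i) \<in> bmeas (leb B)"
   using measurable_component_singleton[of i B "\<lambda>_. lborel :: real measure"] by simp
  show "(\<lambda>z. normal_density (2 * pmean x' i - pmean x i) (sqrt (2 * h)) (z i)) \<in> bmeas (leb B)" by measurable
 qed
 have q1: "(\<integral>\<^sup>+z. ennreal (q z) \<partial>leb B) = 1"
 proof -
  have "(\<integral>\<^sup>+z. ennreal (q z) \<partial>leb B)
   = (\<integral>\<^sup>+z. (\<Prod>i\<in>B. ennreal (normal_density (2 * pmean x' i - pmean x i) (sqrt (2 * h)) (z i))) \<partial>leb B)"
   by (simp add: q_def prod_ennreal)
  also have "... = (\<Prod>i\<in>B. (NI y. ennreal (normal_density (2 * pmean x' i - pmean x i) (sqrt (2 * h)) y)))"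
   by (rule lborel_product.product_nn_integral_prod[OF finite_block]) simp
  also have "... = 1"
   using h_pos by (intro prod.neutral ballI) (subst nn_integral_eq_integral, auto)
  finally show ?thesis .
 qed
 \<comment> \<open>This is |p - p'| \<le> (5/2) (p - p')^2 / p + p / 10 with the square expanded and
   the negative term moved to the left. A divergence of at most 1/25 makes the right side integrate
   to at most 1/10 + 1/10.\<close>
 have pt: "max 0 (pden x z - pden x' z) + 5 * pden x' z <= 13 / 5 * pden x z + 5 / 2 * (e * q z)" for z
 proof -
  define a b where "a = pden x z" and "b = pden x' z"
  have ab: "0 < a" "0 < b" using prop_pos by (auto simp: a_def b_def)
  have c: "e * q z = b\<^sup>2 / a" using chi[of z] by (simp add: a_def b_def)
  have "max 0 (a - b) * a + 5 * b * a <= 13 / 5 * a\<^sup>2 + 5 / 2 * b\<^sup>2"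
  proof (cases "a <= b")
   case True
   have "13 / 5 * a\<^sup>2 + 5 / 2 * b\<^sup>2 - 5 * b * a = 5 / 2 * (a - b)^2 + 1 / 10 * a\<^sup>2"
    by (simp add: power2_eq_square field_simps)
   also have "0 <= ..." by simp
   finally have "5 * b * a <= 13 / 5 * a\<^sup>2 + 5 / 2 * b\<^sup>2" by linarith
   moreover have "max 0 (a - b) = 0" using True by simp
   ultimately show ?thesis by simp
  next
   case False
   have "13 / 5 * a\<^sup>2 + 5 / 2 * b\<^sup>2 - ((a - b) * a + 5 * b * a) = (8 / 5) * (a - 5 / 4 * b)^2"
    by (simp add: power2_eq_square field_simps)
   also have "0 <= ..." by simp
   finally have "(a - b) * a + 5 * b * a <= 13 / 5 * a\<^sup>2 + 5 / 2 * b\<^sup>2" by linarith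
   moreover have "max 0 (a - b) = a - b" using False by simp
   ultimately show ?thesis by simp
  qed
  then have "(max 0 (a - b) * a + 5 * b * a) / a <= (13 / 5 * a\<^sup>2 + 5 / 2 * b\<^sup>2) / a" using ab by (intro divide_right_mono) auto
  then show ?thesis using ab unfolding c by (simp add: a_def[symmetric] b_def[symmetric] add_divide_distrib power2_eq_square)
 qed
 define X where "X = (\<integral>\<^sup>+z. ennreal (max 0 (pden x z - pden x' z)) \<partial>leb B)"
 have "X + ennreal 5 = (\<integral>\<^sup>+z. ennreal (max 0 (pden x z - pden x' z)) + ennreal 5 * ennreal (pden x' z) \<partial>leb B)"
  unfolding X_def by (subst nn_integral_add) (auto simp: nn_integral_cmult nn_integral_prop)
 also have "... <= (\<integral>\<^sup>+z. ennreal (13 / 5) * ennreal (pden x z) + ennreal (5 / 2 * e) * ennreal (q z) \<partial>leb B)"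
 proof (rule nn_integral_mono)
  fix z
  have "ennreal (max 0 (pden x z - pden x' z)) + ennreal 5 * ennreal (pden x' z) = ennreal (max 0 (pden x z - pden x' z) + 5 * pden x' z)"
   using prop_pos[of x' z] by (subst ennreal_mult[symmetric]) (auto simp: less_imp_le)
  also have "... <= ennreal (13 / 5 * pden x z + 5 / 2 * e * q z)" using pt[of z] by (intro ennreal_leI) simp
  also have "... = ennreal (13 / 5) * ennreal (pden x z) + ennreal (5 / 2 * e) * ennreal (q z)"
   using prop_pos[of x z] e q0 by (simp add: ennreal_mult[symmetric] less_imp_le flip: ennreal_plus)
  finally show "ennreal (max 0 (pden x z - pden x' z)) + ennreal 5 * ennreal (pden x' z)
   <= ennreal (13 / 5) * ennreal (pden x z) + ennreal (5 / 2 * e) * ennreal (q z)" .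
 qed
 also have "... = ennreal (13 / 5) + ennreal (5 / 2 * e)"
  by (subst nn_integral_add) (auto simp: nn_integral_cmult nn_integral_prop q1)
 also have "... = ennreal (13 / 5 + 5 / 2 * e)" using e by (subst ennreal_plus) auto
 also have "... <= ennreal (26 / 5)" using e by (intro ennreal_leI) simp
 finally have X5: "X + ennreal 5 <= ennreal (26 / 5)" .
 have "X <= ennreal (1 / 5)"
 proof (cases X)
  case (real y)
  then have "ennreal (y + 5) = X + ennreal 5" using ennreal_plus[of y 5] by simp
  then have "ennreal (y + 5) <= ennreal (26 / 5)" using X5 by simp
  then have "y + 5 <= 26 / 5" by (subst (asm) ennreal_le_iff) auto
  then have "y <= 1 / 5" by simp
  then show ?thesis unfolding real(2) by (rule ennreal_leI)
 next
  case top
  then show ?thesis using X5 by (simp add: top_unique)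
 qed
 then show ?thesis by (simp add: X_def x'_def)
qed

definition move :: "point => point => real" where
 "move x z = pden x z * acc x (ov x z)"

lemma move_nonneg: "0 <= move x z"
 unfolding move_def using prop_pos[of x z] acc_nonneg[of x z] by simp

lemma move_section[measurable]: "x \<in> space (lebn N) ==> move x \<in> bmeas (leb B)"
 unfolding move_def[abs_def] using acc_section_meas[of x] by measurable

text \<open>The two points share their landing points, and acceptance increases with the gradient
  norm at the start, so \<open>y\<close> accepts at least as often as \<open>x\<close>. Hence the
  common part is at least the accepted mass from \<open>x\<close> minus the excess of its proposal:
  19/40 - 1/5 \<ge> 1/4.\<close>

lemma overlap_aux:
 assumes x: "x \<in> space (lebn N)" and y: "y \<in> space (lebn N)"
  and same: "\<And>z. ov y z = ov x z" and le: "grad_norm x <= grad_norm y"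
  and excess: "(\<integral>\<^sup>+z. ennreal (max 0 (pden x z - pden y z)) \<partial>leb B) <= ennreal (1 / 5)"
 shows "ennreal (1 / 4) <= (\<integral>\<^sup>+z. ennreal (min (move x z) (move y z)) \<partial>leb B)" (is "_ <= ?m")
proof -
 note [measurable] = move_section[OF x] move_section[OF y] acc_section_meas[OF x]
 have "ennreal (19 / 40) <= (\<integral>\<^sup>+z. ennreal (acc x (ov x z)) * ennreal (pden x z) \<partial>leb B)"
  by (rule mean_acceptance[OF x])
 also have "... <= (\<integral>\<^sup>+z. ennreal (min (move x z) (move y z)) + ennreal (max 0 (pden x z - pden y z)) \<partial>leb B)"
 proof (rule nn_integral_mono)
  fix z
  define a where "a = acc x (ov x z)"
  have a: "0 <= a" "a <= 1" by (simp_all add: a_def acc_nonneg) (simp add: acc_ov)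
  have e1: "acc x (ov x z) = min 1 (exp (h / 4 * (grad_norm x - grad_norm (ov x z))))" by (rule acc_ov)
  have e2: "acc y (ov y z) = min 1 (exp (h / 4 * (grad_norm y - grad_norm (ov x z))))" using acc_ov[of y z] by (simp only: same)
  have ay: "a <= acc y (ov y z)"
   unfolding a_def e1 e2 using le h_pos by (intro min.mono) (auto simp: mult_le_cancel_left)
  have p: "0 <= pden x z" "0 <= pden y z" using prop_pos[of x z] prop_pos[of y z] by auto
  have "a * pden x z <= min (move x z) (move y z) + max 0 (pden x z - pden y z)"
  proof (cases "pden x z <= pden y z")
   case True
   have "a * pden x z <= acc y (ov y z) * pden y z" using True ay a p by (intro mult_mono) auto
   then show ?thesis by (simp add: move_def a_def mult.commute)
  next
   case False
   have 1: "a * pden y z <= acc y (ov y z) * pden y z" using ay p by (intro mult_right_mono) auto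
   have 2: "a * pden y z <= a * pden x z" using False a by (intro mult_left_mono) auto
   have 3: "a * (pden x z - pden y z) <= 1 * (pden x z - pden y z)" using False a by (intro mult_right_mono) auto
   have 4: "a * pden y z <= min (move x z) (move y z)" using 1 2 by (simp add: move_def a_def mult.commute)
   have "a * pden x z = a * pden y z + a * (pden x z - pden y z)" by (simp add: algebra_simps)
   also have "... <= min (move x z) (move y z) + 1 * (pden x z - pden y z)" by (rule add_mono[OF 4 3])
   finally show ?thesis using False by simp
  qed
  then have "ennreal (a * pden x z) <= ennreal (min (move x z) (move y z) + max 0 (pden x z - pden y z))" by (rule ennreal_leI)
  then show "ennreal (acc x (ov x z)) * ennreal (pden x z) <= ennreal (min (move x z) (move y z)) + ennreal (max 0 (pden x z - pden y z))"
   using a p move_nonneg by (simp add: a_def ennreal_mult)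
 qed
 also have "... = ?m + (\<integral>\<^sup>+z. ennreal (max 0 (pden x z - pden y z)) \<partial>leb B)"
  by (rule nn_integral_add) auto
 also have "... <= ?m + ennreal (1 / 5)" by (rule add_left_mono[OF excess])
 finally have le: "ennreal (19 / 40) <= ?m + ennreal (1 / 5)" .
 show ?thesis
 proof (cases ?m)
  case (real q)
  then have "ennreal (q + 1 / 5) = ?m + ennreal (1 / 5)" using ennreal_plus[of q "1 / 5"] by simp
  then have "ennreal (19 / 40) <= ennreal (q + 1 / 5)" using le by simp
  then have "19 / 40 <= q + 1 / 5" using real by (subst (asm) ennreal_le_iff) auto
  then have "1 / 4 <= q" by simp
  then show ?thesis unfolding real(2) by (rule ennreal_leI)
 qed simp
qed

lemma overlap:
 assumes x: "x \<in> space (lebn N)" and t: "t \<in> B" and d: "\<bar>x t - u\<bar> <= sqrt h / 4"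
 shows "ennreal (1 / 4) <= (\<integral>\<^sup>+z. ennreal (min (move x z) (move (x(t := u)) z)) \<partial>leb B)"
proof -
 have y: "x(t := u) \<in> space (lebn N)"
  using x block_less[OF t] by (auto simp: space_PiM PiE_def extensional_def)
 have "(x t - u)^2 <= (sqrt h / 4)^2" using d by (metis abs_ge_zero power2_abs power_mono)
 then have d2: "(x t - u)^2 <= h / 16" using h_pos by (simp add: power_divide)
 have same: "ov (x(t := u)) z = ov x z" for z using t by (auto simp: override_on_def)
 show ?thesis
 proof (cases "grad_norm x <= grad_norm (x(t := u))")
  case True
  show ?thesis by (rule overlap_aux[OF x y same True proposal_excess[of t x u, OF t d2]])
 next
  case False
  have d3: "((x(t := u)) t - x t)^2 <= h / 16" using d2 by (simp add: power2_commute)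
  have e: "(x(t := u))(t := x t) = x" by simp
  have "ennreal (1 / 4) <= (\<integral>\<^sup>+z. ennreal (min (move (x(t := u)) z) (move x z)) \<partial>leb B)"
   by (rule overlap_aux[OF y x same[symmetric]]) (use False proposal_excess[of t "x(t := u)" "x t", OF t d3] in \<open>simp_all add: e\<close>)
  then show ?thesis by (simp add: min.commute)
 qed
qed

end

section \<open>From one-site variances to the Dirichlet form of the update\<close>

locale gauss_update = gauss_block +
 assumes dens_prob: "(\<integral>\<^sup>+x. ennreal (dens x) \<partial>lebn N) = 1"
  and T_diag: "\<And>t. t \<in> B ==> 1 <= T t t"
begin

sublocale mala: mala_target N dens B h
proof
 show "(\<lambda>x. prop_mean dens h x i) \<in> bmeas (lebn N)" if i: "i \<in> B" for i
 proof -
  have [measurable]: "(\<lambda>x. x i) \<in> bmeas (lebn N)"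
   using measurable_component_singleton[of i "{..<N}" "\<lambda>_. lborel :: real measure"] block_less[OF i] by simp
  show ?thesis unfolding prop_mean_dens[OF block_less[OF i]] by measurable
 qed
qed (use dens_pos block_subset h_pos dens_prob in auto)

abbreviation target :: "point measure" where "target \<equiv> mala.target"
abbreviation K :: "point => point measure" where "K \<equiv> mala.K"

lemma move_measurable[measurable]: "(\<lambda>w. move (fst w) (snd w)) \<in> bmeas (lebn N \<Otimes>\<^sub>M leb B)"
 unfolding move_def by measurable

definition escape :: "(point => real) => point => ennreal" where
 "escape f x = (\<integral>\<^sup>+z. ennreal (move x z) * ennreal ((f x - f (ov x z))^2) \<partial>leb B)"

lemma escape_measurable[measurable]:
 assumes [measurable]: "f \<in> bmeas (lebn N)"
 shows "escape f \<in> bmeas (lebn N)"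
 unfolding escape_def[abs_def]
 by (rule sigma_finite_measure.borel_measurable_nn_integral[OF lborel_product.sigma_finite[OF finite_block]]) (unfold split_beta', measurable)

lemma energy_escape:
 assumes f[measurable]: "f \<in> bmeas (lebn N)"
 shows "energy target K f = (\<integral>\<^sup>+x. ennreal (dens x) * escape f x \<partial>lebn N)"
proof -
 have "energy target K f = (\<integral>\<^sup>+x. \<integral>\<^sup>+z. ennreal (dens x * pden x z * acc x (ov x z)) * ennreal ((f x - f (ov x z))^2) \<partial>leb B \<partial>lebn N)"
  unfolding energy_def using mala.nn_integral_target_K[of "\<lambda>w. ennreal ((f (fst w) - f (snd w))^2)"] by simp
 also have "... = (\<integral>\<^sup>+x. ennreal (dens x) * escape f x \<partial>lebn N)"
 proof (rule nn_integral_cong)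
  fix x assume x: "x \<in> space (lebn N)"
  note [measurable] = move_section[OF x] ov_meas[OF x]
  have "(\<integral>\<^sup>+z. ennreal (dens x * pden x z * acc x (ov x z)) * ennreal ((f x - f (ov x z))^2) \<partial>leb B)
   = (\<integral>\<^sup>+z. ennreal (dens x) * (ennreal (move x z) * ennreal ((f x - f (ov x z))^2)) \<partial>leb B)"
  proof (rule nn_integral_cong)
   fix z
   have "ennreal (dens x * pden x z * acc x (ov x z)) = ennreal (dens x) * ennreal (move x z)"
    using dens_pos[of x] by (simp add: move_def mult.assoc ennreal_mult' less_imp_le)
   then show "ennreal (dens x * pden x z * acc x (ov x z)) * ennreal ((f x - f (ov x z))^2)
    = ennreal (dens x) * (ennreal (move x z) * ennreal ((f x - f (ov x z))^2))" by (simp add: mult.assoc)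
  qed
  also have "... = ennreal (dens x) * escape f x"
   unfolding escape_def by (rule nn_integral_cmult) measurable
  finally show "(\<integral>\<^sup>+z. ennreal (dens x * pden x z * acc x (ov x z)) * ennreal ((f x - f (ov x z))^2) \<partial>leb B)
   = ennreal (dens x) * escape f x" .
 qed
 finally show ?thesis .
qed

text \<open>As \<open>t\<close> lies in the block, both points land at the same
  \<open>ov x z\<close>. Comparing their values through a common accepted landing point costs a
  factor 2, and the mass of such points is at least 1/4.\<close>

lemma square_diff_le_escape:
 assumes f[measurable]: "f \<in> bmeas (lebn N)"
  and x: "x \<in> space (lebn N)" and t: "t \<in> B" and d: "\<bar>x t - u\<bar> <= sqrt h / 4"
 shows "ennreal ((f x - f (x(t := u)))^2) <= 8 * escape f x + 8 * escape f (x(t := u))"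
proof -
 define y where "y = x(t := u)"
 have y: "y \<in> space (lebn N)"
  using x block_less[OF t] by (auto simp: y_def space_PiM PiE_def extensional_def)
 have same: "ov y z = ov x z" for z using t by (auto simp: y_def override_on_def)
 note [measurable] = move_section[OF x] move_section[OF y] ov_meas[OF x] ov_meas[OF y]
 define D where "D = (f x - f y)^2"
 have "ennreal (1 / 4) * ennreal D <= (\<integral>\<^sup>+z. ennreal (min (move x z) (move y z)) \<partial>leb B) * ennreal D"
  unfolding y_def by (intro mult_right_mono overlap[OF x t d]) simp
 also have "... = (\<integral>\<^sup>+z. ennreal (min (move x z) (move y z)) * ennreal D \<partial>leb B)"
  by (rule nn_integral_multc[symmetric]) measurable
 also have "... <= (\<integral>\<^sup>+z. 2 * (ennreal (move x z) * ennreal ((f x - f (ov x z))^2)) + 2 * (ennreal (move y z) * ennreal ((f y - f (ov y z))^2)) \<partial>leb B)"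
 proof (rule nn_integral_mono)
  fix z
  define w where "w = f (ov x z)"
  have m: "0 <= move x z" "0 <= move y z" by (rule move_nonneg)+
  have "D <= 2 * (f x - w)^2 + 2 * (f y - w)^2"
  proof -
   have "2 * (f x - w)^2 + 2 * (f y - w)^2 - D = ((f x - w) + (f y - w))^2" unfolding D_def by (simp add: power2_eq_square algebra_simps)
   then show ?thesis by (smt (verit) zero_le_power2)
  qed
  then have "min (move x z) (move y z) * D <= min (move x z) (move y z) * (2 * (f x - w)^2 + 2 * (f y - w)^2)"
   using m by (intro mult_left_mono) auto
  also have "... = min (move x z) (move y z) * (2 * (f x - w)^2) + min (move x z) (move y z) * (2 * (f y - w)^2)" by (rule distrib_left)
  also have "... <= move x z * (2 * (f x - w)^2) + move y z * (2 * (f y - w)^2)"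
   by (intro add_mono mult_right_mono) auto
  finally have "ennreal (min (move x z) (move y z) * D) <= ennreal (move x z * (2 * (f x - w)^2) + move y z * (2 * (f y - w)^2))"
   by (rule ennreal_leI)
  also have "... = ennreal (move x z * (2 * (f x - w)^2)) + ennreal (move y z * (2 * (f y - w)^2))" using m by (intro ennreal_plus) auto
  also have "... = 2 * (ennreal (move x z) * ennreal ((f x - w)^2)) + 2 * (ennreal (move y z) * ennreal ((f y - w)^2))"
   using m by (simp add: ennreal_mult mult.left_commute)
  finally show "ennreal (min (move x z) (move y z)) * ennreal D <= 2 * (ennreal (move x z) * ennreal ((f x - f (ov x z))^2)) + 2 * (ennreal (move y z) * ennreal ((f y - f (ov y z))^2))"
   using m by (simp add: w_def same ennreal_mult[symmetric] D_def)
 qed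
 also have "... = 2 * escape f x + 2 * escape f y"
  unfolding escape_def by (simp add: nn_integral_add nn_integral_cmult)
 finally have "4 * (ennreal (1 / 4) * ennreal D) <= 4 * (2 * escape f x + 2 * escape f y)" by (rule mult_left_mono) simp
 moreover have "4 * (ennreal (1 / 4) * ennreal D) = ennreal D"
 proof -
  have "4 * (ennreal (1 / 4) * ennreal D) = ennreal 4 * ennreal (1 / 4) * ennreal D" by (simp only: mult.assoc ennreal_numeral)
  also have "ennreal 4 * ennreal (1 / 4) = 1" by (subst ennreal_mult[symmetric]) auto
  finally show ?thesis by simp
 qed
 moreover have "4 * (2 * escape f x + 2 * escape f y) = 8 * escape f x + 8 * escape f y"
  by (simp add: distrib_left mult.assoc[symmetric])
 ultimately show ?thesis by (simp add: D_def y_def)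
qed

definition local_form :: "nat => (point => real) => ennreal" where
 "local_form t f = (\<integral>\<^sup>+x. (NI u. ennreal (if \<bar>x t - u\<bar> <= sqrt h / 4 then (f x - f (x(t := u)))^2 * min (dens x) (dens (x(t := u))) else 0)) \<partial>lebn N)"

lemma component: "t < N ==> (\<lambda>x. x t) \<in> bmeas (lebn N)"
 using measurable_component_singleton[of t "{..<N}" "\<lambda>_. lborel :: real measure"] by simp

lemma upd_measurable: "t < N ==> (\<lambda>w. (fst w)(t := snd w)) \<in> lebn N \<Otimes>\<^sub>M borel \<rightarrow>\<^sub>M lebn N"
 using measurable_add_dim[of t "{..<N}" "\<lambda>_. lborel :: real measure"]
 by (simp add: split_beta' insert_absorb cong: measurable_cong_sets)

text \<open>The minimum of the densities is below the density at either end, so each escape term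
  gets its own weight; exchanging old and new value at \<open>t\<close> identifies the two. The free
  value ranges over an interval of length sqrt h / 2, and 2 * 8 / 2 = 8.\<close>

lemma local_form_le:
 assumes f[measurable]: "f \<in> bmeas (lebn N)" and t: "t \<in> B"
 shows "local_form t f <= ennreal (8 * sqrt h) * energy target K f"
proof -
 define rho where "rho = sqrt h / 4"
 have rho: "0 < rho" using h_pos by (simp add: rho_def)
 have tN: "t < N" by (rule block_less[OF t])
 note [measurable] = component[OF tN] upd_measurable[OF tN]
 define G where "G w = (if \<bar>fst w t - snd w t\<bar> <= rho then 8 * (ennreal (dens (fst w)) * escape f (fst w)) else 0)" for w :: "point \<times> point"
 have fc: "(\<lambda>w. fst w t) \<in> bmeas (lebn N \<Otimes>\<^sub>M lebn N)"
  "(\<lambda>w. snd w t) \<in> bmeas (lebn N \<Otimes>\<^sub>M lebn N)"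
  using measurable_compose[OF measurable_fst component[OF tN]] measurable_compose[OF measurable_snd component[OF tN]] by auto
 note [measurable] = this
 have Gm[measurable]: "G \<in> bmeas (lebn N \<Otimes>\<^sub>M lebn N)"
  unfolding G_def[abs_def] by measurable
 have up[measurable]: "(\<lambda>w. (fst w)(t := snd w)) \<in> lebn N \<Otimes>\<^sub>M lborel \<rightarrow>\<^sub>M lebn N"
  using upd_measurable[OF tN] by (simp cong: measurable_cong_sets)
 have ups: "(\<lambda>u. x(t := u)) \<in> borel \<rightarrow>\<^sub>M lebn N" if "x \<in> space (lebn N)" for x
  using measurable_compose[OF measurable_Pair1'[OF that] upd_measurable[OF tN]] by simp
 have "local_form t f <= (\<integral>\<^sup>+x. (NI u. G (x, x(t := u)) + G (x(t := u), x)) \<partial>lebn N)"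
  unfolding local_form_def
 proof (intro nn_integral_mono)
  fix x u assume x: "x \<in> space (lebn N)"
  show "ennreal (if \<bar>x t - u\<bar> <= sqrt h / 4 then (f x - f (x(t := u)))^2 * min (dens x) (dens (x(t := u))) else 0) <= G (x, x(t := u)) + G (x(t := u), x)"
  proof (cases "\<bar>x t - u\<bar> <= sqrt h / 4")
   case True
   define m where "m = min (dens x) (dens (x(t := u)))"
   have m: "0 <= m" using dens_pos by (simp add: m_def less_imp_le)
   have "ennreal ((f x - f (x(t := u)))^2 * m) = ennreal m * ennreal ((f x - f (x(t := u)))^2)"
    using m by (simp add: ennreal_mult mult.commute)
   also have "... <= ennreal m * (8 * escape f x + 8 * escape f (x(t := u)))"
    by (intro mult_left_mono square_diff_le_escape[OF f x t True]) simp
   also have "... = 8 * (ennreal m * escape f x) + 8 * (ennreal m * escape f (x(t := u)))"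
    by (simp only: distrib_left mult.left_commute)
   also have "... <= 8 * (ennreal (dens x) * escape f x) + 8 * (ennreal (dens (x(t := u))) * escape f (x(t := u)))"
    by (intro add_mono mult_left_mono mult_right_mono ennreal_leI) (auto simp: m_def)
   finally show ?thesis using True by (simp add: G_def m_def rho_def abs_minus_commute)
  qed simp
 qed
 also have "... = (\<integral>\<^sup>+x. (NI u. G (x, x(t := u))) + (NI u. G (x(t := u), x)) \<partial>lebn N)"
 proof (rule nn_integral_cong)
  fix x assume x: "x \<in> space (lebn N)"
  note [measurable] = ups[OF x]
  have "(\<lambda>u. G (x, x(t := u))) \<in> bmeas lborel" "(\<lambda>u. G (x(t := u), x)) \<in> bmeas lborel"
   using measurable_compose[OF measurable_Pair[OF measurable_const[OF x] ups[OF x]] Gm]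
    measurable_compose[OF measurable_Pair[OF ups[OF x] measurable_const[OF x]] Gm] by simp_all
  then show "(NI u. G (x, x(t := u)) + G (x(t := u), x)) = (NI u. G (x, x(t := u))) + (NI u. G (x(t := u), x))"
   by (rule nn_integral_add)
 qed
 also have "... = (\<integral>\<^sup>+x. (NI u. G (x, x(t := u))) \<partial>lebn N) + (\<integral>\<^sup>+x. (NI u. G (x(t := u), x)) \<partial>lebn N)"
  by (rule nn_integral_add; rule lborel.borel_measurable_nn_integral, unfold split_beta', measurable)
 also have "(\<integral>\<^sup>+x. (NI u. G (x(t := u), x)) \<partial>lebn N) = (\<integral>\<^sup>+x. (NI u. G (x, x(t := u))) \<partial>lebn N)"
  by (rule nn_integral_coordinate_swap[OF tN Gm, symmetric])
 also have "(\<integral>\<^sup>+x. (NI u. G (x, x(t := u))) \<partial>lebn N) = (\<integral>\<^sup>+x. ennreal (2 * rho) * (8 * (ennreal (dens x) * escape f x)) \<partial>lebn N)"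
 proof (rule nn_integral_cong)
  fix x
  have "(NI u. G (x, x(t := u))) = (NI u. 8 * (ennreal (dens x) * escape f x) * indicator {x t - rho..x t + rho} u)"
   by (intro nn_integral_cong) (auto simp: G_def indicator_def abs_le_iff)
  also have "... = 8 * (ennreal (dens x) * escape f x) * ennreal (2 * rho)"
   using rho by (subst nn_integral_cmult_indicator) (auto simp: emeasure_lborel_Icc)
  finally show "(NI u. G (x, x(t := u))) = ennreal (2 * rho) * (8 * (ennreal (dens x) * escape f x))" by (simp add: mult.commute)
 qed
 also have "... = ennreal (2 * rho) * (8 * energy target K f)"
  unfolding energy_escape[OF f] by (simp add: nn_integral_cmult)
 also have "... + ... = ennreal (8 * sqrt h) * energy target K f"
 proof -
  have "ennreal (8 * sqrt h) = ennreal (2 * rho * 16)" by (rule arg_cong[of _ _ ennreal]) (simp add: rho_def)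
  also have "... = ennreal (2 * rho) * ennreal 16" using rho by (intro ennreal_mult) auto
  finally have e16: "ennreal (8 * sqrt h) = ennreal (2 * rho) * 16" by (simp only: ennreal_numeral)
  have "a * (8 * b) + a * (8 * b) = a * 16 * b" for a b :: ennreal
  proof -
   have "a * (8 * b) + a * (8 * b) = a * ((8 + 8) * b)" by (simp only: distrib_left distrib_right)
   then show ?thesis by (simp add: mult.assoc)
  qed
  then show ?thesis by (simp only: e16)
 qed
 finally show ?thesis .
qed

text \<open>Mean of coordinate \<open>t\<close> given the others, by completing the square; the
  \<open>x t\<close> in the formula cancels against the gradient
  (\<open>cond_mean_upd\<close>).\<close>

definition cond_mean :: "nat => point => real" where
 "cond_mean t x = x t - grad x t / T t t"

definition cond_sd :: "nat => real" where
 "cond_sd t = 1 / sqrt (T t t)"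

lemma diag_le:
 assumes t: "t < N"
 shows "T t t <= \<Lambda>"
proof -
 have "(\<Sum>i<N. \<Sum>k<N. T i k * (if i = t then 1 else 0) * (if k = t then 1 else 0)) = T t t"
  using t by (simp add: if_distrib[of "\<lambda>a. a * _"] if_distrib[of "\<lambda>a. _ * a"] cong: if_cong)
 moreover have "(\<Sum>i<N. (if i = t then 1 else 0 :: real)^2) = 1"
  using t by (simp add: if_distrib[of "\<lambda>a. a\<^sup>2"] cong: if_cong)
 ultimately show ?thesis using form_le[of "\<lambda>k. if k = t then 1 else 0"] by simp
qed

lemma cond_mean_upd:
 assumes t: "t \<in> B"
 shows "cond_mean t (x(t := u)) = cond_mean t x"
proof -
 have "grad (x(t := u)) t = grad x t + apply_block (\<lambda>k. (x(t := u)) k - x k) t"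
  by (rule grad_diff) (use t in auto)
 also have "apply_block (\<lambda>k. (x(t := u)) k - x k) t = (\<Sum>k\<in>B. if k = t then T t t * (u - x t) else 0)"
  unfolding apply_block_def by (intro sum.cong) auto
 also have "... = T t t * (u - x t)" using t finite_block by simp
 finally have g: "grad (x(t := u)) t = grad x t + T t t * (u - x t)" .
 show ?thesis unfolding cond_mean_def g using T_diag[OF t] by (simp add: field_simps)
qed

lemma dens_upd:
 assumes t: "t \<in> B"
 obtains C where "0 < C" "\<And>u. dens (x(t := u)) = C * normal_density (cond_mean t x) (cond_sd t) u"
proof
 define C where "C = Z * exp (- (form (\<lambda>k. x k - \<mu> k) (\<lambda>k. x k - \<mu> k) - (grad x t)^2 / T t t) / 2) * sqrt (2 * pi * (cond_sd t)^2)"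
 have T0: "0 < T t t" using T_diag[OF t] by simp
 have s: "0 < cond_sd t" using T0 by (simp add: cond_sd_def)
 have s2: "(cond_sd t)^2 = 1 / T t t" using T0 by (simp add: cond_sd_def power_divide)
 show "0 < C" using Z_pos s by (simp add: C_def)
 fix u
 have e: "form (\<lambda>k. (x(t := u)) k - \<mu> k) (\<lambda>k. (x(t := u)) k - \<mu> k)
  = form (\<lambda>k. x k - \<mu> k) (\<lambda>k. x k - \<mu> k) - (grad x t)^2 / T t t + (u - cond_mean t x)^2 * T t t"
  unfolding form_upd[OF block_less[OF t]] using T0 by (simp add: cond_mean_def power2_eq_square field_simps)
 have "dens (x(t := u)) = Z * (exp (- (form (\<lambda>k. x k - \<mu> k) (\<lambda>k. x k - \<mu> k) - (grad x t)^2 / T t t) / 2) * exp (- (u - cond_mean t x)\<^sup>2 / (2 * (cond_sd t)^2)))"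
  unfolding dens_def e s2 exp_add[symmetric] by (simp add: field_simps)
 also have "... = C * normal_density (cond_mean t x) (cond_sd t) u"
  using s by (simp add: C_def normal_density_def real_sqrt_mult)
 finally show "dens (x(t := u)) = C * normal_density (cond_mean t x) (cond_sd t) u" .
qed

text \<open>Along each line in direction \<open>t\<close> the density is a multiple of a normal
  density. Both sides are homogeneous in that multiple, so
  \<open>normal_variance_le_local_energy\<close> applies line by line.\<close>

lemma gibbs_le_local_form:
 assumes f[measurable]: "f \<in> bmeas (lebn N)" and M: "\<And>x. \<bar>f x\<bar> <= M" and t: "t \<in> B"
 shows "(\<integral>\<^sup>+x. ennreal (dens x) * ennreal (normal_var (cond_mean t x) (cond_sd t) (\<lambda>u. f (x(t := u)))) \<partial>lebn N)
  <= ennreal (1088 / (sqrt h / 4) ^ 3) * local_form t f"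
proof -
 define rho where "rho = sqrt h / 4"
 define c where "c = 1088 / rho ^ 3"
 define I where "I = {..<N} - {t}"
 have tN: "t < N" by (rule block_less[OF t])
 have I: "finite I" "t \<notin> I" "insert t I = {..<N}" using tN by (auto simp: I_def)
 have rho: "0 < rho" using h_pos by (simp add: rho_def)
 have c0: "0 <= c" using rho by (simp add: c_def)
 have T1: "1 <= T t t" "0 < T t t" using T_diag[OF t] by simp_all
 have s: "0 < cond_sd t" "cond_sd t <= 1" using T1 by (simp_all add: cond_sd_def)
 \<comment> \<open>The diagonal entry is at most \<open>\<Lambda>\<close>, so
   \<open>cond_sd t\<close> is at least sqrt h and the radius sqrt h / 4 is admissible;
   \<open>T_diag\<close> is what keeps \<open>cond_sd t\<close> below 1.\<close>
 have "h * T t t <= h * \<Lambda>" using diag_le[OF tN] h_pos by simp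
 then have "h * T t t <= 1" using step_le_1 by simp
 then have "sqrt h * sqrt (T t t) <= 1" by (simp add: real_sqrt_mult[symmetric])
 then have "sqrt h <= cond_sd t" using T1 by (simp add: cond_sd_def field_simps)
 then have rho2: "rho <= 2 * cond_sd t" using s unfolding rho_def by simp
 have nv_eq: "normal_var m sd g = (EE z. (g (m + sd * z))^2) - (EE z. g (m + sd * z))^2" for m sd g
  by (simp add: normal_var_def)
 have up: "(\<lambda>u. a(t := u)) \<in> borel \<rightarrow>\<^sub>M lebn N" if a: "a \<in> space (leb I)" for a
  using measurable_component_update[OF a I(2)] unfolding I(3) by (simp cong: measurable_cong_sets)
 have upp: "(\<lambda>w. (fst w)(t := snd w)) \<in> lebn N \<Otimes>\<^sub>M lborel \<rightarrow>\<^sub>M lebn N"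
  using upd_measurable[OF tN] by (simp cong: measurable_cong_sets)
 define P where "P x = ennreal (dens x) * ennreal (normal_var (cond_mean t x) (cond_sd t) (\<lambda>u. f (x(t := u))))" for x
 define R where "R x = (NI u. ennreal (if \<bar>x t - u\<bar> <= rho then (f x - f (x(t := u)))^2 * min (dens x) (dens (x(t := u))) else 0))" for x
 have Pm: "P \<in> bmeas (lebn N)"
 proof -
  note [measurable] = component[OF tN] upp
  have [measurable]: "cond_mean t \<in> bmeas (lebn N)" unfolding cond_mean_def[abs_def] by measurable
  have "(\<lambda>x. normal_var (cond_mean t x) (cond_sd t) (\<lambda>u. f (x(t := u)))) \<in> bmeas (lebn N)"
   by (rule normal_var_measurable) (simp_all add: split_beta')
  then show ?thesis unfolding P_def[abs_def] by measurable
 qed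
 have Rm: "R \<in> bmeas (lebn N)"
 proof -
  note [measurable] = component[OF tN] upp
  show ?thesis unfolding R_def[abs_def] by (rule lborel.borel_measurable_nn_integral) (unfold split_beta', measurable)
 qed
 have "(\<integral>\<^sup>+x. P x \<partial>lebn N) = (\<integral>\<^sup>+a. (NI y. P (a(t := y))) \<partial>leb I)"
  using lborel_product.product_nn_integral_insert[OF I(1,2), of P] Pm unfolding I(3) by blast
 also have "... <= (\<integral>\<^sup>+a. ennreal c * (NI y. R (a(t := y))) \<partial>leb I)"
 proof (rule nn_integral_mono)
  fix a assume a: "a \<in> space (leb I)"
  define m where "m = cond_mean t a"
  define g where "g u = f (a(t := u))" for u
  from dens_upd[OF t, of a] obtain C where C: "0 < C" "\<And>u. dens (a(t := u)) = C * normal_density m (cond_sd t) u"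
   unfolding m_def by blast
  have gm[measurable]: "g \<in> bmeas borel"
   unfolding g_def[abs_def] by (rule measurable_compose[OF up[OF a] f])
  define v where "v = normal_var m (cond_sd t) g"
  have "(NI y. P (a(t := y))) = (NI y. (ennreal C * ennreal v) * ennreal (normal_density m (cond_sd t) y))"
   using C by (intro nn_integral_cong) (simp add: P_def cond_mean_upd[OF t] m_def[symmetric] g_def[symmetric] v_def[symmetric] ennreal_mult mult.assoc mult.commute mult.left_commute)
  also have "... = (ennreal C * ennreal v) * (NI y. ennreal (normal_density m (cond_sd t) y))"
   by (rule nn_integral_cmult) measurable
  also have "(NI y. ennreal (normal_density m (cond_sd t) y)) = 1"
   using s by (subst nn_integral_eq_integral) auto
  also have "ennreal C * ennreal v * 1 <= ennreal C * (ennreal c * local_energy (normal_density m (cond_sd t)) g rho) * 1"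
   unfolding v_def nv_eq c_def
   by (intro mult_right_mono mult_left_mono normal_variance_le_local_energy[where B = M] gm) (use M s rho rho2 in \<open>auto simp: g_def\<close>)
  also have "... = ennreal c * (ennreal C * local_energy (normal_density m (cond_sd t)) g rho)" by (simp add: mult.commute mult.left_commute)
  also have "ennreal C * local_energy (normal_density m (cond_sd t)) g rho = (NI y. R (a(t := y)))"
  proof -
   have mn: "min (C * b) (C * b') = C * min b b'" for b b' using C(1) by (simp add: min_mult_distrib_left)
   have "(NI y. R (a(t := y))) = (NI y. (NI u. ennreal C * ennreal (if \<bar>y - u\<bar> <= rho then (g y - g u)^2 * min (normal_density m (cond_sd t) y) (normal_density m (cond_sd t) u) else 0)))"
    unfolding R_def using C(1)
    by (intro nn_integral_cong) (auto simp: C(2) g_def[symmetric] mn ennreal_mult[symmetric] mult.left_commute)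
   also have "... = (NI y. ennreal C * (NI u. ennreal (if \<bar>y - u\<bar> <= rho then (g y - g u)^2 * min (normal_density m (cond_sd t) y) (normal_density m (cond_sd t) u) else 0)))"
    by (rule nn_integral_cong, rule nn_integral_cmult) measurable
   also have "... = ennreal C * local_energy (normal_density m (cond_sd t)) g rho"
    unfolding local_energy_def by (rule nn_integral_cmult) measurable
   finally show ?thesis by simp
  qed
  finally show "(NI y. P (a(t := y))) <= ennreal c * (NI y. R (a(t := y)))" .
 qed
 also have "... = ennreal c * (\<integral>\<^sup>+a. (NI y. R (a(t := y))) \<partial>leb I)"
 proof (rule nn_integral_cmult)
  have "(\<lambda>w. R ((fst w)(t := snd w))) \<in> bmeas (leb I \<Otimes>\<^sub>M lborel)"
   using measurable_compose[OF measurable_add_dim[of t I "\<lambda>_. lborel :: real measure"], unfolded I(3), OF Rm] by (simp add: split_beta')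
  then show "(\<lambda>a. (NI y. R (a(t := y)))) \<in> bmeas (leb I)"
   by (intro lborel.borel_measurable_nn_integral) (simp add: split_beta')
 qed
 also have "(\<integral>\<^sup>+a. (NI y. R (a(t := y))) \<partial>leb I) = (\<integral>\<^sup>+x. R x \<partial>lebn N)"
  using lborel_product.product_nn_integral_insert[OF I(1,2), of R] Rm unfolding I(3) by simp
 also have "... = local_form t f" by (simp add: R_def local_form_def rho_def)
 finally show ?thesis by (simp add: P_def c_def rho_def)
qed

lemma gibbs_le_energy:
 assumes f: "f \<in> bmeas (lebn N)" and M: "\<And>x. \<bar>f x\<bar> <= M" and t: "t \<in> B"
 shows "(\<integral>\<^sup>+x. ennreal (dens x) * ennreal (normal_var (cond_mean t x) (cond_sd t) (\<lambda>u. f (x(t := u)))) \<partial>lebn N)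
  <= ennreal (557056 / h) * energy target K f"
proof -
 have "(\<integral>\<^sup>+x. ennreal (dens x) * ennreal (normal_var (cond_mean t x) (cond_sd t) (\<lambda>u. f (x(t := u)))) \<partial>lebn N)
  <= ennreal (1088 / (sqrt h / 4) ^ 3) * local_form t f"
  by (rule gibbs_le_local_form[OF f M t])
 also have "... <= ennreal (1088 / (sqrt h / 4) ^ 3) * (ennreal (8 * sqrt h) * energy target K f)"
  by (intro mult_left_mono local_form_le[OF f t]) simp
 also have "... = ennreal (1088 / (sqrt h / 4) ^ 3 * (8 * sqrt h)) * energy target K f"
  using h_pos by (subst ennreal_mult) (auto simp: mult.assoc)
 \<comment> \<open>1088 * 4^3 * 8 = 557056.\<close>
 also have "1088 / (sqrt h / 4) ^ 3 * (8 * sqrt h) = 557056 / h"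
 proof -
  define r where "r = sqrt h"
  have r: "0 < r" "h = r * r" using h_pos by (auto simp: r_def)
  show ?thesis unfolding r_def[symmetric] unfolding r(2) using r(1) by (simp add: field_simps power3_eq_cube)
 qed
 finally show ?thesis .
qed

end

section \<open>Positivity of the block update\<close>

definition block_form :: "nat => nat set => (point \<times> point => ennreal) => (point => ennreal) => (point => ennreal) => ennreal" where
 "block_form N B H u v = (\<integral>\<^sup>+w. H (fst w, override_on (fst w) (snd w) B) * (u (fst w) * v (override_on (fst w) (snd w) B))
  \<partial>(lebn N \<Otimes>\<^sub>M leb B))"

text \<open>Positive semidefiniteness of the kernel \<open>H\<close>, tested on \<open>u - v\<close> and rearranged so that only
 nonnegative integrals occur.\<close>

definition pos_form :: "nat => nat set => (point \<times> point => ennreal) => bool" where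
 "pos_form N B H \<longleftrightarrow> H \<in> bmeas (lebn N \<Otimes>\<^sub>M lebn N) \<and>
  (\<forall>u\<in>bmeas (lebn N). \<forall>v\<in>bmeas (lebn N).
   block_form N B H u v + block_form N B H v u <= block_form N B H u u + block_form N B H v v)"

lemma std_normal_mgf: "(EN z. ennreal (exp (t * z))) = ennreal (exp (t\<^sup>2 / 2))"
proof -
 have e: "sdens z * exp (t * z) = exp (t\<^sup>2 / 2) * normal_density t 1 z" for z
  unfolding normal_density_def
  by (simp add: exp_add[symmetric]) (simp add: power2_eq_square field_simps)
 have "(EN z. ennreal (exp (t * z))) = (NI z. ennreal (sdens z) * ennreal (exp (t * z)))"
  by (rule nn_integral_density) auto
 also have "... = (NI z. ennreal (exp (t\<^sup>2 / 2)) * ennreal (normal_density t 1 z))"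
  by (intro nn_integral_cong) (simp add: ennreal_mult[symmetric] e)
 also have "... = ennreal (exp (t\<^sup>2 / 2)) * (NI z. ennreal (normal_density t 1 z))"
  by (rule nn_integral_cmult) auto
 also have "(NI z. ennreal (normal_density t 1 z)) = 1"
  by (subst nn_integral_eq_integral) auto
 finally show ?thesis by simp
qed

context
 fixes N :: nat and B :: "nat set"
 assumes B: "B \<subseteq> {..<N}"
begin

lemma finite_block': "finite B" using B by (rule finite_subset) simp

lemma pair_sigma: "sigma_finite_measure (lebn N \<Otimes>\<^sub>M leb B)"
proof -
 interpret pair_sigma_finite "lebn N" "leb B"
  by (intro pair_sigma_finite.intro lborel_product.sigma_finite finite_block') simp
 show ?thesis by (rule sigma_finite_measure_axioms)
qed

lemma block_form_iterated:
 assumes [measurable]: "H \<in> bmeas (lebn N \<Otimes>\<^sub>M lebn N)"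
  "u \<in> bmeas (lebn N)" "v \<in> bmeas (lebn N)"
 shows "block_form N B H u v = (\<integral>\<^sup>+x. \<integral>\<^sup>+z. H (x, override_on x z B) * (u x * v (override_on x z B)) \<partial>leb B \<partial>lebn N)"
proof -
 note [measurable] = override_on_measurable[OF B]
 show ?thesis unfolding block_form_def
  using sigma_finite_measure.nn_integral_fst[OF lborel_product.sigma_finite[OF finite_block'],
   of "\<lambda>w. H (fst w, override_on (fst w) (snd w) B) * (u (fst w) * v (override_on (fst w) (snd w) B))" "lebn N"] by simp
qed

text \<open>For the constant kernel the form is the integral, over the coordinates outside the
  block, of \<open>U u * U v\<close> with \<open>U\<close> integrating the block out: a Gram
  form.\<close>

lemma pos_form_one: "pos_form N B (\<lambda>_. 1)"
 unfolding pos_form_def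
proof (intro conjI ballI)
 fix u v :: "point => ennreal"
 assume u[measurable]: "u \<in> bmeas (lebn N)" and v[measurable]: "v \<in> bmeas (lebn N)"
 define R where "R = {..<N} - B"
 have RB: "R \<union> B = {..<N}" using B by (auto simp: R_def)
 define U where "U f a = (\<integral>\<^sup>+b. f (merge R B (a, b)) \<partial>leb B)" for f :: "point => ennreal" and a
 have mm[measurable]: "merge R B \<in> leb R \<Otimes>\<^sub>M leb B \<rightarrow>\<^sub>M lebn N"
  using measurable_merge[of R B "\<lambda>_. lborel :: real measure"] unfolding RB .
 have Um[measurable]: "U f \<in> bmeas (leb R)" if [measurable]: "f \<in> bmeas (lebn N)" for f
  unfolding U_def[abs_def]
  by (rule sigma_finite_measure.borel_measurable_nn_integral[OF lborel_product.sigma_finite[OF finite_block']]) (simp add: split_beta')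
 have e: "block_form N B (\<lambda>_. 1) f g = (\<integral>\<^sup>+a. U f a * U g a \<partial>leb R)"
  if [measurable]: "f \<in> bmeas (lebn N)" "g \<in> bmeas (lebn N)" for f g
 proof -
  have "block_form N B (\<lambda>_. 1) f g = (\<integral>\<^sup>+x. \<integral>\<^sup>+z. (\<lambda>w. f (fst w) * g (snd w)) (x, override_on x z B) \<partial>leb B \<partial>lebn N)"
   by (subst block_form_iterated) auto
  also have "... = (\<integral>\<^sup>+a. \<integral>\<^sup>+b. \<integral>\<^sup>+z. (\<lambda>w. f (fst w) * g (snd w)) (merge R B (a, b), merge R B (a, z)) \<partial>leb B \<partial>leb B \<partial>leb R)"
   unfolding R_def by (rule nn_integral_override_fold[OF B]) auto
  also have "... = (\<integral>\<^sup>+a. U f a * U g a \<partial>leb R)"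
  proof (rule nn_integral_cong)
   fix a assume a: "a \<in> space (leb R)"
   have s: "(\<lambda>b. merge R B (a, b)) \<in> leb B \<rightarrow>\<^sub>M lebn N"
    using measurable_compose[OF measurable_Pair1'[OF a] mm] .
   note [measurable] = measurable_compose[OF s that(1)] measurable_compose[OF s that(2)]
   have "(\<integral>\<^sup>+b. \<integral>\<^sup>+z. f (merge R B (a, b)) * g (merge R B (a, z)) \<partial>leb B \<partial>leb B)
    = (\<integral>\<^sup>+b. f (merge R B (a, b)) * U g a \<partial>leb B)"
    unfolding U_def by (rule nn_integral_cong, rule nn_integral_cmult) measurable
   also have "... = U f a * U g a" unfolding U_def by (rule nn_integral_multc) measurable
   finally show "(\<integral>\<^sup>+b. \<integral>\<^sup>+z. (\<lambda>w. f (fst w) * g (snd w)) (merge R B (a, b), merge R B (a, z)) \<partial>leb B \<partial>leb B) = U f a * U g a"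
    by simp
  qed
  finally show ?thesis .
 qed
 show "block_form N B (\<lambda>_. 1) u v + block_form N B (\<lambda>_. 1) v u <= block_form N B (\<lambda>_. 1) u u + block_form N B (\<lambda>_. 1) v v"
  unfolding e[OF u v] e[OF v u] e[OF u u] e[OF v v]
  by (subst (1 2) nn_integral_add[symmetric]) (auto intro!: nn_integral_mono ennreal_cross_le)
qed simp

text \<open>Schur product principle: for fixed \<open>\<zeta>\<close> the extra factor only rescales
  the two test functions, and averaging over \<open>\<zeta>\<close> preserves the
  inequality.\<close>

lemma pos_form_mixture:
 assumes H: "pos_form N B H" and \<nu>: "sigma_finite_measure \<nu>"
  and \<phi>[measurable]: "\<phi> \<in> bmeas (\<nu> \<Otimes>\<^sub>M lebn N)"
 shows "pos_form N B (\<lambda>w. H w * (\<integral>\<^sup>+\<zeta>. \<phi> (\<zeta>, fst w) * \<phi> (\<zeta>, snd w) \<partial>\<nu>))"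
proof -
 interpret \<nu>: sigma_finite_measure \<nu> by (rule \<nu>)
 let ?P = "lebn N \<Otimes>\<^sub>M leb B"
 interpret P: sigma_finite_measure ?P by (rule pair_sigma)
 interpret PP: pair_sigma_finite \<nu> ?P by standard
 note [measurable] = override_on_measurable[OF B]
 have Hm[measurable]: "H \<in> bmeas (lebn N \<Otimes>\<^sub>M lebn N)" using H by (simp add: pos_form_def)
 define y where "y w = override_on (fst w) (snd w) B" for w :: "point \<times> point"
 have ym[measurable]: "y \<in> ?P \<rightarrow>\<^sub>M lebn N" unfolding y_def by measurable
 let ?H = "\<lambda>w. H w * (\<integral>\<^sup>+\<zeta>. \<phi> (\<zeta>, fst w) * \<phi> (\<zeta>, snd w) \<partial>\<nu>)"
 have H'm[measurable]: "?H \<in> bmeas (lebn N \<Otimes>\<^sub>M lebn N)"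
 proof -
  have "(\<lambda>w. \<integral>\<^sup>+\<zeta>. \<phi> (\<zeta>, fst w) * \<phi> (\<zeta>, snd w) \<partial>\<nu>) \<in> bmeas (lebn N \<Otimes>\<^sub>M lebn N)"
   by (rule \<nu>.borel_measurable_nn_integral) (unfold split_beta', measurable)
  then show ?thesis by measurable
 qed
 define G where "G f g \<zeta> = block_form N B H (\<lambda>x. \<phi> (\<zeta>, x) * f x) (\<lambda>x. \<phi> (\<zeta>, x) * g x)" for f g \<zeta>
 have Gm: "G f g \<in> bmeas \<nu>"
  and mix: "block_form N B ?H f g = (\<integral>\<^sup>+\<zeta>. G f g \<zeta> \<partial>\<nu>)"
  if [measurable]: "f \<in> bmeas (lebn N)" "g \<in> bmeas (lebn N)" for f g
 proof -
  have Fm: "(\<lambda>(\<zeta>, w). H (fst w, y w) * ((\<phi> (\<zeta>, fst w) * f (fst w)) * (\<phi> (\<zeta>, y w) * g (y w)))) \<in> bmeas (\<nu> \<Otimes>\<^sub>M ?P)"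
   unfolding split_beta' by measurable
  show "G f g \<in> bmeas \<nu>"
   unfolding G_def[abs_def] block_form_def y_def[symmetric] by (rule P.borel_measurable_nn_integral[OF Fm])
  have "block_form N B ?H f g = (\<integral>\<^sup>+w. \<integral>\<^sup>+\<zeta>. H (fst w, y w) * ((\<phi> (\<zeta>, fst w) * f (fst w)) * (\<phi> (\<zeta>, y w) * g (y w))) \<partial>\<nu> \<partial>?P)"
   unfolding block_form_def y_def[symmetric]
  proof (rule nn_integral_cong)
   fix w assume w: "w \<in> space ?P"
   have 1: "fst w \<in> space (lebn N)" "y w \<in> space (lebn N)"
    using w measurable_space[OF ym w] by (auto simp: space_pair_measure)
   have [measurable]: "(\<lambda>\<zeta>. \<phi> (\<zeta>, fst w)) \<in> bmeas \<nu>" "(\<lambda>\<zeta>. \<phi> (\<zeta>, y w)) \<in> bmeas \<nu>"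
    using measurable_compose[OF measurable_Pair2'[OF 1(1)] \<phi>] measurable_compose[OF measurable_Pair2'[OF 1(2)] \<phi>] by auto
   have "H (fst w, y w) * (\<integral>\<^sup>+\<zeta>. \<phi> (\<zeta>, fst w) * \<phi> (\<zeta>, y w) \<partial>\<nu>) * (f (fst w) * g (y w))
    = (H (fst w, y w) * (f (fst w) * g (y w))) * (\<integral>\<^sup>+\<zeta>. \<phi> (\<zeta>, fst w) * \<phi> (\<zeta>, y w) \<partial>\<nu>)" by (simp only: mult.assoc mult.commute mult.left_commute)
   also have "... = (\<integral>\<^sup>+\<zeta>. (H (fst w, y w) * (f (fst w) * g (y w))) * (\<phi> (\<zeta>, fst w) * \<phi> (\<zeta>, y w)) \<partial>\<nu>)"
    by (rule nn_integral_cmult[symmetric]) measurable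
   also have "... = (\<integral>\<^sup>+\<zeta>. H (fst w, y w) * ((\<phi> (\<zeta>, fst w) * f (fst w)) * (\<phi> (\<zeta>, y w) * g (y w))) \<partial>\<nu>)"
    by (rule nn_integral_cong) (simp only: mult.assoc mult.commute mult.left_commute)
   finally show "H (fst w, y w) * (\<integral>\<^sup>+\<zeta>. \<phi> (\<zeta>, fst (fst w, y w)) * \<phi> (\<zeta>, snd (fst w, y w)) \<partial>\<nu>) * (f (fst w) * g (y w))
    = (\<integral>\<^sup>+\<zeta>. H (fst w, y w) * ((\<phi> (\<zeta>, fst w) * f (fst w)) * (\<phi> (\<zeta>, y w) * g (y w))) \<partial>\<nu>)" by simp
  qed
  also have "... = (\<integral>\<^sup>+\<zeta>. G f g \<zeta> \<partial>\<nu>)"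
   unfolding G_def block_form_def y_def[symmetric] by (rule PP.Fubini'[OF Fm])
  finally show "block_form N B ?H f g = (\<integral>\<^sup>+\<zeta>. G f g \<zeta> \<partial>\<nu>)" .
 qed
 show ?thesis
  unfolding pos_form_def
 proof (intro conjI ballI H'm)
  fix u v :: "point => ennreal"
  assume u: "u \<in> bmeas (lebn N)" and v: "v \<in> bmeas (lebn N)"
  show "block_form N B ?H u v + block_form N B ?H v u <= block_form N B ?H u u + block_form N B ?H v v"
   unfolding mix[OF u v] mix[OF v u] mix[OF u u] mix[OF v v]
  proof (subst (1 2) nn_integral_add[symmetric]; (intro Gm u v)?)
   show "(\<integral>\<^sup>+\<zeta>. G u v \<zeta> + G v u \<zeta> \<partial>\<nu>) <= (\<integral>\<^sup>+\<zeta>. G u u \<zeta> + G v v \<zeta> \<partial>\<nu>)"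
   proof (rule nn_integral_mono)
    fix \<zeta> assume z: "\<zeta> \<in> space \<nu>"
    have [measurable]: "(\<lambda>x. \<phi> (\<zeta>, x)) \<in> bmeas (lebn N)"
     using measurable_compose[OF measurable_Pair1'[OF z] \<phi>] .
    have "(\<lambda>x. \<phi> (\<zeta>, x) * u x) \<in> bmeas (lebn N)" "(\<lambda>x. \<phi> (\<zeta>, x) * v x) \<in> bmeas (lebn N)"
     using u v by measurable
    then show "G u v \<zeta> + G v u \<zeta> <= G u u \<zeta> + G v v \<zeta>" using H unfolding G_def pos_form_def by blast
   qed
  qed
 qed
qed

text \<open>A mixture whose family does not depend on the parameter; any probability measure serves
  for it.\<close>

lemma pos_form_product:
 assumes H: "pos_form N B H" and g[measurable]: "g \<in> bmeas (lebn N)"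
 shows "pos_form N B (\<lambda>w. H w * (g (fst w) * g (snd w)))"
 using pos_form_mixture[OF H std_normal.sigma_finite_measure_axioms, of "\<lambda>w. g (snd w)"] by (simp add: std_normal.emeasure_space_1)

text \<open>The minimum of two nonnegative numbers is the length of the common part of the intervals
  from 0, hence a mixture of products of indicators.\<close>

lemma pos_form_min:
 assumes H: "pos_form N B H" and a[measurable]: "a \<in> bmeas (lebn N)" and a0: "\<And>x. 0 <= a x"
 shows "pos_form N B (\<lambda>w. H w * ennreal (min (a (fst w)) (a (snd w))))"
proof -
 define \<phi> where "\<phi> w = (if 0 <= fst w \<and> fst w <= a (snd w) then 1 else 0 :: ennreal)" for w :: "real \<times> point"
 have "\<phi> \<in> bmeas (lborel \<Otimes>\<^sub>M lebn N)" unfolding \<phi>_def[abs_def] by measurable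
 from pos_form_mixture[OF H lborel.sigma_finite_measure_axioms this]
 have "pos_form N B (\<lambda>w. H w * (NI \<zeta>. \<phi> (\<zeta>, fst w) * \<phi> (\<zeta>, snd w)))" .
 moreover have "(NI \<zeta>. \<phi> (\<zeta>, x) * \<phi> (\<zeta>, y)) = ennreal (min (a x) (a y))" for x y
 proof -
  have "(NI \<zeta>. \<phi> (\<zeta>, x) * \<phi> (\<zeta>, y)) = (NI \<zeta>. indicator {0..min (a x) (a y)} \<zeta>)"
   by (intro nn_integral_cong) (auto simp: \<phi>_def indicator_def)
  also have "... = ennreal (min (a x) (a y))" using a0 by (simp add: emeasure_lborel_Icc)
  finally show ?thesis .
 qed
 ultimately show ?thesis by simp
qed

text \<open>A Gaussian mixture of products: the moment generating function at sqrt c (l x + l y)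
  produces the cross term, and the prefactors of \<open>\<phi>\<close> cancel the two
  squares.\<close>

lemma pos_form_exp:
 assumes H: "pos_form N B H" and l[measurable]: "l \<in> bmeas (lebn N)" and c: "0 <= c"
 shows "pos_form N B (\<lambda>w. H w * ennreal (exp (c * (l (fst w) * l (snd w)))))"
proof -
 define \<phi> where "\<phi> w = ennreal (exp (- c * (l (snd w))^2 / 2) * exp (sqrt c * l (snd w) * fst w))" for w :: "real \<times> point"
 have "\<phi> \<in> bmeas (std_normal \<Otimes>\<^sub>M lebn N)" unfolding \<phi>_def[abs_def] by measurable
 from pos_form_mixture[OF H std_normal.sigma_finite_measure_axioms this]
 have "pos_form N B (\<lambda>w. H w * (EN \<zeta>. \<phi> (\<zeta>, fst w) * \<phi> (\<zeta>, snd w)))" .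
 moreover have "(EN \<zeta>. \<phi> (\<zeta>, x) * \<phi> (\<zeta>, y)) = ennreal (exp (c * (l x * l y)))" for x y
 proof -
  define t where "t = sqrt c * (l x + l y)"
  have t2: "t\<^sup>2 = c * (l x + l y)^2" using c by (simp add: t_def power_mult_distrib)
  have "(EN \<zeta>. \<phi> (\<zeta>, x) * \<phi> (\<zeta>, y))
   = (EN \<zeta>. ennreal (exp (- c * (l x)^2 / 2 - c * (l y)^2 / 2)) * ennreal (exp (t * \<zeta>)))"
   by (intro nn_integral_cong) (simp add: \<phi>_def ennreal_mult[symmetric] exp_add[symmetric] t_def, simp add: algebra_simps)
  also have "... = ennreal (exp (- c * (l x)^2 / 2 - c * (l y)^2 / 2)) * ennreal (exp (t\<^sup>2 / 2))"
   by (subst nn_integral_cmult) (auto simp: std_normal_mgf)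
  also have "... = ennreal (exp (c * (l x * l y)))"
   by (simp add: ennreal_mult[symmetric] exp_add[symmetric] t2) (simp add: power2_eq_square field_simps)
  finally show ?thesis .
 qed
 ultimately show ?thesis by simp
qed

end

text \<open>\<open>decomposition\<close> certifies that I/h - T is positive semidefinite by an
  explicit sum of nonnegative rank-one terms, each of which can be fed to
  \<open>pos_form_exp\<close>.\<close>

locale gauss_psd_update = gauss_update +
 fixes n :: nat and c :: "nat => real" and L :: "nat => nat => real"
 assumes c_nonneg: "\<And>j. 0 <= c j"
  and decomposition: "\<And>i k. i < N ==> k < N ==> (if i = k then 1 / h else 0) - T i k = (\<Sum>j<n. c j * (L j i * L j k))"
begin

definition lin :: "nat => point => real" where
 "lin j x = (\<Sum>i<N. L j i * (x i - \<mu> i))"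

lemma lin_measurable: "lin j \<in> bmeas (lebn N)"
 unfolding lin_def[abs_def] by (intro borel_measurable_sum borel_measurable_times borel_measurable_diff borel_measurable_const component) auto

lemma lin_sum: "(\<Sum>j<n. c j * (lin j x * lin j y)) = (\<Sum>i<N. (x i - \<mu> i) * (y i - \<mu> i)) / h - form (\<lambda>i. x i - \<mu> i) (\<lambda>i. y i - \<mu> i)"
proof -
 define v where "v i = x i - \<mu> i" for i
 define w where "w i = y i - \<mu> i" for i
 have pr: "(\<Sum>i<N. L j i * v i) * (\<Sum>i<N. L j i * w i) = (\<Sum>i<N. \<Sum>k<N. (L j i * L j k) * (v i * w k))" for j
  unfolding sum_product by (intro sum.cong refl) (simp add: mult.assoc mult.left_commute)
 have "(\<Sum>j<n. c j * (lin j x * lin j y)) = (\<Sum>j<n. \<Sum>i<N. \<Sum>k<N. c j * (L j i * L j k) * (v i * w k))"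
  unfolding lin_def v_def[symmetric] w_def[symmetric] pr by (simp add: sum_distrib_left mult.assoc)
 also have "... = (\<Sum>i<N. \<Sum>j<n. \<Sum>k<N. c j * (L j i * L j k) * (v i * w k))" by (rule sum.swap)
 also have "... = (\<Sum>i<N. \<Sum>k<N. \<Sum>j<n. c j * (L j i * L j k) * (v i * w k))" by (intro sum.cong refl sum.swap)
 also have "... = (\<Sum>i<N. \<Sum>k<N. ((if i = k then 1 / h else 0) - T i k) * (v i * w k))"
  by (intro sum.cong refl) (simp add: decomposition sum_distrib_right)
 also have "... = (\<Sum>i<N. \<Sum>k<N. (if i = k then v i * w k / h else 0) - T i k * v i * w k)"
  by (intro sum.cong refl) (simp add: left_diff_distrib mult.assoc)
 also have "... = (\<Sum>i<N. v i * w i) / h - form v w"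
  by (simp add: sum_subtractf form_def sum_divide_distrib)
 finally show ?thesis unfolding v_def[abs_def] w_def[abs_def] .
qed

lemma pos_form_lin: "pos_form N B (\<lambda>w. ennreal (exp (\<Sum>j<m. c j / 2 * (lin j (fst w) * lin j (snd w)))))"
proof (induction m)
 case 0
 show ?case using pos_form_one[OF block_subset] by simp
next
 case (Suc m)
 show ?case
  using pos_form_exp[OF block_subset Suc.IH lin_measurable[of m], of "c m / 2"] c_nonneg[of m]
  by (simp add: ennreal_mult[symmetric] exp_add[symmetric])
qed

text \<open>The exponent of the symmetric flow splits into one function of each point and half of
  the bilinear form of I/h - T. The first two are a product, the last is a sum of the terms in
  \<open>decomposition\<close>, and the acceptance contributes a minimum, so the accepted flow is
  assembled from the constant kernel by the rules above.\<close>

lemma psd_update: "psd_kernel target K"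
proof (rule mala.psd_kernel_target)
 define C where "C = Z * (1 / sqrt (2 * pi * (2 * h))) ^ card B"
 define g where "g x = sqrt C * exp (- (\<Sum>i<N. (x i - \<mu> i)^2) / (4 * h))" for x
 define a where "a x = exp (- (h / 4) * grad_norm x)" for x
 define H where "H w = ennreal (exp (\<Sum>j<n. c j / 2 * (lin j (fst w) * lin j (snd w)))) * (ennreal (g (fst w)) * ennreal (g (snd w))) * ennreal (min (a (fst w)) (a (snd w)))" for w
 have C: "0 < C" using Z_pos h_pos by (simp add: C_def)
 have gm: "(\<lambda>x. ennreal (g x)) \<in> bmeas (lebn N)"
 proof -
  have "(\<lambda>x. \<Sum>i<N. (x i - \<mu> i)^2) \<in> bmeas (lebn N)"
   by (intro borel_measurable_sum borel_measurable_power borel_measurable_diff borel_measurable_const component) auto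
  then show ?thesis unfolding g_def by measurable
 qed
 have am: "a \<in> bmeas (lebn N)" unfolding a_def[abs_def] by measurable
 have H: "pos_form N B H"
  unfolding H_def[abs_def]
  by (rule pos_form_min[OF block_subset pos_form_product[OF block_subset pos_form_lin gm] am]) (simp add: a_def)
 have flow: "ennreal (dens x * pden x z * acc x (ov x z)) = H (x, ov x z)" for x z
 proof -
  define y where "y = ov x z"
  have off: "\<And>i. i < N ==> i \<notin> B ==> y i = x i" by (simp add: y_def override_on_def)
  have p: "pden x z = pden x y" unfolding y_def by (rule mala.prop_density_ov[symmetric])
  have f1: "dens x * pden x y = sym_flow x y * a x" unfolding a_def by (rule flow_eq[OF off])
  have f2: "dens y * pden y x = sym_flow x y * a y" unfolding a_def using flow_eq[of x y] off by (simp add: sym_flow_sym)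
  have "dens x * pden x z * acc x y = min (sym_flow x y * a x) (sym_flow x y * a y)"
   using mala.accept_flow[of x y] unfolding p f1 f2 .
  also have "... = sym_flow x y * min (a x) (a y)" using sym_flow_pos[of x y] by (simp add: min_mult_distrib_left)
  also have "sym_flow x y = exp (\<Sum>j<n. c j / 2 * (lin j x * lin j y)) * (g x * g y)"
  proof -
   define X where "X = (\<Sum>i<N. (x i - \<mu> i)^2)"
   define Y where "Y = (\<Sum>i<N. (y i - \<mu> i)^2)"
   define S where "S = (\<Sum>i<N. (x i - \<mu> i) * (y i - \<mu> i))"
   define F where "F = form (\<lambda>i. x i - \<mu> i) (\<lambda>i. y i - \<mu> i)"
   \<comment> \<open>The points agree off the block, so the sum may run over all coordinates; only
     then do the square terms depend on a single point each.\<close>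
   have "(\<Sum>i\<in>B. (y i - x i)^2) = (\<Sum>i<N. (y i - x i)^2)"
    using block_subset off by (intro sum.mono_neutral_left) auto
   also have "... = (\<Sum>i<N. (x i - \<mu> i)^2 + (y i - \<mu> i)^2 - 2 * ((x i - \<mu> i) * (y i - \<mu> i)))"
    by (intro sum.cong refl) (simp add: power2_eq_square algebra_simps)
   also have "... = X + Y - 2 * S" by (simp add: X_def Y_def S_def sum.distrib sum_subtractf sum_distrib_left)
   finally have d: "(\<Sum>i\<in>B. (y i - x i)^2) = X + Y - 2 * S" .
   have s: "(\<Sum>j<n. c j / 2 * (lin j x * lin j y)) = (S / h - F) / 2"
    using lin_sum[of x y] unfolding S_def[symmetric] F_def[symmetric] by (simp add: sum_divide_distrib[symmetric])
   have "sym_flow x y = C * exp (- (X + Y - 2 * S) / (4 * h) - F / 2)"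
    unfolding sym_flow_def C_def d F_def form_sym[of "\<lambda>i. y i - \<mu> i"] ..
   also have "- (X + Y - 2 * S) / (4 * h) - F / 2 = (S / h - F) / 2 + (- X / (4 * h) + - Y / (4 * h))"
    using h_pos by (simp add: field_simps)
   also have "C * exp ... = exp ((S / h - F) / 2) * ((sqrt C * exp (- X / (4 * h))) * (sqrt C * exp (- Y / (4 * h))))"
   proof -
    have "sqrt C * sqrt C = C" using C by simp
    moreover have "p * ((sqrt C * q) * (sqrt C * r)) = (sqrt C * sqrt C) * (p * (q * r))" for p q r by (simp only: mult.assoc mult.commute mult.left_commute)
    ultimately show ?thesis unfolding exp_add by simp
   qed
   finally show ?thesis unfolding s g_def X_def Y_def .
  qed
  finally have e: "dens x * pden x z * acc x y = exp (\<Sum>j<n. c j / 2 * (lin j x * lin j y)) * (g x * g y) * min (a x) (a y)" .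
  have "0 <= g x" "0 <= g y" "0 <= min (a x) (a y)" using C by (auto simp: g_def a_def)
  then show ?thesis unfolding y_def[symmetric] e H_def by (simp add: ennreal_mult)
 qed
 fix u v :: "point => ennreal"
 assume uv: "u \<in> bmeas (lebn N)" "v \<in> bmeas (lebn N)"
 have Hm: "H \<in> bmeas (lebn N \<Otimes>\<^sub>M lebn N)" using H by (simp add: pos_form_def)
 have "block_form N B H u v + block_form N B H v u <= block_form N B H u u + block_form N B H v v"
  using H uv by (simp add: pos_form_def)
 then show "(\<integral>\<^sup>+x. \<integral>\<^sup>+z. ennreal (dens x * pden x z * acc x (ov x z)) * (u x * v (ov x z)) \<partial>leb B \<partial>lebn N)
  + (\<integral>\<^sup>+x. \<integral>\<^sup>+z. ennreal (dens x * pden x z * acc x (ov x z)) * (v x * u (ov x z)) \<partial>leb B \<partial>lebn N)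
  <= (\<integral>\<^sup>+x. \<integral>\<^sup>+z. ennreal (dens x * pden x z * acc x (ov x z)) * (u x * u (ov x z)) \<partial>leb B \<partial>lebn N)
  + (\<integral>\<^sup>+x. \<integral>\<^sup>+z. ennreal (dens x * pden x z * acc x (ov x z)) * (v x * v (ov x z)) \<partial>leb B \<partial>lebn N)"
  unfolding flow block_form_iterated[OF block_subset Hm uv(1,2)] block_form_iterated[OF block_subset Hm uv(2,1)]
   block_form_iterated[OF block_subset Hm uv(1,1)] block_form_iterated[OF block_subset Hm uv(2,2)] .
qed

end

section \<open>The autoregressive precision matrix\<close>

lemma sum_lessThan_add: "(\<Sum>j<m + n. f j) = (\<Sum>j<m. f j) + (\<Sum>j<n. f (m + j))" for f :: "nat => 'a::comm_monoid_add"
 by (induction n) (simp_all add: add.assoc)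

context ar1_chain
begin

definition innov :: "nat => point => real" where
 "innov t v = v t - (if t = 0 then 0 else \<phi> * v (t - 1))"

definition ell :: "nat => nat => real" where
 "ell t i = (if i = t then 1 else if Suc i = t then - \<phi> else 0)"

text \<open>The innovations are independent with variances \<open>(sd t)^2\<close>, so the precision
  matrix factorises as L^T S^-1 L, where \<open>ell t\<close> is row t of L.\<close>

definition prec :: "nat => nat => nat => real" where
 "prec N i k = (\<Sum>t<N. ell t i * ell t k / (sd t)^2)"

text \<open>The maximum of the Toeplitz symbol (1 + \<phi>^2 - 2 \<phi> cos) / (1 - \<phi>^2) of the
  precision, hence an upper bound of its spectrum.\<close>

definition bound :: real where
 "bound = (1 + \<bar>\<phi>\<bar>) / (1 - \<bar>\<phi>\<bar>)"

lemma sum_ell: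
 assumes t: "t < N"
 shows "(\<Sum>i<N. ell t i * v i) = innov t v"
proof (cases t)
 case 0
 have "(\<Sum>i<N. ell t i * v i) = (\<Sum>i<N. if i = 0 then v 0 else 0)" unfolding 0 by (intro sum.cong refl) (auto simp: ell_def)
 then show ?thesis using t by (simp add: 0 innov_def)
next
 case (Suc u)
 have "(\<Sum>i<N. ell t i * v i) = (\<Sum>i<N. (if i = t then v t else 0) + (if i = u then - \<phi> * v u else 0))"
  unfolding Suc by (intro sum.cong refl) (auto simp: ell_def)
 also have "... = v t + - \<phi> * v u" unfolding sum.distrib using t Suc by simp
 finally show ?thesis by (simp add: Suc innov_def)
qed

lemma sum_ell_column:
 assumes t: "t < N"
 shows "(\<Sum>r<N. ell r t * g r) = g t + (if Suc t < N then - \<phi> * g (Suc t) else 0)"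
proof -
 have "(\<Sum>r<N. ell r t * g r) = (\<Sum>r<N. (if r = t then g t else 0) + (if r = Suc t then - \<phi> * g (Suc t) else 0))"
  by (intro sum.cong refl) (auto simp: ell_def)
 also have "... = g t + (if Suc t < N then - \<phi> * g (Suc t) else 0)"
  unfolding sum.distrib using t by (simp add: sum.delta')
 finally show ?thesis .
qed

lemma prec_form: "(\<Sum>i<N. \<Sum>k<N. prec N i k * v i * w k) = (\<Sum>t<N. innov t v * innov t w / (sd t)^2)"
proof -
 have "(\<Sum>i<N. \<Sum>k<N. prec N i k * v i * w k) = (\<Sum>i<N. \<Sum>k<N. \<Sum>t<N. (ell t i * v i) * (ell t k * w k) / (sd t)^2)"
  unfolding prec_def sum_distrib_right by (intro sum.cong refl) simp
 also have "... = (\<Sum>i<N. \<Sum>t<N. \<Sum>k<N. (ell t i * v i) * (ell t k * w k) / (sd t)^2)" by (intro sum.cong refl sum.swap)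
 also have "... = (\<Sum>t<N. \<Sum>i<N. \<Sum>k<N. (ell t i * v i) * (ell t k * w k) / (sd t)^2)" by (rule sum.swap)
 also have "... = (\<Sum>t<N. (\<Sum>i<N. ell t i * v i) * (\<Sum>k<N. ell t k * w k) / (sd t)^2)"
  unfolding sum_product sum_divide_distrib ..
 also have "... = (\<Sum>t<N. innov t v * innov t w / (sd t)^2)" by (intro sum.cong refl) (simp add: sum_ell)
 finally show ?thesis .
qed

text \<open>Rank-one vectors that absorb the coupling of neighbouring sites. The sign of
  \<open>\<phi>\<close> is chosen so that they enter the precision with a negative coefficient, and
  thus \<open>\<kappa>\<close> I minus the precision with a positive one.\<close>

definition bump :: "nat => nat => real" where
 "bump t i = (if i = t then 1 else if Suc i = t then sgn \<phi> else 0)"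

definition bump_weight :: "nat => real" where
 "bump_weight t = (if t = 0 then 0 else \<bar>\<phi>\<bar> / (1 - \<phi>\<^sup>2))"

definition diag_weight :: "nat => nat => real" where
 "diag_weight N i = (if i = 0 then 1 else 1 / (1 - \<bar>\<phi>\<bar>)) + (if Suc i < N then \<bar>\<phi>\<bar> / (1 - \<bar>\<phi>\<bar>) else 0)"

lemma phi_factor: "1 - \<phi>\<^sup>2 = (1 - \<bar>\<phi>\<bar>) * (1 + \<bar>\<phi>\<bar>)"
proof -
 have "\<phi>\<^sup>2 = \<bar>\<phi>\<bar> * \<bar>\<phi>\<bar>" by (simp add: power2_eq_square)
 then show ?thesis by (simp add: algebra_simps)
qed

lemma phi_ratio: "1 / (1 - \<bar>\<phi>\<bar>) = (1 + \<bar>\<phi>\<bar>) / (1 - \<phi>\<^sup>2)"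
proof -
 have "1 / (1 - a) = (1 + a) / ((1 - a) * (1 + a))" if "0 <= a" "a < 1" for a :: real
  using mult_divide_mult_cancel_right[of "1 + a" 1 "1 - a"] that by simp
 from this[of "\<bar>\<phi>\<bar>"] show ?thesis unfolding phi_factor using \<phi> by simp
qed

lemma bump_weight_nonneg: "0 <= bump_weight t"
 using phi_square_less by (simp add: bump_weight_def)

text \<open>A certificate for the upper spectral bound: for \<open>\<kappa>\<close> at least
  \<open>bound\<close>, subtracting from \<open>\<kappa>\<close> I leaves a nonnegative diagonal
  plus nonnegative bump terms.\<close>

lemma prec_decomposition:
 assumes i: "i < N" and k: "k < N"
 shows "prec N i k = (if i = k then diag_weight N i else 0) - (\<Sum>t<N. bump_weight t * (bump t i * bump t k))"
proof -
 define p where "p = 1 - \<phi>\<^sup>2"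
 define a where "a = \<bar>\<phi>\<bar>"
 have p: "0 < p" using phi_square_less by (simp add: p_def)
 have a0: "\<phi> = 0 ==> a = 0" by (simp add: a_def)
 have as: "a * sgn \<phi> = \<phi>" by (simp add: a_def abs_mult_sgn)
 have ass: "a * (sgn \<phi> * sgn \<phi>) = a" by (simp add: a_def abs_if sgn_if)
 have aa: "a * a = \<phi> * \<phi>" by (simp add: a_def)
 have r1: "1 / (1 - a) = (1 + a) / p" using phi_ratio by (simp add: a_def p_def)
 have "a / (1 - a) = a * (1 / (1 - a))" by simp
 then have r2: "a / (1 - a) = (a + a * a) / p" unfolding r1 by (simp add: distrib_left)
 \<comment> \<open>Innovation \<open>t\<close> touches only sites \<open>t\<close> and
   \<open>t - 1\<close>: completing its off-diagonal part to a bump adds to the two diagonal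
   entries.\<close>
 have tm: "ell t i * ell t k / (sd t)^2 = (if t = i then (if i = k then (if i = 0 then 1 else 1 / (1 - a)) else 0) else 0)
  + (if t = Suc i then (if i = k then a / (1 - a) else 0) else 0) - bump_weight t * (bump t i * bump t k)" for t
 proof -
  consider "t = 0" | "t \<noteq> 0" "i = t" "k = t" | "t \<noteq> 0" "i = t" "Suc k = t" | "t \<noteq> 0" "Suc i = t" "k = t" | "t \<noteq> 0" "Suc i = t" "Suc k = t"
   | "t \<noteq> 0" "i \<noteq> t" "Suc i \<noteq> t" | "t \<noteq> 0" "k \<noteq> t" "Suc k \<noteq> t" by blast
  then show ?thesis
  proof cases
   case 1 then show ?thesis by (auto simp: ell_def sigma_square bump_weight_def)
  next
   case 2 then show ?thesis unfolding r1 by (simp add: ell_def sigma_square bump_weight_def bump_def p_def[symmetric] a_def[symmetric] diff_divide_distrib[symmetric])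
  next
   case 3 then show ?thesis by (simp add: ell_def sigma_square bump_weight_def bump_def p_def[symmetric] a_def[symmetric] as)
  next
   case 4 then show ?thesis by (simp add: ell_def sigma_square bump_weight_def bump_def p_def[symmetric] a_def[symmetric] as)
  next
   case 5 then show ?thesis unfolding r2 by (simp add: ell_def sigma_square bump_weight_def bump_def p_def[symmetric] a_def[symmetric] ass aa diff_divide_distrib[symmetric]) (use a0 in blast)
  next
   case 6 then show ?thesis by (auto simp: ell_def bump_def)
  next
   case 7 then show ?thesis by (auto simp: ell_def bump_def)
  qed
 qed
 show ?thesis
  unfolding prec_def tm sum_subtractf sum.distrib diag_weight_def a_def[symmetric] using i by (simp add: sum.delta)
qed

text \<open>One family of 2 N rank-one terms: the first N are the diagonal remainders, the last N
  the bumps.\<close>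

definition split_weight :: "nat => real => nat => real" where
 "split_weight N \<kappa> j = (if j < N then \<kappa> - diag_weight N j else bump_weight (j - N))"

definition split_vec :: "nat => nat => nat => real" where
 "split_vec N j i = (if j < N then (if i = j then 1 else 0) else bump (j - N) i)"

lemma diag_weight_le: "diag_weight N i <= bound"
proof -
 have "1 <= 1 / (1 - \<bar>\<phi>\<bar>)" "0 <= \<bar>\<phi>\<bar> / (1 - \<bar>\<phi>\<bar>)" using \<phi> by auto
 then have "diag_weight N i <= 1 / (1 - \<bar>\<phi>\<bar>) + \<bar>\<phi>\<bar> / (1 - \<bar>\<phi>\<bar>)" unfolding diag_weight_def by (intro add_mono) auto
 then show ?thesis by (simp add: bound_def add_divide_distrib)
qed

lemma split_weight_nonneg: "bound <= \<kappa> ==> 0 <= split_weight N \<kappa> j"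
 using diag_weight_le[of N j] bump_weight_nonneg by (auto simp: split_weight_def)

lemma split_eq:
 assumes i: "i < N" and k: "k < N"
 shows "(if i = k then \<kappa> else 0) - prec N i k = (\<Sum>j<N + N. split_weight N \<kappa> j * (split_vec N j i * split_vec N j k))"
proof -
 have "(\<Sum>j<N. split_weight N \<kappa> j * (split_vec N j i * split_vec N j k)) = (\<Sum>j<N. if j = i then (if i = k then \<kappa> - diag_weight N i else 0) else 0)"
  by (intro sum.cong refl) (auto simp: split_weight_def split_vec_def)
 also have "... = (if i = k then \<kappa> - diag_weight N i else 0)" using i by (simp add: sum.delta)
 finally show ?thesis
  unfolding sum_lessThan_add prec_decomposition[OF i k] by (simp add: split_weight_def split_vec_def)
qed

lemma prec_form_nonneg: "0 <= (\<Sum>i<N. \<Sum>k<N. prec N i k * w i * w k)"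
 unfolding prec_form by (intro sum_nonneg) simp

lemma prec_form_le: "(\<Sum>i<N. \<Sum>k<N. prec N i k * w i * w k) <= bound * (\<Sum>i<N. (w i)^2)"
proof -
 have "bound * (\<Sum>i<N. (w i)^2) - (\<Sum>i<N. \<Sum>k<N. prec N i k * w i * w k) = (\<Sum>i<N. \<Sum>k<N. ((if i = k then bound else 0) - prec N i k) * (w i * w k))"
 proof -
  have "(\<Sum>k<N. ((if i = k then bound else 0) - prec N i k) * (w i * w k)) = bound * (w i)^2 - (\<Sum>k<N. prec N i k * w i * w k)" if i: "i < N" for i
  proof -
   have "(\<Sum>k<N. ((if i = k then bound else 0) - prec N i k) * (w i * w k)) = (\<Sum>k<N. (if k = i then bound * (w i)^2 else 0) - prec N i k * w i * w k)"
    by (intro sum.cong refl) (auto simp: left_diff_distrib power2_eq_square mult.assoc)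
   then show ?thesis using i by (simp add: sum_subtractf)
  qed
  then show ?thesis by (simp add: sum_subtractf sum_distrib_left)
 qed
 also have "... = (\<Sum>i<N. \<Sum>k<N. \<Sum>j<N + N. split_weight N bound j * ((split_vec N j i * w i) * (split_vec N j k * w k)))"
  by (intro sum.cong refl) (simp add: split_eq sum_distrib_right sum_distrib_left mult.assoc mult.left_commute mult.commute)
 also have "... = (\<Sum>i<N. \<Sum>j<N + N. \<Sum>k<N. split_weight N bound j * ((split_vec N j i * w i) * (split_vec N j k * w k)))" by (intro sum.cong refl sum.swap)
 also have "... = (\<Sum>j<N + N. \<Sum>i<N. \<Sum>k<N. split_weight N bound j * ((split_vec N j i * w i) * (split_vec N j k * w k)))" by (rule sum.swap)
 also have "... = (\<Sum>j<N + N. split_weight N bound j * ((\<Sum>i<N. split_vec N j i * w i) * (\<Sum>i<N. split_vec N j i * w i)))"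
  unfolding sum_product by (simp add: sum_distrib_left)
 also have "0 <= ..." by (intro sum_nonneg) (rule mult_nonneg_nonneg[OF split_weight_nonneg[OF order_refl] zero_le_square])
 finally show ?thesis by simp
qed

definition norm_const :: "nat => real" where
 "norm_const N = (\<Prod>t<N. 1 / sqrt (2 * pi * (sd t)^2))"

lemma bound_ge_1: "1 <= bound"
 using \<phi> by (simp add: bound_def)

lemma chain_density_eq: "chain_density N x = norm_const N * exp (- (\<Sum>t<N. (innov t (\<lambda>i. x i - \<mu> i))^2 / (sd t)^2) / 2)"
proof -
 have "chain_density N x = (\<Prod>t<N. (1 / sqrt (2 * pi * (sd t)^2)) * exp (- ((innov t (\<lambda>i. x i - \<mu> i))^2 / (sd t)^2) / 2))"
 proof -
  have "innov t (\<lambda>i. x i - \<mu> i) = x t - c t x" for t by (simp add: innov_def c_def)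
  then show ?thesis unfolding chain_density_def normal_density_def by (intro prod.cong refl) (simp add: mult.commute)
 qed
 also have "... = norm_const N * exp (\<Sum>t<N. - ((innov t (\<lambda>i. x i - \<mu> i))^2 / (sd t)^2) / 2)"
  by (simp only: prod.distrib norm_const_def exp_sum[OF finite_lessThan])
 finally show ?thesis by (simp add: sum_negf sum_divide_distrib)
qed

lemma diag_ge_1:
 assumes t: "t < N"
 shows "1 <= prec N t t"
proof -
 have "1 <= ell t t * ell t t / (sd t)^2" using phi_square_less by (simp add: ell_def sigma_square)
 also have "... <= prec N t t" unfolding prec_def by (rule member_le_sum) (use t in auto)
 finally show ?thesis .
qed

text \<open>The variance at the last site does not depend on that coordinate, so it may be
  integrated over the longer chain.\<close>

lemma last_var_eq:
 assumes f: "f \<in> bmeas (lebn (Suc n))" and M: "\<And>x. \<bar>f x\<bar> <= M"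
 shows "last_var n f = (\<integral>x. normal_var (c n x) (sd n) (\<lambda>u. f (x(n := u))) \<partial>chain (Suc n))"
proof -
 define F where "F x = normal_var (c n x) (sd n) (\<lambda>u. f (x(n := u)))" for x
 have sec: "(\<lambda>u. f (x(n := u))) \<in> bmeas borel" if "x \<in> space (lebn (Suc n))" for x
  using measurable_compose[OF measurable_compose[OF measurable_Pair1' upd_measurable_in[of n "Suc n"]] f, of x] that by simp
 have Fm: "F \<in> bmeas (lebn (Suc n))"
  unfolding F_def[abs_def]
  by (rule normal_var_measurable) (use measurable_compose[OF upd_measurable_in[of n "Suc n"] f] in \<open>simp_all add: split_beta'\<close>)
 have Fb: "\<bar>F x\<bar> <= M * M" if "x \<in> space (lebn (Suc n))" for x
  unfolding F_def by (rule abs_normal_var_le[OF sec[OF that] M])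
 have "(\<integral>x. F x \<partial>chain (Suc n)) = (\<integral>x. (EE z. F (nxt n x z)) \<partial>chain n)"
  by (rule integral_chain_Suc'(1)[OF Fm Fb]) auto
 also have "... = (\<integral>x. F x \<partial>chain n)"
 proof -
  have "F (x(n := y)) = F x" for x y by (simp add: F_def c_upd)
  then show ?thesis by (simp add: std_normal.prob_space)
 qed
 finally show ?thesis by (simp add: last_var_def F_def)
qed

context
 fixes N :: nat and B :: "nat set" and h :: real
 assumes B: "B \<subseteq> {..<N}" and h: "0 < h" and step: "10 * real (card B) * (h * bound)^2 <= 1" "h * bound <= 1"
begin

lemma gauss_block_ar1: "gauss_block N (prec N) (norm_const N) bound h B"
proof
 show "prec N i k = prec N k i" for i k by (simp add: prec_def mult.commute)
 show "0 < norm_const N" unfolding norm_const_def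
  by (intro prod_pos divide_pos_pos real_sqrt_gt_zero mult_pos_pos zero_less_power sigma_pos) auto
qed (use B h step prec_form_nonneg prec_form_le bound_ge_1 in auto)

interpretation G: gauss_block N "prec N" \<mu> "norm_const N" bound h B
 by (rule gauss_block_ar1)

lemma dens_ar1: "G.dens = chain_density N"
 unfolding fun_eq_iff G.dens_def G.form_def prec_form chain_density_eq by (simp add: power2_eq_square)

lemma gauss_psd_update_ar1: "gauss_psd_update N (prec N) \<mu> (norm_const N) bound h B (N + N) (split_weight N (1 / h)) (split_vec N)"
proof unfold_locales
 have "(\<integral>\<^sup>+x. ennreal (chain_density N x) \<partial>lebn N) = emeasure (chain N) (space (chain N))"
  by (simp add: chain_def emeasure_density cong: nn_integral_cong_simp)
 then show "(\<integral>\<^sup>+x. ennreal (G.dens x) \<partial>lebn N) = 1"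
  unfolding dens_ar1 using prob_space.emeasure_space_1[OF prob_space_chain, of N] by simp
 show "1 <= prec N t t" if "t \<in> B" for t using that B by (intro diag_ge_1) auto
 have "bound <= 1 / h" using step(2) h by (simp add: field_simps)
 then show "0 <= split_weight N (1 / h) j" for j by (rule split_weight_nonneg)
 show "(if i = k then 1 / h else 0) - prec N i k = (\<Sum>j<N + N. split_weight N (1 / h) j * (split_vec N j i * split_vec N j k))"
  if "i < N" "k < N" for i k using that by (rule split_eq)
qed

interpretation G: gauss_psd_update N "prec N" \<mu> "norm_const N" bound h B "N + N" "split_weight N (1 / h)" "split_vec N"
 by (rule gauss_psd_update_ar1)

abbreviation block_kernel :: "point => point measure" where
 "block_kernel \<equiv> mala_kernel N (chain_density N) B h"

lemma psd_block_kernel: "psd_kernel (chain N) block_kernel"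
 using G.psd_update unfolding dens_ar1 chain_def .

lemma grad_ar1:
 assumes t: "t < N"
 shows "G.grad x t = innov t (\<lambda>i. x i - \<mu> i) / (sd t)^2 + (if Suc t < N then - \<phi> * (innov (Suc t) (\<lambda>i. x i - \<mu> i) / (1 - \<phi>\<^sup>2)) else 0)"
proof -
 have "G.grad x t = (\<Sum>k<N. \<Sum>r<N. ell r t * (ell r k * (x k - \<mu> k) / (sd r)^2))"
  unfolding G.grad_def prec_def sum_distrib_right by (intro sum.cong refl) simp
 also have "... = (\<Sum>r<N. \<Sum>k<N. ell r t * (ell r k * (x k - \<mu> k) / (sd r)^2))" by (rule sum.swap)
 also have "... = (\<Sum>r<N. ell r t * ((\<Sum>k<N. ell r k * (x k - \<mu> k)) / (sd r)^2))"
  by (simp add: sum_distrib_left sum_divide_distrib)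
 also have "... = (\<Sum>r<N. ell r t * (innov r (\<lambda>i. x i - \<mu> i) / (sd r)^2))" by (intro sum.cong refl) (simp add: sum_ell)
 also have "... = innov t (\<lambda>i. x i - \<mu> i) / (sd t)^2 + (if Suc t < N then - \<phi> * (innov (Suc t) (\<lambda>i. x i - \<mu> i) / (sd (Suc t))^2) else 0)"
  by (rule sum_ell_column[OF t])
 finally show ?thesis by (simp add: sigma_square)
qed

lemma diag_ar1:
 assumes t: "t < N"
 shows "prec N t t = 1 / (sd t)^2 + (if Suc t < N then \<phi>\<^sup>2 / (1 - \<phi>\<^sup>2) else 0)"
proof -
 have "prec N t t = (\<Sum>r<N. ell r t * (ell r t / (sd r)^2))" by (simp add: prec_def)
 also have "... = ell t t / (sd t)^2 + (if Suc t < N then - \<phi> * (ell (Suc t) t / (sd (Suc t))^2) else 0)" by (rule sum_ell_column[OF t])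
 also have "(sd (Suc t))^2 = 1 - \<phi>\<^sup>2" by (simp add: sigma_square)
 finally show ?thesis by (simp add: ell_def power2_eq_square)
qed

text \<open>Matches the conditional law read off the precision matrix with the one that drives the
  chain recursion, so that the MALA estimate can be inserted there.\<close>

lemma cond_interior:
 assumes t: "Suc t < N"
 shows "G.cond_mean t x = gibbs_mean t x" "G.cond_sd t = gibbs_sd t"
proof -
 define p where "p = 1 - \<phi>\<^sup>2"
 have p: "0 < p" and ph: "\<phi>\<^sup>2 = 1 - p" using phi_square_less by (simp_all add: p_def)
 have q: "0 < 1 + \<phi>\<^sup>2" by (simp add: add_pos_nonneg)
 have tN: "t < N" using t by simp
 define v where "v i = x i - \<mu> i" for i
 have T: "prec N t t = (if t = 0 then 1 else 1 + \<phi>\<^sup>2) / p"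
  unfolding diag_ar1[OF tN] using t p by (auto simp: sigma_square p_def[symmetric] add_divide_distrib) (simp add: ph field_simps)
 have g: "G.grad x t = (if t = 0 then v 0 - \<phi> * v 1 else (1 + \<phi>\<^sup>2) * v t - \<phi> * (v (t - 1) + v (Suc t))) / p"
 proof (cases "t = 0")
  case True
  have "G.grad x t = v 0 + - \<phi> * ((v 1 - \<phi> * v 0) / p)"
   unfolding grad_ar1[OF tN] using t True by (simp add: innov_def v_def[symmetric] p_def[symmetric] sigma_square)
  also have "... = (p * v 0 + \<phi>\<^sup>2 * v 0 - \<phi> * v 1) / p" using p by (simp add: field_simps power2_eq_square)
  also have "p * v 0 + \<phi>\<^sup>2 * v 0 - \<phi> * v 1 = v 0 - \<phi> * v 1" unfolding ph by (simp add: algebra_simps)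
  finally show ?thesis using True by simp
 next
  case False
  have "G.grad x t = (v t - \<phi> * v (t - 1)) / p + - \<phi> * ((v (Suc t) - \<phi> * v t) / p)"
   unfolding grad_ar1[OF tN] using t False by (simp add: innov_def v_def[symmetric] p_def[symmetric] sigma_square)
  also have "... = ((1 + \<phi>\<^sup>2) * v t - \<phi> * (v (t - 1) + v (Suc t))) / p" using p by (simp add: field_simps power2_eq_square)
  finally show ?thesis using False by simp
 qed
 have x: "x i = \<mu> i + v i" for i by (simp add: v_def)
 show "G.cond_mean t x = gibbs_mean t x"
 proof (cases "t = 0")
  case True
  then show ?thesis unfolding G.cond_mean_def T g gibbs_mean_def using p by (simp add: x)
 next
  case False
  have "G.cond_mean t x = \<mu> t + v t - ((1 + \<phi>\<^sup>2) * v t - \<phi> * (v (t - 1) + v (Suc t))) / (1 + \<phi>\<^sup>2)"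
   unfolding G.cond_mean_def T g using False p by (simp add: x)
  also have "... = \<mu> t + \<phi> / (1 + \<phi>\<^sup>2) * (v (t - 1) + v (Suc t))" using q by (simp add: field_simps)
  finally show ?thesis using False by (simp add: gibbs_mean_def v_def)
 qed
 show "G.cond_sd t = gibbs_sd t"
  unfolding G.cond_sd_def T gibbs_sd_def p_def[symmetric] using p q by (simp add: real_sqrt_divide)
qed

lemma cond_last:
 assumes t: "N = Suc t"
 shows "G.cond_mean t x = c t x" "G.cond_sd t = sd t"
proof -
 have tN: "t < N" using t by simp
 have T: "prec N t t = 1 / (sd t)^2" unfolding diag_ar1[OF tN] using t by simp
 have g: "G.grad x t = innov t (\<lambda>i. x i - \<mu> i) / (sd t)^2" unfolding grad_ar1[OF tN] using t by simp
 show "G.cond_mean t x = c t x"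
  unfolding G.cond_mean_def T g using sigma_pos[of t] by (auto simp: innov_def c_def)
 show "G.cond_sd t = sd t"
  unfolding G.cond_sd_def T using sigma_pos[of t] by (simp add: real_sqrt_divide)
qed

lemma site_energy:
 assumes f: "f \<in> bmeas (lebn N)" and M: "\<And>x. \<bar>f x\<bar> <= M" and t: "t \<in> B"
 shows "(\<integral>\<^sup>+x. ennreal (normal_var (G.cond_mean t x) (G.cond_sd t) (\<lambda>u. f (x(t := u)))) \<partial>chain N)
  <= ennreal (557056 / h) * energy (chain N) block_kernel f"
proof -
 have tN: "t < N" using t B by auto
 have [measurable]: "G.cond_mean t \<in> bmeas (lebn N)"
 proof -
  have "(\<lambda>x. x t) \<in> bmeas (lebn N)" by (rule coordinate_measurable[OF tN])
  then show ?thesis unfolding G.cond_mean_def[abs_def] by measurable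
 qed
 have [measurable]: "(\<lambda>x. normal_var (G.cond_mean t x) (G.cond_sd t) (\<lambda>u. f (x(t := u)))) \<in> bmeas (lebn N)"
  by (rule normal_var_measurable) (use measurable_compose[OF upd_measurable_in[OF tN] f] in \<open>simp_all add: split_beta'\<close>)
 show ?thesis
  using G.gibbs_le_energy[OF f M t] unfolding dens_ar1
  unfolding chain_def by (subst nn_integral_density) auto
qed

lemma site_energy_real:
 assumes f: "f \<in> bmeas (lebn N)" and M: "\<And>x. \<bar>f x\<bar> <= M" and t: "t \<in> B"
 shows "(\<integral>x. normal_var (G.cond_mean t x) (G.cond_sd t) (\<lambda>u. f (x(t := u))) \<partial>chain N)
  <= 1114112 / h * psd_kernel.gap_form (chain N) block_kernel f"
proof -
 have tN: "t < N" using t B by auto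
 have sec: "(\<lambda>u. f (x(t := u))) \<in> bmeas borel" if "x \<in> space (chain N)" for x
  using measurable_compose[OF measurable_compose[OF measurable_Pair1' upd_measurable_in[OF tN]] f, of x] that by simp
 interpret K: psd_kernel "chain N" block_kernel by (rule psd_block_kernel)
 have L2: "f \<in> L2 (chain N)"
 proof -
  have "integrable (chain N) (\<lambda>x. (f x)^2)"
   by (rule chain.integrable_const_bound[where B = "M\<^sup>2"]) (use f order_trans[OF M abs_ge_self] in \<open>auto simp: abs_le_square_iff[symmetric]\<close>)
  then show ?thesis using f by (simp add: L2_def)
 qed
 have nn: "\<And>x. x \<in> space (chain N) ==> 0 <= normal_var (G.cond_mean t x) (G.cond_sd t) (\<lambda>u. f (x(t := u)))"
  using sec M by (intro normal_var_nonneg) auto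
 have g0: "0 <= K.gap_form f" by (rule K.energy_eq(2)[OF L2])
 have "(\<integral>x. normal_var (G.cond_mean t x) (G.cond_sd t) (\<lambda>u. f (x(t := u))) \<partial>chain N)
  <= enn2real (\<integral>\<^sup>+x. ennreal (normal_var (G.cond_mean t x) (G.cond_sd t) (\<lambda>u. f (x(t := u)))) \<partial>chain N)"
 proof (cases "(\<lambda>x. normal_var (G.cond_mean t x) (G.cond_sd t) (\<lambda>u. f (x(t := u)))) \<in> bmeas (chain N)")
  case True
  then show ?thesis using nn by (subst integral_eq_nn_integral) auto
 next
  case False
  then have "\<not> integrable (chain N) (\<lambda>x. normal_var (G.cond_mean t x) (G.cond_sd t) (\<lambda>u. f (x(t := u))))" by auto
  then show ?thesis by (simp add: not_integrable_integral_eq)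
 qed
 also have "... <= enn2real (ennreal (557056 / h) * energy (chain N) block_kernel f)"
 proof (rule enn2real_mono[OF site_energy[OF f M t]])
  show "ennreal (557056 / h) * energy (chain N) block_kernel f < \<top>"
   by (simp add: K.energy_eq(1)[OF L2] ennreal_mult_less_top)
 qed
 \<comment> \<open>Twice 557056, because \<open>energy\<close> is twice
   \<open>gap_form\<close>.\<close>
 also have "... = 1114112 / h * K.gap_form f"
  using h g0 by (simp add: K.energy_eq(1)[OF L2] enn2real_mult)
 finally show ?thesis .
qed

lemma gibbs_var_le_gap:
 assumes f: "f \<in> bmeas (lebn N)" and M: "\<And>x. \<bar>f x\<bar> <= M" and t: "t \<in> B" "Suc t < N"
 shows "gibbs_var N t f <= 1114112 / h * psd_kernel.gap_form (chain N) block_kernel f"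
 using site_energy_real[OF f M t(1)] unfolding cond_interior[OF t(2)] gibbs_var_def .

lemma last_var_le_gap:
 assumes f: "f \<in> bmeas (lebn N)" and M: "\<And>x. \<bar>f x\<bar> <= M" and t: "t \<in> B" "N = Suc t"
 shows "last_var t f <= 1114112 / h * psd_kernel.gap_form (chain N) block_kernel f"
proof -
 have "last_var t f = (\<integral>x. normal_var (c t x) (sd t) (\<lambda>u. f (x(t := u))) \<partial>chain N)"
  using last_var_eq[of f t M] f M unfolding t(2) by simp
 then show ?thesis using site_energy_real[OF f M t(1)] unfolding cond_last[OF t(2)] by simp
qed

end

end

section \<open>Poincare inequality for the sum of the block Dirichlet forms\<close>

context ar1_chain
begin

context
 fixes N d s :: nat and Bk :: "nat => nat set" and h :: real
 assumes N: "0 < N" and cover: "(\<Union>j<d. Bk j) = {..<N}" and disj: "\<And>i j. i < d ==> j < d ==> i \<noteq> j ==> Bk i \<inter> Bk j = {}"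
  and card: "\<And>j. j < d ==> card (Bk j) = s" and h: "0 < h" and step: "10 * real s * (h * bound)^2 <= 1" "h * bound <= 1"
begin

abbreviation kern :: "nat => point => point measure" where
 "kern j \<equiv> mala_kernel N (chain_density N) (Bk j) h"

abbreviation gap :: "nat => (point => real) => real" where
 "gap j \<equiv> psd_kernel.gap_form (chain N) (kern j)"

lemma blk: "j < d ==> Bk j \<subseteq> {..<N}"
 using cover by auto

lemma psd_kern: "j < d ==> psd_kernel (chain N) (kern j)"
 by (rule psd_block_kernel) (use blk h step card in auto)

lemma variance_le_gap_bounded:
 assumes f: "f \<in> bmeas (lebn N)" and M: "\<And>x. \<bar>f x\<bar> <= M"
 shows "chain_var N f <= 8912896 * real s / ((1 - \<bar>\<phi>\<bar>)^2 * h) * (\<Sum>j<d. gap j f)"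
proof -
 obtain n where n: "N = Suc n" using N by (cases N) auto
 define a where "a = \<bar>\<phi>\<bar>"
 have a: "0 <= a" "a < 1" using \<phi> by (auto simp: a_def)
 define V where "V t = (if t < n then gibbs_var N t f else last_var t f)" for t
 have V: "V t <= 1114112 / h * gap j f" if j: "j < d" and t: "t \<in> Bk j" for j t
 proof (cases "t < n")
  case True
  then show ?thesis unfolding V_def using gibbs_var_le_gap[OF blk[OF j] h _ step(2) f M t] step(1) card[OF j] n by simp
 next
  case False
  then have "N = Suc t" using t blk[OF j] n by auto
  then show ?thesis unfolding V_def using last_var_le_gap[OF blk[OF j] h _ step(2) f M t] step(1) card[OF j] False by simp
 qed
 have one: "(1 - a)^2 <= 1" using a by (simp add: power_le_one)
 \<comment> \<open>Brings the weight of the last site to the constant of the other sites.\<close>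
 have cl: "(if n = 0 then 1 else 1 / (1 - a)) <= 8 / (1 - a)^2"
 proof -
  have "1 / (1 - a) = (1 - a) / (1 - a)^2" using a by (simp add: power2_eq_square)
  also have "... <= 8 / (1 - a)^2" using a by (intro divide_right_mono) auto
  finally have "1 / (1 - a) <= 8 / (1 - a)^2" .
  moreover have "1 <= 1 / (1 - a)" using a by simp
  ultimately show ?thesis by auto
 qed
 have fn: "f \<in> bmeas (lebn (Suc n))" using f n by simp
 have "chain_var N f <= 8 / (1 - a)^2 * (\<Sum>t<n. gibbs_var N t f) + (if n = 0 then 1 else 1 / (1 - a)) * last_var n f"
  unfolding n a_def by (rule chain_var_le[OF fn M])
 also have "... <= 8 / (1 - a)^2 * (\<Sum>t<n. gibbs_var N t f) + 8 / (1 - a)^2 * last_var n f"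
  by (intro add_left_mono mult_right_mono cl last_var_nonneg[OF fn M])
 also have "... = 8 / (1 - a)^2 * (\<Sum>t<N. V t)"
 proof -
  have "(\<Sum>t<N. V t) = (\<Sum>t<Suc n. V t)" using n by simp
  also have "... = (\<Sum>t<n. V t) + V n" by simp
  also have "(\<Sum>t<n. V t) = (\<Sum>t<n. gibbs_var N t f)" by (intro sum.cong refl) (simp add: V_def)
  also have "V n = last_var n f" by (simp add: V_def)
  finally show ?thesis by (simp only: distrib_left)
 qed
 also have "(\<Sum>t<N. V t) = (\<Sum>j<d. \<Sum>t\<in>Bk j. V t)"
  unfolding cover[symmetric] by (rule sum.UNION_disjoint) (use disj finite_subset[OF blk finite_lessThan] in auto)
 \<comment> \<open>All \<open>s\<close> sites of a block are charged to one and the same Dirichlet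
   form; 8 * 1114112 = 8912896.\<close>
 also have "8 / (1 - a)^2 * (\<Sum>j<d. \<Sum>t\<in>Bk j. V t) <= 8 / (1 - a)^2 * (\<Sum>j<d. real s * (1114112 / h * gap j f))"
 proof (intro mult_left_mono sum_mono)
  fix j assume "j \<in> {..<d}"
  then have j: "j < d" by simp
  have "(\<Sum>t\<in>Bk j. V t) <= of_nat (card (Bk j)) * (1114112 / h * gap j f)"
   by (rule sum_bounded_above) (rule V[OF j])
  then show "(\<Sum>t\<in>Bk j. V t) <= real s * (1114112 / h * gap j f)" using card[OF j] by simp
 qed simp
 also have "... = 8912896 * real s / ((1 - a)^2 * h) * (\<Sum>j<d. gap j f)"
  by (simp add: sum_distrib_left mult.assoc)
 finally show ?thesis by (simp add: a_def)
qed

text \<open>Clipping at level k is 1-Lipschitz on the real line, so it does not increase the energy;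
  dominated convergence carries the bound from the clipped functions to \<open>f\<close>.\<close>

lemma variance_le_gap:
 assumes f: "f \<in> L2 (chain N)" and mean: "(\<integral>x. f x \<partial>chain N) = 0"
 shows "(\<integral>x. (f x)^2 \<partial>chain N) <= 8912896 * real s / ((1 - \<bar>\<phi>\<bar>)^2 * h) * (\<Sum>j<d. gap j f)"
proof -
 define C where "C = 8912896 * real s / ((1 - \<bar>\<phi>\<bar>)^2 * h)"
 have C: "0 <= C" using h by (simp add: C_def)
 define g where "g k x = max (- real k) (min (real k) (f x))" for k :: nat and x
 have fm[measurable]: "f \<in> bmeas (chain N)" and fi: "integrable (chain N) (\<lambda>x. (f x)^2)" using f by (auto simp: L2_def)
 have fm': "f \<in> bmeas (lebn N)" using fm by simp
 have f1: "integrable (chain N) (\<lambda>x. \<bar>f x\<bar>)"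
  using chain.square_integrable_imp_integrable[OF fm fi] by simp
 have gm[measurable]: "g k \<in> bmeas (chain N)" for k unfolding g_def[abs_def] by measurable
 have gm': "g k \<in> bmeas (lebn N)" for k using gm[of k] by simp
 have gb: "\<bar>g k x\<bar> <= real k" for k x unfolding g_def by auto
 have gf: "\<bar>g k x\<bar> <= \<bar>f x\<bar>" for k x unfolding g_def by auto
 have gd: "(g k x - g k y)^2 <= (f x - f y)^2" for k x y
 proof -
  have "\<bar>g k x - g k y\<bar> <= \<bar>f x - f y\<bar>" unfolding g_def by auto
  then show ?thesis by (simp add: abs_le_square_iff)
 qed
 have glim: "(\<lambda>k. g k x) \<longlonglongrightarrow> f x" for x
 proof (rule tendsto_eventually)
  obtain m :: nat where m: "\<bar>f x\<bar> <= real m" using real_arch_simple by blast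
  show "\<forall>\<^sub>F k in sequentially. g k x = f x"
   using eventually_ge_at_top[of m] by eventually_elim (use m in \<open>auto simp: g_def\<close>)
 qed
 have g2: "(\<lambda>k. \<integral>x. (g k x)^2 \<partial>chain N) \<longlonglongrightarrow> (\<integral>x. (f x)^2 \<partial>chain N)"
  by (rule integral_dominated_convergence[where w = "\<lambda>x. (f x)^2"])
   (use fi gf in \<open>auto intro!: tendsto_power glim simp: abs_le_square_iff[symmetric]\<close>)
 have g1: "(\<lambda>k. \<integral>x. g k x \<partial>chain N) \<longlonglongrightarrow> (\<integral>x. f x \<partial>chain N)"
  by (rule integral_dominated_convergence[where w = "\<lambda>x. \<bar>f x\<bar>"]) (use f1 gf in \<open>auto intro!: glim\<close>)
 have lim: "(\<lambda>k. chain_var N (g k)) \<longlonglongrightarrow> (\<integral>x. (f x)^2 \<partial>chain N) - 0\<^sup>2"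
  unfolding chain_var_def by (intro tendsto_diff g2 tendsto_power) (use g1 mean in simp)
 have "chain_var N (g k) <= C * (\<Sum>j<d. gap j f)" for k
 proof -
  have "chain_var N (g k) <= C * (\<Sum>j<d. gap j (g k))"
   unfolding C_def by (rule variance_le_gap_bounded[OF gm' gb])
  also have "... <= C * (\<Sum>j<d. gap j f)"
  proof (intro mult_left_mono sum_mono C)
   fix j assume "j \<in> {..<d}"
   then interpret K: psd_kernel "chain N" "kern j" by (intro psd_kern) simp
   have gL: "g k \<in> L2 (chain N)"
    unfolding L2_def using integrable_dominated[OF fi, of "\<lambda>x. (g k x)^2"] gf gm[of k] by (auto simp: abs_le_square_iff[symmetric])
   have "energy (chain N) (kern j) (g k) <= energy (chain N) (kern j) f"
    unfolding energy_def by (intro nn_integral_mono ennreal_leI gd)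
   then have "ennreal (2 * gap j (g k)) <= ennreal (2 * gap j f)" by (simp only: K.energy_eq(1)[OF gL] K.energy_eq(1)[OF f])
   then show "gap j (g k) <= gap j f" using K.energy_eq(2)[OF f] by (subst (asm) ennreal_le_iff) auto
  qed
  finally show ?thesis .
 qed
 then have "(\<integral>x. (f x)^2 \<partial>chain N) - 0\<^sup>2 <= C * (\<Sum>j<d. gap j f)"
  by (intro LIMSEQ_le_const2[OF lim]) auto
 then show ?thesis by (simp add: C_def)
qed

end

section \<open>The inverse of the autoregressive covariance and its density\<close>

lemma prec_apply: "(\<Sum>k<N. prec N t k * w k) = (\<Sum>r<N. ell r t * (innov r w / (sd r)^2))"
proof -
 have "(\<Sum>k<N. prec N t k * w k) = (\<Sum>k<N. \<Sum>r<N. ell r t * (ell r k * w k / (sd r)^2))"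
  unfolding prec_def sum_distrib_right by (intro sum.cong refl) simp
 also have "... = (\<Sum>r<N. \<Sum>k<N. ell r t * (ell r k * w k / (sd r)^2))" by (rule sum.swap)
 also have "... = (\<Sum>r<N. ell r t * ((\<Sum>k<N. ell r k * w k) / (sd r)^2))"
  by (simp add: sum_distrib_left sum_divide_distrib)
 also have "... = (\<Sum>r<N. ell r t * (innov r w / (sd r)^2))" by (intro sum.cong refl) (simp add: sum_ell)
 finally show ?thesis .
qed

text \<open>Column \<open>j\<close> holds the covariances with coordinate \<open>j\<close>. An
  innovation after \<open>j\<close> is uncorrelated with that coordinate, so it annihilates the
  column.\<close>

lemma innov_cov: "innov t (\<lambda>k. \<phi> ^ nat \<bar>int k - int j\<bar>) / (sd t)^2 = (if t <= j then \<phi> ^ (j - t) else 0)"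
proof -
 have p: "1 - \<phi>\<^sup>2 \<noteq> 0" using phi_square_less by simp
 consider "t = 0" | u where "t = Suc u" "t <= j" | u where "t = Suc u" "j <= u"
  by (metis not0_implies_Suc not_less_eq_eq)
 then show ?thesis
 proof cases
  case 1 then show ?thesis by (simp add: innov_def sigma_square)
 next
  case 2
  have e: "nat \<bar>int t - int j\<bar> = j - t" "nat \<bar>int u - int j\<bar> = Suc (j - t)" using 2 by auto
  have iu: "innov t w = w t - \<phi> * w u" for w using 2(1) by (simp add: innov_def)
  have "innov t (\<lambda>k. \<phi> ^ nat \<bar>int k - int j\<bar>) = \<phi> ^ (j - t) - \<phi> * \<phi> ^ Suc (j - t)" unfolding iu e ..
  also have "... = \<phi> ^ (j - t) * (1 - \<phi>\<^sup>2)" by (simp add: power2_eq_square algebra_simps)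
  finally show ?thesis using 2 p by (simp add: sigma_square)
 next
  case 3
  have e: "nat \<bar>int t - int j\<bar> = Suc (u - j)" "nat \<bar>int u - int j\<bar> = u - j" using 3 by auto
  have iu: "innov t w = w t - \<phi> * w u" for w using 3(1) by (simp add: innov_def)
  have "innov t (\<lambda>k. \<phi> ^ nat \<bar>int k - int j\<bar>) = \<phi> ^ Suc (u - j) - \<phi> * \<phi> ^ (u - j)" unfolding iu e ..
  then show ?thesis using 3 by simp
 qed
qed

lemma prec_cov:
 assumes i: "i < N" and j: "j < N"
 shows "(\<Sum>k<N. prec N i k * \<phi> ^ nat \<bar>int k - int j\<bar>) = (if i = j then 1 else 0)"
proof -
 have "(\<Sum>k<N. prec N i k * \<phi> ^ nat \<bar>int k - int j\<bar>) = (\<Sum>r<N. ell r i * (if r <= j then \<phi> ^ (j - r) else 0))"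
  unfolding prec_apply innov_cov ..
 also have "... = (if i <= j then \<phi> ^ (j - i) else 0) + (if Suc i < N then - \<phi> * (if Suc i <= j then \<phi> ^ (j - Suc i) else 0) else 0)"
  by (rule sum_ell_column[OF i])
 also have "... = (if i = j then 1 else 0)"
 proof (cases "i < j")
  case True
  then have "j - i = Suc (j - Suc i)" by simp
  then have "\<phi> ^ (j - i) = \<phi> * \<phi> ^ (j - Suc i)" by simp
  then show ?thesis using True j by simp
 qed auto
 finally show ?thesis .
qed

text \<open>\<open>Q\<close> is given only through its inverse; a left inverse of that inverse must
  be \<open>Q\<close>.\<close>

lemma precision_matrix:
 assumes Q: "Q \<in> carrier_mat N N" and inv: "mat_inverse Q = Some (ar1_cov N \<phi>)"
 shows "Q = Matrix.mat N N (\<lambda>(i, k). prec N i k)"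
proof -
 define W where "W = Matrix.mat N N (\<lambda>(i, k). prec N i k)"
 have W: "W \<in> carrier_mat N N" by (simp add: W_def)
 note m = mat_inverse(2)[OF Q inv]
 have S: "ar1_cov N \<phi> \<in> carrier_mat N N" using m by blast
 have "W * ar1_cov N \<phi> = 1\<^sub>m N"
 proof (rule eq_matI)
  fix i j assume "i < dim_row (1\<^sub>m N :: real mat)" "j < dim_col (1\<^sub>m N :: real mat)"
  then have ij: "i < N" "j < N" by auto
  have "(W * ar1_cov N \<phi>) $$ (i, j) = (\<Sum>k<N. prec N i k * \<phi> ^ nat \<bar>int k - int j\<bar>)"
   using ij by (simp add: W_def ar1_cov_def scalar_prod_def atLeast0LessThan)
  then show "(W * ar1_cov N \<phi>) $$ (i, j) = 1\<^sub>m N $$ (i, j)" using ij by (simp add: prec_cov)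
 qed (use W S in auto)
 then have "W * ar1_cov N \<phi> * Q = Q" using Q by simp
 moreover have "W * ar1_cov N \<phi> * Q = W" using m W S Q by (simp add: assoc_mult_mat[OF W S Q])
 ultimately show ?thesis by (simp add: W_def)
qed

text \<open>The matrix is a transposed unit lower triangular matrix times a lower triangular one
  with diagonal \<open>1 / (sd t)^2\<close>.\<close>

lemma det_precision: "Determinant.det (Matrix.mat N N (\<lambda>(i, k). prec N i k)) = (\<Prod>t<N. 1 / (sd t)^2)"
proof -
 define A where "A = Matrix.mat N N (\<lambda>(t, i). ell t i)"
 define E where "E = Matrix.mat N N (\<lambda>(t, i). ell t i / (sd t)^2)"
 have AE: "A \<in> carrier_mat N N" "E \<in> carrier_mat N N" by (simp_all add: A_def E_def)
 have "Matrix.mat N N (\<lambda>(i, k). prec N i k) = transpose_mat A * E"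
  by (rule eq_matI) (auto simp: A_def E_def prec_def scalar_prod_def atLeast0LessThan)
 then have "Determinant.det (Matrix.mat N N (\<lambda>(i, k). prec N i k)) = Determinant.det A * Determinant.det E"
  using AE by (simp add: det_mult[of _ N] det_transpose[of _ N])
 also have "Determinant.det A = 1"
 proof (subst det_lower_triangular[OF _ AE(1)])
  show "A $$ (i, j) = 0" if "i < j" "j < N" for i j using that by (simp add: A_def ell_def)
  show "prod_list (diag_mat A) = 1" unfolding prod_list_diag_prod by (simp add: A_def ell_def)
 qed
 also have "Determinant.det E = (\<Prod>t<N. 1 / (sd t)^2)"
 proof (subst det_lower_triangular[OF _ AE(2)])
  show "E $$ (i, j) = 0" if "i < j" "j < N" for i j using that by (simp add: E_def ell_def)
  show "prod_list (diag_mat E) = (\<Prod>t<N. 1 / (sd t)^2)" unfolding prod_list_diag_prod by (simp add: E_def ell_def atLeast0LessThan)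
 qed
 finally show ?thesis by simp
qed

lemma gauss_density_eq:
 assumes m: "m \<in> carrier_vec N" and \<mu>: "\<mu> = (\<lambda>i. m $ i)" and Q: "Q = Matrix.mat N N (\<lambda>(i, k). prec N i k)"
 shows "gauss_density m Q = chain_density N"
proof
 fix x
 define v where "v = Matrix.vec N x - m"
 have v: "v $ i = x i - \<mu> i" if "i < N" for i using that m by (simp add: v_def \<mu>)
 have vd: "dim_vec v = N" using m by (simp add: v_def)
 have "scalar_prod v (Q *\<^sub>v v) = (\<Sum>i<N. \<Sum>k<N. prec N i k * (x i - \<mu> i) * (x k - \<mu> k))"
 proof -
  have Qv: "(Q *\<^sub>v v) $ i = (\<Sum>k<N. prec N i k * (x k - \<mu> k))" if "i < N" for i
  proof -
   have "(Q *\<^sub>v v) $ i = (\<Sum>k<N. prec N i k * v $ k)" using that vd by (simp add: Q mult_mat_vec_def scalar_prod_def atLeast0LessThan)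
   also have "... = (\<Sum>k<N. prec N i k * (x k - \<mu> k))" by (intro sum.cong refl) (simp add: v)
   finally show ?thesis .
  qed
  have dq: "dim_vec (Q *\<^sub>v v) = N" by (simp add: Q)
  have "scalar_prod v (Q *\<^sub>v v) = (\<Sum>i<N. v $ i * (Q *\<^sub>v v) $ i)" unfolding scalar_prod_def dq atLeast0LessThan ..
  also have "... = (\<Sum>i<N. (x i - \<mu> i) * (\<Sum>k<N. prec N i k * (x k - \<mu> k)))" by (intro sum.cong refl) (simp add: v Qv)
  finally show ?thesis by (simp add: sum_distrib_left mult.assoc mult.left_commute)
 qed
 also have "... = (\<Sum>t<N. (innov t (\<lambda>i. x i - \<mu> i))^2 / (sd t)^2)" by (simp add: prec_form power2_eq_square)
 finally have q: "scalar_prod v (Q *\<^sub>v v) = (\<Sum>t<N. (innov t (\<lambda>i. x i - \<mu> i))^2 / (sd t)^2)" .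
 have n: "sqrt (Determinant.det Q / (2 * pi) ^ N) = norm_const N"
 proof (rule real_sqrt_unique)
  have "(norm_const N)^2 = (\<Prod>t<N. (1 / sqrt (2 * pi * (sd t)^2))^2)" unfolding norm_const_def by (simp only: prod_power_distrib)
  also have "... = (\<Prod>t<N. (1 / (sd t)^2) * (1 / (2 * pi)))" by (intro prod.cong refl) (simp add: power_divide mult.commute)
  also have "... = (\<Prod>t<N. 1 / (sd t)^2) * (1 / (2 * pi)) ^ N" unfolding prod.distrib by simp
  finally show "(norm_const N)^2 = Determinant.det Q / (2 * pi) ^ N"
   unfolding Q det_precision by (simp add: power_divide)
  show "0 <= norm_const N" unfolding norm_const_def by (intro prod_nonneg) auto
 qed
 show "gauss_density m Q x = chain_density N x"
  unfolding gauss_density_def Let_def chain_density_eq using m q n by (simp add: v_def)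
qed

end

section \<open>Spectrum of the block Jacobi matrix\<close>

context ar1_chain
begin

text \<open>Unrolling the recursion, the left side is the square of a sum of increments with weights
  \<phi>^(m - 1 - t), and the bound is Cauchy-Schwarz, proved by induction.\<close>

lemma chain_gain: "(x m - \<phi> ^ m * x 0)^2 <= (\<Sum>t<m. (x (Suc t) - \<phi> * x t)^2) * (\<Sum>i<m. (\<phi>\<^sup>2) ^ i)" for x :: "nat => real"
proof (induction m)
 case 0
 show ?case by simp
next
 case (Suc m)
 define G where "G = (\<Sum>t<m. (x (Suc t) - \<phi> * x t)^2)"
 define S where "S = (\<Sum>i<m. (\<phi>\<^sup>2) ^ i)"
 define A where "A = x (Suc m) - \<phi> * x m"
 define C where "C = x m - \<phi> ^ m * x 0"
 have IH: "C\<^sup>2 <= G * S" using Suc by (simp add: C_def G_def S_def)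
 have S0: "0 <= S" by (simp add: S_def sum_nonneg)
 have G0: "0 <= G" by (simp add: G_def sum_nonneg)
 have S: "(\<Sum>i<Suc m. (\<phi>\<^sup>2) ^ i) = 1 + \<phi>\<^sup>2 * S"
  unfolding sum.lessThan_Suc_shift S_def by (simp add: sum_distrib_left)
 have e: "x (Suc m) - \<phi> ^ Suc m * x 0 = A + \<phi> * C" by (simp add: A_def C_def algebra_simps)
 have "2 * (\<phi> * A * C) <= G + \<phi>\<^sup>2 * S * A\<^sup>2"
 proof (cases "S = 0")
  case True
  then have "C = 0" using IH by simp
  then show ?thesis using G0 S0 by simp
 next
  case False
  then have S1: "0 < S" using S0 by simp
  have "S * (2 * (\<phi> * A * C)) <= C\<^sup>2 + (\<phi> * S * A)^2"
   using zero_le_power2[of "C - \<phi> * S * A"] by (simp add: power2_diff algebra_simps)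
  also have "... <= S * (G + \<phi>\<^sup>2 * S * A\<^sup>2)" using IH by (simp add: power_mult_distrib power2_eq_square algebra_simps)
  finally show ?thesis using S1 by simp
 qed
 moreover have "(A + \<phi> * C)^2 = A\<^sup>2 + 2 * (\<phi> * A * C) + \<phi>\<^sup>2 * C\<^sup>2" by (simp add: power2_eq_square algebra_simps)
 moreover have "\<phi>\<^sup>2 * C\<^sup>2 <= \<phi>\<^sup>2 * (G * S)" using IH by (intro mult_left_mono) auto
 moreover have "(G + A\<^sup>2) * (1 + \<phi>\<^sup>2 * S) = G + A\<^sup>2 + \<phi>\<^sup>2 * (G * S) + \<phi>\<^sup>2 * S * A\<^sup>2" by (simp add: algebra_simps)
 ultimately have "(A + \<phi> * C)^2 <= (G + A\<^sup>2) * (1 + \<phi>\<^sup>2 * S)" by linarith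
 then show ?case unfolding e S by (simp add: G_def A_def)
qed

text \<open>Minimising the inner increments for fixed ends by \<open>chain_gain\<close> leaves a
  quadratic form with equal weights on \<open>x 0\<close> and \<open>x m\<close> and a cross term
  proportional to \<phi>^m. Its smallest eigenvalue, attained at ends equal up to sign, is (1 +
  \<phi>^2 b) / (1 + b).\<close>

lemma interior_block_bound:
 fixes x :: "nat => real" and m :: nat
 defines "b \<equiv> \<bar>\<phi>\<bar> ^ m"
 shows "(1 + \<phi>\<^sup>2 * b) * ((x 0)^2 + (x m)^2) <= (1 + b) * ((x 0)^2 + (\<Sum>t<m. (x (Suc t) - \<phi> * x t)^2) + \<phi>\<^sup>2 * (x m)^2)"
proof (cases "m = 0")
 case True
 then show ?thesis by (simp add: b_def algebra_simps)
next
 case False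
 define G where "G = (\<Sum>t<m. (x (Suc t) - \<phi> * x t)^2)"
 define S where "S = (\<Sum>i<m. (\<phi>\<^sup>2) ^ i)"
 define \<beta> where "\<beta> = \<phi> ^ m"
 define p where "p = x 0"
 define r where "r = x m"
 define P where "P = 1 - \<phi>\<^sup>2"
 have P: "0 < P" using phi_square_less by (simp add: P_def)
 have b3: "b = \<bar>\<beta>\<bar>" by (simp add: b_def \<beta>_def power_abs)
 have b4: "b * b = \<beta>\<^sup>2" unfolding b3 by (simp add: power2_eq_square)
 have b12: "0 <= b" "b < 1" using \<phi> False by (auto simp: b_def power_less_one_iff)
 note b = b12 b3 b4
 have S: "P * S = 1 - \<beta>\<^sup>2"
 proof -
  have "P * S = 1 - (\<phi>\<^sup>2) ^ m" unfolding P_def S_def by (rule one_diff_power_eq[symmetric])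
  then show ?thesis by (simp add: \<beta>_def power_mult[symmetric] mult.commute)
 qed
 have "(r - \<beta> * p)^2 <= G * S" using chain_gain[of x m] by (simp add: r_def p_def \<beta>_def G_def S_def)
 then have "P * (r - \<beta> * p)^2 <= P * (G * S)" using P by simp
 also have "... = (1 - \<beta>\<^sup>2) * G" using S by (simp add: mult.assoc mult.commute mult.left_commute)
 finally have g: "P * (r - \<beta> * p)^2 <= (1 - \<beta>\<^sup>2) * G" .
 have pr: "2 * (\<beta> * (p * r)) <= b * (p\<^sup>2 + r\<^sup>2)"
 proof -
  have "2 * (\<beta> * (p * r)) <= 2 * (b * \<bar>p * r\<bar>)"
   using abs_ge_self[of "\<beta> * (p * r)"] unfolding b(3) abs_mult by simp
  also have "... = b * (2 * \<bar>p * r\<bar>)" by simp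
  also have "... <= b * (p\<^sup>2 + r\<^sup>2)"
  proof (intro mult_left_mono b)
   have "0 <= (\<bar>p\<bar> - \<bar>r\<bar>)^2" by simp
   then show "2 * \<bar>p * r\<bar> <= p\<^sup>2 + r\<^sup>2" by (simp add: power2_diff abs_mult)
  qed
  finally show ?thesis .
 qed
 \<comment> \<open>The factor \<open>1 - b\<close> completes 1 + b to 1 - \<phi>^(2 m), the
   numerator of the geometric sum in \<open>chain_gain\<close>. It has to be positive, hence the
   separate case m = 0.\<close>
 have "(1 - b) * ((1 + \<phi>\<^sup>2 * b) * (p\<^sup>2 + r\<^sup>2)) = (p\<^sup>2 + r\<^sup>2) * (1 - \<phi>\<^sup>2 * (b * b)) - P * (b * (p\<^sup>2 + r\<^sup>2))"
  by (simp add: P_def algebra_simps)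
 also have "... <= (p\<^sup>2 + r\<^sup>2) * (1 - \<phi>\<^sup>2 * \<beta>\<^sup>2) - P * (2 * (\<beta> * (p * r)))"
  unfolding b(4) using mult_left_mono[OF pr, of P] P by simp
 also have "... = (1 - \<beta>\<^sup>2) * (p\<^sup>2 + \<phi>\<^sup>2 * r\<^sup>2) + P * (r - \<beta> * p)^2"
  by (simp add: P_def power2_eq_square algebra_simps)
 also have "... <= (1 - \<beta>\<^sup>2) * (p\<^sup>2 + \<phi>\<^sup>2 * r\<^sup>2) + (1 - \<beta>\<^sup>2) * G" using g by simp
 also have "... = (1 - b * b) * (p\<^sup>2 + G + \<phi>\<^sup>2 * r\<^sup>2)" unfolding b(4) by (simp add: algebra_simps)
 also have "... = (1 - b) * ((1 + b) * (p\<^sup>2 + G + \<phi>\<^sup>2 * r\<^sup>2))" by (simp add: algebra_simps)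
 finally show ?thesis using b by (simp add: p_def r_def G_def)
qed

text \<open>Reversibility of the stationary chain: (1 - \<phi>^2) p^2 + (q - \<phi> p)^2 is
  symmetric in p and q, so each step may be read backwards and its square dropped.\<close>

lemma first_block_bound: "(1 - \<phi>\<^sup>2) * (x m)^2 <= (1 - \<phi>\<^sup>2) * (x 0)^2 + (\<Sum>t<m. (x (Suc t) - \<phi> * x t)^2)" for x :: "nat => real"
proof (induction m)
 case (Suc m)
 have "(1 - \<phi>\<^sup>2) * (x m)^2 + (x (Suc m) - \<phi> * x m)^2 - (1 - \<phi>\<^sup>2) * (x (Suc m))^2 = (x m - \<phi> * x (Suc m))^2"
  by (simp add: power2_eq_square algebra_simps)
 then have "(1 - \<phi>\<^sup>2) * (x (Suc m))^2 <= (1 - \<phi>\<^sup>2) * (x m)^2 + (x (Suc m) - \<phi> * x m)^2"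
  by (smt (verit) zero_le_power2)
 then show ?case using Suc by simp
qed simp

definition qform :: "nat => point => real" where
 "qform N u = (\<Sum>t<N. (innov t u)^2 / (sd t)^2)"

lemma qform_eq: "(\<Sum>i<N. \<Sum>k<N. prec N i k * u i * u k) = qform N u"
 by (simp add: prec_form qform_def power2_eq_square)

lemma qform_nonneg: "0 <= qform N u"
 by (simp add: qform_def sum_nonneg)

lemma qform_zero:
 assumes "qform N u = 0" and "i < N"
 shows "u i = 0"
proof -
 have z: "innov t u = 0" if "t < N" for t
 proof -
  have "(innov t u)^2 / (sd t)^2 = 0"
   using assms(1) that unfolding qform_def by (subst (asm) sum_nonneg_eq_0_iff) auto
  then show ?thesis using sigma_pos[of t] by simp
 qed
 have "i < N ==> u i = 0" for i
  by (induction i) (use z in \<open>force simp: innov_def\<close>)+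
 then show ?thesis using assms(2) by simp
qed

context
 fixes N d s m :: nat
 assumes s: "s = Suc m" and N: "N = d * s"
begin

definition res :: "nat => point => nat => real" where
 "res j u i = (if i div s = j then u i else 0)"

lemma div_block: "r < s ==> (j * s + r) div s = j"
 by simp

text \<open>Cutting out a block leaves its inner innovations, its first value and, if a block
  follows, the innovation \<open>- \<phi> * x m\<close> of the next site. The factor 1 - \<phi>^2
  clears the variances except at site 0, whose variance is 1.\<close>

lemma block_energy_ge:
 fixes u :: "nat => real"
 assumes j: "j < d"
 defines "x \<equiv> \<lambda>r. u (j * s + r)"
 shows "(if j = 0 then 1 - \<phi>\<^sup>2 else 1) * (x 0)^2 + (\<Sum>r<m. (x (Suc r) - \<phi> * x r)^2) + (if Suc j < d then \<phi>\<^sup>2 * (x m)^2 else 0)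
  <= (1 - \<phi>\<^sup>2) * qform N (res j u)"
proof -
 define v where "v = res j u"
 define w where "w t = (if t = 0 then 1 - \<phi>\<^sup>2 else 1) * (innov t v)^2" for t
 have P: "0 < 1 - \<phi>\<^sup>2" using phi_square_less by simp
 have w0: "0 <= w t" for t using P by (simp add: w_def)
 have "(1 - \<phi>\<^sup>2) * qform N v = (\<Sum>t<N. w t)"
  unfolding qform_def sum_distrib_left by (intro sum.cong refl) (use P in \<open>simp add: w_def sigma_square\<close>)
 have jN: "j * s + s <= N"
 proof -
  have "Suc j * s <= d * s" using j by (intro mult_right_mono) auto
  then show ?thesis by (simp add: N add.commute)
 qed
 have i0: "innov (j * s) v = x 0"
 proof (cases j)
  case 0 then show ?thesis by (simp add: innov_def v_def res_def x_def)
 next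
  case (Suc k)
  have s0: "0 < s" using s by simp
  have "j * s - 1 = k * s + m" using Suc s by simp
  then have "(j * s - 1) div s = k" using div_block[of m k] s by simp
  then have "v (j * s - 1) = 0" unfolding v_def res_def Suc by simp
  moreover have "v (j * s) = x 0" using div_block[OF s0, of j] by (simp add: v_def res_def x_def)
  moreover have "j * s \<noteq> 0" using Suc s0 by simp
  ultimately show ?thesis by (simp add: innov_def)
 qed
 have ir: "innov (j * s + Suc r) v = x (Suc r) - \<phi> * x r" if "r < m" for r
 proof -
  have "r < s" "Suc r < s" using that s by simp_all
  then have "v (j * s + Suc r) = x (Suc r)" "v (j * s + r) = x r" by (simp_all only: v_def res_def x_def div_block simp_thms if_True)
  then show ?thesis by (simp add: innov_def)
 qed
 have il: "innov (j * s + s) v = - \<phi> * x m"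
 proof -
  have s0: "0 < s" "m < s" using s by simp_all
  have "(j * s + s) div s = Suc j" using s0 by simp
  then have "v (j * s + s) = 0" unfolding v_def res_def by simp
  moreover have "v (j * s + m) = x m" using s0 by (simp only: v_def res_def x_def div_block simp_thms if_True)
  moreover have "j * s + s - 1 = j * s + m" using s by simp
  ultimately show ?thesis using s0 by (simp add: innov_def)
 qed
 have T: "(\<Sum>t\<in>{j * s..<j * s + s}. w t) = w (j * s) + (\<Sum>r<m. w (j * s + Suc r))"
 proof -
  have "(\<Sum>t\<in>{j * s..<j * s + s}. w t) = (\<Sum>r<s. w (j * s + r))"
   using sum.shift_bounds_nat_ivl[of w 0 "j * s" s] by (simp add: atLeast0LessThan add.commute)
  then show ?thesis unfolding s sum.lessThan_Suc_shift by simp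
 qed
 have "(if j = 0 then 1 - \<phi>\<^sup>2 else 1) * (x 0)^2 + (\<Sum>r<m. (x (Suc r) - \<phi> * x r)^2) + (if Suc j < d then \<phi>\<^sup>2 * (x m)^2 else 0)
  = (\<Sum>t\<in>{j * s..<j * s + s}. w t) + (if Suc j < d then w (j * s + s) else 0)"
 proof -
  have "(\<Sum>r<m. w (j * s + Suc r)) = (\<Sum>r<m. (x (Suc r) - \<phi> * x r)^2)" by (intro sum.cong refl) (use ir in \<open>simp add: w_def\<close>)
  moreover have "w (j * s) = (if j = 0 then 1 - \<phi>\<^sup>2 else 1) * (x 0)^2" using s i0 by (simp add: w_def)
  moreover have "w (j * s + s) = \<phi>\<^sup>2 * (x m)^2" using s unfolding w_def il by (simp add: power_mult_distrib)
  ultimately show ?thesis unfolding T by simp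
 qed
 also have "... <= (\<Sum>t<N. w t)"
 proof (cases "Suc j < d")
  case True
  have "Suc (Suc j) * s <= d * s" using True by (intro mult_right_mono) auto
  then have "j * s + s < N" using s by (simp add: N)
  then have "(\<Sum>t\<in>insert (j * s + s) {j * s..<j * s + s}. w t) <= (\<Sum>t<N. w t)"
   using w0 by (intro sum_mono2) auto
  then show ?thesis using True by simp
 next
  case False
  then show ?thesis using w0 jN by (auto intro!: sum_mono2)
 qed
 finally show ?thesis using \<open>(1 - \<phi>\<^sup>2) * qform N v = (\<Sum>t<N. w t)\<close> by (simp add: v_def)
qed

text \<open>Only ends facing another block count. Two such ends need
  \<open>interior_block_bound\<close>; with at most one, the energy dominates its square with
  constant 1, and 1 + \<phi>^2 b \<le> 1 + b weakens this to the common form.\<close>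

lemma block_energy_ends:
 assumes j: "j < d"
 shows "(1 + \<phi>\<^sup>2 * \<bar>\<phi>\<bar> ^ m) * ((if j = 0 then 0 else (u (j * s))^2) + (if Suc j < d then (u (j * s + m))^2 else 0))
  <= (1 + \<bar>\<phi>\<bar> ^ m) * ((1 - \<phi>\<^sup>2) * qform N (res j u))"
proof -
 define x where "x r = u (j * s + r)" for r
 define G where "G = (\<Sum>r<m. (x (Suc r) - \<phi> * x r)^2)"
 define b where "b = \<bar>\<phi>\<bar> ^ m"
 define Y where "Y = (1 - \<phi>\<^sup>2) * qform N (res j u)"
 have b: "0 <= b" by (simp add: b_def)
 have P: "0 < 1 - \<phi>\<^sup>2" using phi_square_less by simp
 have G: "0 <= G" by (simp add: G_def sum_nonneg)
 have Y: "(if j = 0 then 1 - \<phi>\<^sup>2 else 1) * (x 0)^2 + G + (if Suc j < d then \<phi>\<^sup>2 * (x m)^2 else 0) <= Y"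
  unfolding G_def x_def Y_def by (rule block_energy_ge[OF j])
 have le: "1 + \<phi>\<^sup>2 * b <= 1 + b" using b phi_square_less by (simp add: mult_left_le_one_le)
 have weak: "(1 + \<phi>\<^sup>2 * b) * Z <= (1 + b) * Y" if "Z <= Y" "0 <= Z" for Z
  using le that b by (intro mult_mono) auto
 have "(1 + \<phi>\<^sup>2 * b) * ((if j = 0 then 0 else (x 0)^2) + (if Suc j < d then (x m)^2 else 0)) <= (1 + b) * Y"
 proof -
  consider "j \<noteq> 0" "Suc j < d" | "j \<noteq> 0" "\<not> Suc j < d" | "j = 0" "Suc j < d" | "j = 0" "\<not> Suc j < d" by blast
  then show ?thesis
  proof cases
   case 1
   have "(1 + b) * ((x 0)^2 + G + \<phi>\<^sup>2 * (x m)^2) <= (1 + b) * Y" using 1 Y b by (intro mult_left_mono) auto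
   then show ?thesis using interior_block_bound[of m x] 1 by (simp add: b_def G_def)
  next
   case 2
   then show ?thesis using Y G by (intro weak) auto
  next
   case 3
   have "(x m)^2 <= Y" using Y 3 first_block_bound[of x m] unfolding G_def by (simp add: algebra_simps)
   then show ?thesis using 3 by (intro weak) auto
  next
   case 4
   have "0 <= (1 - \<phi>\<^sup>2) * (x 0)^2" using P by simp
   then show ?thesis using Y 4 G by (intro weak) auto
  qed
 qed
 then show ?thesis unfolding x_def b_def Y_def by (simp only: add_0_right)
qed

text \<open>Inside a block the restriction leaves an innovation unchanged; at the first site of a
  later block the square of p - \<phi> q is replaced by p^2 + \<phi>^2 q^2, which exposes the cross
  term.\<close>

lemma energy_split:
 "(\<Sum>j<d. qform N (res j u)) - qform N u
  = (\<Sum>t<N. if t \<noteq> 0 \<and> (t - 1) div s \<noteq> t div s then 2 * \<phi> * u t * u (t - 1) / (1 - \<phi>\<^sup>2) else 0)"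
proof -
 have "(\<Sum>j<d. qform N (res j u)) = (\<Sum>t<N. (\<Sum>j<d. (innov t (res j u))^2) / (sd t)^2)"
  unfolding qform_def sum_divide_distrib by (rule sum.swap)
 moreover have "(\<Sum>j<d. (innov t (res j u))^2) = (innov t u)^2 + (if t \<noteq> 0 \<and> (t - 1) div s \<noteq> t div s then 2 * \<phi> * u t * u (t - 1) else 0)"
  if t: "t < N" for t
 proof -
  have td: "t div s < d" using t s by (simp add: N less_mult_imp_div_less)
  have td': "(t - 1) div s < d" using td by (meson diff_le_self div_le_mono le_less_trans)
  show ?thesis
  proof (cases "t = 0")
   case True
   have "(\<Sum>j<d. (innov t (res j u))^2) = (\<Sum>j<d. if j = 0 then (u 0)^2 else 0)"
    by (intro sum.cong refl) (simp add: True innov_def res_def)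
   then show ?thesis using td True by (simp add: innov_def)
  next
   case False
   show ?thesis
   proof (cases "(t - 1) div s = t div s")
    case True
    have "(\<Sum>j<d. (innov t (res j u))^2) = (\<Sum>j<d. if j = t div s then (innov t u)^2 else 0)"
     by (intro sum.cong refl) (use False True in \<open>auto simp: innov_def res_def\<close>)
    then show ?thesis using td True by simp
   next
    case neq: False
    have "(\<Sum>j<d. (innov t (res j u))^2) = (\<Sum>j<d. (if j = t div s then (u t)^2 else 0) + (if j = (t - 1) div s then (\<phi> * u (t - 1))^2 else 0))"
     by (intro sum.cong refl) (use False neq in \<open>auto simp: innov_def res_def\<close>)
    also have "... = (u t)^2 + (\<phi> * u (t - 1))^2" unfolding sum.distrib using td td' by simp
    finally show ?thesis using False neq by (simp add: innov_def power2_eq_square algebra_simps)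
   qed
  qed
 qed
 ultimately have "(\<Sum>j<d. qform N (res j u)) = (\<Sum>t<N. ((innov t u)^2 + (if t \<noteq> 0 \<and> (t - 1) div s \<noteq> t div s then 2 * \<phi> * u t * u (t - 1) else 0)) / (sd t)^2)"
  by simp
 then have "(\<Sum>j<d. qform N (res j u)) - qform N u = (\<Sum>t<N. (if t \<noteq> 0 \<and> (t - 1) div s \<noteq> t div s then 2 * \<phi> * u t * u (t - 1) else 0) / (sd t)^2)"
  by (simp add: qform_def add_divide_distrib sum.distrib)
 also have "... = (\<Sum>t<N. if t \<noteq> 0 \<and> (t - 1) div s \<noteq> t div s then 2 * \<phi> * u t * u (t - 1) / (1 - \<phi>\<^sup>2) else 0)"
  by (intro sum.cong refl) (simp add: sigma_square)
 finally show ?thesis .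
qed

definition psi :: real where
 "psi = (\<bar>\<phi>\<bar> + \<bar>\<phi>\<bar> ^ s) / (1 + \<bar>\<phi>\<bar> ^ (s + 1))"

text \<open>As quadratic forms, D^-1 - Q \<le> psi D^-1. The left side is a sum of couplings of
  adjacent block ends; 2 p q \<le> p^2 + q^2 separates them into end values, which
  \<open>block_energy_ends\<close> compares with the block energies.\<close>

lemma rayleigh: "(1 - psi) * (\<Sum>j<d. qform N (res j u)) <= qform N u"
proof -
 define a where "a = \<bar>\<phi>\<bar>"
 define b where "b = a ^ m"
 define P where "P = 1 - \<phi>\<^sup>2"
 define Z where "Z j = (if j = 0 then 0 else (u (j * s))^2) + (if Suc j < d then (u (j * s + m))^2 else 0)" for j
 have P: "0 < P" using phi_square_less by (simp add: P_def)
 have a: "0 <= a" and b: "0 <= b" by (simp_all add: a_def b_def)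
 have aa: "\<phi>\<^sup>2 = a * a" by (simp add: a_def power2_eq_square)
 have den: "0 < 1 + \<phi>\<^sup>2 * b" using b by (simp add: add_pos_nonneg)
 \<comment> \<open>With s = m + 1 the stated constant is |\<phi>| divided by the end value constant
   of \<open>interior_block_bound\<close>.\<close>
 have psi: "psi = a * (1 + b) / (1 + \<phi>\<^sup>2 * b)"
 proof -
  have "a + a ^ s = a * (1 + b)" "a ^ (s + 1) = a * a * b" unfolding s b_def by (simp_all add: algebra_simps)
  then show ?thesis by (simp only: psi_def a_def[symmetric] aa)
 qed
 have Zle: "a * Z j <= psi * (P * qform N (res j u))" if j: "j < d" for j
 proof -
  have "(1 + \<phi>\<^sup>2 * b) * Z j <= (1 + b) * (P * qform N (res j u))"
   unfolding Z_def b_def a_def P_def by (rule block_energy_ends[OF j])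
  then have "a * ((1 + \<phi>\<^sup>2 * b) * Z j) <= a * ((1 + b) * (P * qform N (res j u)))" using a by (rule mult_left_mono)
  then have "a * Z j * (1 + \<phi>\<^sup>2 * b) <= a * (1 + b) * (P * qform N (res j u))" by (simp only: mult.assoc mult.commute mult.left_commute)
  then have "a * Z j <= a * (1 + b) * (P * qform N (res j u)) / (1 + \<phi>\<^sup>2 * b)" using den by (simp add: pos_le_divide_eq)
  then show ?thesis unfolding psi by simp
 qed
 define g where "g t = a * ((u t)^2 + (u (t - 1))^2)" for t
 \<comment> \<open>Blocks change exactly at the first site of every block except block 0.\<close>
 have bdry: "t \<noteq> 0 \<and> (t - 1) div s \<noteq> t div s \<longleftrightarrow> (\<exists>j. t = Suc j * s)" for t
 proof
  assume t: "t \<noteq> 0 \<and> (t - 1) div s \<noteq> t div s"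
  have "t mod s = 0"
  proof (rule ccontr)
   assume "t mod s \<noteq> 0"
   then obtain r where r: "t mod s = Suc r" using not0_implies_Suc by blast
   have "Suc r < s" using r s mod_less_divisor[of s t] by simp
   have "t - 1 = (t div s) * s + r" using r div_mult_mod_eq[of t s] by simp
   then have "(t - 1) div s = t div s" using \<open>Suc r < s\<close> by simp
   then show False using t by simp
  qed
  then have "t = (t div s) * s" using div_mult_mod_eq[of t s] by simp
  moreover have "t div s \<noteq> 0" using calculation t by (metis mult_0)
  ultimately show "\<exists>j. t = Suc j * s" by (metis not0_implies_Suc)
 next
  assume "\<exists>j. t = Suc j * s"
  then obtain j where t: "t = Suc j * s" by blast
  have "t - 1 = j * s + m" using t s by simp
  then have "(t - 1) div s = j" using div_block[of m j] s by simp
  moreover have "t div s = Suc j" unfolding t by (rule nonzero_mult_div_cancel_right) (use s in simp)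
  ultimately show "t \<noteq> 0 \<and> (t - 1) div s \<noteq> t div s" using t s by simp
 qed
 have "P * ((\<Sum>j<d. qform N (res j u)) - qform N u) = (\<Sum>t<N. if t \<noteq> 0 \<and> (t - 1) div s \<noteq> t div s then 2 * \<phi> * u t * u (t - 1) else 0)"
  unfolding energy_split sum_distrib_left by (intro sum.cong refl) (use P in \<open>simp add: P_def\<close>)
 also have "... <= (\<Sum>t<N. if t \<noteq> 0 \<and> (t - 1) div s \<noteq> t div s then g t else 0)"
 proof (intro sum_mono)
  fix t
  have "2 * \<phi> * u t * u (t - 1) <= 2 * (a * \<bar>u t * u (t - 1)\<bar>)"
   using abs_ge_self[of "\<phi> * (u t * u (t - 1))"] unfolding abs_mult[of \<phi>] a_def by (simp add: mult.assoc)
  also have "... = a * (2 * \<bar>u t * u (t - 1)\<bar>)" by simp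
  also have "... <= g t"
   unfolding g_def
  proof (intro mult_left_mono a)
   have "0 <= (\<bar>u t\<bar> - \<bar>u (t - 1)\<bar>)^2" by simp
   then show "2 * \<bar>u t * u (t - 1)\<bar> <= (u t)^2 + (u (t - 1))^2" by (simp add: power2_diff abs_mult)
  qed
  finally show "(if t \<noteq> 0 \<and> (t - 1) div s \<noteq> t div s then 2 * \<phi> * u t * u (t - 1) else 0) <= (if t \<noteq> 0 \<and> (t - 1) div s \<noteq> t div s then g t else 0)" by simp
 qed
 also have "... = (\<Sum>t\<in>(\<lambda>j. Suc j * s) ` {..<d - 1}. g t)"
 proof (rule sum.mono_neutral_cong_right)
  show "(\<lambda>j. Suc j * s) ` {..<d - 1} \<subseteq> {..<N}"
  proof
   fix t assume "t \<in> (\<lambda>j. Suc j * s) ` {..<d - 1}"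
   then obtain j where j: "t = Suc j * s" "j < d - 1" by blast
   have "Suc j < d" "0 < s" using j(2) s by simp_all
   then have "Suc j * s < d * s" by (rule mult_less_mono1)
   then show "t \<in> {..<N}" unfolding j(1) N by simp
  qed
  show "\<forall>t\<in>{..<N} - (\<lambda>j. Suc j * s) ` {..<d - 1}. (if t \<noteq> 0 \<and> (t - 1) div s \<noteq> t div s then g t else 0) = 0"
  proof
   fix t assume t: "t \<in> {..<N} - (\<lambda>j. Suc j * s) ` {..<d - 1}"
   have "\<not> (\<exists>j. t = Suc j * s)"
   proof
    assume "\<exists>j. t = Suc j * s"
    then obtain j where j: "t = Suc j * s" by blast
    then have "Suc j * s < d * s" using t N by simp
    then have "j \<in> {..<d - 1}" by (simp only: mult_less_cancel2) auto
    then show False using t j by blast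
   qed
   then have "\<not> (t \<noteq> 0 \<and> (t - 1) div s \<noteq> t div s)" using bdry[of t] by blast
   then show "(if t \<noteq> 0 \<and> (t - 1) div s \<noteq> t div s then g t else 0) = 0" by (rule if_not_P)
  qed
 qed (use bdry in auto)
 also have "... = (\<Sum>j<d - 1. g (Suc j * s))"
 proof -
  have "s \<noteq> 0" using s by simp
  then have "inj_on (\<lambda>j. Suc j * s) {..<d - 1}" by (intro inj_onI) (metis mult_cancel2 nat.inject)
  then show ?thesis by (simp add: sum.reindex del: mult_Suc)
 qed
 \<comment> \<open>Each boundary contributes the last value of one block and the first value of the
   next. Regrouped by blocks, block 0 lacks its left end and the last block its right end, as in
   \<open>Z\<close>.\<close>
 also have "... = (\<Sum>j<d. a * Z j)"
 proof (cases d)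
  case (Suc k)
  have e: "Suc j * s - 1 = j * s + m" for j using s by simp
  have "(\<Sum>j<d. a * Z j) = a * ((\<Sum>j<Suc k. if j = 0 then 0 else (u (j * s))^2) + (\<Sum>j<Suc k. if j < k then (u (j * s + m))^2 else 0))"
   unfolding Suc Z_def by (simp only: sum_distrib_left[symmetric] sum.distrib Suc_less_eq)
  also have "(\<Sum>j<Suc k. if j = 0 then 0 else (u (j * s))^2) = (\<Sum>j<k. (u (Suc j * s))^2)"
   unfolding sum.lessThan_Suc_shift by simp
  also have "(\<Sum>j<Suc k. if j < k then (u (j * s + m))^2 else 0) = (\<Sum>j<k. (u (j * s + m))^2)"
  proof -
   have "(\<Sum>j<k. if j < k then (u (j * s + m))^2 else 0) = (\<Sum>j<k. (u (j * s + m))^2)" by (intro sum.cong refl) simp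
   then show ?thesis by simp
  qed
  finally show ?thesis
   unfolding Suc g_def e by (simp only: diff_Suc_1 sum_distrib_left[symmetric] sum.distrib)
 qed simp
 also have "... <= (\<Sum>j<d. psi * (P * qform N (res j u)))" by (intro sum_mono Zle) simp
 also have "... = P * (psi * (\<Sum>j<d. qform N (res j u)))" by (simp add: sum_distrib_left mult.left_commute)
 finally have "(\<Sum>j<d. qform N (res j u)) - qform N u <= psi * (\<Sum>j<d. qform N (res j u))" using P by simp
 then show ?thesis by (simp add: algebra_simps)
qed

text \<open>The block diagonal part of the precision matrix, that is the inverse of
  \<open>D\<close>.\<close>

definition diag_prec :: "nat => nat => real" where
 "diag_prec i k = (if i div s = k div s then prec N i k else 0)"

lemma diag_prec_form: "(\<Sum>i<N. \<Sum>k<N. diag_prec i k * u i * u k) = (\<Sum>j<d. qform N (res j u))"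
proof -
 have "(\<Sum>j<d. qform N (res j u)) = (\<Sum>j<d. \<Sum>i<N. \<Sum>k<N. prec N i k * res j u i * res j u k)" by (simp only: qform_eq)
 also have "... = (\<Sum>i<N. \<Sum>j<d. \<Sum>k<N. prec N i k * res j u i * res j u k)" by (rule sum.swap)
 also have "... = (\<Sum>i<N. \<Sum>k<N. \<Sum>j<d. prec N i k * res j u i * res j u k)" by (intro sum.cong refl sum.swap)
 also have "... = (\<Sum>i<N. \<Sum>k<N. diag_prec i k * u i * u k)"
 proof (intro sum.cong refl)
  fix i k assume "i \<in> {..<N}"
  then have "i div s < d" using s by (simp add: N less_mult_imp_div_less)
  moreover have "(\<Sum>j<d. prec N i k * res j u i * res j u k) = (\<Sum>j<d. if j = i div s then diag_prec i k * u i * u k else 0)"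
   by (intro sum.cong refl) (auto simp: res_def diag_prec_def)
  ultimately show "(\<Sum>j<d. prec N i k * res j u i * res j u k) = diag_prec i k * u i * u k" by simp
 qed
 finally show ?thesis by simp
qed

lemma diag_prec_form_pos:
 assumes "i < N" "u i \<noteq> 0"
 shows "0 < (\<Sum>j<d. qform N (res j u))"
proof -
 define j where "j = i div s"
 have j: "j < d" using assms s by (simp add: j_def N less_mult_imp_div_less)
 have "res j u i \<noteq> 0" using assms by (simp add: res_def j_def)
 then have "qform N (res j u) \<noteq> 0" using qform_zero[OF _ assms(1)] by blast
 then have "0 < qform N (res j u)" using qform_nonneg[of N "res j u"] by linarith
 also have "... <= (\<Sum>j<d. qform N (res j u))"
  by (rule member_le_sum) (use j qform_nonneg in auto)
 finally show ?thesis .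
qed

end

end

section \<open>Block diagonal matrices and the eigenvalues of I - D Q\<close>

lemma diag_block_mat_index:
 assumes "\<forall>A\<in>set As. A \<in> carrier_mat s s" and s: "0 < s"
 shows "diag_block_mat As \<in> carrier_mat (length As * s) (length As * s)"
  and "i < length As * s ==> k < length As * s ==>
   diag_block_mat As $$ (i, k) = (if i div s = k div s then As ! (i div s) $$ (i mod s, k mod s) else 0)"
 using assms(1)
proof (induction As arbitrary: i k)
 case Nil
 { case 1 show ?case by simp }
 { case 2 then show ?case by simp }
next
 case (Cons A As)
 have A: "A \<in> carrier_mat s s" and As: "\<forall>A\<in>set As. A \<in> carrier_mat s s" if "\<forall>A\<in>set (A # As). A \<in> carrier_mat s s" using that by auto
 { case 1
  then show ?case using Cons.IH(1)[OF As[OF 1]] A[OF 1] by (auto simp: Let_def) }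
 { case 2
  have D: "diag_block_mat As \<in> carrier_mat (length As * s) (length As * s)" by (rule Cons.IH(1)[OF As[OF 2(3)]])
  note IH = Cons.IH(2)[OF _ _ As[OF 2(3)]]
  have dims: "dim_row A = s" "dim_col A = s" "dim_row (diag_block_mat As) = length As * s" "dim_col (diag_block_mat As) = length As * s"
   using A[OF 2(3)] D by auto
  have e: "diag_block_mat (A # As) $$ (i, k) =
   (if i < s then if k < s then A $$ (i, k) else 0 else if k < s then 0 else diag_block_mat As $$ (i - s, k - s))"
   using 2(1,2) by (auto simp: Let_def dims)
  have dv: "i div s = Suc ((i - s) div s)" "i mod s = (i - s) mod s" if "\<not> i < s" for i
   using that s by (simp_all add: le_div_geq le_mod_geq)
  show ?case
  proof (cases "i < s"; cases "k < s")
   assume "\<not> i < s" "\<not> k < s"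
   moreover have "i - s < length As * s" "k - s < length As * s" using 2(1,2) calculation by auto
   ultimately show ?thesis unfolding e using IH[of "i - s" "k - s"] by (simp add: dv)
  qed (use e dv in auto) }
qed

lemma sum_block:
 fixes f :: "nat => 'a::comm_monoid_add"
 assumes j: "j < d" and s: "0 < s"
 shows "(\<Sum>l<d * s. if l div s = j then f (l mod s) else 0) = (\<Sum>b<s. f b)"
proof -
 have "(\<Sum>l<d * s. if l div s = j then f (l mod s) else 0) = (\<Sum>l\<in>(\<lambda>b. j * s + b) ` {..<s}. f (l mod s))"
 proof (rule sum.mono_neutral_cong_right)
  have "Suc j * s <= d * s" using j by (intro mult_right_mono) auto
  then show "(\<lambda>b. j * s + b) ` {..<s} \<subseteq> {..<d * s}" by auto
  show "\<forall>l\<in>{..<d * s} - (\<lambda>b. j * s + b) ` {..<s}. (if l div s = j then f (l mod s) else 0) = 0"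
  proof
   fix l assume l: "l \<in> {..<d * s} - (\<lambda>b. j * s + b) ` {..<s}"
   have "l div s \<noteq> j"
   proof
    assume "l div s = j"
    then have "l = j * s + l mod s" using div_mult_mod_eq[of l s] by simp
    moreover have "l mod s \<in> {..<s}" using s by simp
    ultimately show False using l by blast
   qed
   then show "(if l div s = j then f (l mod s) else 0) = 0" by simp
  qed
  show "\<And>l. l \<in> (\<lambda>b. j * s + b) ` {..<s} ==> (if l div s = j then f (l mod s) else 0) = f (l mod s)" by auto
 qed simp
 also have "... = (\<Sum>b<s. f b)"
  by (subst sum.reindex) (auto simp: inj_on_def intro!: sum.cong)
 finally show ?thesis .
qed

lemma mult_mat_vec_entry:
 assumes "A \<in> carrier_mat n n'" "v \<in> carrier_vec n'" "i < n"
 shows "(A *\<^sub>v v) $ i = (\<Sum>k<n'. A $$ (i, k) * v $ k)"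
 using assms by (simp add: scalar_prod_def atLeast0LessThan)

lemma mult_mat_entry:
 assumes "A \<in> carrier_mat n n'" "B \<in> carrier_mat n' n''" "i < n" "k < n''"
 shows "(A * B) $$ (i, k) = (\<Sum>l<n'. A $$ (i, l) * B $$ (l, k))"
 using assms by (simp add: scalar_prod_def atLeast0LessThan)

text \<open>Reduces Hermitian forms of complex eigenvectors to the real energies of their real and
  imaginary parts; by symmetry the mixed terms cancel.\<close>

lemma hermitian_form:
 fixes w :: "nat => complex" and S :: "nat => nat => real"
 assumes sym: "\<And>h k. S h k = S k h"
 shows "(\<Sum>h<n. \<Sum>k<n. of_real (S h k) * (cnj (w h) * w k))
  = of_real ((\<Sum>h<n. \<Sum>k<n. S h k * Re (w h) * Re (w k)) + (\<Sum>h<n. \<Sum>k<n. S h k * Im (w h) * Im (w k)))"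
proof (rule complex_eqI)
 have re: "Re (of_real r * (cnj a * b)) = r * Re a * Re b + r * Im a * Im b" for r a b by (simp add: algebra_simps)
 have im: "Im (of_real r * (cnj a * b)) = r * (Re a * Im b) - r * (Im a * Re b)" for r a b by (simp add: algebra_simps)
 show "Re (\<Sum>h<n. \<Sum>k<n. of_real (S h k) * (cnj (w h) * w k))
  = Re (of_real ((\<Sum>h<n. \<Sum>k<n. S h k * Re (w h) * Re (w k)) + (\<Sum>h<n. \<Sum>k<n. S h k * Im (w h) * Im (w k))))"
  by (simp only: Re_sum re Re_complex_of_real sum.distrib)
 have "(\<Sum>h<n. \<Sum>k<n. S h k * (Im (w h) * Re (w k))) = (\<Sum>k<n. \<Sum>h<n. S h k * (Im (w h) * Re (w k)))" by (rule sum.swap)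
 also have "... = (\<Sum>h<n. \<Sum>k<n. S h k * (Re (w h) * Im (w k)))" by (intro sum.cong refl) (simp add: sym mult.commute)
 finally show "Im (\<Sum>h<n. \<Sum>k<n. of_real (S h k) * (cnj (w h) * w k))
  = Im (of_real ((\<Sum>h<n. \<Sum>k<n. S h k * Re (w h) * Re (w k)) + (\<Sum>h<n. \<Sum>k<n. S h k * Im (w h) * Im (w k))))"
  by (simp only: Im_sum im Im_complex_of_real sum_subtractf diff_self)
qed

context ar1_chain
begin

context
 fixes N d s m :: nat and Ns :: "nat => nat"
 assumes s: "s = Suc m" and N: "N = d * s" and d: "1 <= d" and Ns: "\<And>j. j < d ==> Ns j = s"
begin

lemma start: "j < d ==> block_start Ns j = j * s"
 unfolding block_start_def using Ns by simp

abbreviation Qm :: "real mat" where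
 "Qm \<equiv> Matrix.mat N N (\<lambda>(i, k). prec N i k)"

lemma sub_block_eq:
 assumes j: "j < d"
 shows "sub_block Ns Qm j j = Matrix.mat s s (\<lambda>(a, b). prec N (j * s + a) (j * s + b))"
proof -
 have "Suc j * s <= d * s" using j by (intro mult_right_mono) auto
 then have "j * s + a < N" if "a < s" for a using that by (simp add: N)
 then show ?thesis unfolding sub_block_def Ns[OF j] start[OF j] by (intro eq_matI) auto
qed

text \<open>\<open>mat_inverse\<close> yields \<open>Some\<close> only for an invertible block. A
  kernel vector of the block, extended by zero, would have energy 0 and vanish by
  \<open>qform_zero\<close>.\<close>

lemma sub_block_inverse:
 assumes j: "j < d"
 defines "S \<equiv> sub_block Ns Qm j j"
 shows "S * the (mat_inverse S) = 1\<^sub>m s" "the (mat_inverse S) \<in> carrier_mat s s"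
proof -
 have S: "S \<in> carrier_mat s s" unfolding S_def sub_block_eq[OF j] by simp
 have "Determinant.det S \<noteq> 0"
 proof
  assume "Determinant.det S = 0"
  then obtain v where v: "v \<in> carrier_vec s" "v \<noteq> 0\<^sub>v s" "S *\<^sub>v v = 0\<^sub>v s"
   using det_0_iff_vec_prod_zero_field[OF S] by blast
  \<comment> \<open>\<open>v\<close> repeated in every block; \<open>res\<close> keeps the copy in
    block \<open>j\<close>.\<close>
  define u where "u i = v $ (i mod s)" for i
  have s0: "0 < s" using s by simp
  have ent: "prec N i k = S $$ (i mod s, k mod s)" if "i div s = j" "k div s = j" for i k
  proof -
   have "i = j * s + i mod s" "k = j * s + k mod s" using that div_mult_mod_eq[of i s] div_mult_mod_eq[of k s] by simp_all
   moreover have "i mod s < s" "k mod s < s" using s0 by simp_all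
   ultimately show ?thesis unfolding S_def sub_block_eq[OF j] by simp
  qed
  have "qform N (res s j u) = (\<Sum>i<N. \<Sum>k<N. prec N i k * res s j u i * res s j u k)" by (rule qform_eq[symmetric])
  also have "... = (\<Sum>i<N. if i div s = j then (\<lambda>a. v $ a * (\<Sum>b<s. S $$ (a, b) * v $ b)) (i mod s) else 0)"
  proof (intro sum.cong refl)
   fix i
   show "(\<Sum>k<N. prec N i k * res s j u i * res s j u k) = (if i div s = j then (\<lambda>a. v $ a * (\<Sum>b<s. S $$ (a, b) * v $ b)) (i mod s) else 0)"
   proof (cases "i div s = j")
    case True
    have "(\<Sum>k<N. prec N i k * res s j u i * res s j u k) = (\<Sum>k<N. if k div s = j then (\<lambda>b. v $ (i mod s) * (S $$ (i mod s, b) * v $ b)) (k mod s) else 0)"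
     by (intro sum.cong refl) (use True ent in \<open>auto simp: res_def[OF s N] u_def\<close>)
    also have "... = (\<Sum>b<s. v $ (i mod s) * (S $$ (i mod s, b) * v $ b))" unfolding N by (rule sum_block[OF j s0])
    finally show ?thesis using True by (simp add: sum_distrib_left)
   qed (simp add: res_def[OF s N])
  qed
  also have "... = (\<Sum>a<s. v $ a * (\<Sum>b<s. S $$ (a, b) * v $ b))" unfolding N by (rule sum_block[OF j s0])
  also have "... = (\<Sum>a<s. v $ a * (S *\<^sub>v v) $ a)" by (intro sum.cong refl) (simp only: mult_mat_vec_entry[OF S v(1)] lessThan_iff)
  also have "... = 0" unfolding v(3) by simp
  finally have z: "qform N (res s j u) = 0" .
  have "v = 0\<^sub>v s"
  proof (rule eq_vecI)
   fix a assume "a < dim_vec (0\<^sub>v s :: real Matrix.vec)"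
   then have a: "a < s" by simp
   have "Suc j * s <= d * s" using j by (intro mult_right_mono) auto
   then have "j * s + a < N" using a by (simp add: N)
   from qform_zero[OF z this] show "v $ a = 0\<^sub>v s $ a" using a by (simp add: res_def[OF s N] u_def)
  qed (use v in simp)
  then show False using v by simp
 qed
 then have "S \<in> Units (ring_mat TYPE(real) s ())" by (rule det_non_zero_imp_unit[OF S])
 then obtain M where M: "mat_inverse S = Some M" using mat_inverse(1)[OF S, where b = "()"] by (cases "mat_inverse S") auto
 from mat_inverse(2)[OF S M] show "S * the (mat_inverse S) = 1\<^sub>m s" "the (mat_inverse S) \<in> carrier_mat s s" by (simp_all add: M)
qed

abbreviation Dm :: "real mat" where
 "Dm \<equiv> block_diag_inv Ns d Qm"

lemma Dm_index:
 shows "Dm \<in> carrier_mat N N"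
  and "i < N ==> k < N ==> Dm $$ (i, k) = (if i div s = k div s then the (mat_inverse (sub_block Ns Qm (i div s) (i div s))) $$ (i mod s, k mod s) else 0)"
proof -
 define As where "As = map (\<lambda>j. the (mat_inverse (sub_block Ns Qm j j))) [0..<d]"
 have As: "\<forall>A\<in>set As. A \<in> carrier_mat s s" unfolding As_def using sub_block_inverse(2) by auto
 have l: "length As * s = N" by (simp add: As_def N)
 have s0: "0 < s" using s by simp
 note ix = diag_block_mat_index[OF As s0, unfolded l]
 show "Dm \<in> carrier_mat N N" using ix(1) by (simp add: block_diag_inv_def As_def)
 assume i: "i < N" and k: "k < N"
 have "i div s < d" using i s by (simp add: N less_mult_imp_div_less)
 then show "Dm $$ (i, k) = (if i div s = k div s then the (mat_inverse (sub_block Ns Qm (i div s) (i div s))) $$ (i mod s, k mod s) else 0)"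
  using ix(2)[OF i k] by (simp add: block_diag_inv_def As_def)
qed

lemma diag_prec_inverse:
 assumes h: "h < N" and k: "k < N"
 shows "(\<Sum>i<N. diag_prec N s h i * Dm $$ (i, k)) = (if h = k then 1 else 0)"
proof (cases "h div s = k div s")
 case False
 then have "(\<Sum>i<N. diag_prec N s h i * Dm $$ (i, k)) = 0"
  by (intro sum.neutral ballI) (use k in \<open>auto simp: diag_prec_def[OF s N] Dm_index(2)\<close>)
 then show ?thesis using False by auto
next
 case True
 define j where "j = k div s"
 define S where "S = sub_block Ns Qm j j"
 define M where "M = the (mat_inverse S)"
 have s0: "0 < s" using s by simp
 have j: "j < d" using k s by (simp add: j_def N less_mult_imp_div_less)
 have SM: "S * M = 1\<^sub>m s" "M \<in> carrier_mat s s" using sub_block_inverse[OF j] by (simp_all add: S_def M_def)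
 have S: "S \<in> carrier_mat s s" unfolding S_def sub_block_eq[OF j] by simp
 have "(\<Sum>i<N. diag_prec N s h i * Dm $$ (i, k)) = (\<Sum>i<N. if i div s = j then (\<lambda>b. S $$ (h mod s, b) * M $$ (b, k mod s)) (i mod s) else 0)"
 proof (intro sum.cong refl)
  fix i assume "i \<in> {..<N}"
  then have i: "i < N" by simp
  show "diag_prec N s h i * Dm $$ (i, k) = (if i div s = j then (\<lambda>b. S $$ (h mod s, b) * M $$ (b, k mod s)) (i mod s) else 0)"
  proof (cases "i div s = j")
   case ij: True
   have "i = j * s + i mod s" "h = j * s + h mod s"
    using ij True div_mult_mod_eq[of i s] div_mult_mod_eq[of h s] by (simp_all add: j_def)
   moreover have "i mod s < s" "h mod s < s" using s0 by simp_all
   ultimately have "prec N h i = S $$ (h mod s, i mod s)" unfolding S_def sub_block_eq[OF j] by simp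
   then show ?thesis using ij True by (simp add: diag_prec_def[OF s N] Dm_index(2)[OF i k] j_def[symmetric] M_def S_def)
  next
   case False
   then show ?thesis by (simp add: Dm_index(2)[OF i k] j_def)
  qed
 qed
 also have "... = (\<Sum>b<s. S $$ (h mod s, b) * M $$ (b, k mod s))" unfolding N by (rule sum_block[OF j s0])
 also have "... = (S * M) $$ (h mod s, k mod s)" by (rule mult_mat_entry[OF S SM(2), symmetric]) (use s0 in auto)
 also have "... = (if h = k then 1 else 0)"
 proof -
  have "h = k \<longleftrightarrow> h mod s = k mod s" using True by (metis div_mult_mod_eq)
  then show ?thesis unfolding SM(1) using s0 by simp
 qed
 finally show ?thesis .
qed

lemma diag_prec_sym: "diag_prec N s h k = diag_prec N s k h"
 by (simp add: diag_prec_def[OF s N] prec_def mult.commute)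

lemma eigenvalue_bound:
 fixes w :: "nat => complex"
 assumes eig: "\<And>i. i < N ==> (\<Sum>k<N. of_real ((1\<^sub>m N - Dm * Qm) $$ (i, k)) * w k) = z * w i"
  and nz: "i0 < N" "w i0 \<noteq> 0"
 shows "\<exists>r. z = of_real r \<and> r <= psi s"
proof -
 have D: "Dm \<in> carrier_mat N N" by (rule Dm_index(1))
 have Qc: "Qm \<in> carrier_mat N N" by simp
 define Qw where "Qw l = (\<Sum>k<N. of_real (prec N l k) * w k)" for l
 have DQ: "(\<Sum>l<N. of_real (Dm $$ (i, l)) * Qw l) = (1 - z) * w i" if i: "i < N" for i
 proof -
  have ent: "(1\<^sub>m N - Dm * Qm) $$ (i, k) = (if k = i then 1 else 0) - (\<Sum>l<N. Dm $$ (i, l) * prec N l k)" if k: "k < N" for k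
  proof -
   have "(Dm * Qm) $$ (i, k) = (\<Sum>l<N. Dm $$ (i, l) * Qm $$ (l, k))" by (rule mult_mat_entry[OF D Qc i k])
   also have "... = (\<Sum>l<N. Dm $$ (i, l) * prec N l k)" by (intro sum.cong refl) (use k in simp)
   finally show ?thesis using i k D by auto
  qed
  have "z * w i = (\<Sum>k<N. (if k = i then w i else 0) - (\<Sum>l<N. of_real (Dm $$ (i, l)) * (of_real (prec N l k) * w k)))"
   unfolding eig[OF i, symmetric] by (intro sum.cong refl) (simp add: ent left_diff_distrib sum_distrib_right mult.assoc)
  also have "... = w i - (\<Sum>k<N. \<Sum>l<N. of_real (Dm $$ (i, l)) * (of_real (prec N l k) * w k))"
   unfolding sum_subtractf using i by simp
  also have "(\<Sum>k<N. \<Sum>l<N. of_real (Dm $$ (i, l)) * (of_real (prec N l k) * w k)) = (\<Sum>l<N. \<Sum>k<N. of_real (Dm $$ (i, l)) * (of_real (prec N l k) * w k))"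
   by (rule sum.swap)
  also have "... = (\<Sum>l<N. of_real (Dm $$ (i, l)) * Qw l)" by (simp add: Qw_def sum_distrib_left)
  finally show ?thesis by (simp add: algebra_simps)
 qed
 have Qw: "Qw h = (1 - z) * (\<Sum>i<N. of_real (diag_prec N s h i) * w i)" if h: "h < N" for h
 proof -
  have "Qw h = (\<Sum>l<N. if l = h then Qw h else 0)" using h by simp
  also have "... = (\<Sum>l<N. of_real (\<Sum>i<N. diag_prec N s h i * Dm $$ (i, l)) * Qw l)"
   by (intro sum.cong refl) (use h in \<open>simp add: diag_prec_inverse del: of_real_sum\<close>)
  also have "... = (\<Sum>l<N. \<Sum>i<N. of_real (diag_prec N s h i) * (of_real (Dm $$ (i, l)) * Qw l))"
   by (simp add: sum_distrib_right mult.assoc)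
  also have "... = (\<Sum>i<N. \<Sum>l<N. of_real (diag_prec N s h i) * (of_real (Dm $$ (i, l)) * Qw l))" by (rule sum.swap)
  also have "... = (\<Sum>i<N. of_real (diag_prec N s h i) * ((1 - z) * w i))"
   by (intro sum.cong refl) (simp add: sum_distrib_left[symmetric] DQ)
  finally show ?thesis by (simp add: sum_distrib_left mult.left_commute)
 qed
 define u where "u i = Re (w i)" for i
 define v where "v i = Im (w i)" for i
 define X where "X = qform N u + qform N v"
 define Y where "Y = (\<Sum>j<d. qform N (res s j u)) + (\<Sum>j<d. qform N (res s j v))"
 have "of_real X = (\<Sum>h<N. \<Sum>k<N. of_real (prec N h k) * (cnj (w h) * w k))"
  unfolding X_def qform_eq[symmetric] u_def v_def by (rule hermitian_form[symmetric]) (simp add: prec_def mult.commute)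
 also have "... = (\<Sum>h<N. cnj (w h) * Qw h)" by (simp add: Qw_def sum_distrib_left mult.left_commute)
 also have "... = (\<Sum>h<N. (1 - z) * (\<Sum>k<N. of_real (diag_prec N s h k) * (cnj (w h) * w k)))"
  by (intro sum.cong refl) (simp add: Qw sum_distrib_left mult.left_commute)
 also have "... = (1 - z) * (\<Sum>h<N. \<Sum>k<N. of_real (diag_prec N s h k) * (cnj (w h) * w k))" by (simp only: sum_distrib_left)
 also have "(\<Sum>h<N. \<Sum>k<N. of_real (diag_prec N s h k) * (cnj (w h) * w k)) = of_real Y"
  unfolding Y_def diag_prec_form[OF s N, symmetric] u_def v_def by (rule hermitian_form[OF diag_prec_sym])
 finally have XY: "of_real X = (1 - z) * of_real Y" .
 have Y0: "0 <= (\<Sum>j<d. qform N (res s j u))" "0 <= (\<Sum>j<d. qform N (res s j v))" by (intro sum_nonneg qform_nonneg)+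
 have Y: "0 < Y"
 proof -
  have "u i0 \<noteq> 0 \<or> v i0 \<noteq> 0" using nz(2) by (auto simp: u_def v_def complex_eq_iff)
  then show ?thesis using diag_prec_form_pos[OF s N nz(1), of u] diag_prec_form_pos[OF s N nz(1), of v] Y0 by (auto simp: Y_def)
 qed
 have "z = of_real (1 - X / Y)" using XY Y by (simp add: field_simps)
 moreover have "1 - X / Y <= psi s"
 proof -
  have "(1 - psi s) * Y <= X"
   unfolding X_def Y_def distrib_left by (intro add_mono rayleigh[OF s N])
  then show ?thesis using Y by (simp add: field_simps)
 qed
 ultimately show ?thesis by blast
qed

text \<open>\<open>Max\<close> needs a nonempty real spectrum. A complex eigenvalue exists, it is
  real by \<open>eigenvalue_bound\<close>, and the real or the imaginary part of its eigenvector is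
  a nonzero real eigenvector.\<close>

lemma psi_max_le: "psi_max (1\<^sub>m N - Dm * Qm) <= psi s"
proof -
 define A where "A = 1\<^sub>m N - Dm * Qm"
 have A: "A \<in> carrier_mat N N"
  unfolding A_def using Dm_index(1) by (intro minus_carrier_mat mult_carrier_mat) auto
 have N0: "0 < N" using d s by (simp add: N)
 define Ac where "Ac = map_mat complex_of_real A"
 have Ac: "Ac \<in> carrier_mat N N" using A by (simp add: Ac_def)
 have Aci: "Ac $$ (i, k) = of_real (A $$ (i, k))" if "i < N" "k < N" for i k using that A by (simp add: Ac_def)
 have nzv: "\<exists>i<N. v $ i \<noteq> 0" if "v \<in> carrier_vec N" "v \<noteq> 0\<^sub>v N" for v :: "'z::zero Matrix.vec"
  using that by (metis carrier_vecD eq_vecI index_zero_vec)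
 have fin: "finite (spectrum A)" by (rule card_finite_spectrum(1)[OF A])
 have "spectrum A \<noteq> {}"
 proof -
  obtain z where "eigenvalue Ac z" using spectrum_non_empty[OF Ac N0] by (auto simp: spectrum_def)
  then obtain w where w: "w \<in> carrier_vec N" "w \<noteq> 0\<^sub>v N" "Ac *\<^sub>v w = z \<cdot>\<^sub>v w"
   using Ac by (auto simp: eigenvalue_def eigenvector_def)
  obtain i0 where i0: "i0 < N" "w $ i0 \<noteq> 0" using nzv[OF w(1,2)] by blast
  have eig: "(\<Sum>k<N. of_real (A $$ (i, k)) * w $ k) = z * w $ i" if i: "i < N" for i
  proof -
   have "(\<Sum>k<N. of_real (A $$ (i, k)) * w $ k) = (Ac *\<^sub>v w) $ i"
    unfolding mult_mat_vec_entry[OF Ac w(1) i] by (intro sum.cong refl) (use i Aci in simp)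
   then show ?thesis unfolding w(3) using i w(1) by simp
  qed
  obtain r where r: "z = of_real r" using eigenvalue_bound[of "\<lambda>i. w $ i" z, folded A_def, OF eig i0] by blast
  have real_part: "(\<Sum>k<N. A $$ (i, k) * Re (w $ k)) = r * Re (w $ i)" "(\<Sum>k<N. A $$ (i, k) * Im (w $ k)) = r * Im (w $ i)" if i: "i < N" for i
   using arg_cong[OF eig[OF i], of Re] arg_cong[OF eig[OF i], of Im] by (simp_all add: r)
  have ev: "eigenvalue A r" if g: "\<And>i. i < N ==> (\<Sum>k<N. A $$ (i, k) * g k) = r * g i" "g i0 \<noteq> 0" for g
  proof -
   define v where "v = Matrix.vec N g"
   have v: "v \<in> carrier_vec N" by (simp add: v_def)
   have "A *\<^sub>v v = r \<cdot>\<^sub>v v"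
   proof (rule eq_vecI)
    fix i assume "i < dim_vec (r \<cdot>\<^sub>v v)"
    then have i: "i < N" by (simp add: v_def)
    have "(A *\<^sub>v v) $ i = (\<Sum>k<N. A $$ (i, k) * g k)"
     unfolding mult_mat_vec_entry[OF A v i] by (intro sum.cong refl) (simp add: v_def)
    then show "(A *\<^sub>v v) $ i = (r \<cdot>\<^sub>v v) $ i" using g(1)[OF i] i by (simp add: v_def)
   qed (use A v in auto)
   moreover have "v \<noteq> 0\<^sub>v N"
   proof
    assume "v = 0\<^sub>v N"
    then have "v $ i0 = 0" using i0 by simp
    then show False using g(2) i0 by (simp add: v_def)
   qed
   ultimately show ?thesis using v A by (auto simp: eigenvalue_def eigenvector_def)
  qed
  have "Re (w $ i0) \<noteq> 0 \<or> Im (w $ i0) \<noteq> 0" using i0(2) by (auto simp: complex_eq_iff)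
  then have "eigenvalue A r"
   using ev[of "\<lambda>i. Re (w $ i)", OF real_part(1)] ev[of "\<lambda>i. Im (w $ i)", OF real_part(2)] by auto
  then show ?thesis by (auto simp: spectrum_def)
 qed
 moreover have "k <= psi s" if kA: "k \<in> spectrum A" for k
 proof -
  obtain v where v: "v \<in> carrier_vec N" "v \<noteq> 0\<^sub>v N" "A *\<^sub>v v = k \<cdot>\<^sub>v v"
   using kA A by (auto simp: spectrum_def eigenvalue_def eigenvector_def)
  obtain i0 where i0: "i0 < N" "v $ i0 \<noteq> 0" using nzv[OF v(1,2)] by blast
  have eig: "(\<Sum>l<N. of_real (A $$ (i, l)) * complex_of_real (v $ l)) = of_real k * of_real (v $ i)" if i: "i < N" for i
  proof -
   have "(\<Sum>l<N. A $$ (i, l) * v $ l) = k * v $ i"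
    unfolding mult_mat_vec_entry[OF A v(1) i, symmetric] v(3) using i v(1) by simp
   then show ?thesis by (simp add: of_real_mult[symmetric] of_real_sum[symmetric] del: of_real_mult of_real_sum)
  qed
  obtain r where "complex_of_real k = of_real r" "r <= psi s"
   using eigenvalue_bound[of "\<lambda>i. of_real (v $ i)" "of_real k", folded A_def, OF eig i0(1)] i0(2) by auto
  then show ?thesis by simp
 qed
 ultimately show ?thesis using fin unfolding psi_max_def A_def[symmetric] by (intro Max.boundedI) auto
qed

end

end

section \<open>The convergence rate\<close>

text \<open>The factor 4 makes room for the \<open>sqrt 10\<close> of the step size.\<close>

lemma c0_cube_le: "c0 ^ 3 / 2 ^ 9 <= 1 / (8912896 * 4)"
proof -
 have "c0 <= 1 / 102400" "0 <= c0"
  using pi_ge_two by (auto simp: c0_def field_simps)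
 then have "c0 ^ 3 <= (1 / 102400) ^ 3" by (intro power_mono)
 also have "... <= 2 ^ 9 * (1 / (8912896 * 4 :: real))" by (simp add: power3_eq_cube)
 finally show ?thesis by simp
qed

text \<open>The rate obtained is a constant times (1 - a)^3 / (1 + a), divided by s sqrt s d (d +
  1), where s d = N. The further factors of the stated rate, powers of 1 - a and 1 - a^r above and
  of 1 + a and 1 + a^(r + 1) below, only make it smaller.\<close>

lemma rate_bound:
 fixes a h s d :: real and r :: nat
 assumes a: "0 <= a" "a < 1" and s: "1 <= s" and d: "1 <= d" and h: "h = 1 / sqrt (10 * s) * ((1 - a) / (1 + a))"
 shows "c0 ^ 3 / (2 ^ 9 * (d * s) * sqrt s * (d + 1)) * ((1 - a) ^ 7 * (1 - a ^ r) / ((1 + a) ^ 6 * (1 + a ^ (r + 1))))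
  <= (1 - a)^2 * h / (8912896 * s) / (d * (d + 1))"
proof -
 define R where "R = (1 - a) ^ 7 * (1 - a ^ r) / ((1 + a) ^ 6 * (1 + a ^ (r + 1)))"
 have R: "R <= (1 - a) ^ 3 / (1 + a)"
 proof -
  have 1: "(1 - a) ^ 7 * (1 - a ^ r) <= (1 - a) ^ 3 * 1"
   using a by (intro mult_mono power_decreasing) (auto simp: power_le_one)
  have "(1 + a) ^ 1 * 1 <= (1 + a) ^ 6 * (1 + a ^ (r + 1))"
   using a by (intro mult_mono power_increasing) auto
  then have 2: "1 + a <= (1 + a) ^ 6 * (1 + a ^ (r + 1))" by simp
  have "R <= (1 - a) ^ 3 / ((1 + a) ^ 6 * (1 + a ^ (r + 1)))"
   unfolding R_def using 1 2 a by (intro divide_right_mono) auto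
  also have "... <= (1 - a) ^ 3 / (1 + a)"
  proof (rule divide_left_mono[OF 2])
   have "0 < 1 + a ^ (r + 1)" using a by (intro add_pos_nonneg) auto
   then show "0 < (1 + a) ^ 6 * (1 + a ^ (r + 1)) * (1 + a)" using a by (intro mult_pos_pos) auto
  qed (use a in simp)
  finally show ?thesis .
 qed
 have R0: "0 <= R" unfolding R_def using a by (intro divide_nonneg_nonneg mult_nonneg_nonneg) (auto simp: power_le_one)
 define q where "q = sqrt s"
 have q: "0 < q" using s by (simp add: q_def)
 have h': "h = 1 / (sqrt 10 * q) * ((1 - a) / (1 + a))" unfolding h q_def by (simp add: real_sqrt_mult)
 have t: "sqrt 10 <= (4::real)" by (rule real_le_lsqrt) auto
 have t0: "0 < sqrt (10::real)" by simp
 have "c0 ^ 3 / 2 ^ 9 * R <= (1 / (8912896 * 4)) * ((1 - a) ^ 3 / (1 + a))"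
  using c0_cube_le R R0 by (intro mult_mono) auto
 also have "... <= (1 / (8912896 * sqrt 10)) * ((1 - a) ^ 3 / (1 + a))"
  using t t0 a by (intro mult_right_mono divide_left_mono) auto
 finally have k: "c0 ^ 3 / 2 ^ 9 * R <= (1 / (8912896 * sqrt 10)) * ((1 - a) ^ 3 / (1 + a))" .
 define W where "W = 1 / (d * s * q * (d + 1))"
 have W: "0 <= W" using d s q by (simp add: W_def)
 have "c0 ^ 3 / (2 ^ 9 * (d * s) * q * (d + 1)) * R = (c0 ^ 3 / 2 ^ 9 * R) * W"
  by (simp add: W_def mult.assoc)
 also have "... <= (1 / (8912896 * sqrt 10)) * ((1 - a) ^ 3 / (1 + a)) * W" by (rule mult_right_mono[OF k W])
 also have "... = (1 - a)^2 * h / (8912896 * s) / (d * (d + 1))"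
  unfolding h' W_def by (simp add: power2_eq_square power3_eq_cube mult.assoc mult.commute mult.left_commute)
 finally show ?thesis by (simp add: R_def q_def)
qed

theorem proposition5p8:
  fixes \<phi> :: real and N d s :: nat and Ns :: "nat \<Rightarrow> nat" and h :: "nat \<Rightarrow> real"
    and \<mu> :: "real Matrix.vec" and Q D :: "real mat"
  assumes "d \<ge> 1" and "s \<ge> 1"
    and N: "N = (\<Sum>j<d. Ns j)"
    and mu: "\<mu> \<in> carrier_vec N"
    and Q: "sym_pos_def N Q"
    and phi: "-1 < \<phi>" "\<phi> < 1"
    and Sigma: "mat_inverse Q = Some (ar1_cov N \<phi>)"
    and sizes: "\<And>j. j < d \<Longrightarrow> Ns j = s"
    and steps: "\<And>j. j < d \<Longrightarrow> h j = 1 / sqrt (10 * real s) * ((1 - \<bar>\<phi>\<bar>) / (1 + \<bar>\<phi>\<bar>))"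
    and D: "D = block_diag_inv Ns d Q"
  shows "psi_max (1\<^sub>m N - D * Q) \<le> (\<bar>\<phi>\<bar> + \<bar>\<phi>\<bar> ^ s) / (1 + \<bar>\<phi>\<bar> ^ (s + 1)) \<and>
    L2_opnorm (gauss_measure \<mu> Q)
      (\<lambda>f x. kernel_op (dcw_mala Ns h \<mu> Q d) f x - mean_op (gauss_measure \<mu> Q) f x)
    \<le> ereal (1 - c0 ^ 3 / (2 ^ 9 * real N * sqrt (real s) * (real d + 1)) *
        ((1 - \<bar>\<phi>\<bar>) ^ 7 * (1 - \<bar>\<phi>\<bar> ^ s) / ((1 + \<bar>\<phi>\<bar>) ^ 6 * (1 + \<bar>\<phi>\<bar> ^ (s + 1)))))"
proof
 interpret ar1_chain \<phi> "\<lambda>i. \<mu> $ i" using phi by unfold_locales auto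
 obtain m where m: "s = Suc m" using \<open>s \<ge> 1\<close> by (cases s) auto
 have Nds: "N = d * s" using N sizes by simp
 have Q_eq: "Q = Matrix.mat N N (\<lambda>(i, k). prec N i k)"
  using precision_matrix[OF _ Sigma] Q by (simp add: sym_pos_def_def)
 show "psi_max (1\<^sub>m N - D * Q) <= (\<bar>\<phi>\<bar> + \<bar>\<phi>\<bar> ^ s) / (1 + \<bar>\<phi>\<bar> ^ (s + 1))"
  using psi_max_le[OF m Nds \<open>d \<ge> 1\<close>, of Ns] sizes unfolding D Q_eq psi_def[OF m Nds] by blast
 define a where "a = \<bar>\<phi>\<bar>"
 have a: "0 <= a" "a < 1" using phi by (auto simp: a_def)
 define h0 where "h0 = 1 / sqrt (10 * real s) * ((1 - a) / (1 + a))"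
 have rs: "0 < sqrt (10 * real s)" using \<open>s \<ge> 1\<close> by simp
 have h0: "0 < h0" using a rs unfolding h0_def by (intro mult_pos_pos divide_pos_pos) auto
 \<comment> \<open>The step size cancels \<open>bound\<close>, so both step conditions become
   statements about \<open>s\<close> alone.\<close>
 have hb: "h0 * bound = 1 / sqrt (10 * real s)"
  unfolding h0_def bound_def a_def[symmetric] using a by simp
 have step1: "10 * real s * (h0 * bound)^2 <= 1" unfolding hb using \<open>s \<ge> 1\<close> by (simp add: power_divide)
 have s10: "1 <= sqrt (10 * real s)" using \<open>s \<ge> 1\<close> by simp
 have step2: "h0 * bound <= 1" unfolding hb using s10 by simp
 define Bk where "Bk = block Ns"
 have Bk: "Bk j = {j * s..<j * s + s}" if j: "j < d" for j
 proof -
  have "block_start Ns j = j * s" unfolding block_start_def using sizes j by simp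
  then show ?thesis unfolding Bk_def block_def using sizes[OF j] by simp
 qed
 have mem: "t \<in> Bk j \<longleftrightarrow> t div s = j" if j: "j < d" for j t
 proof
  assume "t \<in> Bk j"
  then obtain r where "t = j * s + r" "r < s" unfolding Bk[OF j] by (auto simp: nat_le_iff_add)
  then show "t div s = j" by simp
 next
  assume "t div s = j"
  then have "t = j * s + t mod s" using div_mult_mod_eq[of t s] by simp
  moreover have "t mod s < s" using m by simp
  ultimately show "t \<in> Bk j" unfolding Bk[OF j] by auto
 qed
 have cover: "(\<Union>j<d. Bk j) = {..<N}"
 proof (intro subset_antisym subsetI)
  fix t assume "t \<in> (\<Union>j<d. Bk j)"
  then obtain j where j: "j < d" "t \<in> Bk j" by blast
  have "Suc j * s <= d * s" using j by (intro mult_right_mono) auto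
  then show "t \<in> {..<N}" using j(2) unfolding Bk[OF j(1)] by (simp add: Nds)
 next
  fix t assume "t \<in> {..<N}"
  then have "t div s < d" by (simp add: Nds less_mult_imp_div_less)
  then show "t \<in> (\<Union>j<d. Bk j)" using mem[of "t div s" t] by auto
 qed
 have disj: "Bk i \<inter> Bk j = {}" if "i < d" "j < d" "i \<noteq> j" for i j using that mem[OF that(1)] mem[OF that(2)] by auto
 have card: "card (Bk j) = s" if "j < d" for j using Bk[OF that] by simp
 have N0: "0 < N" using \<open>d \<ge> 1\<close> m by (simp add: Nds)
 have dens: "gauss_density \<mu> Q = chain_density N" by (rule gauss_density_eq[OF mu refl Q_eq])
 have dim: "dim_vec \<mu> = N" using mu by simp
 have target: "gauss_measure \<mu> Q = chain N" unfolding gauss_measure_def chain_def dens dim ..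
 have kern: "block_mala Ns h \<mu> Q j = mala_kernel N (chain_density N) (Bk j) h0" if "j < d" for j
  unfolding block_mala_def dens dim Bk_def using steps[OF that] by (simp add: h0_def a_def)
 note setting = N0 cover disj card h0 step1 step2
 \<comment> \<open>The reciprocal of the constant in \<open>variance_le_gap\<close>.\<close>
 define \<kappa> where "\<kappa> = (1 - a)^2 * h0 / (8912896 * real s)"
 have k0: "0 < (1 - a)^2 * h0" using a h0 by simp
 have k1: "\<kappa> <= 1"
 proof -
  have "h0 <= 1 * 1" unfolding h0_def using s10 a by (intro mult_mono) auto
  then have "(1 - a)^2 * h0 <= 1 * 1" using a h0 by (intro mult_mono) (auto simp: power_le_one)
  then show ?thesis using \<open>s \<ge> 1\<close> by (simp add: \<kappa>_def divide_le_eq)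
 qed
 have dd: "1 * 1 <= real d * (real d + 1)" using \<open>d \<ge> 1\<close> by (intro mult_mono) auto
 have "L2_opnorm (gauss_measure \<mu> Q) (\<lambda>f x. kernel_op (dcw_mala Ns h \<mu> Q d) f x - mean_op (gauss_measure \<mu> Q) f x)
  <= ereal (1 - \<kappa> / (real d * (real d + 1)))"
  unfolding target
 proof (rule scan_opnorm_le[where K = "block_mala Ns h \<mu> Q"])
  show "prob_space (chain N)" by (rule prob_space_chain)
  show "dcw_mala Ns h \<mu> Q 0 = return (\<Pi>\<^sub>M i\<in>{..<N}. borel)" by (simp add: dim)
  show "sets (\<Pi>\<^sub>M i\<in>{..<N}. (borel :: real measure)) = sets (chain N)" by (simp cong: sets_PiM_cong)
  show "psd_kernel (chain N) (block_mala Ns h \<mu> Q j)" if "j < d" for j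
   unfolding kern[OF that] by (rule psd_kern[OF setting that])
  show "\<kappa> * (\<integral>x. (f x)^2 \<partial>chain N) <= (\<Sum>j<d. psd_kernel.gap_form (chain N) (block_mala Ns h \<mu> Q j) f)"
   if f: "f \<in> L2 (chain N)" "(\<integral>x. f x \<partial>chain N) = 0" for f
  proof -
   define G where "G = (\<Sum>j<d. psd_kernel.gap_form (chain N) (block_mala Ns h \<mu> Q j) f)"
   have G: "G = (\<Sum>j<d. psd_kernel.gap_form (chain N) (mala_kernel N (chain_density N) (Bk j) h0) f)"
    unfolding G_def by (intro sum.cong refl) (simp add: kern)
   have "(\<integral>x. (f x)^2 \<partial>chain N) <= 8912896 * real s / ((1 - a)^2 * h0) * G"
    unfolding G a_def by (rule variance_le_gap[OF setting f])
   then have "\<kappa> * (\<integral>x. (f x)^2 \<partial>chain N) <= \<kappa> * (8912896 * real s / ((1 - a)^2 * h0) * G)"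
    using k0 by (intro mult_left_mono) (auto simp: \<kappa>_def)
   also have "... = G" using a h0 \<open>s \<ge> 1\<close> by (simp add: \<kappa>_def)
   finally show ?thesis by (simp add: G_def)
  qed
  show "0 <= \<kappa>" using k0 by (simp add: \<kappa>_def)
  show "\<kappa> <= real d * (real d + 1)" using k1 dd by simp
 qed (use \<open>d \<ge> 1\<close> in auto)
 also have "... <= ereal (1 - c0 ^ 3 / (2 ^ 9 * real N * sqrt (real s) * (real d + 1)) *
    ((1 - \<bar>\<phi>\<bar>) ^ 7 * (1 - \<bar>\<phi>\<bar> ^ s) / ((1 + \<bar>\<phi>\<bar>) ^ 6 * (1 + \<bar>\<phi>\<bar> ^ (s + 1)))))"
  using rate_bound[OF a, of "real s" "real d" h0 s] \<open>s \<ge> 1\<close> \<open>d \<ge> 1\<close> unfolding \<kappa>_def h0_def a_def[symmetric] Nds by simp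
 finally show "L2_opnorm (gauss_measure \<mu> Q) (\<lambda>f x. kernel_op (dcw_mala Ns h \<mu> Q d) f x - mean_op (gauss_measure \<mu> Q) f x)
  <= ereal (1 - c0 ^ 3 / (2 ^ 9 * real N * sqrt (real s) * (real d + 1)) *
    ((1 - \<bar>\<phi>\<bar>) ^ 7 * (1 - \<bar>\<phi>\<bar> ^ s) / ((1 + \<bar>\<phi>\<bar>) ^ 6 * (1 + \<bar>\<phi>\<bar> ^ (s + 1)))))" .
qed

end
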